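(* Let $m,n\ge 1$, let $K\subset\mathbb{C}^m$ be a nonempty, compact, polynomially convex set whose Siciak extremal function $\Phi_K$ is continuous, let $a_1,\dots,a_n\colon K\to\mathbb{C}$ be continuous functions, put $F(x,t)=t^n+a_1(x)t^{n-1}+\ldots+a_n(x)$ for $(x,t)\in K\times\mathbb{C}$, and let $$Y:=\{(x,t)\in K\times\mathbb{C} : F(x,t)=0\}.$$ Assume that for some $x_0\in K$ the polynomial $F(x_0,\cdot)$ has exactly $n$ different roots, i.e. the fibre of $Y$ over $x_0$ consists of exactly $n$ different points. If $$\limsup_{d\to+\infty}\sqrt[d]{\mathrm{dist}_\delta(Y,\mathcal{H}_d^{m,n}(K))}<1,$$ then for some open neighbourhood $U\supset K$ in $\mathbb{C}^m$ there is a complex analytic set $X\subset U\times\mathbb{C}$ of pure codimension $1$, having proper projection onto $U$ (under $(x,t)\mapsto x$), such that $X\cap(K\times\mathbb{C})=Y$. In particular, each coefficient $a_j$ admits a holomorphic extension $\tilde a_j\in\mathcal{O}(U)$, and $X=\tilde F^{-1}(0)$ for $\tilde F(x,t)=t^n+\tilde a_1(x)t^{n-1}+\ldots+\tilde a_n(x)\in\mathcal{O}(U)[t]$.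
   Context: Polynomial convexity: a nonempty compact set $K\subset\mathbb{C}^m$ is polynomially convex if $K=\{x\in\mathbb{C}^m : |P(x)|\le \sup_K|P| \text{ for all complex polynomials } P \text{ in } m \text{ variables}\}$. Siciak extremal function: $\Phi_K(x):=\sup\{|P(x)|^{1/\deg P} : P \text{ a nonconstant complex polynomial in } m \text{ variables with } \sup_K|P|\le 1\}$, $x\in\mathbb{C}^m$. For $V\subset\mathbb{C}^m\times\mathbb{C}$ put $V_K:=V\cap(K\times\mathbb{C})$. For $W\subset K\times\mathbb{C}$ and $x\in K$, $W(x):=\{t\in\mathbb{C} : (x,t)\in W\}$ is the section of $W$ at $x$. For nonempty compact $E,F\subset\mathbb{C}$, $d_H(E,F):=\max\{\max_{x\in E}\mathrm{dist}(x,F),\max_{x\in F}\mathrm{dist}(x,E)\}$ is the Hausdorff distance. For sets $Y,W\subset K\times\mathbb{C}$ with nonempty compact sections, $\delta_K(Y,W):=\sup_{x\in K}d_H(Y(x),W(x))$, and for a nonempty family $\mathcal{W}$ of such sets, $\mathrm{dist}_\delta(Y,\mathcal{W}):=\inf\{\delta_K(Y,W) : W\in\mathcal{W}\}$. Degree: for an algebraic hypersurface $V\subset\mathbb{C}^{m+1}$ (nonempty algebraic set of pure dimension $m$), $\deg V$ is its projective degree, which equals the degree of a reduced (square-free) polynomial $P$ with $V=P^{-1}(0)$. $\mathcal{H}_d^{m,n}(K)$ is the family of all sets $V_K$, where $V\subset\mathbb{C}^{m+1}=\mathbb{C}^m_x\times\mathbb{C}_t$ is a nonempty algebraic set of pure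 dimension $m$ with $\deg V\le d$, such that the projection $(x,t)\mapsto x$ restricted to $V$ is proper onto $\mathbb{C}^m$, with covering number (the number of points of $V$ over a generic $x\in\mathbb{C}^m$) at most $n$. Equivalently, such a $V$ is the zero set of a square-free polynomial, monic in $t$, of degree at most $n$ in $t$ and of total degree at most $d$.
   Formalization: That the coefficients of F̃ extend the a_j is claimed only on connected components of K containing a point where F has n different roots (all of K if K is connected); for disconnected K the printed claim fails, since Y does not see multiplicities of roots. *)

theory Defs
  imports
    "HOL-Analysis.Analysis"
    "HOL-Library.Poly_Mapping"
    "HOL-Computational_Algebra.Squarefree"
begin

section \<open>Polynomials in finitely many variables\<close>

text \<open>Variables are indexed by a finite type \<open>'k\<close>; a polynomial maps exponent vectors to coefficients.
  Ring operations, divisibility and \<^const>\<open>squarefree\<close> are those of the monoid algebra.\<close>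

type_synonym 'k cpoly = "('k \<Rightarrow>\<^sub>0 nat) \<Rightarrow>\<^sub>0 complex"

definition peval :: "'k::finite cpoly \<Rightarrow> complex ^ 'k \<Rightarrow> complex" where
  "peval p z = (\<Sum>\<alpha>\<in>Poly_Mapping.keys p.
     Poly_Mapping.lookup p \<alpha> * (\<Prod>i\<in>UNIV. (z $ i) ^ Poly_Mapping.lookup \<alpha> i))"

text \<open>Total degree, with value \<open>0\<close> at the zero polynomial.\<close>

definition pdeg :: "'k::finite cpoly \<Rightarrow> nat" where
  "pdeg p = Max (insert 0 ((\<lambda>\<alpha>. \<Sum>i\<in>UNIV. Poly_Mapping.lookup \<alpha> i) ` Poly_Mapping.keys p))"

definition polynomially_convex :: "(complex ^ 'm) set \<Rightarrow> bool" where
  "polynomially_convex K \<longleftrightarrow> K \<noteq> {} \<and> compact K \<and>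
     K = {x. \<forall>p. cmod (peval p x) \<le> (SUP y\<in>K. cmod (peval p y))}"

text \<open>Extended-real valued, since the supremum is infinite at some points when \<open>K\<close> is pluripolar.\<close>

definition siciak :: "(complex ^ 'm) set \<Rightarrow> complex ^ 'm \<Rightarrow> ereal" where
  "siciak K x = (SUP p\<in>{p. 0 < pdeg p \<and> (\<forall>y\<in>K. cmod (peval p y) \<le> 1)}.
     ereal (cmod (peval p x) powr (1 / real (pdeg p))))"

section \<open>Holomorphic maps, analytic sets, dimension\<close>

definition cholomorphic :: "(complex ^ 'k \<Rightarrow> complex) \<Rightarrow> (complex ^ 'k) set \<Rightarrow> bool" where
  "cholomorphic f W \<longleftrightarrow> open W \<and>
     (\<forall>z\<in>W. \<exists>D. (f has_derivative D) (at z) \<and> (\<forall>c v. D (c *s v) = c * D v))"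

definition cholomorphic_map :: "(complex ^ 'k \<Rightarrow> complex ^ 'k) \<Rightarrow> (complex ^ 'k) set \<Rightarrow> bool" where
  "cholomorphic_map f W \<longleftrightarrow> (\<forall>i. cholomorphic (\<lambda>z. f z $ i) W)"

definition biholomorphic_on :: "(complex ^ 'k \<Rightarrow> complex ^ 'k) \<Rightarrow> (complex ^ 'k) set \<Rightarrow> bool" where
  "biholomorphic_on f W \<longleftrightarrow> inj_on f W \<and> cholomorphic_map f W \<and>
     cholomorphic_map (inv_into W f) (f ` W)"

text \<open>Locally closed complex submanifolds: locally straightened, by a biholomorphic chart of the
  ambient space, to a coordinate subspace of dimension \<open>k\<close>.\<close>

definition complex_submanifold :: "nat \<Rightarrow> (complex ^ 'k) set \<Rightarrow> bool" where
  "complex_submanifold k M \<longleftrightarrow> M \<noteq> {} \<and>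
     (\<forall>a\<in>M. \<exists>W f S. open W \<and> a \<in> W \<and> biholomorphic_on f W \<and> card S = k \<and>
        (\<forall>z\<in>W. z \<in> M \<longleftrightarrow> (\<forall>i. i \<notin> S \<longrightarrow> f z $ i = 0)))"

text \<open>The dimension of \<open>X\<close> at a point \<open>a \<in> X\<close>: the largest dimension of complex submanifolds
  contained in \<open>X\<close> that occurs in every neighbourhood of \<open>a\<close>.\<close>

definition local_dim :: "(complex ^ 'k) set \<Rightarrow> complex ^ 'k \<Rightarrow> nat" where
  "local_dim X a = Max {k. \<forall>W. open W \<and> a \<in> W \<longrightarrow> (\<exists>M. complex_submanifold k M \<and> M \<subseteq> X \<inter> W)}"

definition pure_dimensional :: "nat \<Rightarrow> (complex ^ 'k) set \<Rightarrow> bool" where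
  "pure_dimensional k X \<longleftrightarrow> (\<forall>a\<in>X. local_dim X a = k)"

definition analytic_subset :: "(complex ^ 'k) set \<Rightarrow> (complex ^ 'k) set \<Rightarrow> bool" where
  "analytic_subset \<Omega> X \<longleftrightarrow> open \<Omega> \<and> X \<subseteq> \<Omega> \<and>
     (\<forall>a\<in>\<Omega>. \<exists>W G. open W \<and> a \<in> W \<and> W \<subseteq> \<Omega> \<and> finite G \<and> (\<forall>g\<in>G. cholomorphic g W) \<and>
        X \<inter> W = {z\<in>W. \<forall>g\<in>G. g z = 0})"

definition algebraic_set :: "(complex ^ 'k) set \<Rightarrow> bool" where
  "algebraic_set V \<longleftrightarrow> (\<exists>S. finite S \<and> V = {z. \<forall>p\<in>S. peval p z = 0})"

text \<open>\<open>hypersurface_degree V e\<close>: the degree of the hypersurface \<open>V\<close> is \<open>e\<close>. It determines \<open>e\<close>, since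
  square-free polynomials with the same zero set agree up to a constant factor.\<close>

definition hypersurface_degree :: "(complex ^ 'k) set \<Rightarrow> nat \<Rightarrow> bool" where
  "hypersurface_degree V e \<longleftrightarrow> (\<exists>p. squarefree p \<and> V = {z. peval p z = 0} \<and> pdeg p = e)"

section \<open>Subsets of \<open>\<complex>\<^sup>m \<times> \<complex>\<close>\<close>

text \<open>Identifies \<open>\<complex>\<^sup>m \<times> \<complex>\<close> with \<open>\<complex>\<^sup>m\<^sup>+\<^sup>1\<close>; the coordinate with index \<^const>\<open>None\<close> is \<open>t\<close>.\<close>

definition join :: "(complex ^ 'm) \<times> complex \<Rightarrow> complex ^ ('m option)" where
  "join z = (\<chi> i. case i of None \<Rightarrow> snd z | Some j \<Rightarrow> fst z $ j)"

definition fibre :: "('a \<times> 'b) set \<Rightarrow> 'a \<Rightarrow> 'b set" where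
  "fibre W x = {t. (x, t) \<in> W}"

text \<open>The projection of \<open>X\<close> along \<open>t\<close> is a proper map onto \<open>U\<close>.\<close>

definition proper_projection :: "((complex ^ 'm) \<times> complex) set \<Rightarrow> (complex ^ 'm) set \<Rightarrow> bool" where
  "proper_projection X U \<longleftrightarrow> proper_map (top_of_set X) (top_of_set U) fst \<and> fst ` X = U"

text \<open>Generic means outside the zero set of some nonzero polynomial.\<close>

definition covering_number :: "((complex ^ 'm) \<times> complex) set \<Rightarrow> nat \<Rightarrow> bool" where
  "covering_number V k \<longleftrightarrow>
     (\<exists>q. q \<noteq> 0 \<and> (\<forall>x. peval q x \<noteq> 0 \<longrightarrow> finite (fibre V x) \<and> card (fibre V x) = k))"

definition hyper_family :: "nat \<Rightarrow> nat \<Rightarrow> (complex ^ 'm) set \<Rightarrow> ((complex ^ 'm) \<times> complex) set set" where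
  "hyper_family d n K = {V \<inter> (K \<times> UNIV) | V.
     V \<noteq> {} \<and> algebraic_set (join ` V) \<and> pure_dimensional CARD('m) (join ` V) \<and>
     (\<exists>e\<le>d. hypersurface_degree (join ` V) e) \<and>
     proper_projection V UNIV \<and> (\<exists>k\<le>n. covering_number V k)}"

definition hausdorff_dist :: "complex set \<Rightarrow> complex set \<Rightarrow> real" where
  "hausdorff_dist E F = max (SUP x\<in>E. infdist x F) (SUP x\<in>F. infdist x E)"

definition delta :: "'a set \<Rightarrow> ('a \<times> complex) set \<Rightarrow> ('a \<times> complex) set \<Rightarrow> ereal" where
  "delta K Y W = (SUP x\<in>K. ereal (hausdorff_dist (fibre Y x) (fibre W x)))"

text \<open>The infimum over the empty family is \<open>\<infinity>\<close>; the family of hypersurfaces is empty only for \<open>d = 0\<close>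
  (given \<open>n \<ge> 1\<close>).\<close>

definition dist_delta :: "'a set \<Rightarrow> ('a \<times> complex) set \<Rightarrow> ('a \<times> complex) set set \<Rightarrow> ereal" where
  "dist_delta K Y \<W> = (INF W\<in>\<W>. delta K Y W)"

definition ereal_root :: "nat \<Rightarrow> ereal \<Rightarrow> ereal" where
  "ereal_root d r = (if r = \<infinity> then \<infinity> else ereal (root d (real_of_ereal r)))"

definition monic_eval :: "nat \<Rightarrow> (nat \<Rightarrow> 'a \<Rightarrow> complex) \<Rightarrow> 'a \<Rightarrow> complex \<Rightarrow> complex" where
  "monic_eval n a x t = t ^ n + (\<Sum>j=1..n. a j x * t ^ (n - j))"

end

theory Submission
  imports Defs "HOL-Complex_Analysis.Complex_Analysis" "HOL-Computational_Algebra.Fundamental_Theorem_Algebra"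
begin

text \<open>For large \<open>d\<close> take a hypersurface of degree at most \<open>d\<close> whose fibres over \<open>K\<close> are within \<open>\<theta>\<^sup>d\<close>, \<open>\<theta> < 1\<close>, of those of
  \<open>Y\<close>. The power sums of its fibres are polynomials of degree \<open>O(d)\<close>. The values at the roots of the \<open>(d+1)\<close>-st monic
  fibre polynomial of the \<open>d\<close>-th one have power sums that are exponentially small on \<open>K\<close>, hence, by the Bernstein--Walsh
  inequality, also near \<open>K\<close>. So the roots stay bounded near \<open>K\<close>, and Montel's theorem yields a limit polynomial
  with holomorphic coefficients whose zero set over \<open>K\<close> is \<open>Y\<close>.

  Let \<open>W\<close> be the set where the limit differs from \<open>F\<close> on the relevant component. There \<open>Y\<close> has fewer than \<open>n\<close> points, so the
  discriminants of the approximants decay exponentially on \<open>W\<close>, and Bernstein--Walsh shows that polynomials are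
  bounded on \<open>W\<close> by their values on the rest of \<open>K\<close>. The part of \<open>W\<close> with the most points in the fibre has its boundary
  in the zero set of a holomorphic function that has no zero on it. Since \<open>K\<close> is polynomially convex, this contradicts a
  form of Rossi's local maximum principle, which follows from Oka's extension theorem.\<close>

section \<open>Holomorphic functions of a sequence of complex variables\<close>

text \<open>The roots of the approximants have no holomorphic numbering. Hence everything passes
  through power sums, whose degree is proportional both to the exponent \<open>r\<close> and to
  \<open>d\<close>: the Bernstein--Walsh factor is then itself an \<open>r\<close>-th power and
  survives the way back from power sums to single roots.

  Closeness of fibres says nothing about multiplicities: (t-u)^2 (t-v) and (t-u) (t-v)^2 have the
  same zeros, so \<open>Y\<close> determines the polynomial only over points with \<open>n\<close>
  distinct roots. The limit has the right zero set at once, but whether its coefficients are the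
  given ones is a separate question. An identity theorem alone cannot answer it, since the
  \<open>a j\<close> are merely continuous and \<open>K\<close> may have empty interior. What can be
  propagated along \<open>K\<close> are estimates for polynomials, which is where polynomial
  convexity enters. Agreement results on every connected component of \<open>K\<close> that contains
  a point with \<open>n\<close> roots.\<close>

definition holomorphic_curve :: "(complex \<Rightarrow> nat \<Rightarrow> complex) \<Rightarrow> complex set \<Rightarrow> bool" where
  "holomorphic_curve c D \<longleftrightarrow> open D \<and> (\<forall>i. (\<lambda>z. c z i) holomorphic_on D)"

text \<open>Sequences with finitely many nonzero entries stand for points of \<open>\<complex>\<^sup>N\<close>, so that the number of variables can
  change within a proof without changing the type.\<close>

definition hol :: "((nat \<Rightarrow> complex) \<Rightarrow> complex) \<Rightarrow> (nat \<Rightarrow> complex) set \<Rightarrow> bool" where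
  "hol f S \<longleftrightarrow> open S \<and> continuous_on S f \<and>
     (\<forall>c D. holomorphic_curve c D \<and> c ` D \<subseteq> S \<longrightarrow> (\<lambda>z. f (c z)) holomorphic_on D)"

lemma hol_open: "hol f S \<Longrightarrow> open S"
  and hol_cont: "hol f S \<Longrightarrow> continuous_on S f"
  and hol_curve: "hol f S \<Longrightarrow> holomorphic_curve c D \<Longrightarrow> c ` D \<subseteq> S \<Longrightarrow> (\<lambda>z. f (c z)) holomorphic_on D"
  by (auto simp: hol_def)

lemma holomorphic_curve_cont: "holomorphic_curve c D \<Longrightarrow> continuous_on D c"
  unfolding holomorphic_curve_def
  by (intro continuous_on_coordinatewise_then_product holomorphic_on_imp_continuous_on) auto

lemma holomorphic_curve_vimage: "holomorphic_curve c D \<Longrightarrow> open T \<Longrightarrow> open (D \<inter> c -` T)"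
  using holomorphic_curve_cont[of c D] continuous_on_open_vimage[of D c] unfolding holomorphic_curve_def
  by (metis Int_commute)

lemma holomorphic_curve_subset: "holomorphic_curve c D \<Longrightarrow> open D' \<Longrightarrow> D' \<subseteq> D \<Longrightarrow> holomorphic_curve c D'"
  unfolding holomorphic_curve_def by (meson holomorphic_on_subset)

lemma hol_subset: "hol f S \<Longrightarrow> open T \<Longrightarrow> T \<subseteq> S \<Longrightarrow> hol f T"
  unfolding hol_def by (meson continuous_on_subset order_trans)

lemma hol_cong: "hol f S \<Longrightarrow> (\<And>x. x \<in> S \<Longrightarrow> f x = g x) \<Longrightarrow> hol g S"
  unfolding hol_def
proof (safe, goal_cases)
  case 1 then show ?case by (metis continuous_on_cong)
next
  case (2 c D)
  then show ?case
    by (metis (no_types, lifting) holomorphic_transform image_subset_iff)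
qed

lemma hol_const: "open S \<Longrightarrow> hol (\<lambda>x. k) S"
  by (auto simp: hol_def)

lemma hol_coord: "open S \<Longrightarrow> hol (\<lambda>x. x i) S"
  by (auto simp: hol_def holomorphic_curve_def intro: continuous_on_product_then_coordinatewise)

lemma hol_add: "hol f S \<Longrightarrow> hol g S \<Longrightarrow> hol (\<lambda>x. f x + g x) S"
  unfolding hol_def by (auto intro!: continuous_intros holomorphic_intros)

lemma hol_diff: "hol f S \<Longrightarrow> hol g S \<Longrightarrow> hol (\<lambda>x. f x - g x) S"
  unfolding hol_def by (auto intro!: continuous_intros holomorphic_intros)

lemma hol_mult: "hol f S \<Longrightarrow> hol g S \<Longrightarrow> hol (\<lambda>x. f x * g x) S"
  unfolding hol_def by (auto intro!: continuous_intros holomorphic_intros)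

lemma hol_divide: "hol f S \<Longrightarrow> hol g S \<Longrightarrow> (\<And>x. x \<in> S \<Longrightarrow> g x \<noteq> 0) \<Longrightarrow> hol (\<lambda>x. f x / g x) S"
  unfolding hol_def
  by (safe; intro continuous_on_divide holomorphic_on_divide) auto

lemma hol_power: "hol f S \<Longrightarrow> hol (\<lambda>x. f x ^ n) S"
  unfolding hol_def by (auto intro!: continuous_intros holomorphic_intros)

lemma hol_sum: "open S \<Longrightarrow> (\<And>i. i \<in> I \<Longrightarrow> hol (f i) S) \<Longrightarrow> hol (\<lambda>x. \<Sum>i\<in>I. f i x) S"
  by (induction I rule: infinite_finite_induct) (auto intro: hol_const hol_add)

text \<open>A map with holomorphic coordinates carries holomorphic curves to holomorphic curves, so
  the curve test composes without a chain rule. All later pullbacks along graphs and changes of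
  coordinates rest on this.\<close>

lemma hol_compose:
  assumes "hol f T" "\<And>i. hol (\<lambda>x. \<Phi> x i) S" "\<Phi> ` S \<subseteq> T"
  shows "hol (\<lambda>x. f (\<Phi> x)) S"
proof -
  have S: "open S" using assms(2) hol_open by blast
  have "continuous_on S \<Phi>"
    using assms(2) hol_cont by (intro continuous_on_coordinatewise_then_product) blast
  then have "continuous_on S (\<lambda>x. f (\<Phi> x))"
    using continuous_on_compose2[OF hol_cont[OF assms(1)], of S \<Phi>] assms(3) by auto
  moreover have "(\<lambda>z. f (\<Phi> (c z))) holomorphic_on D" if "holomorphic_curve c D" "c ` D \<subseteq> S" for c D
  proof (rule hol_curve[OF assms(1)])
    show "holomorphic_curve (\<lambda>z. \<Phi> (c z)) D"
      using that assms(2) unfolding holomorphic_curve_def by (auto simp: hol_def holomorphic_curve_def)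
    show "(\<lambda>z. \<Phi> (c z)) ` D \<subseteq> T" using that assms(3) by auto
  qed
  ultimately show ?thesis using S by (auto simp: hol_def)
qed

lemma hol_local:
  assumes "\<And>x. x \<in> S \<Longrightarrow> \<exists>T. x \<in> T \<and> hol f T \<and> T \<subseteq> S"
  shows "hol f S"
proof -
  have op: "open S"
    by (subst open_subopen) (metis assms hol_open)
  have "continuous_on S f"
    unfolding continuous_on_eq_continuous_at[OF op]
    using assms by (metis continuous_on_eq_continuous_at hol_cont hol_open)
  moreover have "(\<lambda>z. f (c z)) holomorphic_on D" if c: "holomorphic_curve c D" "c ` D \<subseteq> S" for c D
  proof -
    have "(\<lambda>z. f (c z)) field_differentiable at z" if z: "z \<in> D" for z
    proof -
      obtain T where T: "c z \<in> T" "hol f T" using assms c z by blast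
      have o: "open (D \<inter> c -` T)" using holomorphic_curve_vimage c T(2) hol_open by blast
      then have "(\<lambda>z. f (c z)) holomorphic_on (D \<inter> c -` T)"
        by (intro hol_curve[OF T(2)] holomorphic_curve_subset[OF c(1)]) auto
      then show ?thesis using o z T(1) holomorphic_on_imp_differentiable_at by blast
    qed
    then show ?thesis using c by (simp add: holomorphic_curve_def holomorphic_on_open field_differentiable_def)
  qed
  ultimately show ?thesis using op by (auto simp: hol_def)
qed

lemma hol_Un: "hol f S \<Longrightarrow> hol f T \<Longrightarrow> hol f (S \<union> T)"
  by (rule hol_local) blast

lemma hol_If:
  assumes "hol f S" "hol g T" "\<And>x. x \<in> S \<Longrightarrow> x \<in> T \<Longrightarrow> f x = g x"
  shows "hol (\<lambda>x. if x \<in> S then f x else g x) (S \<union> T)"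
  by (rule hol_Un; rule hol_cong[OF assms(1)] hol_cong[OF assms(2)]) (auto simp: assms(3))

text \<open>Along a curve the parameter integral satisfies Cauchy's formula on small circles,
  because the two contour integrals may be interchanged. Differentiability follows from that
  formula; nothing is differentiated under the integral sign.\<close>

lemma hol_contour_integral:
  assumes \<gamma>: "valid_path \<gamma>" "continuous_on {0..1} (\<lambda>t. vector_derivative \<gamma> (at t))"
    and S: "open S"
    and cont: "continuous_on (S \<times> path_image \<gamma>) (\<lambda>(x,\<zeta>). \<Phi> \<zeta> x)"
    and h: "\<And>\<zeta>. \<zeta> \<in> path_image \<gamma> \<Longrightarrow> hol (\<Phi> \<zeta>) S"
  shows "hol (\<lambda>x. contour_integral \<gamma> (\<lambda>\<zeta>. \<Phi> \<zeta> x)) S"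
proof -
  have gc: "continuous_on {0..1} \<gamma>"
    using \<gamma>(1) valid_path_imp_path path_def by blast
  have ci: "contour_integral \<gamma> (\<lambda>\<zeta>. \<Phi> \<zeta> x)
      = integral (cbox 0 1) (\<lambda>t. \<Phi> (\<gamma> t) x * vector_derivative \<gamma> (at t))" for x
    by (simp add: contour_integral_integral)
  have c1: "continuous_on (S \<times> {0..1}) (\<lambda>p. \<Phi> (\<gamma> (snd p)) (fst p))"
  proof -
    have "continuous_on (S \<times> {0..1}) (\<lambda>p. (fst p, \<gamma> (snd p)))"
      by (intro continuous_intros continuous_on_compose2[OF gc]) auto
    moreover have "(\<lambda>p. (fst p, \<gamma> (snd p))) ` (S \<times> {0..1}) \<subseteq> S \<times> path_image \<gamma>"
      by (auto simp: path_image_def)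
    ultimately show ?thesis
      using continuous_on_compose2[OF cont] by fastforce
  qed
  have c1x: "continuous_on {0..1} (\<lambda>t. \<Phi> (\<gamma> t) x)" if "x \<in> S" for x
  proof -
    have "continuous_on {0..1} (\<lambda>t. (x, t))" by (intro continuous_intros)
    moreover have "Pair x ` {0..1} \<subseteq> S \<times> {0..1}" using that by auto
    ultimately show ?thesis using continuous_on_compose2[OF c1] by fastforce
  qed
  have cont2: "continuous_on S (\<lambda>x. contour_integral \<gamma> (\<lambda>\<zeta>. \<Phi> \<zeta> x))"
    unfolding ci
  proof (rule integral_continuous_on_param)
    show "continuous_on (S \<times> cbox 0 1) (\<lambda>(x, t). \<Phi> (\<gamma> t) x * vector_derivative \<gamma> (at t))"
      unfolding split_beta
      by (intro continuous_intros continuous_on_compose2[OF \<gamma>(2)]) (use c1 in auto)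
  qed
  have "(\<lambda>z. contour_integral \<gamma> (\<lambda>\<zeta>. \<Phi> \<zeta> (c z))) holomorphic_on D"
    if c: "holomorphic_curve c D" "c ` D \<subseteq> S" for c D
  proof -
    let ?I = "\<lambda>z. contour_integral \<gamma> (\<lambda>\<zeta>. \<Phi> \<zeta> (c z))"
    have D: "open D" using c holomorphic_curve_def by blast
    have cc: "continuous_on D c" using holomorphic_curve_cont c by blast
    have contI: "continuous_on D ?I"
      using continuous_on_compose2[OF cont2 cc] c by auto
    have hz: "(\<lambda>z. \<Phi> \<zeta> (c z)) holomorphic_on D" if "\<zeta> \<in> path_image \<gamma>" for \<zeta>
      using hol_curve[OF h] that c by blast
    have cj: "continuous_on (path_image \<gamma> \<times> D) (\<lambda>p. \<Phi> (fst p) (c (snd p)))"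
    proof -
      have "continuous_on (path_image \<gamma> \<times> D) (\<lambda>p. (c (snd p), fst p))"
        by (intro continuous_intros continuous_on_compose2[OF cc]) auto
      moreover have "(\<lambda>p. (c (snd p), fst p)) ` (path_image \<gamma> \<times> D) \<subseteq> S \<times> path_image \<gamma>"
        using c by auto
      ultimately show ?thesis
        using continuous_on_compose2[OF cont] by fastforce
    qed
    have "?I field_differentiable at z0" if z0: "z0 \<in> D" for z0
    proof -
      obtain r where r: "r > 0" "cball z0 r \<subseteq> D" using D z0 open_contains_cball by blast
      have ps: "path_image (circlepath z0 r) \<subseteq> D" using r by auto
      \<comment> \<open>The exponent 1 gives the shape that
        \<open>Cauchy_next_derivative_circlepath\<close> expects: an integral with kernel of order
        \<open>k\<close> is differentiable in \<open>w\<close>, here for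
        \<open>k = 1\<close>.\<close>
      have int: "((\<lambda>u. ?I u / (u - w)^1) has_contour_integral (2 * of_real pi*\<i> * ?I w)) (circlepath z0 r)"
        if w: "w \<in> ball z0 r" for w
      proof -
        have wn: "u \<noteq> w" if "u \<in> path_image (circlepath z0 r)" for u
          using w that r by auto
        have cu: "continuous_on (path_image (circlepath z0 r)) (\<lambda>u. ?I u / (u - w))"
          using wn by (intro continuous_intros continuous_on_subset[OF contI ps]) auto
        then have "(\<lambda>u. ?I u / (u - w)) contour_integrable_on (circlepath z0 r)"
          by (metis contour_integrable_continuous_circlepath)
        moreover have "contour_integral (circlepath z0 r) (\<lambda>u. ?I u / (u - w)) = 2 * of_real pi*\<i> * ?I w"
        proof -
          have "contour_integral (circlepath z0 r) (\<lambda>u. ?I u / (u - w))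
             = contour_integral (circlepath z0 r) (\<lambda>u. contour_integral \<gamma> (\<lambda>\<zeta>. \<Phi> \<zeta> (c u) / (u - w)))"
          proof (rule contour_integral_eq)
            fix u assume u: "u \<in> path_image (circlepath z0 r)"
            have "continuous_on {0..1} (\<lambda>t. \<Phi> (\<gamma> t) (c u) * vector_derivative \<gamma> (at t))"
              by (intro continuous_on_mult \<gamma>(2) c1x) (use u c ps in blast)
            then have "(\<lambda>\<zeta>. \<Phi> \<zeta> (c u)) contour_integrable_on \<gamma>"
              by (simp add: contour_integrable_on integrable_continuous_real)
            then show "?I u / (u - w) = contour_integral \<gamma> (\<lambda>\<zeta>. \<Phi> \<zeta> (c u) / (u - w))"
              by (simp add: contour_integral_div)
          qed
          also have "\<dots> = contour_integral \<gamma> (\<lambda>\<zeta>. contour_integral (circlepath z0 r) (\<lambda>u. \<Phi> \<zeta> (c u) / (u - w)))"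
          proof (rule contour_integral_swap)
            have "continuous_on (path_image (circlepath z0 r) \<times> path_image \<gamma>)
               (\<lambda>p. \<Phi> (snd p) (c (fst p)) / (fst p - w))"
            proof (intro continuous_on_divide continuous_intros)
              have "continuous_on (path_image (circlepath z0 r) \<times> path_image \<gamma>) (\<lambda>p. (snd p, fst p))"
                by (intro continuous_intros)
              moreover have "(\<lambda>p. (snd p, fst p)) ` (path_image (circlepath z0 r) \<times> path_image \<gamma>) \<subseteq> path_image \<gamma> \<times> D"
                using ps by auto
              ultimately have "continuous_on (path_image (circlepath z0 r) \<times> path_image \<gamma>)
                  (\<lambda>p. \<Phi> (fst (snd p, fst p)) (c (snd (snd p, fst p))))"
                by (rule continuous_on_compose2[OF cj])
              then show "continuous_on (path_image (circlepath z0 r) \<times> path_image \<gamma>) (\<lambda>p. \<Phi> (snd p) (c (fst p)))"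
                by simp
            qed (use wn in auto)
            then show "continuous_on (path_image (circlepath z0 r) \<times> path_image \<gamma>)
               (\<lambda>(u,\<zeta>). \<Phi> \<zeta> (c u) / (u - w))" by (simp add: split_beta)
          qed (use \<gamma> in \<open>auto simp: vector_derivative_circlepath intro!: continuous_intros\<close>)
          also have "\<dots> = contour_integral \<gamma> (\<lambda>\<zeta>. 2 * of_real pi*\<i> * \<Phi> \<zeta> (c w))"
          proof (rule contour_integral_eq)
            fix \<zeta> assume \<zeta>: "\<zeta> \<in> path_image \<gamma>"
            show "contour_integral (circlepath z0 r) (\<lambda>u. \<Phi> \<zeta> (c u) / (u - w)) = 2 * of_real pi*\<i> * \<Phi> \<zeta> (c w)"
              by (rule contour_integral_unique, rule Cauchy_integral_circlepath_simple)
                 (use w r holomorphic_on_subset[OF hz[OF \<zeta>]] in \<open>auto simp: dist_norm norm_minus_commute\<close>)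
          qed
          also have "\<dots> = 2 * of_real pi*\<i> * ?I w"
          proof -
            have "continuous_on {0..1} (\<lambda>t. \<Phi> (\<gamma> t) (c w) * vector_derivative \<gamma> (at t))"
              by (intro continuous_on_mult \<gamma>(2) c1x) (use w r c ball_subset_cball in blast)
            then have "(\<lambda>\<zeta>. \<Phi> \<zeta> (c w)) contour_integrable_on \<gamma>"
              by (simp add: contour_integrable_on integrable_continuous_real)
            then show ?thesis by (simp add: contour_integral_lmul)
          qed
          finally show ?thesis .
        qed
        ultimately show ?thesis
          using has_contour_integral_integral[of "\<lambda>u. ?I u / (u - w)" "circlepath z0 r"] by simp
      qed
      have "((\<lambda>w. 2 * of_real pi*\<i> * ?I w) has_field_derivative
          (of_nat 1 * contour_integral (circlepath z0 r) (\<lambda>u. ?I u/(u-z0)^(Suc 1)))) (at z0)"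
        by (rule Cauchy_next_derivative_circlepath(2)[OF _ int])
           (use r ps contI continuous_on_subset in auto)
      then have "((\<lambda>w. (2 * of_real pi*\<i> * ?I w) / (2 * of_real pi*\<i>)) has_field_derivative
          (of_nat 1 * contour_integral (circlepath z0 r) (\<lambda>u. ?I u/(u-z0)^(Suc 1)) / (2 * of_real pi*\<i>))) (at z0)"
        by (rule DERIV_cdivide)
      then show ?thesis by (auto simp: field_differentiable_def)
    qed
    then show ?thesis using D by (simp add: holomorphic_on_open field_differentiable_def)
  qed
  then show ?thesis using S cont2 by (auto simp: hol_def)
qed

text \<open>Normality separates \<open>A - S\<close> from \<open>B\<close>, and adding
  \<open>S\<close> to the first neighbourhood does no harm. In the gluing of extensions this makes
  two domains overlap only where the transition function has been split.\<close>

lemma open_neighbourhoods_Int_subset: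
  fixes A B :: "'a::t4_space set"
  assumes "compact A" "compact B" "open S" "A \<inter> B \<subseteq> S"
  obtains T1 T2 where "open T1" "open T2" "A \<subseteq> T1" "B \<subseteq> T2" "T1 \<inter> T2 \<subseteq> S"
proof -
  have "closed (A - S)" "closed B"
    using assms by (simp_all add: compact_imp_closed closed_Diff)
  moreover have "(A - S) \<inter> B = {}" using assms by blast
  ultimately obtain P1 P2 where "open P1" "open P2" "A - S \<subseteq> P1" "B \<subseteq> P2" "P1 \<inter> P2 = {}"
    using t4_space by meson
  then show ?thesis using assms by (intro that[of "P1 \<union> S" P2]) auto
qed

section \<open>Boxes and polynomial polyhedra in sequence space\<close>

definition prod_box :: "(nat \<Rightarrow> complex) \<Rightarrow> (nat \<Rightarrow> complex) \<Rightarrow> (nat \<Rightarrow> complex) set" where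
  "prod_box l u = {x. \<forall>i. x i \<in> cbox (l i) (u i)}"

text \<open>The values of \<open>p j\<close> are confined to a square and not to a disc, so that the
  graph of \<open>p\<close> over the polyhedron lies again in a box, where Cauchy's formula over
  rectangles is available.\<close>

definition box_polyhedron where
  "box_polyhedron l u p s = {x \<in> prod_box l u. \<forall>j<s::nat. p j x \<in> cbox (-1-\<i>) (1+\<i>)}"

lemma compact_prod_box: "compact (prod_box l u)"
proof -
  have "prod_box l u = PiE UNIV (\<lambda>i. cbox (l i) (u i))"
    by (auto simp: prod_box_def PiE_def Pi_def)
  then show ?thesis
    using compactin_PiE[of "\<lambda>_. euclidean" UNIV "\<lambda>i. cbox (l i) (u i)"]
    by (simp add: euclidean_product_topology)
qed

lemma compact_box_polyhedron:
  assumes "\<And>j. j < s \<Longrightarrow> hol (p j) UNIV"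
  shows "compact (box_polyhedron l u p s)"
proof -
  have "closed (p j -` cbox (-1-\<i>) (1+\<i>))" if "j < s" for j
    using hol_cont[OF assms[OF that]] closed_vimage continuous_on_eq_continuous_within closed_cbox by blast
  then have "closed (\<Inter>j\<in>{..<s}. p j -` cbox (-1-\<i>) (1+\<i>))" by auto
  moreover have "box_polyhedron l u p s = prod_box l u \<inter> (\<Inter>j\<in>{..<s}. p j -` cbox (-1-\<i>) (1+\<i>))"
    by (auto simp: box_polyhedron_def)
  ultimately show ?thesis by (simp add: compact_Int_closed compact_prod_box)
qed

section \<open>Splitting a holomorphic function across a cut of a box\<close>

definition re_or_im :: "bool \<Rightarrow> complex \<Rightarrow> real" where "re_or_im b z = (if b then Re z else Im z)"
definition set_re_or_im :: "bool \<Rightarrow> real \<Rightarrow> complex \<Rightarrow> complex" where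
  "set_re_or_im b a z = (if b then Complex a (Im z) else Complex (Re z) a)"

lemma continuous_on_re_or_im [continuous_intros]: "continuous_on A f \<Longrightarrow> continuous_on A (\<lambda>x. re_or_im b (f x))"
  unfolding re_or_im_def by (cases b) (auto intro!: continuous_intros)

lemma re_or_im_set_re_or_im [simp]: "re_or_im b (set_re_or_im b a z) = a" "set_re_or_im b (re_or_im b z) z = z" "set_re_or_im b a (set_re_or_im b c z) = set_re_or_im b a z"
  by (auto simp: re_or_im_def set_re_or_im_def)

lemma in_cbox_upper: "a \<le> re_or_im b v \<Longrightarrow> z \<in> cbox w (set_re_or_im b a v) \<longleftrightarrow> z \<in> cbox w v \<and> re_or_im b z \<le> a"
  and in_cbox_lower: "re_or_im b w \<le> a \<Longrightarrow> z \<in> cbox (set_re_or_im b a w) v \<longleftrightarrow> z \<in> cbox w v \<and> a \<le> re_or_im b z"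
  by (auto simp: in_cbox_complex_iff re_or_im_def set_re_or_im_def)

lemma prod_box_upper: assumes "a \<le> re_or_im b (u k)" shows "prod_box l (u(k := set_re_or_im b a (u k))) = {x \<in> prod_box l u. re_or_im b (x k) \<le> a}"
proof (intro set_eqI iffI)
  fix x assume "x \<in> prod_box l (u(k := set_re_or_im b a (u k)))"
  then have *: "x i \<in> cbox (l i) ((u(k := set_re_or_im b a (u k))) i)" for i
    by (simp add: prod_box_def)
  have k: "x k \<in> cbox (l k) (u k)" "re_or_im b (x k) \<le> a"
    using *[of k] in_cbox_upper[OF assms] by simp_all
  have "x i \<in> cbox (l i) (u i)" for i
    using k(1) *[of i] by (cases "i = k") simp_all
  then show "x \<in> {x \<in> prod_box l u. re_or_im b (x k) \<le> a}"
    using k by (simp add: prod_box_def)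
qed (use in_cbox_upper[OF assms] in \<open>simp add: prod_box_def\<close>)

lemma prod_box_lower: assumes "re_or_im b (l k) \<le> a" shows "prod_box (l(k := set_re_or_im b a (l k))) u = {x \<in> prod_box l u. a \<le> re_or_im b (x k)}"
proof (intro set_eqI iffI)
  fix x assume "x \<in> prod_box (l(k := set_re_or_im b a (l k))) u"
  then have *: "x i \<in> cbox ((l(k := set_re_or_im b a (l k))) i) (u i)" for i
    by (simp add: prod_box_def)
  have k: "x k \<in> cbox (l k) (u k)" "a \<le> re_or_im b (x k)"
    using *[of k] in_cbox_lower[OF assms] by simp_all
  have "x i \<in> cbox (l i) (u i)" for i
    using k(1) *[of i] by (cases "i = k") simp_all
  then show "x \<in> {x \<in> prod_box l u. a \<le> re_or_im b (x k)}"
    using k by (simp add: prod_box_def)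
qed (use in_cbox_lower[OF assms] in \<open>simp add: prod_box_def\<close>)

lemma box_polyhedron_upper: "a \<le> re_or_im b (u k) \<Longrightarrow> box_polyhedron l (u(k := set_re_or_im b a (u k))) p s = {x \<in> box_polyhedron l u p s. re_or_im b (x k) \<le> a}"
  and box_polyhedron_lower: "re_or_im b (l k) \<le> a \<Longrightarrow> box_polyhedron (l(k := set_re_or_im b a (l k))) u p s = {x \<in> box_polyhedron l u p s. a \<le> re_or_im b (x k)}"
  by (auto simp: box_polyhedron_def prod_box_upper prod_box_lower)

lemma box_polyhedron_mid: "re_or_im b (l k) \<le> a \<Longrightarrow> a \<le> re_or_im b (u k) \<Longrightarrow>
   box_polyhedron (l(k := set_re_or_im b a (l k))) (u(k := set_re_or_im b a (u k))) p s = {x \<in> box_polyhedron l u p s. re_or_im b (x k) = a}"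
  by (auto simp: box_polyhedron_upper box_polyhedron_lower)

text \<open>A rectangle boundary that passes the segment \<open>re_or_im b z = \<alpha>\<close> of \<open>cbox w v\<close>, in two halves.\<close>

lemma cauchy_two_arcs:
  fixes b :: bool and \<alpha> :: real and w v :: complex and e :: real
  assumes ass: "0 < e" "re_or_im b w \<le> \<alpha>" "\<alpha> \<le> re_or_im b v" "Re w \<le> Re v" "Im w \<le> Im v"
  defines "J \<equiv> {z \<in> cbox w v. re_or_im b z = \<alpha>}"
  obtains P Q :: "(complex \<times> complex) set" and I where
    "finite P" "finite Q" "open I" "J \<subseteq> I"
    "\<And>z x. z \<in> P \<union> Q \<Longrightarrow> x \<in> closed_segment (fst z) (snd z) \<Longrightarrow> \<exists>y\<in>J. dist y x < e"
    "\<And>z x. z \<in> P \<Longrightarrow> x \<in> closed_segment (fst z) (snd z) \<Longrightarrow> \<not> (x \<in> cbox w v \<and> re_or_im b x \<le> \<alpha>)"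
    "\<And>z x. z \<in> Q \<Longrightarrow> x \<in> closed_segment (fst z) (snd z) \<Longrightarrow> \<not> (x \<in> cbox w v \<and> \<alpha> \<le> re_or_im b x)"
    "\<And>z x. z \<in> P \<union> Q \<Longrightarrow> x \<in> closed_segment (fst z) (snd z) \<Longrightarrow> x \<notin> I"
    "\<And>f z. f holomorphic_on {x. \<exists>y\<in>J. dist y x < e} \<Longrightarrow> z \<in> I \<Longrightarrow>
      (\<Sum>q\<in>P. contour_integral (linepath (fst q) (snd q)) (\<lambda>\<zeta>. f \<zeta> / (\<zeta> - z))) +
      (\<Sum>q\<in>Q. contour_integral (linepath (fst q) (snd q)) (\<lambda>\<zeta>. f \<zeta> / (\<zeta> - z))) = 2 * of_real pi * \<i> * f z"
proof -
  \<comment> \<open>The rectangle is \<open>J\<close> enlarged by \<delta> in both real directions.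
    Its points are within 2\<delta> of \<open>J\<close>, and this has to stay below
    \<open>e\<close>.\<close>
  define \<delta> where "\<delta> = e / 3"
  have \<delta>: "\<delta> > 0" "2 * \<delta> < e" using ass by (auto simp: \<delta>_def)
  define w' v' where "w' = (if b then Complex \<alpha> (Im w) else Complex (Re w) \<alpha>)"
    and "v' = (if b then Complex \<alpha> (Im v) else Complex (Re v) \<alpha>)"
  define a1 a3 where "a1 = w' - Complex \<delta> \<delta>" and "a3 = v' + Complex \<delta> \<delta>"
  define a2 a4 where "a2 = Complex (Re a3) (Im a1)" and "a4 = Complex (Re a1) (Im a3)"
  have J: "J = cbox w' v'"
    using ass by (auto simp: J_def w'_def v'_def in_cbox_complex_iff re_or_im_def)
  have le: "Re w' \<le> Re v'" "Im w' \<le> Im v'" using ass by (auto simp: w'_def v'_def)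
  have near: "\<exists>y\<in>J. dist y x < e" if "x \<in> cbox a1 a3" for x
  proof -
    define y where "y = Complex (max (Re w') (min (Re v') (Re x))) (max (Im w') (min (Im v') (Im x)))"
    have "y \<in> J" using le by (auto simp: J y_def in_cbox_complex_iff)
    moreover have "cmod (y - x) \<le> \<bar>Re (y - x)\<bar> + \<bar>Im (y - x)\<bar>" by (rule cmod_le)
    moreover have "\<bar>Re (y - x)\<bar> \<le> \<delta>" "\<bar>Im (y - x)\<bar> \<le> \<delta>"
      using that le \<delta> by (auto simp: y_def in_cbox_complex_iff a1_def a3_def)
    ultimately show ?thesis using \<delta> by (auto simp: dist_norm intro!: bexI[of _ y])
  qed
  \<comment> \<open>\<open>m1\<close> and \<open>m2\<close> are the points where the boundary of the
    rectangle crosses the line \<open>re_or_im b z = \<alpha>\<close>. They lie outside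
    \<open>cbox w v\<close>, because \<open>J\<close> runs across the whole box; so each half of the
    boundary misses the part of the box on the other side, its end points included.\<close>
  define m1 m2 where "m1 = (if b then Complex \<alpha> (Im a1) else Complex (Re a3) \<alpha>)"
    and "m2 = (if b then Complex \<alpha> (Im a3) else Complex (Re a1) \<alpha>)"
  define P where "P = (if b then {(m1,a2),(a2,a3),(a3,m2)} else {(m1,a3),(a3,a4),(a4,m2)})"
  define Q where "Q = (if b then {(m2,a4),(a4,a1),(a1,m1)} else {(m2,a1),(a1,a2),(a2,m1)})"
  note defs = a1_def a2_def a3_def a4_def m1_def m2_def w'_def v'_def
  have seg: "closed_segment c d \<subseteq> cbox (Complex (min (Re c) (Re d)) (min (Im c) (Im d)))
      (Complex (max (Re c) (Re d)) (max (Im c) (Im d)))" for c d :: complex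
    by (rule closed_segment_subset) (auto simp: in_cbox_complex_iff)
  have bd: "x \<in> cbox a1 a3 \<and> (Re x = Re a1 \<or> Re x = Re a3 \<or> Im x = Im a1 \<or> Im x = Im a3)"
    if "z \<in> P \<union> Q" "x \<in> closed_segment (fst z) (snd z)" for z x
    using that seg[of "fst z" "snd z"] le \<delta>
    by (cases b) (auto simp: P_def Q_def in_cbox_complex_iff defs subset_iff)
  have cP: "\<not> (x \<in> cbox w v \<and> re_or_im b x \<le> \<alpha>)" if "z \<in> P" "x \<in> closed_segment (fst z) (snd z)" for z x
    using that seg[of "fst z" "snd z"] le \<delta>
    by (cases b) (force simp: P_def in_cbox_complex_iff defs subset_iff re_or_im_def)+
  have cQ: "\<not> (x \<in> cbox w v \<and> \<alpha> \<le> re_or_im b x)" if "z \<in> Q" "x \<in> closed_segment (fst z) (snd z)" for z x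
    using that seg[of "fst z" "snd z"] le \<delta>
    by (cases b) (force simp: Q_def in_cbox_complex_iff defs subset_iff re_or_im_def)+
  show ?thesis
  proof (rule that[of P Q "box a1 a3"])
    show "finite P" "finite Q" by (auto simp: P_def Q_def)
    show "J \<subseteq> box a1 a3" using \<delta> by (auto simp: J in_cbox_complex_iff in_box_complex_iff defs split: if_splits)
    show "\<exists>y\<in>J. dist y x < e" if "z \<in> P \<union> Q" "x \<in> closed_segment (fst z) (snd z)" for z x
      using bd[OF that] near by blast
    show "x \<notin> box a1 a3" if "z \<in> P \<union> Q" "x \<in> closed_segment (fst z) (snd z)" for z x
      using bd[OF that] by (auto simp: in_box_complex_iff)
    fix f z
    assume f: "f holomorphic_on {x. \<exists>y\<in>J. dist y x < e}" and z: "z \<in> box a1 a3"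
    let ?g = "\<lambda>\<zeta>. f \<zeta> / (\<zeta> - z)"
    let ?i = "\<lambda>c d. contour_integral (linepath c d) ?g"
    have f': "f holomorphic_on cbox a1 a3" by (rule holomorphic_on_subset[OF f]) (use near in blast)
    have less: "Re a1 < Re a3" "Im a1 < Im a3" using le \<delta> by (auto simp: defs)
    have base_pt: "path_image (rectpath a1 a3) \<subseteq> cbox a1 a3 - {z}"
      using path_image_rectpath_subset_cbox[of a1 a3] path_image_rectpath_inter_box[of a1 a3] z less by auto
    have hi: "(?g has_contour_integral 2 * pi * \<i> * winding_number (rectpath a1 a3) z * f z) (rectpath a1 a3)"
      by (rule Cauchy_integral_formula_convex_simple[OF _ f'])
         (use base_pt z in \<open>auto simp: interior_cbox valid_path_rectpath\<close>)
    have sub: "closed_segment c d \<subseteq> cbox a1 a3 - {z}"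
      if "(c,d) \<in> {(a1,a2),(a2,a3),(a3,a4),(a4,a1)}" for c d
    proof
      fix x assume "x \<in> closed_segment c d"
      from subsetD[OF seg this] show "x \<in> cbox a1 a3 - {z}"
        using that z less by (elim insertE) (auto simp: in_cbox_complex_iff in_box_complex_iff a2_def a4_def)
    qed
    have cont: "continuous_on (closed_segment c d) ?g"
      if "(c,d) \<in> {(a1,a2),(a2,a3),(a3,a4),(a4,a1)}" for c d
      by (intro continuous_intros holomorphic_on_imp_continuous_on holomorphic_on_subset[OF f'])
         (use sub[OF that] in auto)
    have ci: "?g contour_integrable_on linepath c d"
      if "(c,d) \<in> {(a1,a2),(a2,a3),(a3,a4),(a4,a1)}" for c d
      using contour_integrable_continuous_linepath cont[OF that] by blast
    have "contour_integral (rectpath a1 a3) ?g = ?i a1 a2 + (?i a2 a3 + (?i a3 a4 + ?i a4 a1))"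
      unfolding rectpath_def Let_def a2_def[symmetric] a4_def[symmetric]
      using ci by (simp add: contour_integral_join)
    then have tot: "?i a1 a2 + ?i a2 a3 + ?i a3 a4 + ?i a4 a1 = 2 * of_real pi * \<i> * f z"
      using contour_integral_unique[OF hi] winding_number_rectpath[OF z] by (simp add: add.assoc)
    have segI: "c \<in> closed_segment d d'" if "Re d = Re d' \<and> Re c = Re d \<and> Im c \<in> closed_segment (Im d) (Im d')
       \<or> Im d = Im d' \<and> Im c = Im d \<and> Re c \<in> closed_segment (Re d) (Re d')" for c d d' :: complex
      using that
    proof (elim disjE conjE)
      assume "Re d = Re d'" "Re c = Re d" "Im c \<in> closed_segment (Im d) (Im d')"
      then show ?thesis by (subst closed_segment_same_Re) simp_all
    next
      assume "Im d = Im d'" "Im c = Im d" "Re c \<in> closed_segment (Re d) (Re d')"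
      then show ?thesis by (subst closed_segment_same_Im) simp_all
    qed
    show "(\<Sum>q\<in>P. contour_integral (linepath (fst q) (snd q)) ?g) +
      (\<Sum>q\<in>Q. contour_integral (linepath (fst q) (snd q)) ?g) = 2 * of_real pi * \<i> * f z"
    proof (cases b)
      case True
      have "?i a1 a2 = ?i a1 m1 + ?i m1 a2"
        by (rule contour_integral_split_linepath[OF cont])
           (use True \<delta> in \<open>auto intro!: segI simp: defs closed_segment_eq_real_ivl\<close>)
      moreover have "?i a3 a4 = ?i a3 m2 + ?i m2 a4"
        by (rule contour_integral_split_linepath[OF cont])
           (use True \<delta> in \<open>auto intro!: segI simp: defs closed_segment_eq_real_ivl\<close>)
      \<comment> \<open>The integrals are summed over sets of pairs of end points, so the three
        pairs of each half have to be distinct.\<close>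
      moreover have "a1 \<noteq> m1" "m1 \<noteq> a2" "a2 \<noteq> a3" "a3 \<noteq> m2" "m2 \<noteq> a4" "a4 \<noteq> a1" "a3 \<noteq> a4"
          "a1 \<noteq> a3" "m1 \<noteq> m2" "a2 \<noteq> a4" "m1 \<noteq> a4" "m1 \<noteq> a3" "a1 \<noteq> m2" "a2 \<noteq> m2"
        using True \<delta> le by (auto simp: defs complex_eq_iff)
      ultimately show ?thesis using True tot by (simp add: P_def Q_def algebra_simps)
    next
      case False
      have "?i a2 a3 = ?i a2 m1 + ?i m1 a3"
        by (rule contour_integral_split_linepath[OF cont])
           (use False \<delta> in \<open>auto intro!: segI simp: defs closed_segment_eq_real_ivl\<close>)
      moreover have "?i a4 a1 = ?i a4 m2 + ?i m2 a1"
        by (rule contour_integral_split_linepath[OF cont])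
           (use False \<delta> in \<open>auto intro!: segI simp: defs closed_segment_eq_real_ivl\<close>)
      moreover have "a2 \<noteq> m1" "m1 \<noteq> a3" "a1 \<noteq> a2" "a4 \<noteq> m2" "m2 \<noteq> a1" "a4 \<noteq> a1" "a3 \<noteq> a4"
          "a1 \<noteq> a3" "m1 \<noteq> m2" "a2 \<noteq> a4" "m1 \<noteq> a4" "m1 \<noteq> a1" "a3 \<noteq> m2" "a2 \<noteq> m2"
        using False \<delta> le by (auto simp: defs complex_eq_iff)
      ultimately show ?thesis using False tot by (simp add: P_def Q_def algebra_simps)
    qed
  qed (use cP cQ in auto)
qed

lemma continuous_on_fun_upd:
  fixes f :: "'a::topological_space \<Rightarrow> nat \<Rightarrow> complex"
  assumes "continuous_on A f" "continuous_on A g"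
  shows "continuous_on A (\<lambda>z. (f z)(k := g z))"
proof (rule continuous_on_coordinatewise_then_product)
  show "continuous_on A (\<lambda>x. ((f x)(k := g x)) i)" for i
    using assms continuous_on_product_then_coordinatewise[OF assms(1), of i] by (cases "i = k") simp_all
qed

lemma open_neighbourhood_all_points:
  fixes \<phi> :: "'a::topological_space \<Rightarrow> 'b::topological_space \<Rightarrow> 'c::topological_space"
  assumes "compact C" "open T" "continuous_on UNIV (\<lambda>(x,y). \<phi> x y)" "\<And>x y. x \<in> B \<Longrightarrow> y \<in> C \<Longrightarrow> \<phi> x y \<in> T"
  obtains T0 where "open T0" "B \<subseteq> T0" "\<And>x y. x \<in> T0 \<Longrightarrow> y \<in> C \<Longrightarrow> \<phi> x y \<in> T"
proof -
  define W where "W = (\<lambda>(x,y). \<phi> x y) -` T"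
  have W: "open W" unfolding W_def using assms(2,3) by (simp add: open_vimage)
  have "\<exists>X0. x \<in> X0 \<and> open X0 \<and> X0 \<times> C \<subseteq> W" if "x \<in> B" for x
    by (rule Elementary_Topology.tube_lemma[OF assms(1) W]) (use assms(4) that in \<open>auto simp: W_def\<close>)
  then obtain X0 where X0: "x \<in> X0 x" "open (X0 x)" "X0 x \<times> C \<subseteq> W" if "x \<in> B" for x by metis
  show ?thesis
    by (rule that[of "\<Union>x\<in>B. X0 x"]) (use X0 in \<open>auto simp: W_def subset_iff\<close>)
qed

lemma hol_fun_upd:
  assumes "hol F T" "open S" "\<And>x. x \<in> S \<Longrightarrow> x(k := \<zeta>) \<in> T"
  shows "hol (\<lambda>x. F (x(k := \<zeta>))) S"
proof (rule hol_compose[OF assms(1)])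
  show "hol (\<lambda>x. (x(k := \<zeta>)) i) S" for i
    by (cases "i = k") (simp_all add: assms(2) hol_const hol_coord)
qed (use assms in auto)

lemma hol_cauchy_kernel:
  assumes F: "hol F T" and S: "open S" and C: "\<And>x \<zeta>. x \<in> S \<Longrightarrow> \<zeta> \<in> path_image \<gamma> \<Longrightarrow> x(k := \<zeta>) \<in> T"
    and \<gamma>: "valid_path \<gamma>" "continuous_on {0..1} (\<lambda>t. vector_derivative \<gamma> (at t))"
    and h: "continuous_on (S \<times> path_image \<gamma>) (\<lambda>(x,\<zeta>). h \<zeta> x)" "\<And>\<zeta>. \<zeta> \<in> path_image \<gamma> \<Longrightarrow> hol (h \<zeta>) S"
  shows "hol (\<lambda>x. contour_integral \<gamma> (\<lambda>\<zeta>. F (x(k := \<zeta>)) * h \<zeta> x)) S"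
proof (rule hol_contour_integral[OF \<gamma> S])
  have "continuous_on (S \<times> path_image \<gamma>) (\<lambda>p. (fst p)(k := snd p))"
    by (intro continuous_on_fun_upd continuous_intros)
  then have "continuous_on (S \<times> path_image \<gamma>) (\<lambda>p. F ((fst p)(k := snd p)))"
    by (rule continuous_on_compose2[OF hol_cont[OF F]]) (use C in auto)
  then show "continuous_on (S \<times> path_image \<gamma>) (\<lambda>(x, \<zeta>). F (x(k := \<zeta>)) * h \<zeta> x)"
    using h(1) by (auto simp: split_beta intro!: continuous_on_mult)
qed (use h(2) C S in \<open>auto intro!: hol_mult hol_fun_upd[OF F]\<close>)

text \<open>Cousin's additive splitting for a box cut along a real hyperplane. Cauchy's formula in
  the variable \<open>x k\<close>, over a rectangle close to the cut, writes \<open>F\<close> as a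
  sum of integrals over two halves of the boundary. Each of them is holomorphic as long as
  \<open>x k\<close> avoids its half, in particular on the whole opposite side of the box.\<close>

lemma cauchy_split:
  assumes F: "hol F T" and \<alpha>: "re_or_im b (l k) \<le> \<alpha>" "\<alpha> \<le> re_or_im b (u k)"
    and T: "{x \<in> prod_box l u. re_or_im b (x k) = \<alpha>} \<subseteq> T"
  obtains F' T' F'' T'' N where "hol F' T'" "hol F'' T''" "open N" "{x \<in> prod_box l u. re_or_im b (x k) \<le> \<alpha>} \<subseteq> T'"
    "{x \<in> prod_box l u. \<alpha> \<le> re_or_im b (x k)} \<subseteq> T''" "{x \<in> prod_box l u. re_or_im b (x k) = \<alpha>} \<subseteq> N"
    "\<And>x. x \<in> N \<Longrightarrow> F x = F' x - F'' x"
proof (cases "prod_box l u = {}")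
  case True
  then show ?thesis by (intro that[of "\<lambda>_. 0" "{}" "\<lambda>_. 0" "{}" "{}"]) (auto intro: hol_const)
next
  case False
  define w v where "w = l k" and "v = u k"
  have "cbox w v \<noteq> {}" using False unfolding prod_box_def w_def v_def by blast
  then have wv: "Re w \<le> Re v" "Im w \<le> Im v" by (auto simp: in_cbox_complex_iff)
  define J where "J = {z \<in> cbox w v. re_or_im b z = \<alpha>}"
  have "closed (re_or_im b -` {\<alpha>})"
    using continuous_on_re_or_im[OF continuous_on_id, of UNIV b] by (auto intro: closed_vimage)
  moreover have "J = cbox w v \<inter> re_or_im b -` {\<alpha>}" by (auto simp: J_def)
  ultimately have cJ: "compact J" by (simp add: compact_Int_closed)
  have contu: "continuous_on UNIV (\<lambda>(\<zeta>::complex,x::nat\<Rightarrow>complex). x(k := \<zeta>))"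
    "continuous_on UNIV (\<lambda>(x::nat\<Rightarrow>complex,\<zeta>::complex). x(k := \<zeta>))"
    unfolding split_beta by (intro continuous_on_fun_upd continuous_intros)+
  \<comment> \<open>By compactness the \<open>k\<close>-th coordinate of any point of the box may be
    moved through one neighbourhood of \<open>J\<close> without leaving \<open>T\<close>. Below,
    \<open>T0\<close> lets the other coordinates vary a little as well, so the contour integrals
    make sense near the whole box and not only near the cut.\<close>
  obtain O' where O': "open O'" "J \<subseteq> O'" "\<And>\<zeta> x. \<zeta> \<in> O' \<Longrightarrow> x \<in> prod_box l u \<Longrightarrow> x(k := \<zeta>) \<in> T"
  proof (rule open_neighbourhood_all_points[OF compact_prod_box hol_open[OF F] contu(1), of J l u])
    show "x(k := \<zeta>) \<in> T" if "\<zeta> \<in> J" "x \<in> prod_box l u" for \<zeta> x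
      using that T by (auto simp: J_def prod_box_def w_def v_def)
  qed blast
  obtain e where e: "e > 0" "(\<Union>x\<in>J. ball x e) \<subseteq> O'"
    using compact_subset_open_imp_ball_epsilon_subset[OF cJ O'(1,2)] by blast
  define C where "C = (\<Union>x\<in>J. cball x (e/2))"
  have "compact C" unfolding C_def using compact_minkowski_sum_cball[OF cJ] by blast
  have CO: "C \<subseteq> O'" using e by (force simp: C_def)
  obtain T0 where T0: "open T0" "prod_box l u \<subseteq> T0" "\<And>x \<zeta>. x \<in> T0 \<Longrightarrow> \<zeta> \<in> C \<Longrightarrow> x(k := \<zeta>) \<in> T"
    using open_neighbourhood_all_points[OF \<open>compact C\<close> hol_open[OF F] contu(2), of "prod_box l u"] O'(3) CO
    by (metis subset_iff)
  obtain P Q I where PQ: "finite P" "finite Q" "open I" "J \<subseteq> I"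
    and near: "\<And>z x. z \<in> P \<union> Q \<Longrightarrow> x \<in> closed_segment (fst z) (snd z) \<Longrightarrow> \<exists>y\<in>J. dist y x < e/2"
    and P: "\<And>z x. z \<in> P \<Longrightarrow> x \<in> closed_segment (fst z) (snd z) \<Longrightarrow> \<not> (x \<in> cbox w v \<and> re_or_im b x \<le> \<alpha>)"
    and Q: "\<And>z x. z \<in> Q \<Longrightarrow> x \<in> closed_segment (fst z) (snd z) \<Longrightarrow> \<not> (x \<in> cbox w v \<and> \<alpha> \<le> re_or_im b x)"
    and nI: "\<And>z x. z \<in> P \<union> Q \<Longrightarrow> x \<in> closed_segment (fst z) (snd z) \<Longrightarrow> x \<notin> I"
    and C: "\<And>f z. f holomorphic_on {x. \<exists>y\<in>J. dist y x < e/2} \<Longrightarrow> z \<in> I \<Longrightarrow>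
      (\<Sum>q\<in>P. contour_integral (linepath (fst q) (snd q)) (\<lambda>\<zeta>. f \<zeta> / (\<zeta> - z))) +
      (\<Sum>q\<in>Q. contour_integral (linepath (fst q) (snd q)) (\<lambda>\<zeta>. f \<zeta> / (\<zeta> - z))) = 2 * of_real pi * \<i> * f z"
    by (rule cauchy_two_arcs[of "e/2" b w \<alpha> v]) (use e \<alpha> wv in \<open>auto simp: w_def v_def J_def\<close>)
  define ar where "ar R = (\<Union>q\<in>R. closed_segment (fst q) (snd q))" for R :: "(complex \<times> complex) set"
  define g where "g R x = (\<Sum>q\<in>R. contour_integral (linepath (fst q) (snd q)) (\<lambda>\<zeta>. F (x(k := \<zeta>)) * (1 / (\<zeta> - x k))))
      / (2 * of_real pi * \<i>)" for R x
  define TT where "TT R = {x \<in> T0. x k \<notin> ar R}" for R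
  have hg: "hol (g R) (TT R)" if R: "finite R" "R \<subseteq> P \<union> Q" for R
  proof -
    have "closed (ar R)" unfolding ar_def using R(1) by auto
    then have "closed ((\<lambda>x. x k) -` ar R)"
      by (rule closed_vimage) (auto intro: continuous_on_product_then_coordinatewise)
    moreover have "TT R = T0 - (\<lambda>x. x k) -` ar R" by (auto simp: TT_def)
    ultimately have op: "open (TT R)" using T0(1) by auto
    have "hol (\<lambda>x. contour_integral (linepath (fst q) (snd q)) (\<lambda>\<zeta>. F (x(k := \<zeta>)) * (1 / (\<zeta> - x k)))) (TT R)"
      if q: "q \<in> R" for q
    proof (rule hol_cauchy_kernel[OF F op])
      show "x(k := \<zeta>) \<in> T" if "x \<in> TT R" "\<zeta> \<in> path_image (linepath (fst q) (snd q))" for x \<zeta>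
        using near[of q \<zeta>] q R that by (intro T0(3)) (force simp: TT_def C_def)+
      have ne: "\<zeta> - x k \<noteq> 0" if "x \<in> TT R" "\<zeta> \<in> path_image (linepath (fst q) (snd q))" for x \<zeta>
        using that q by (auto simp: TT_def ar_def)
      have "continuous_on (TT R \<times> path_image (linepath (fst q) (snd q))) (\<lambda>p. fst p k)"
        by (rule continuous_on_product_then_coordinatewise) (intro continuous_intros)
      then show "continuous_on (TT R \<times> path_image (linepath (fst q) (snd q))) (\<lambda>(x, \<zeta>). 1 / (\<zeta> - x k))"
        unfolding split_beta by (intro continuous_intros) (use ne in auto)
      show "hol (\<lambda>x. 1 / (\<zeta> - x k)) (TT R)" if "\<zeta> \<in> path_image (linepath (fst q) (snd q))" for \<zeta>
        by (intro hol_divide hol_const hol_diff hol_coord op) (use that ne in auto)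
    qed (auto intro!: continuous_intros)
    then show ?thesis unfolding g_def
      by (intro hol_divide hol_sum hol_const op) auto
  qed
  define N where "N = {x \<in> T0. x k \<in> I}"
  \<comment> \<open>The arcs in \<open>P\<close> lie beyond the cut, so their integral serves the
    side \<open>re_or_im b (x k) \<le> \<alpha>\<close>. The sign of the other integral turns the
    sum into a difference, the form used for transition functions.\<close>
  show ?thesis
  proof (rule that[of "g P" "TT P" "\<lambda>x. 0 - g Q x" "TT Q" N])
    show "hol (g P) (TT P)" using PQ hg by auto
    have "hol (g Q) (TT Q)" using PQ hg by auto
    then show "hol (\<lambda>x. 0 - g Q x) (TT Q)" by (intro hol_diff hol_const hol_open)
    have "open ((\<lambda>x::nat\<Rightarrow>complex. x k) -` I)"
      by (rule open_vimage[OF PQ(3)]) (auto intro: continuous_on_product_then_coordinatewise)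
    moreover have "N = T0 \<inter> (\<lambda>x. x k) -` I" by (auto simp: N_def)
    ultimately show "open N" using T0(1) by auto
    have k: "x k \<in> cbox w v" if "x \<in> prod_box l u" for x using that by (auto simp: prod_box_def w_def v_def)
    show "{x \<in> prod_box l u. re_or_im b (x k) \<le> \<alpha>} \<subseteq> TT P"
      using T0(2) P k by (fastforce simp: TT_def ar_def)
    show "{x \<in> prod_box l u. \<alpha> \<le> re_or_im b (x k)} \<subseteq> TT Q"
      using T0(2) Q k by (fastforce simp: TT_def ar_def)
    show "{x \<in> prod_box l u. re_or_im b (x k) = \<alpha>} \<subseteq> N"
      using T0(2) PQ(4) k by (auto simp: N_def J_def)
    fix x assume x: "x \<in> N"
    let ?D = "{\<zeta>. \<exists>y\<in>J. dist y \<zeta> < e/2}"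
    have D: "?D = (\<Union>y\<in>J. ball y (e/2))" by auto
    have "(\<lambda>\<zeta>. F (x(k := \<zeta>))) holomorphic_on ?D"
    proof (rule hol_curve[OF F])
      show "holomorphic_curve (\<lambda>\<zeta>. x(k := \<zeta>)) ?D"
        unfolding holomorphic_curve_def D
      proof (intro conjI allI)
        show "(\<lambda>z. (x(k := z)) i) holomorphic_on (\<Union>y\<in>J. ball y (e/2))" for i
          by (cases "i = k") simp_all
      qed auto
      show "(\<lambda>\<zeta>. x(k := \<zeta>)) ` ?D \<subseteq> T"
        using x T0(3) by (force simp: N_def C_def)
    qed
    from C[OF this, of "x k"] show "F x = g P x - (0 - g Q x)"
      using x unfolding g_def N_def by (simp flip: add_divide_distrib)
  qed
qed

section \<open>Oka's theorem: extension from graphs\<close>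

definition prepend_const :: "nat \<Rightarrow> complex \<Rightarrow> (nat \<Rightarrow> complex) \<Rightarrow> nat \<Rightarrow> complex" where
  "prepend_const s c l = (\<lambda>i. if i < s then c else l (i - s))"

text \<open>The values of \<open>p\<close> stand in front of the coordinates. A further function
  then gets the position directly before \<open>x\<close>, and this is how the induction on
  \<open>s\<close> adds a variable.\<close>

definition graph_map :: "nat \<Rightarrow> (nat \<Rightarrow> (nat \<Rightarrow> complex) \<Rightarrow> complex) \<Rightarrow> (nat \<Rightarrow> complex) \<Rightarrow> nat \<Rightarrow> complex" where
  "graph_map s p x = (\<lambda>i. if i < s then p i x else x (i - s))"

abbreviation "prepend_box s l u \<equiv> prod_box (prepend_const s (-1-\<i>) l) (prepend_const s (1+\<i>) u)"

lemma graph_map_prepend_box: "x \<in> box_polyhedron l u p s \<Longrightarrow> graph_map s p x \<in> prepend_box s l u"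
  by (auto simp: box_polyhedron_def prod_box_def prepend_const_def graph_map_def)

lemma hol_graph_map: "(\<And>j. j < s \<Longrightarrow> hol (p j) S) \<Longrightarrow> open S \<Longrightarrow> hol (\<lambda>x. graph_map s p x i) S"
  by (cases "i < s") (simp_all add: graph_map_def hol_coord)

lemma hol_compose_vimage:
  assumes "hol F T" "\<And>i. hol (\<lambda>x. \<Phi> x i) UNIV"
  shows "hol (\<lambda>x. F (\<Phi> x)) (\<Phi> -` T)"
proof -
  have "continuous_on UNIV \<Phi>"
    using assms(2) by (intro continuous_on_coordinatewise_then_product hol_cont)
  then have "open (\<Phi> -` T)" using hol_open[OF assms(1)] by (simp add: open_vimage)
  then show ?thesis
    by (intro hol_compose[OF assms(1)] hol_subset[OF assms(2)]) auto
qed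

lemma prepend_const_upd: "prepend_const s c (l(k := z)) = (prepend_const s c l)(k + s := z)"
  by (auto simp: prepend_const_def fun_eq_iff)

text \<open>Oka's theorem with \<open>s\<close> polynomial inequalities: functions near the polyhedron are pulled back along the
  graph of \<open>(p 0, \<dots>, p (s - 1))\<close> from functions near a box with \<open>s\<close> more dimensions. The condition \<open>l i = u i\<close>
  for \<open>i \<ge> M\<close> freezes all but finitely many coordinates.\<close>

definition oka_extension :: "nat \<Rightarrow> bool" where
  "oka_extension s \<longleftrightarrow> (\<forall>p l u M f T. (\<forall>j<s. hol (p j) UNIV) \<and> (\<forall>i\<ge>M. l i = u i) \<and> box_polyhedron l u p s \<subseteq> T \<and> hol f T \<longrightarrow>
     (\<exists>F T' N. prepend_box s l u \<subseteq> T' \<and> hol F T' \<and> open N \<and> box_polyhedron l u p s \<subseteq> N \<and> (\<forall>x\<in>N. F (graph_map s p x) = f x)))"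

text \<open>The slice of the polyhedron is a polyhedron over a degenerate box. Oka extension
  therefore carries \<open>v\<close> to a slice of the larger box, where Cauchy's formula splits it,
  and restriction to the graph brings the splitting back. So the Cousin problem on the polyhedron is
  solved with Cauchy's formula as the only analytic tool.\<close>

lemma split_box_polyhedron:
  assumes E: "oka_extension s" and p: "\<And>j. j < s \<Longrightarrow> hol (p j) UNIV" and lu: "\<And>i. i \<ge> M \<Longrightarrow> l i = u i"
    and \<alpha>: "re_or_im b (l k) \<le> \<alpha>" "\<alpha> \<le> re_or_im b (u k)"
    and v: "hol v T" "{x \<in> box_polyhedron l u p s. re_or_im b (x k) = \<alpha>} \<subseteq> T"
  obtains v' T' v'' T'' N where "hol v' T'" "hol v'' T''" "open N" "{x \<in> box_polyhedron l u p s. re_or_im b (x k) \<le> \<alpha>} \<subseteq> T'"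
    "{x \<in> box_polyhedron l u p s. \<alpha> \<le> re_or_im b (x k)} \<subseteq> T''" "{x \<in> box_polyhedron l u p s. re_or_im b (x k) = \<alpha>} \<subseteq> N"
    "\<And>x. x \<in> N \<Longrightarrow> v x = v' x - v'' x"
proof -
  define l1 u1 where "l1 = l(k := set_re_or_im b \<alpha> (l k))" and "u1 = u(k := set_re_or_im b \<alpha> (u k))"
  have ph1: "box_polyhedron l1 u1 p s = {x \<in> box_polyhedron l u p s. re_or_im b (x k) = \<alpha>}"
    unfolding l1_def u1_def using \<alpha> by (rule box_polyhedron_mid)
  have "l1 i = u1 i" if "i \<ge> max M (Suc k)" for i using that lu[of i] by (auto simp: l1_def u1_def)
  then have "\<exists>V TV N1. prepend_box s l1 u1 \<subseteq> TV \<and> hol V TV \<and> open N1 \<and> box_polyhedron l1 u1 p s \<subseteq> N1 \<and>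
      (\<forall>x\<in>N1. V (graph_map s p x) = v x)"
    using p v by (intro E[unfolded oka_extension_def, rule_format, of p "max M (Suc k)" l1 u1 T v]) (auto simp: ph1)
  then obtain V TV N1 where V: "prepend_box s l1 u1 \<subseteq> TV" "hol V TV" "open N1" "box_polyhedron l1 u1 p s \<subseteq> N1"
    "\<And>x. x \<in> N1 \<Longrightarrow> V (graph_map s p x) = v x" by blast
  have ck: "prepend_const s c l (k + s) = l k" for c l by (simp add: prepend_const_def)
  have cb: "prepend_box s l1 u1 = {x \<in> prepend_box s l u. re_or_im b (x (k + s)) = \<alpha>}"
    unfolding l1_def u1_def prepend_const_upd
    using prod_box_upper[of \<alpha> b "prepend_const s (1+\<i>) u" "k+s"] prod_box_lower[of b "prepend_const s (-1-\<i>) l" "k+s" \<alpha>] \<alpha>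
    by (auto simp: ck)
  obtain V' T' V'' T'' N where s: "hol V' T'" "hol V'' T''" "open N" "{x \<in> prepend_box s l u. re_or_im b (x (k+s)) \<le> \<alpha>} \<subseteq> T'"
    "{x \<in> prepend_box s l u. \<alpha> \<le> re_or_im b (x (k+s))} \<subseteq> T''" "{x \<in> prepend_box s l u. re_or_im b (x (k+s)) = \<alpha>} \<subseteq> N"
    "\<And>x. x \<in> N \<Longrightarrow> V x = V' x - V'' x"
  proof (rule cauchy_split[OF V(2), of b "prepend_const s (-1-\<i>) l" "k+s" \<alpha> "prepend_const s (1+\<i>) u"], goal_cases)
    case 4 show ?case by (rule 4(1)) (fact 4)+
  qed (use V(1) \<alpha> cb in \<open>simp_all add: ck\<close>)
  have hj: "hol (\<lambda>x. graph_map s p x i) UNIV" for i using hol_graph_map p by simp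
  have jk: "graph_map s p x (k + s) = x k" for x by (simp add: graph_map_def)
  show ?thesis
  proof (rule that)
    show "hol (\<lambda>x. V' (graph_map s p x)) (graph_map s p -` T')" "hol (\<lambda>x. V'' (graph_map s p x)) (graph_map s p -` T'')"
      using hol_compose_vimage s hj by auto
    have "hol (\<lambda>x. graph_map s p x i) UNIV" for i using hj .
    then have "open (graph_map s p -` N)" using hol_open[OF hol_compose_vimage[OF hol_const[OF s(3)] hj]] by simp
    then show "open (N1 \<inter> graph_map s p -` N)" using V(3) by auto
    show "v x = V' (graph_map s p x) - V'' (graph_map s p x)" if "x \<in> N1 \<inter> graph_map s p -` N" for x
      using that s(7)[of "graph_map s p x"] V(5)[of x] by simp
  qed (use V(4) ph1 graph_map_prepend_box s(4-6) in \<open>auto simp: jk subset_iff\<close>)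
qed

section \<open>Extension from hypersurfaces in polynomial polyhedra\<close>

text \<open>\<open>F\<close> extends \<open>f\<close> from the hypersurface \<open>g = 0\<close>; \<open>u\<close> witnesses that \<open>g\<close> divides \<open>F - f\<close> near it.\<close>

definition extension_on where
  "extension_on f g N F T \<longleftrightarrow> hol F T \<and> (\<exists>u. hol u (T \<inter> N) \<and> (\<forall>x\<in>T \<inter> N. F x = f x + g x * u x))"

definition extendable where "extendable f g N X \<longleftrightarrow> (\<exists>F T. X \<subseteq> T \<and> extension_on f g N F T)"

text \<open>Two extensions differ near the overlap by \<open>g x * v x\<close> with \<open>v\<close>
  holomorphic; splitting \<open>v\<close> as \<open>v' - v''\<close> makes \<open>F1 - g v'\<close>
  and \<open>F2 - g v''\<close> agree. The divisibility witnesses are carried along because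
  \<open>g\<close> may vanish to higher order: equality of both extensions with \<open>f\<close> on
  the zero set would not make \<open>(F1 - F2) / g\<close> holomorphic.\<close>

lemma extendable_merge:
  assumes E: "oka_extension s" and p: "\<And>j. j < s \<Longrightarrow> hol (p j) UNIV" and lu: "\<And>i. i \<ge> M \<Longrightarrow> l i = u i"
    and \<alpha>: "re_or_im b (l k) \<le> \<alpha>" "\<alpha> \<le> re_or_im b (u k)"
    and f: "hol f N" and g: "hol g G" "box_polyhedron l u p s \<subseteq> G"
    and N: "\<And>x. x \<in> box_polyhedron l u p s \<Longrightarrow> g x = 0 \<Longrightarrow> x \<in> N"
    and s1: "extendable f g N (box_polyhedron l (u(k := set_re_or_im b \<alpha> (u k))) p s)"
    and s2: "extendable f g N (box_polyhedron (l(k := set_re_or_im b \<alpha> (l k))) u p s)"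
  shows "extendable f g N (box_polyhedron l u p s)"
proof -
  define X1 X2 where "X1 = {x \<in> box_polyhedron l u p s. re_or_im b (x k) \<le> \<alpha>}" and "X2 = {x \<in> box_polyhedron l u p s. \<alpha> \<le> re_or_im b (x k)}"
  have X: "box_polyhedron l (u(k := set_re_or_im b \<alpha> (u k))) p s = X1" "box_polyhedron (l(k := set_re_or_im b \<alpha> (l k))) u p s = X2"
    unfolding X1_def X2_def using \<alpha> by (auto simp: box_polyhedron_upper box_polyhedron_lower)
  have cX: "compact X1" "compact X2" unfolding X[symmetric] by (rule compact_box_polyhedron, rule p, assumption)+
  have X12: "X1 \<union> X2 = box_polyhedron l u p s" "X1 \<inter> X2 = {x \<in> box_polyhedron l u p s. re_or_im b (x k) = \<alpha>}"
    by (auto simp: X1_def X2_def)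
  obtain F1 T1 u1 where 1: "X1 \<subseteq> T1" "hol F1 T1" "hol u1 (T1 \<inter> N)" "\<And>x. x \<in> T1 \<inter> N \<Longrightarrow> F1 x = f x + g x * u1 x"
    using s1 unfolding X extendable_def extension_on_def by blast
  obtain F2 T2 u2 where 2: "X2 \<subseteq> T2" "hol F2 T2" "hol u2 (T2 \<inter> N)" "\<And>x. x \<in> T2 \<inter> N \<Longrightarrow> F2 x = f x + g x * u2 x"
    using s2 unfolding X extendable_def extension_on_def by blast
  note op = hol_open[OF f] hol_open[OF g(1)] hol_open[OF 1(2)] hol_open[OF 2(2)]
  have "continuous_on G g" using g hol_cont by blast
  then have "open (G \<inter> g -` (- {0}))" using op(2) by (simp add: continuous_on_open_vimage Int_commute open_Compl)
  then have opZ: "open (T1 \<inter> T2 \<inter> (G \<inter> g -` (- {0})))" using op by auto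
  \<comment> \<open>The quotient \<open>(F1 - F2) / g\<close>, continued across the zeros of
    \<open>g\<close> by the difference of the two witnesses.\<close>
  define v where "v x = (if x \<in> T1 \<inter> T2 \<inter> N then u1 x - u2 x else (F1 x - F2 x) / g x)" for x
  define A where "A = T1 \<inter> T2 \<inter> N \<union> T1 \<inter> T2 \<inter> (G \<inter> g -` (- {0}))"
  have hv: "hol v A"
    unfolding v_def A_def
  proof (rule hol_If)
    show "hol (\<lambda>x. u1 x - u2 x) (T1 \<inter> T2 \<inter> N)"
      by (intro hol_diff hol_subset[OF 1(3)] hol_subset[OF 2(3)]) (use op in auto)
    show "hol (\<lambda>x. (F1 x - F2 x) / g x) (T1 \<inter> T2 \<inter> (G \<inter> g -` (- {0})))"
      by (intro hol_divide hol_diff hol_subset[OF 1(2)] hol_subset[OF 2(2)] hol_subset[OF g(1)] opZ) auto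
    show "u1 x - u2 x = (F1 x - F2 x) / g x"
      if "x \<in> T1 \<inter> T2 \<inter> N" "x \<in> T1 \<inter> T2 \<inter> (G \<inter> g -` (- {0}))" for x
      using that 1(4)[of x] 2(4)[of x] by (simp add: field_simps)
  qed
  have gv: "F1 x - F2 x = g x * v x" if "x \<in> A" for x
    using that 1(4)[of x] 2(4)[of x] by (auto simp: A_def v_def field_simps)
  have XA: "X1 \<inter> X2 \<subseteq> A" using 1(1) 2(1) g(2) N by (auto simp: A_def X1_def X2_def)
  obtain v' T' v'' T'' N0 where sp: "hol v' T'" "hol v'' T''" "open N0" "X1 \<subseteq> T'" "X2 \<subseteq> T''" "X1 \<inter> X2 \<subseteq> N0"
    "\<And>x. x \<in> N0 \<Longrightarrow> v x = v' x - v'' x"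
  proof (rule split_box_polyhedron[where k=k and b=b and \<alpha>=\<alpha> and v=v and T=A and s=s and p=p and M=M and l=l and u=u], goal_cases)
    case 8 show ?case by (rule 8(1)[unfolded X12(2), unfolded X1_def X2_def]) (fact 8)+
  qed (rule E p lu \<alpha> hv XA[unfolded X12(2)] | assumption)+
  have "open (N0 \<inter> A)" using sp(3) hol_open[OF hv] by auto
  then obtain O1 O2 where O: "open O1" "open O2" "X1 \<subseteq> O1" "X2 \<subseteq> O2" "O1 \<inter> O2 \<subseteq> N0 \<inter> A"
    using open_neighbourhoods_Int_subset[OF cX, of "N0 \<inter> A"] XA sp(6) by (metis le_inf_iff)
  \<comment> \<open>\<open>O1\<close> and \<open>O2\<close> shrink the domains so that they meet
    only inside \<open>N0 \<inter> A\<close>, where both the formula for \<open>F1 - F2\<close> and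
    the splitting of \<open>v\<close> hold.\<close>
  define S1 S2 where "S1 = T1 \<inter> T' \<inter> G \<inter> O1" and "S2 = T2 \<inter> T'' \<inter> G \<inter> O2"
  have oS: "open S1" "open S2" unfolding S1_def S2_def
    by (intro open_Int op O(1,2) hol_open[OF sp(1)] hol_open[OF sp(2)])+
  define F where "F x = (if x \<in> S1 then F1 x - g x * v' x else F2 x - g x * v'' x)" for x
  define w where "w x = (if x \<in> S1 \<inter> N then u1 x - v' x else u2 x - v'' x)" for x
  have hF: "hol F (S1 \<union> S2)" unfolding F_def
  proof (rule hol_If)
    show "hol (\<lambda>x. F1 x - g x * v' x) S1"
      by (intro hol_diff hol_mult hol_subset[OF 1(2)] hol_subset[OF g(1)] hol_subset[OF sp(1)] oS) (auto simp: S1_def)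
    show "hol (\<lambda>x. F2 x - g x * v'' x) S2"
      by (intro hol_diff hol_mult hol_subset[OF 2(2)] hol_subset[OF g(1)] hol_subset[OF sp(2)] oS) (auto simp: S2_def)
    show "F1 x - g x * v' x = F2 x - g x * v'' x" if "x \<in> S1" "x \<in> S2" for x
    proof -
      have x: "x \<in> N0" "x \<in> A" using that O(5) by (auto simp: S1_def S2_def)
      show ?thesis using gv[OF x(2)] sp(7)[OF x(1)] by (simp add: algebra_simps)
    qed
  qed
  have hw: "hol w (S1 \<inter> N \<union> S2 \<inter> N)" unfolding w_def
  proof (rule hol_If)
    show "hol (\<lambda>x. u1 x - v' x) (S1 \<inter> N)"
      by (intro hol_diff hol_subset[OF 1(3)] hol_subset[OF sp(1)] open_Int oS op) (auto simp: S1_def)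
    show "hol (\<lambda>x. u2 x - v'' x) (S2 \<inter> N)"
      by (intro hol_diff hol_subset[OF 2(3)] hol_subset[OF sp(2)] open_Int oS op) (auto simp: S2_def)
    show "u1 x - v' x = u2 x - v'' x" if "x \<in> S1 \<inter> N" "x \<in> S2 \<inter> N" for x
    proof -
      have x: "x \<in> N0" "v x = u1 x - u2 x" using that O(5) by (auto simp: S1_def S2_def v_def)
      show ?thesis using x sp(7)[OF x(1)] by (simp add: algebra_simps)
    qed
  qed
  have eq: "F x = f x + g x * w x" if "x \<in> (S1 \<union> S2) \<inter> N" for x
    using that 1(4)[of x] 2(4)[of x] by (auto simp: F_def w_def S1_def S2_def algebra_simps)
  have "hol w ((S1 \<union> S2) \<inter> N)" using hw by (simp add: Int_Un_distrib2)
  then have "extension_on f g N F (S1 \<union> S2)" using hF eq unfolding extension_on_def by blast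
  moreover have "box_polyhedron l u p s \<subseteq> S1 \<union> S2"
  proof -
    have "X1 \<subseteq> G" "X2 \<subseteq> G" using g(2) unfolding X12(1)[symmetric] by blast+
    then have "X1 \<subseteq> S1" "X2 \<subseteq> S2" using 1(1) 2(1) sp(4,5) O(3,4) unfolding S1_def S2_def by blast+
    then show ?thesis unfolding X12(1)[symmetric] by blast
  qed
  ultimately show ?thesis using extendable_def by blast
qed

lemma continuous_on_coord: "continuous_on A (\<lambda>x::nat\<Rightarrow>complex. x k)"
  using hol_cont[OF hol_coord[of UNIV k]] continuous_on_subset by blast

lemma box_polyhedron_slab_near:
  assumes p: "\<And>j. j < s \<Longrightarrow> hol (p j) UNIV" and T: "open T" "{x \<in> box_polyhedron l u p s. re_or_im b (x k) = \<alpha>} \<subseteq> T"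
  shows "\<exists>d>0. {x \<in> box_polyhedron l u p s. \<bar>re_or_im b (x k) - \<alpha>\<bar> < d} \<subseteq> T"
proof -
  let ?c = "\<lambda>x::nat\<Rightarrow>complex. re_or_im b (x k)"
  have "compact (box_polyhedron l u p s - T)" by (intro compact_diff compact_box_polyhedron p T(1))
  then have "compact (?c ` (box_polyhedron l u p s - T))"
    by (rule compact_continuous_image[OF continuous_on_re_or_im[OF continuous_on_coord]])
  moreover have "\<alpha> \<notin> ?c ` (box_polyhedron l u p s - T)" using T(2) by auto
  ultimately have "\<exists>d>0. \<forall>x\<in>?c ` (box_polyhedron l u p s - T). d \<le> dist \<alpha> x"
    by (intro separate_point_closed compact_imp_closed)
  then obtain d where "d > 0" "\<forall>x\<in>?c ` (box_polyhedron l u p s - T). d \<le> dist \<alpha> x" by blast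
  then show ?thesis by (intro exI[of _ d]) (force simp: dist_real_def abs_minus_commute)
qed

lemma extension_on_near_point:
  assumes "hol f N" "hol g G" "x \<in> G" "g x = 0 \<Longrightarrow> x \<in> N"
  shows "\<exists>F T. x \<in> T \<and> extension_on f g N F T"
proof (cases "x \<in> N")
  case True
  have "open (N \<inter> G)" using assms hol_open by auto
  then have "extension_on f g N f (N \<inter> G)"
    unfolding extension_on_def using hol_subset[OF assms(1)] hol_open[OF assms(1)]
    by (auto intro!: exI[of _ "\<lambda>_. 0"] hol_const open_Int)
  then show ?thesis using True assms by blast
next
  case False
  have "continuous_on G g" using assms(2) hol_cont by blast
  then have o: "open (G \<inter> g -` (- {0}))"
    using hol_open[OF assms(2)] by (simp add: continuous_on_open_vimage Int_commute open_Compl)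
  have o2: "open (G \<inter> g -` (- {0}) \<inter> N)" using o hol_open[OF assms(1)] by auto
  \<comment> \<open>Away from the zeros of \<open>g\<close> there is nothing to extend:
    \<open>F = 0\<close> will do, with witness \<open>-f / g\<close> on the part where
    \<open>f\<close> is defined.\<close>
  have "hol (\<lambda>x. (0 - f x) / g x) (G \<inter> g -` (- {0}) \<inter> N)"
    by (intro hol_divide hol_diff hol_const hol_subset[OF assms(1)] hol_subset[OF assms(2)] o2) auto
  then have "extension_on f g N (\<lambda>_. 0) (G \<inter> g -` (- {0}))"
    unfolding extension_on_def using o by (intro conjI hol_const exI[of _ "\<lambda>x. (0 - f x) / g x"]) auto
  then show ?thesis using False assms by (intro exI[of _ "\<lambda>_. 0"] exI[of _ "G \<inter> g -` (- {0})"]) auto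
qed

lemma extendable_singleton: "\<exists>F T. x \<in> T \<and> extension_on f g N F T \<Longrightarrow> X \<subseteq> {x} \<Longrightarrow> extendable f g N X"
  unfolding extendable_def by blast

text \<open>The box is built up from a point, one coordinate at a time. An extension near a slice is
  also one near a thin slab around it, and neighbouring slabs merge, so bisection of the interval
  yields the full width. Each complex coordinate takes two rounds, one for its real and one for its
  imaginary part. Only \<open>oka_extension s\<close> is used, so the lemma may serve in the step
  from \<open>s\<close> to \<open>Suc s\<close>.\<close>

lemma hypersurface_extension:
  assumes E: "oka_extension s" and p: "\<And>j. j < s \<Longrightarrow> hol (p j) UNIV" and lu: "\<And>i. i \<ge> M \<Longrightarrow> l i = u i"
    and f: "hol f N" and g: "hol g G" "box_polyhedron l u p s \<subseteq> G"
    and N: "\<And>x. x \<in> box_polyhedron l u p s \<Longrightarrow> g x = 0 \<Longrightarrow> x \<in> N"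
  shows "extendable f g N (box_polyhedron l u p s)"
proof -
  have main: "extendable f g N (box_polyhedron l' u' p s)"
    if "prod_box l' u' \<subseteq> prod_box l u" "\<And>i. i \<ge> n \<Longrightarrow> l' i = u' i" for n l' u'
    using that
  proof (induction n arbitrary: l' u')
    case 0
    then have "box_polyhedron l' u' p s \<subseteq> {l'}" by (auto simp: box_polyhedron_def prod_box_def fun_eq_iff)
    moreover have "\<exists>F T. l' \<in> T \<and> extension_on f g N F T" if "l' \<in> box_polyhedron l' u' p s"
    proof (rule extension_on_near_point[OF f g(1)])
      have "l' \<in> box_polyhedron l u p s" using that 0(1) by (auto simp: box_polyhedron_def)
      then show "l' \<in> G" "g l' = 0 \<Longrightarrow> l' \<in> N" using g(2) N by auto
    qed
    moreover have "extendable f g N {}" unfolding extendable_def extension_on_def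
      by (rule exI[of _ "\<lambda>_. 0"], rule exI[of _ "{}"]) (auto intro: hol_const)
    ultimately show ?case
      by (metis extendable_singleton subset_singletonD insertI1)
  next
    case (Suc n)
    show ?case
    proof (cases "prod_box l' u' = {}")
      case True
      moreover have "extendable f g N {}" unfolding extendable_def extension_on_def
        by (rule exI[of _ "\<lambda>_. 0"], rule exI[of _ "{}"]) (auto intro: hol_const)
      ultimately show ?thesis by (metis (no_types, lifting) box_polyhedron_def empty_iff Collect_empty_eq)
    next
      case False
      have le: "re_or_im b (l' n) \<le> re_or_im b (u' n)" for b
      proof -
        have "cbox (l' n) (u' n) \<noteq> {}" using False unfolding prod_box_def by blast
        then show ?thesis by (auto simp: in_cbox_complex_iff re_or_im_def)
      qed
      have step: "extendable f g N (box_polyhedron l1 u1 p s)"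
        if sub: "prod_box l1 u1 \<subseteq> prod_box l u" and e: "\<And>i. i \<ge> Suc n \<Longrightarrow> l1 i = u1 i" and le: "re_or_im b (l1 n) \<le> re_or_im b (u1 n)"
          and IH: "\<And>\<alpha>. re_or_im b (l1 n) \<le> \<alpha> \<Longrightarrow> \<alpha> \<le> re_or_im b (u1 n) \<Longrightarrow>
            extendable f g N (box_polyhedron (l1(n := set_re_or_im b \<alpha> (l1 n))) (u1(n := set_re_or_im b \<alpha> (u1 n))) p s)" for b l1 u1
      proof -
        define L U where "L a = l1(n := set_re_or_im b a (l1 n))" and "U a = u1(n := set_re_or_im b a (u1 n))" for a
        \<comment> \<open>The induction rule \<open>Bolzano\<close> speaks of arbitrary intervals;
          the two guards make the claim vacuous for those that leave the interval of the
          box.\<close>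
        define P where "P a c \<longleftrightarrow> (re_or_im b (l1 n) \<le> a \<longrightarrow> c \<le> re_or_im b (u1 n) \<longrightarrow> extendable f g N (box_polyhedron (L a) (U c) p s))" for a c
        have LU: "re_or_im b (L a n) = a" "re_or_im b (U a n) = a" for a by (auto simp: L_def U_def)
        have phLU: "box_polyhedron (L a) (U c) p s = {x \<in> box_polyhedron l1 u1 p s. a \<le> re_or_im b (x n) \<and> re_or_im b (x n) \<le> c}"
          if "re_or_im b (l1 n) \<le> a" "c \<le> re_or_im b (u1 n)" for a c
          using that box_polyhedron_upper[of c b u1 n "L a"] box_polyhedron_lower[of b l1 n a u1] by (auto simp: L_def U_def)
        have phs: "box_polyhedron l1 u1 p s \<subseteq> box_polyhedron l u p s" using sub by (auto simp: box_polyhedron_def)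
        have "P (re_or_im b (l1 n)) (re_or_im b (u1 n))"
          using le
        proof (induction rule: Bolzano)
          case (trans a c d)
          show ?case unfolding P_def
          proof (intro impI)
            assume ad: "re_or_im b (l1 n) \<le> a" "d \<le> re_or_im b (u1 n)"
            have "box_polyhedron (L a) (U d) p s \<subseteq> box_polyhedron l u p s" using phLU[OF ad] phs by auto
            moreover have "(U d)(n := set_re_or_im b c (U d n)) = U c" "(L a)(n := set_re_or_im b c (L a n)) = L c"
              by (auto simp: L_def U_def)
            ultimately show "extendable f g N (box_polyhedron (L a) (U d) p s)"
              using trans ad g N
              by (intro extendable_merge[where f=f and g=g and N=N and G=G and s=s and p=p and M="Suc n" and l="L a" and u="U d" and b=b and k=n and \<alpha>=c])
                 (auto simp: E p f LU P_def e L_def U_def)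
          qed
        next
          case (local x)
          have "extendable f g N (box_polyhedron (L x) (U x) p s)"
            unfolding L_def U_def by (rule IH[OF local])
          then obtain F T where FT: "box_polyhedron (L x) (U x) p s \<subseteq> T" "extension_on f g N F T" unfolding extendable_def by blast
          then have "open T" using hol_open extension_on_def by blast
          moreover have "{y \<in> box_polyhedron l1 u1 p s. re_or_im b (y n) = x} \<subseteq> T" using FT(1) phLU[OF local] by auto
          \<comment> \<open>The extension near the slice lives on an open set, which by compactness
            contains a slab of positive width.\<close>
          ultimately have "\<exists>d>0. {y \<in> box_polyhedron l1 u1 p s. \<bar>re_or_im b (y n) - x\<bar> < d} \<subseteq> T"
            by (rule box_polyhedron_slab_near[rotated 1]) (rule p)
          then obtain d where d: "d > 0" "{y \<in> box_polyhedron l1 u1 p s. \<bar>re_or_im b (y n) - x\<bar> < d} \<subseteq> T" by blast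
          have "P a c" if "a \<le> x" "x \<le> c" "c - a < d" for a c
            unfolding P_def
          proof (intro impI)
            assume ac: "re_or_im b (l1 n) \<le> a" "c \<le> re_or_im b (u1 n)"
            have "box_polyhedron (L a) (U c) p s \<subseteq> T" unfolding phLU[OF ac] using d(2) that by fastforce
            then show "extendable f g N (box_polyhedron (L a) (U c) p s)" using FT(2) extendable_def by blast
          qed
          then show ?case using d(1) by blast
        qed
        then show ?thesis by (simp add: P_def L_def U_def)
      qed
      \<comment> \<open>Slices in the real direction are treated by slicing them in the imaginary
        direction. Once both parts are fixed the \<open>n\<close>-th coordinate is frozen, and the
        induction hypothesis applies.\<close>
      show ?thesis
      proof (rule step[OF Suc.prems(1) Suc.prems(2) le[of True]])
        fix \<alpha> assume \<alpha>: "re_or_im True (l' n) \<le> \<alpha>" "\<alpha> \<le> re_or_im True (u' n)"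
        define l1 u1 where "l1 = l'(n := set_re_or_im True \<alpha> (l' n))" and "u1 = u'(n := set_re_or_im True \<alpha> (u' n))"
        have s1: "prod_box l1 u1 \<subseteq> prod_box l u"
          using Suc.prems(1) \<alpha> prod_box_upper[of \<alpha> True u' n l1] prod_box_lower[of True l' n \<alpha> u']
          by (auto simp: l1_def u1_def)
        have F: "re_or_im False (l1 n) = re_or_im False (l' n)" "re_or_im False (u1 n) = re_or_im False (u' n)"
          by (auto simp: re_or_im_def set_re_or_im_def l1_def u1_def)
        have "extendable f g N (box_polyhedron l1 u1 p s)"
        proof (rule step[OF s1, of False])
          show "re_or_im False (l1 n) \<le> re_or_im False (u1 n)" using le F by simp
          show "l1 i = u1 i" if "i \<ge> Suc n" for i using Suc.prems(2)[OF that] that by (auto simp: l1_def u1_def)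
          fix \<beta> assume \<beta>: "re_or_im False (l1 n) \<le> \<beta>" "\<beta> \<le> re_or_im False (u1 n)"
          show "extendable f g N (box_polyhedron (l1(n := set_re_or_im False \<beta> (l1 n))) (u1(n := set_re_or_im False \<beta> (u1 n))) p s)"
          proof (rule Suc.IH)
            show "prod_box (l1(n := set_re_or_im False \<beta> (l1 n))) (u1(n := set_re_or_im False \<beta> (u1 n))) \<subseteq> prod_box l u"
              using s1 \<beta> prod_box_upper[of \<beta> False u1 n "l1(n := set_re_or_im False \<beta> (l1 n))"] prod_box_lower[of False l1 n \<beta> u1]
              by auto
            fix i assume "n \<le> i"
            then show "(l1(n := set_re_or_im False \<beta> (l1 n))) i = (u1(n := set_re_or_im False \<beta> (u1 n))) i"
              using Suc.prems(2)[of i] by (cases "i = n") (auto simp: l1_def u1_def set_re_or_im_def)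
          qed
        qed
        then show "extendable f g N (box_polyhedron (l'(n := set_re_or_im True \<alpha> (l' n))) (u'(n := set_re_or_im True \<alpha> (u' n))) p s)"
          by (simp add: l1_def u1_def)
      qed auto
    qed
  qed
  show ?thesis by (rule main[of l u M]) (use lu in auto)
qed

lemma oka_extension_0: "oka_extension 0"
  unfolding oka_extension_def
proof (intro allI impI)
  fix p l u M and f :: "(nat \<Rightarrow> complex) \<Rightarrow> complex" and T
  assume *: "(\<forall>j<0. hol (p j) UNIV) \<and> (\<forall>i\<ge>M. l i = u i) \<and> box_polyhedron l u p 0 \<subseteq> T \<and> hol f T"
  have "prepend_box 0 l u = box_polyhedron l u p 0" "graph_map 0 p = id" by (auto simp: prepend_const_def box_polyhedron_def graph_map_def fun_eq_iff)
  then show "\<exists>F T' N. prepend_box 0 l u \<subseteq> T' \<and> hol F T' \<and> open N \<and> box_polyhedron l u p 0 \<subseteq> N \<and> (\<forall>x\<in>N. F (graph_map 0 p x) = f x)"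
    using * hol_open by (intro exI[of _ f] exI[of _ T]) auto
qed

definition shift_seq :: "(nat \<Rightarrow> complex) \<Rightarrow> nat \<Rightarrow> complex" where "shift_seq y = (\<lambda>i. y (Suc i))"

lemma hol_shift_seq: "hol (\<lambda>y. shift_seq y i) UNIV" by (simp add: shift_seq_def hol_coord)

lemma all_nat_Suc: "(\<forall>i. P i) \<longleftrightarrow> P 0 \<and> (\<forall>i. P (Suc i))"
  by (metis nat.exhaust)

lemma box_polyhedron_Suc_shift:
  "y \<in> box_polyhedron (prepend_const 1 c l) (prepend_const 1 d u) (\<lambda>j x. p j (shift_seq x)) s \<longleftrightarrow> y 0 \<in> cbox c d \<and> shift_seq y \<in> box_polyhedron l u p s"
proof -
  have "(\<forall>i. y i \<in> cbox (prepend_const 1 c l i) (prepend_const 1 d u i)) \<longleftrightarrow> y 0 \<in> cbox c d \<and> (\<forall>i. shift_seq y i \<in> cbox (l i) (u i))"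
    by (subst all_nat_Suc) (auto simp: prepend_const_def shift_seq_def)
  then show ?thesis by (auto simp: box_polyhedron_def prod_box_def)
qed

text \<open>The polyhedron with one more inequality is the hypersurface \<open>y 0 = p s x\<close>
  in the product of a square with the polyhedron given by the first \<open>s\<close> inequalities.
  Extending \<open>f\<close> from this hypersurface removes the last inequality at the price of one
  coordinate, and \<open>oka_extension s\<close> then removes the others.\<close>

lemma oka_extension_Suc:
  assumes E: "oka_extension s"
  shows "oka_extension (Suc s)"
  unfolding oka_extension_def
proof (intro allI impI)
  fix p l u M and f :: "(nat \<Rightarrow> complex) \<Rightarrow> complex" and T
  assume *: "(\<forall>j<Suc s. hol (p j) UNIV) \<and> (\<forall>i\<ge>M. l i = u i) \<and> box_polyhedron l u p (Suc s) \<subseteq> T \<and> hol f T"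
  define l1 u1 where "l1 = prepend_const 1 (-1-\<i>) l" and "u1 = prepend_const 1 (1+\<i>) u"
  define q where "q = (\<lambda>j x. p j (shift_seq x))"
  define g where "g y = y 0 - p s (shift_seq y)" for y
  have hq: "hol (q j) UNIV" if "j < s" for j
    unfolding q_def using * that hol_compose[of "p j" UNIV shift_seq UNIV] hol_shift_seq by auto
  have hps: "hol (\<lambda>y. p s (shift_seq y)) UNIV"
    using * hol_compose[of "p s" UNIV shift_seq UNIV] hol_shift_seq by auto
  have hg: "hol g UNIV" unfolding g_def by (intro hol_diff hol_coord hps) auto
  have hf: "hol (\<lambda>y. f (shift_seq y)) (shift_seq -` T)" using * hol_shift_seq by (intro hol_compose_vimage) auto
  have lu1: "l1 i = u1 i" if "i \<ge> Suc M" for i using that * by (auto simp: l1_def u1_def prepend_const_def)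
  have memph: "y \<in> box_polyhedron l1 u1 q s \<longleftrightarrow> y 0 \<in> cbox (-1-\<i>) (1+\<i>) \<and> shift_seq y \<in> box_polyhedron l u p s" for y
    unfolding l1_def u1_def q_def by (rule box_polyhedron_Suc_shift)
  have "extendable (\<lambda>y. f (shift_seq y)) g (shift_seq -` T) (box_polyhedron l1 u1 q s)"
  proof (rule hypersurface_extension[OF E hq lu1 hf hg])
    fix y assume y: "y \<in> box_polyhedron l1 u1 q s" "g y = 0"
    then have "shift_seq y \<in> box_polyhedron l u p (Suc s)" unfolding memph by (auto simp: box_polyhedron_def less_Suc_eq g_def)
    then show "y \<in> shift_seq -` T" using * by auto
  qed auto
  then obtain F1 T1 w where F1: "box_polyhedron l1 u1 q s \<subseteq> T1" "hol F1 T1"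
      "\<And>y. y \<in> T1 \<Longrightarrow> shift_seq y \<in> T \<Longrightarrow> F1 y = f (shift_seq y) + g y * w y"
    unfolding extendable_def extension_on_def by blast
  have "\<exists>F T' N. prepend_box s l1 u1 \<subseteq> T' \<and> hol F T' \<and> open N \<and> box_polyhedron l1 u1 q s \<subseteq> N \<and> (\<forall>x\<in>N. F (graph_map s q x) = F1 x)"
    using F1 hq lu1 by (intro E[unfolded oka_extension_def, rule_format, of q "Suc M" l1 u1 T1 F1]) auto
  then obtain F T' N where F: "prepend_box s l1 u1 \<subseteq> T'" "hol F T'" "open N" "box_polyhedron l1 u1 q s \<subseteq> N"
    "\<And>x. x \<in> N \<Longrightarrow> F (graph_map s q x) = F1 x" by blast
  define \<Phi> where "\<Phi> x = prepend_const 1 (p s x) x" for x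
  have h\<Phi>: "hol (\<lambda>x. \<Phi> x i) UNIV" for i using * by (cases i) (auto simp: \<Phi>_def prepend_const_def hol_coord)
  have shift_seq\<Phi>: "shift_seq (\<Phi> x) = x" "\<Phi> x 0 = p s x" "g (\<Phi> x) = 0" for x by (auto simp: \<Phi>_def prepend_const_def shift_seq_def g_def)
  \<comment> \<open>The coordinate \<open>y 0\<close> becomes the last of the prepended ones, so
    \<open>s\<close> squares in front of it make \<open>Suc s\<close> squares altogether.\<close>
  have cb: "prepend_box s l1 u1 = prepend_box (Suc s) l u"
  proof -
    have "prepend_const s c (prepend_const 1 c l) = prepend_const (Suc s) c l" for c l by (auto simp: prepend_const_def fun_eq_iff)
    then show ?thesis by (simp add: l1_def u1_def)
  qed
  have j: "graph_map s q (\<Phi> x) = graph_map (Suc s) p x" for x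
    by (auto simp: graph_map_def q_def shift_seq\<Phi>(1) fun_eq_iff less_Suc_eq) (auto simp: \<Phi>_def prepend_const_def)
  define N' where "N' = T \<inter> \<Phi> -` (N \<inter> T1)"
  have "open (N \<inter> T1)" using F(3) hol_open[OF F1(2)] by (rule open_Int)
  then have "open (\<Phi> -` (N \<inter> T1))"
    by (intro hol_open[OF hol_compose_vimage[OF hol_const h\<Phi>]])
  then have "open N'" unfolding N'_def using * hol_open by blast
  moreover have "box_polyhedron l u p (Suc s) \<subseteq> N'"
  proof
    fix x assume x: "x \<in> box_polyhedron l u p (Suc s)"
    then have "\<Phi> x \<in> box_polyhedron l1 u1 q s" unfolding memph shift_seq\<Phi> by (auto simp: box_polyhedron_def)
    then show "x \<in> N'" using x * F(4) F1(1) by (auto simp: N'_def)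
  qed
  \<comment> \<open>On the graph \<open>g\<close> vanishes, and with it the error term
    \<open>g y * w y\<close> of the extension.\<close>
  moreover have "F (graph_map (Suc s) p x) = f x" if "x \<in> N'" for x
    using that F(5)[of "\<Phi> x"] F1(3)[of "\<Phi> x"] by (simp add: N'_def j shift_seq\<Phi>)
  ultimately show "\<exists>F T' N. prepend_box (Suc s) l u \<subseteq> T' \<and> hol F T' \<and> open N \<and> box_polyhedron l u p (Suc s) \<subseteq> N \<and>
     (\<forall>x\<in>N. F (graph_map (Suc s) p x) = f x)"
    using F(1,2) unfolding cb by blast
qed

theorem oka_extension_all: "oka_extension s"
  by (induction s) (auto intro: oka_extension_0 oka_extension_Suc)

section \<open>Polynomial approximation on polydiscs and polyhedra\<close>

inductive seq_poly :: "((nat \<Rightarrow> complex) \<Rightarrow> complex) \<Rightarrow> bool" where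
  const: "seq_poly (\<lambda>x. c)"
| coord: "seq_poly (\<lambda>x. x i)"
| add: "seq_poly f \<Longrightarrow> seq_poly g \<Longrightarrow> seq_poly (\<lambda>x. f x + g x)"
| mult: "seq_poly f \<Longrightarrow> seq_poly g \<Longrightarrow> seq_poly (\<lambda>x. f x * g x)"

lemma seq_poly_hol: "seq_poly f \<Longrightarrow> hol f UNIV"
  by (induction rule: seq_poly.induct) (auto intro: hol_const hol_coord hol_add hol_mult)

lemma seq_poly_sum: "(\<And>i. i \<in> I \<Longrightarrow> seq_poly (f i)) \<Longrightarrow> seq_poly (\<lambda>x. \<Sum>i\<in>I. f i x)"
  by (induction I rule: infinite_finite_induct) (auto intro: seq_poly.intros)

lemma seq_poly_power: "seq_poly f \<Longrightarrow> seq_poly (\<lambda>x. f x ^ n)"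
  by (induction n) (auto intro: seq_poly.intros)

lemma seq_poly_compose: "seq_poly f \<Longrightarrow> (\<And>i. seq_poly (\<lambda>x. \<Phi> x i)) \<Longrightarrow> seq_poly (\<lambda>x. f (\<Phi> x))"
  by (induction rule: seq_poly.induct) (auto intro: seq_poly.intros)

definition polydisc :: "nat \<Rightarrow> (nat \<Rightarrow> real) \<Rightarrow> (nat \<Rightarrow> complex) set" where
  "polydisc M r = {x. \<forall>i. x i \<in> cball 0 (if i < M then r i else 0)}"

lemma compact_polydisc: "compact (polydisc M r)"
proof -
  have "polydisc M r = PiE UNIV (\<lambda>i. cball 0 (if i < M then r i else 0))"
    by (auto simp: polydisc_def PiE_def Pi_def)
  moreover have "compactin (product_topology (\<lambda>_. euclidean) UNIV) (PiE UNIV (\<lambda>i. cball (0::complex) (if i < M then r i else 0)))"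
    unfolding compactin_PiE by (simp only: compactin_euclidean_iff compact_cball) simp
  ultimately show ?thesis
    by (simp add: euclidean_product_topology)
qed

lemma polydiscD: "x \<in> polydisc M r \<Longrightarrow> cmod (x i) \<le> (if i < M then r i else 0)"
  by (auto simp: polydisc_def)

lemma continuous_on_fun_upd_pair:
  "continuous_on UNIV (\<lambda>(\<zeta>::complex,x::nat\<Rightarrow>complex). x(k := \<zeta>))"
  "continuous_on UNIV (\<lambda>(x::nat\<Rightarrow>complex,\<zeta>::complex). x(k := \<zeta>))"
  unfolding split_beta by (intro continuous_on_fun_upd continuous_intros)+

text \<open>Expansion in the last variable only. Its Taylor coefficients are contour integrals,
  holomorphic in the remaining variables near the smaller polydisc, so the induction hypothesis
  approximates finitely many of them. The remainder is geometric because the contour has a radius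
  larger than \<open>r k\<close>.\<close>

lemma polydisc_approx:
  assumes "\<And>i. i < M \<Longrightarrow> 0 < r i" "polydisc M r \<subseteq> T" "hol F T" "0 < e"
  shows "\<exists>P. seq_poly P \<and> (\<forall>x\<in>polydisc M r. cmod (F x - P x) < e)"
  using assms
proof (induction M arbitrary: F T e)
  case 0
  have "polydisc 0 r = {\<lambda>_. 0}" by (auto simp: polydisc_def)
  then show ?case using 0 by (intro exI[of _ "\<lambda>x. F (\<lambda>_. 0)"]) (auto intro: seq_poly.intros)
next
  case (Suc k)
  let ?B = "polydisc (Suc k) r"
  have rk: "r k > 0" using Suc.prems(1) by auto
  have upd: "x(k := \<zeta>) \<in> ?B" if "x \<in> ?B" "cmod \<zeta> \<le> r k" for x \<zeta>
    unfolding polydisc_def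
  proof (intro CollectI allI)
    show "(x(k := \<zeta>)) i \<in> cball 0 (if i < Suc k then r i else 0)" for i
      using that(2) polydiscD[OF that(1), of i] by (cases "i = k") auto
  qed
  have sub: "polydisc k r \<subseteq> ?B"
  proof
    fix x assume x: "x \<in> polydisc k r"
    have "x i \<in> cball 0 (if i < Suc k then r i else 0)" for i
      using x rk unfolding polydisc_def by (cases "i = k") (auto split: if_splits dest!: spec[of _ i])
    then show "x \<in> ?B" by (simp add: polydisc_def)
  qed
  obtain O' where O': "open O'" "cball 0 (r k) \<subseteq> O'" "\<And>\<zeta> x. \<zeta> \<in> O' \<Longrightarrow> x \<in> ?B \<Longrightarrow> x(k := \<zeta>) \<in> T"
  proof (rule open_neighbourhood_all_points[OF compact_polydisc[of "Suc k" r] hol_open[OF Suc.prems(3)]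
        continuous_on_fun_upd_pair(1), of "cball 0 (r k)" k])
    show "x(k := \<zeta>) \<in> T" if "\<zeta> \<in> cball 0 (r k)" "x \<in> ?B" for \<zeta> x
      using that upd Suc.prems(2) by auto
  qed blast
  obtain d where d: "d > 0" "(\<Union>x\<in>cball 0 (r k). ball x d) \<subseteq> O'"
    using compact_subset_open_imp_ball_epsilon_subset[OF compact_cball O'(1,2)] by blast
  \<comment> \<open>Half of the available distance \<open>d\<close>, so that the closed disc of
    radius \<rho> still lies in \<open>O'\<close> although \<rho> exceeds
    \<open>r k\<close>.\<close>
  define \<rho> where "\<rho> = r k + d / 2"
  have \<rho>: "\<rho> > r k" "\<rho> > 0" using d rk by (auto simp: \<rho>_def)
  have c\<rho>: "cball 0 \<rho> \<subseteq> O'"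
  proof
    fix \<zeta> :: complex assume \<zeta>: "\<zeta> \<in> cball 0 \<rho>"
    show "\<zeta> \<in> O'"
    proof (cases "cmod \<zeta> \<le> r k")
      case False
      define y where "y = of_real (r k / cmod \<zeta>) * \<zeta>"
      have "cmod y = r k" using False rk by (auto simp: y_def norm_mult norm_divide)
      moreover have "dist y \<zeta> < d"
      proof -
        have "y - \<zeta> = of_real (r k / cmod \<zeta> - 1) * \<zeta>" by (simp add: y_def algebra_simps)
        then have "dist y \<zeta> = \<bar>r k / cmod \<zeta> - 1\<bar> * cmod \<zeta>" by (simp only: dist_norm norm_mult norm_of_real)
        also have "\<dots> = cmod \<zeta> - r k" using False rk by (auto simp: abs_if field_simps)
        finally show ?thesis using \<zeta> d by (auto simp: \<rho>_def)
      qed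
      ultimately have "\<zeta> \<in> (\<Union>x\<in>cball 0 (r k). ball x d)" by (auto intro!: bexI[of _ y])
      then show ?thesis using d by blast
    qed (use O' in auto)
  qed
  have inT: "x(k := \<zeta>) \<in> T" if "x \<in> ?B" "cmod \<zeta> \<le> \<rho>" for x \<zeta>
    using O'(3)[of \<zeta> x] c\<rho> that by auto
  obtain T1 where T1: "open T1" "polydisc k r \<subseteq> T1" "\<And>x \<zeta>. x \<in> T1 \<Longrightarrow> \<zeta> \<in> sphere 0 \<rho> \<Longrightarrow> x(k := \<zeta>) \<in> T"
  proof (rule open_neighbourhood_all_points[OF compact_sphere[of 0 \<rho>] hol_open[OF Suc.prems(3)]
        continuous_on_fun_upd_pair(2), of "polydisc k r" k])
    show "x(k := \<zeta>) \<in> T" if "x \<in> polydisc k r" "\<zeta> \<in> sphere 0 \<rho>" for \<zeta> x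
      using that sub inT by auto
  qed blast
  define G where "G n x = contour_integral (circlepath 0 \<rho>) (\<lambda>\<zeta>. F (x(k := \<zeta>)) * (1 / \<zeta> ^ Suc n)) / (2 * of_real pi * \<i>)" for n x
  have hG: "hol (G n) T1" for n
    unfolding G_def
  proof (intro hol_divide hol_const T1(1) hol_cauchy_kernel[OF Suc.prems(3) T1(1)])
    show "continuous_on (T1 \<times> path_image (circlepath 0 \<rho>)) (\<lambda>(x, \<zeta>). 1 / \<zeta> ^ Suc n)"
      unfolding split_beta using \<rho> by (intro continuous_intros) auto
  qed (use T1 \<rho> in \<open>auto simp: vector_derivative_circlepath intro!: continuous_intros\<close>)
  obtain C where C: "C > 0" "\<And>x \<zeta>. x \<in> ?B \<Longrightarrow> cmod \<zeta> \<le> \<rho> \<Longrightarrow> cmod (F (x(k := \<zeta>))) \<le> C"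
  proof -
    define S where "S = (\<lambda>(x,\<zeta>). x(k := \<zeta>)) ` (?B \<times> cball 0 \<rho>)"
    have "compact S" unfolding S_def
      by (intro compact_continuous_image continuous_on_subset[OF continuous_on_fun_upd_pair(2)] compact_Times
          compact_polydisc compact_cball) auto
    moreover have "S \<subseteq> T" using inT by (auto simp: S_def)
    ultimately have "compact (F ` S)"
      using hol_cont[OF Suc.prems(3)] by (meson compact_continuous_image continuous_on_subset)
    then obtain C where "C > 0" "\<forall>y\<in>F ` S. cmod y \<le> C" using compact_imp_bounded bounded_pos by metis
    then show ?thesis by (intro that[of C]) (auto simp: S_def)
  qed
  define q where "q = r k / \<rho>"
  have q: "0 < q" "q < 1" using \<rho> rk by (auto simp: q_def)
  have est: "cmod (F x - (\<Sum>n<L. G n (x(k := 0)) * x k ^ n)) \<le> C * \<rho> / (\<rho> - r k) * q ^ L" if x: "x \<in> ?B" for x L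
  proof -
    define f where "f \<zeta> = F (x(k := \<zeta>))" for \<zeta>
    define z where "z = x k"
    have z: "cmod z \<le> r k" using x by (auto simp: polydisc_def z_def dest: spec[of _ k])
    have fz: "f z = F x" by (simp add: f_def z_def)
    have hf: "f holomorphic_on cball 0 \<rho>"
    proof -
      have "open O'" by fact
      have "f holomorphic_on O'" unfolding f_def
      proof (rule hol_curve[OF Suc.prems(3)])
        show "holomorphic_curve (\<lambda>\<zeta>. x(k := \<zeta>)) O'"
          unfolding holomorphic_curve_def
        proof (intro conjI allI)
          show "(\<lambda>z. (x(k := z)) i) holomorphic_on O'" for i by (cases "i = k") simp_all
        qed fact
        show "(\<lambda>\<zeta>. x(k := \<zeta>)) ` O' \<subseteq> T" using O'(3) x by blast
      qed
      then show ?thesis using c\<rho> holomorphic_on_subset by blast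
    qed
    have cauchy: "((\<lambda>\<zeta>. f \<zeta> / (\<zeta> - z)) has_contour_integral (2 * of_real pi * \<i> * f z)) (circlepath 0 \<rho>)"
      by (rule Cauchy_integral_circlepath_simple[OF hf]) (use z \<rho> in auto)
    have ne: "\<zeta> \<noteq> 0" "\<zeta> \<noteq> z" if "cmod \<zeta> = \<rho>" for \<zeta> using that z \<rho> by auto
    have cf: "continuous_on (sphere 0 \<rho>) f"
      using hf holomorphic_on_imp_continuous_on continuous_on_subset by (metis sphere_cball)
    have Gi: "((\<lambda>\<zeta>. f \<zeta> * (1 / \<zeta> ^ Suc n)) has_contour_integral (2 * of_real pi * \<i> * G n (x(k := 0)))) (circlepath 0 \<rho>)" for n
    proof -
      have "(\<lambda>\<zeta>. f \<zeta> * (1 / \<zeta> ^ Suc n)) contour_integrable_on circlepath 0 \<rho>"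
        by (rule contour_integrable_continuous_circlepath)
           (use \<rho> ne cf in \<open>auto intro!: continuous_intros\<close>)
      then show ?thesis
        using has_contour_integral_integral by (fastforce simp: G_def f_def)
    qed
    let ?S = "\<Sum>n<L. G n (x(k := 0)) * z ^ n"
    have "((\<lambda>\<zeta>. \<Sum>n<L. f \<zeta> * (1 / \<zeta> ^ Suc n) * z ^ n) has_contour_integral
        (\<Sum>n<L. 2 * of_real pi * \<i> * G n (x(k := 0)) * z ^ n)) (circlepath 0 \<rho>)"
      by (intro has_contour_integral_sum has_contour_integral_rmul Gi) auto
    then have "((\<lambda>\<zeta>. f \<zeta> / (\<zeta> - z) - (\<Sum>n<L. f \<zeta> * (1 / \<zeta> ^ Suc n) * z ^ n)) has_contour_integral
        (2 * of_real pi * \<i> * f z - (\<Sum>n<L. 2 * of_real pi * \<i> * G n (x(k := 0)) * z ^ n))) (circlepath 0 \<rho>)"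
      by (rule has_contour_integral_diff[OF cauchy])
    also have "(\<Sum>n<L. 2 * of_real pi * \<i> * G n (x(k := 0)) * z ^ n) = 2 * of_real pi * \<i> * ?S"
      by (simp add: sum_distrib_left mult_ac)
    finally have I: "((\<lambda>\<zeta>. f \<zeta> / (\<zeta> - z) - (\<Sum>n<L. f \<zeta> * (1 / \<zeta> ^ Suc n) * z ^ n)) has_contour_integral
        (2 * of_real pi * \<i> * (f z - ?S))) (circlepath 0 \<rho>)" by (simp add: algebra_simps)
    have "cmod (2 * of_real pi * \<i> * (f z - ?S)) \<le> (C * q ^ L / (\<rho> - r k)) * (2 * pi * \<rho>)"
    proof (rule has_contour_integral_bound_circlepath[OF I])
      show "0 \<le> C * q ^ L / (\<rho> - r k)" using C q \<rho> by auto
      fix \<zeta> assume "cmod (\<zeta> - 0) = \<rho>"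
      then have \<zeta>: "cmod \<zeta> = \<rho>" by simp
      have gs: "(\<Sum>n<L. (z / \<zeta>) ^ n) = (1 - (z / \<zeta>) ^ L) / (1 - z / \<zeta>)"
        using ne[OF \<zeta>] by (subst sum_gp_strict) auto
      have "(\<Sum>n<L. f \<zeta> * (1 / \<zeta> ^ Suc n) * z ^ n) = f \<zeta> / \<zeta> * (\<Sum>n<L. (z / \<zeta>) ^ n)"
        by (simp add: sum_distrib_left power_divide mult_ac)
      also have "\<dots> = f \<zeta> * (1 - (z / \<zeta>) ^ L) / (\<zeta> - z)"
        unfolding gs using ne[OF \<zeta>] by (simp add: divide_simps)
      finally have eqS: "(\<Sum>n<L. f \<zeta> * (1 / \<zeta> ^ Suc n) * z ^ n) = f \<zeta> * (1 - (z / \<zeta>) ^ L) / (\<zeta> - z)" .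
      have eq: "f \<zeta> / (\<zeta> - z) - (\<Sum>n<L. f \<zeta> * (1 / \<zeta> ^ Suc n) * z ^ n) = f \<zeta> * (z / \<zeta>) ^ L / (\<zeta> - z)"
        unfolding eqS by (simp add: right_diff_distrib flip: diff_divide_distrib)
      have "cmod (f \<zeta> * (z / \<zeta>) ^ L / (\<zeta> - z)) = cmod (f \<zeta>) * (cmod z / \<rho>) ^ L / cmod (\<zeta> - z)"
        using \<zeta> by (simp add: norm_mult norm_divide norm_power)
      also have "\<dots> \<le> C * q ^ L / (\<rho> - r k)"
      proof (rule frac_le)
        show "cmod (f \<zeta>) * (cmod z / \<rho>) ^ L \<le> C * q ^ L"
          using C(2)[OF x] \<zeta> z \<rho> C(1) unfolding q_def
          by (intro mult_mono power_mono divide_right_mono) (auto simp: f_def)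
        show "\<rho> - r k \<le> cmod (\<zeta> - z)" using \<zeta> z norm_triangle_ineq2[of \<zeta> z] by linarith
      qed (use C q \<rho> in auto)
      finally show "cmod (f \<zeta> / (\<zeta> - z) - (\<Sum>n<L. f \<zeta> * (1 / \<zeta> ^ Suc n) * z ^ n)) \<le> C * q ^ L / (\<rho> - r k)"
        unfolding eq .
    qed (use \<rho> in auto)
    moreover have "cmod (2 * of_real pi * \<i> * (f z - ?S)) = cmod (f z - ?S) * (2 * pi)"
      by (simp add: norm_mult)
    ultimately have "cmod (f z - ?S) * (2 * pi) \<le> (C * \<rho> / (\<rho> - r k) * q ^ L) * (2 * pi)"
      by (simp add: mult_ac)
    then have "cmod (f z - ?S) \<le> C * \<rho> / (\<rho> - r k) * q ^ L"
      by (rule mult_right_le_imp_le) simp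
    then show ?thesis unfolding fz by (simp add: z_def)
  qed
  have "(\<lambda>L. C * \<rho> / (\<rho> - r k) * q ^ L) \<longlonglongrightarrow> C * \<rho> / (\<rho> - r k) * 0"
    using q by (intro tendsto_intros LIMSEQ_power_zero) auto
  then have "eventually (\<lambda>L. C * \<rho> / (\<rho> - r k) * q ^ L < e / 2) sequentially"
    using Suc.prems(4) by (intro order_tendstoD(2)) auto
  then obtain L where L: "C * \<rho> / (\<rho> - r k) * q ^ L < e / 2" by (auto simp: eventually_sequentially)
  \<comment> \<open>The accuracy for the coefficients: weighted with the powers of
    \<open>r k\<close> their errors add up to less than \<open>e / 2\<close>. The \<open>+ 1\<close>
    keeps the denominator positive when \<open>L = 0\<close>.\<close>
  define E where "E = e / (2 * (\<Sum>n<L. (r k) ^ n) + 1) / 2"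
  have sp: "(\<Sum>n<L. (r k) ^ n) \<ge> 0" using rk by (intro sum_nonneg) auto
  define \<sigma> where "\<sigma> = (\<Sum>n<L. (r k) ^ n)"
  have "e * \<sigma> \<ge> 0" "\<sigma> \<ge> 0" using sp Suc.prems(4) by (auto simp: \<sigma>_def)
  then have "E > 0" "E * \<sigma> < e / 2"
    using Suc.prems(4) unfolding E_def \<sigma>_def[symmetric] by (auto simp: field_simps intro!: add_pos_nonneg)
  then have E: "E > 0" "E * (\<Sum>n<L. (r k) ^ n) < e / 2" by (auto simp: \<sigma>_def)
  have "\<exists>P. seq_poly P \<and> (\<forall>x\<in>polydisc k r. cmod (G n x - P x) < E)" for n
    by (rule Suc.IH[OF _ T1(2) hG E(1)]) (use Suc.prems(1) in auto)
  then obtain P where P: "\<And>n. seq_poly (P n)" "\<And>n x. x \<in> polydisc k r \<Longrightarrow> cmod (G n x - P n x) < E"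
    by metis
  define Q where "Q x = (\<Sum>n<L. P n (x(k := 0)) * x k ^ n)" for x
  have "seq_poly (\<lambda>x. (x(k := 0)) i)" for i by (cases "i = k") (auto intro: seq_poly.intros)
  then have "seq_poly Q" unfolding Q_def
    by (intro seq_poly_sum seq_poly.mult seq_poly_power seq_poly.coord seq_poly_compose[OF P(1)])
  moreover have "cmod (F x - Q x) < e" if x: "x \<in> ?B" for x
  proof -
    have x0: "x(k := 0) \<in> polydisc k r" unfolding polydisc_def
    proof (intro CollectI allI)
      show "(x(k := 0)) i \<in> cball 0 (if i < k then r i else 0)" for i
        using polydiscD[OF x, of i] by (cases "i = k") auto
    qed
    have xk: "cmod (x k) \<le> r k" using x by (auto simp: polydisc_def dest: spec[of _ k])
    have "cmod ((\<Sum>n<L. G n (x(k := 0)) * x k ^ n) - Q x) = cmod (\<Sum>n<L. (G n (x(k := 0)) - P n (x(k := 0))) * x k ^ n)"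
      by (simp add: Q_def sum_subtractf algebra_simps)
    also have "\<dots> \<le> (\<Sum>n<L. E * (r k) ^ n)"
      by (rule sum_norm_le) (use P(2)[OF x0, THEN less_imp_le] xk less_imp_le[OF E(1)] in
        \<open>auto simp: norm_mult norm_power intro!: mult_mono power_mono\<close>)
    also have "\<dots> < e / 2" using E by (simp add: sum_distrib_left)
    finally have "cmod ((\<Sum>n<L. G n (x(k := 0)) * x k ^ n) - Q x) < e / 2" .
    from norm_diff_triangle_less[OF le_less_trans[OF est[OF x] L] this] show ?thesis by simp
  qed
  ultimately show ?case by blast
qed

text \<open>The Oka--Weil theorem. A function near the polyhedron is the restriction to the graph of
  a function near a box; there it is approximated on a polydisc, and inserting the graph map into
  the approximating polynomial gives a polynomial again.\<close>

lemma polyhedron_approx: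
  assumes p: "\<And>j. j < s \<Longrightarrow> seq_poly (p j)" and R: "R > 0"
    and l: "l = (\<lambda>i. if i < M then of_real R * (-1-\<i>) else 0)" and u: "u = (\<lambda>i. if i < M then of_real R * (1+\<i>) else 0)"
    and f: "hol f T" "box_polyhedron l u p s \<subseteq> T" and e: "e > 0"
    and K: "\<And>x i. x \<in> K \<Longrightarrow> i < M \<Longrightarrow> cmod (x i) \<le> R" "\<And>x i. x \<in> K \<Longrightarrow> i \<ge> M \<Longrightarrow> x i = 0"
      "\<And>x j. x \<in> K \<Longrightarrow> j < s \<Longrightarrow> cmod (p j x) \<le> 1"
  shows "\<exists>P. seq_poly P \<and> (\<forall>x\<in>K. cmod (f x - P x) < e)"
proof -
  have box: "z \<in> cbox (of_real \<rho> * (-1-\<i>)) (of_real \<rho> * (1+\<i>))" if "cmod z \<le> \<rho>" for z \<rho>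
    using that abs_Re_le_cmod[of z] abs_Im_le_cmod[of z] by (auto simp: in_cbox_complex_iff)
  have Kph: "x \<in> box_polyhedron l u p s" if "x \<in> K" for x
  proof -
    have "x i \<in> cbox (l i) (u i)" for i using K(1,2)[OF that, of i] box unfolding l u by (cases "i < M") auto
    moreover have "p j x \<in> cbox (-1-\<i>) (1+\<i>)" if "j < s" for j
      using box[of "p j x" 1] K(3)[OF \<open>x \<in> K\<close> that] by simp
    ultimately show ?thesis by (auto simp: box_polyhedron_def prod_box_def)
  qed
  have "\<exists>F T' N. prepend_box s l u \<subseteq> T' \<and> hol F T' \<and> open N \<and> box_polyhedron l u p s \<subseteq> N \<and> (\<forall>x\<in>N. F (graph_map s p x) = f x)"
    using f p by (intro oka_extension_all[unfolded oka_extension_def, rule_format, of s p M l u T f])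
      (auto simp: l u intro: seq_poly_hol)
  then obtain F T' N where F: "prepend_box s l u \<subseteq> T'" "hol F T'" "box_polyhedron l u p s \<subseteq> N" "\<And>x. x \<in> N \<Longrightarrow> F (graph_map s p x) = f x"
    by blast
  \<comment> \<open>Radius 1 for the values of the \<open>p j\<close> and \<open>R\<close> for the
    coordinates: this polydisc lies in the box of squares and contains the graph over
    \<open>K\<close>.\<close>
  define r where "r i = (if i < s then 1 else R)" for i
  have "polydisc (s + M) r \<subseteq> prepend_box s l u"
  proof
    fix x assume x: "x \<in> polydisc (s + M) r"
    have "x i \<in> cbox (prepend_const s (-1-\<i>) l i) (prepend_const s (1+\<i>) u i)" for i
    proof -
      have xi: "x i \<in> cball 0 (if i < s + M then r i else 0)" using x by (auto simp: polydisc_def)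
      consider "i < s" | "s \<le> i" "i < s + M" | "s + M \<le> i" by linarith
      then show ?thesis
      proof cases
        case 1 then show ?thesis using xi box[of "x i" 1] by (auto simp: prepend_const_def r_def)
      next
        case 2 then show ?thesis using xi box[of "x i" R] by (auto simp: prepend_const_def r_def l u)
      next
        case 3 then show ?thesis using xi by (auto simp: prepend_const_def l u)
      qed
    qed
    then show "x \<in> prepend_box s l u" by (simp add: prod_box_def)
  qed
  then have "\<exists>P. seq_poly P \<and> (\<forall>x\<in>polydisc (s + M) r. cmod (F x - P x) < e)"
    using F R e by (intro polydisc_approx[where T=T']) (auto simp: r_def)
  then obtain P where P: "seq_poly P" "\<And>x. x \<in> polydisc (s + M) r \<Longrightarrow> cmod (F x - P x) < e" by blast
  have "seq_poly (\<lambda>x. graph_map s p x i)" for i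
    using p by (cases "i < s") (auto simp: graph_map_def intro: seq_poly.coord)
  then have "seq_poly (\<lambda>x. P (graph_map s p x))" by (intro seq_poly_compose[OF P(1)])
  moreover have "cmod (f x - P (graph_map s p x)) < e" if x: "x \<in> K" for x
  proof -
    have "graph_map s p x \<in> polydisc (s + M) r"
      using K(1,2)[OF x] K(3)[OF x] by (auto simp: polydisc_def graph_map_def r_def)
    then show ?thesis using P(2)[of "graph_map s p x"] F(3,4) Kph[OF x] by auto
  qed
  ultimately show ?thesis by blast
qed

section \<open>A maximum principle for polynomial hulls\<close>

text \<open>Finitely many separating polynomials cover the compact rest of the box. They have to
  exceed 2 there, and not just 1, because a point of the square used in
  \<open>box_polyhedron\<close> may have modulus up to the square root of 2.\<close>

lemma polynomial_polyhedron_inside: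
  assumes K: "compact K" "\<And>x i. x \<in> K \<Longrightarrow> i \<ge> M \<Longrightarrow> x i = 0"
    and hull: "\<And>x. x \<notin> K \<Longrightarrow> (\<And>i. i \<ge> M \<Longrightarrow> x i = 0) \<Longrightarrow> \<exists>P. seq_poly P \<and> (\<forall>y\<in>K. cmod (P y) \<le> 1) \<and> cmod (P x) > 2"
    and V: "open V" "K \<subseteq> V" and lu: "\<And>i. i \<ge> M \<Longrightarrow> l i = 0 \<and> u i = 0"
  obtains p s where "\<And>j. j < s \<Longrightarrow> seq_poly (p j)" "\<And>j x. j < s \<Longrightarrow> x \<in> K \<Longrightarrow> cmod (p j x) \<le> 1" "box_polyhedron l u p s \<subseteq> V"
proof -
  have cmp: "compact (prod_box l u - V)" by (intro compact_diff compact_prod_box V(1))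
  have "\<exists>P. seq_poly P \<and> (\<forall>y\<in>K. cmod (P y) \<le> 1) \<and> cmod (P z) > 2" if z: "z \<in> prod_box l u - V" for z
  proof (rule hull)
    show "z \<notin> K" using z V by auto
    show "z i = 0" if "i \<ge> M" for i
    proof -
      have "z i \<in> cbox (l i) (u i)" using z by (auto simp: prod_box_def)
      then show ?thesis using lu[OF that] by simp
    qed
  qed
  then obtain P where P: "\<And>z. z \<in> prod_box l u - V \<Longrightarrow> seq_poly (P z) \<and> (\<forall>y\<in>K. cmod (P z y) \<le> 1) \<and> cmod (P z z) > 2"
    by metis
  define O' where "O' z = {y. cmod (P z y) > 2}" for z
  have "open (O' z)" if "z \<in> prod_box l u - V" for z
  proof -
    have "continuous_on UNIV (\<lambda>y. cmod (P z y))"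
      using P[OF that] seq_poly_hol hol_cont by (intro continuous_on_norm) blast
    then show ?thesis unfolding O'_def by (intro open_Collect_less) auto
  qed
  moreover have "prod_box l u - V \<subseteq> (\<Union>z\<in>prod_box l u - V. O' z)" using P by (auto simp: O'_def)
  ultimately obtain Z where Z: "Z \<subseteq> prod_box l u - V" "finite Z" "prod_box l u - V \<subseteq> (\<Union>z\<in>Z. O' z)"
    using compactE_image[OF cmp] by metis
  obtain zs where zs: "set zs = Z" using Z(2) finite_list by blast
  have sq: "cmod z \<le> 2" if "z \<in> cbox (-1-\<i>) (1+\<i>)" for z
    using that cmod_le[of z] by (auto simp: in_cbox_complex_iff)
  show ?thesis
  proof (rule that[of "length zs" "\<lambda>j. P (zs ! j)"])
    have m: "zs ! j \<in> prod_box l u - V" if "j < length zs" for j using that zs Z(1) nth_mem by blast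
    show "seq_poly (P (zs ! j))" "x \<in> K \<Longrightarrow> cmod (P (zs ! j) x) \<le> 1" if "j < length zs" for j x
      using P[OF m[OF that]] by auto
    show "box_polyhedron l u (\<lambda>j. P (zs ! j)) (length zs) \<subseteq> V"
    proof
      fix x assume x: "x \<in> box_polyhedron l u (\<lambda>j. P (zs ! j)) (length zs)"
      show "x \<in> V"
      proof (rule ccontr)
        assume "x \<notin> V"
        then obtain z where z: "z \<in> Z" "x \<in> O' z" using Z(3) x by (auto simp: box_polyhedron_def)
        then obtain j where "j < length zs" "z = zs ! j" using zs by (metis in_set_conv_nth)
        then have "cmod (P z x) \<le> 2" using x sq by (auto simp: box_polyhedron_def)
        then show False using z by (auto simp: O'_def)
      qed
    qed
  qed
qed

text \<open>Integrating this kernel against a power series with coefficients \<open>c s\<close>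
  gives the sum of the \<open>c s * h ^ (L - s)\<close> over \<open>s \<le> L\<close>: this is
  \<open>h ^ L\<close> times a Taylor polynomial at the point \<open>1 / h\<close>, written without
  negative powers of \<open>h\<close>. The closed form is a geometric sum that compares it with
  Cauchy's kernel.\<close>

lemma peak_kernel_sum:
  fixes h \<zeta> :: complex
  assumes "\<zeta> \<noteq> 0" "h * \<zeta> \<noteq> 1"
  shows "(\<Sum>s\<le>L. h ^ (L - s) / \<zeta> ^ Suc s) = (h ^ Suc L - 1 / \<zeta> ^ Suc L) / (h * \<zeta> - 1)"
proof (induction L)
  case 0 then show ?case using assms by (simp add: field_simps)
next
  case (Suc L)
  have "(\<Sum>s\<le>Suc L. h ^ (Suc L - s) / \<zeta> ^ Suc s) = h * (\<Sum>s\<le>L. h ^ (L - s) / \<zeta> ^ Suc s) + 1 / \<zeta> ^ Suc (Suc L)"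
    by (simp add: sum_distrib_left Suc_diff_le)
  then show ?case unfolding Suc using assms by (simp add: divide_simps) (simp add: algebra_simps)
qed

text \<open>A clopen part of \<open>{x \<in> K. \<bar>h x\<bar> \<ge> \<epsilon>}\<close> inside \<open>W\<close> would carry a function peaking on it: extend its
  indicator from the hypersurface \<open>y h(x) = 1\<close> and keep the nonnegative powers of \<open>h\<close> in \<open>h\<^sup>L\<close> times
  the resulting power series in \<open>y = 1/h\<close>.\<close>

theorem polynomial_hull_boundary_zero:
  assumes K: "compact K" "\<And>x i. x \<in> K \<Longrightarrow> i \<ge> M \<Longrightarrow> x i = 0"
    and hull: "\<And>x. x \<notin> K \<Longrightarrow> (\<And>i. i \<ge> M \<Longrightarrow> x i = 0) \<Longrightarrow> \<exists>P. seq_poly P \<and> (\<forall>y\<in>K. cmod (P y) \<le> 1) \<and> cmod (P x) > 2"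
    and h: "hol h U" "K \<subseteq> U"
    and W: "W \<subseteq> K" "compact (K - W)" "\<And>x. x \<in> closure W \<Longrightarrow> x \<in> K - W \<Longrightarrow> h x = 0"
    and small: "\<And>P c x. seq_poly P \<Longrightarrow> (\<And>y. y \<in> K - W \<Longrightarrow> cmod (P y) \<le> c) \<Longrightarrow> x \<in> W \<Longrightarrow> cmod (P x) \<le> c"
    and p: "p \<in> W"
  shows "h p = 0"
proof (rule ccontr)
  assume hp: "h p \<noteq> 0"
  \<comment> \<open>Four levels of \<open>cmod (h x)\<close> are needed: the two parts of
    \<open>K\<close> are separated above \<epsilon>, the contour corresponds to 2\<epsilon>, the
    cases of the estimate are divided at 3\<epsilon>, and the value at \<open>p\<close> is
    4\<epsilon>.\<close>
  define \<epsilon> where "\<epsilon> = cmod (h p) / 4"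
  have \<epsilon>: "\<epsilon> > 0" "cmod (h p) = 4 * \<epsilon>" using hp by (auto simp: \<epsilon>_def)
  have contK: "continuous_on K (\<lambda>x. cmod (h x))"
    using hol_cont[OF h(1)] h(2) by (intro continuous_on_norm) (rule continuous_on_subset)
  have clK: "closed K" using K(1) compact_imp_closed by blast
  have "closed (K \<inter> (\<lambda>x. cmod (h x)) -` {\<epsilon>..})"
    using continuous_closed_preimage[OF contK clK, of "{\<epsilon>..}"] by auto
  then have cl\<epsilon>: "closed {x \<in> K. \<epsilon> \<le> cmod (h x)}" by (simp add: vimage_def Int_def)
  \<comment> \<open>A limit point of \<open>W\<close> outside \<open>W\<close> is a zero of
    \<open>h\<close>. Above the level \<epsilon> the closure of \<open>W\<close> therefore stays
    inside \<open>W\<close>, and \<open>A\<close> and \<open>B\<close> are disjoint closed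
    sets.\<close>
  define A where "A = closure W \<inter> {x \<in> K. \<epsilon> \<le> cmod (h x)}"
  define B where "B = (K - W) \<inter> {x \<in> K. \<epsilon> \<le> cmod (h x)}"
  have AW: "A \<subseteq> W" using W(3) \<epsilon> by (force simp: A_def)
  have cAB: "closed A" "closed B" using cl\<epsilon> W(2) compact_imp_closed by (auto simp: A_def B_def)
  have "A \<inter> B = {}" using AW by (auto simp: B_def)
  then obtain NA NB where NAB: "open NA" "open NB" "A \<subseteq> NA" "B \<subseteq> NB" "NA \<inter> NB = {}"
    using t4_space[OF cAB] by blast
  \<comment> \<open>In this neighbourhood of \<open>K\<close> every point with
    \<open>cmod (h x) \<ge> \<epsilon>\<close> belongs to \<open>NA\<close> or \<open>NB\<close>.
    The polyhedron is taken inside it.\<close>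
  define V where "V = {x \<in> U. cmod (h x) < \<epsilon>} \<union> U \<inter> (NA \<union> NB)"
  have "open (U \<inter> (\<lambda>x. cmod (h x)) -` {..<\<epsilon>})"
    using continuous_on_open_vimage[OF hol_open[OF h(1)]] continuous_on_norm[OF hol_cont[OF h(1)]]
    by (metis Int_commute open_lessThan)
  then have "open {x \<in> U. cmod (h x) < \<epsilon>}" by (simp add: vimage_def Int_def)
  then have oV: "open V" using NAB hol_open[OF h(1)] by (auto simp: V_def)
  have KV: "K \<subseteq> V"
  proof
    fix x assume x: "x \<in> K"
    show "x \<in> V"
    proof (cases "cmod (h x) < \<epsilon>")
      case False
      then have "x \<in> A \<or> x \<in> B" using x closure_subset[of W] by (auto simp: A_def B_def)
      then show ?thesis using NAB x h(2) by (auto simp: V_def)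
    qed (use x h in \<open>auto simp: V_def\<close>)
  qed
  obtain R where R: "R > 0" "\<And>x i. x \<in> K \<Longrightarrow> i < M \<Longrightarrow> cmod (x i) \<le> R"
  proof -
    have "\<exists>R>0. \<forall>x\<in>K. cmod (x i) \<le> R" for i
    proof -
      have "compact ((\<lambda>x. x i) ` K)" by (rule compact_continuous_image[OF continuous_on_coord K(1)])
      then show ?thesis using compact_imp_bounded bounded_pos by (metis image_eqI)
    qed
    then obtain R where R: "\<And>i. R i > 0" "\<And>i x. x \<in> K \<Longrightarrow> cmod (x i) \<le> R i" by metis
    have "cmod (x i) \<le> 1 + (\<Sum>i<M. R i)" if "x \<in> K" "i < M" for x i
    proof -
      have "R i \<le> (\<Sum>i<M. R i)" using that R(1) by (intro member_le_sum) (auto intro: less_imp_le)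
      then show ?thesis using R(2)[OF that(1), of i] by linarith
    qed
    moreover have "1 + (\<Sum>i<M. R i) > 0" using R(1) by (intro add_pos_nonneg sum_nonneg) (auto intro: less_imp_le)
    ultimately show ?thesis using that by blast
  qed
  define l u where "l = (\<lambda>i. if i < M then of_real R * (-1-\<i>) else 0 :: complex)"
    and "u = (\<lambda>i. if i < M then of_real R * (1+\<i>) else 0 :: complex)"
  obtain q s where q: "\<And>j. j < s \<Longrightarrow> seq_poly (q j)" "\<And>j x. j < s \<Longrightarrow> x \<in> K \<Longrightarrow> cmod (q j x) \<le> 1" "box_polyhedron l u q s \<subseteq> V"
  proof (rule polynomial_polyhedron_inside[where K=K and M=M and V=V and l=l and u=u], goal_cases)
    case (2 x i) show ?case by (rule K(2)) (fact 2)+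
  next
    case (3 x) show ?case by (rule hull) (fact 3)+
  next
    case (7 q s) show ?case by (rule 7(1)) (fact 7)+
  qed (use K(1) oV KV in \<open>simp_all add: l_def u_def\<close>)
  have Kph: "K \<subseteq> box_polyhedron l u q s"
  proof
    fix x assume x: "x \<in> K"
    have box: "z \<in> cbox (of_real \<rho> * (-1-\<i>)) (of_real \<rho> * (1+\<i>))" if "cmod z \<le> \<rho>" for z \<rho>
      using that abs_Re_le_cmod[of z] abs_Im_le_cmod[of z] by (auto simp: in_cbox_complex_iff)
    have "x i \<in> cbox (l i) (u i)" for i
      using R(2)[OF x, of i] K(2)[OF x, of i] box unfolding l_def u_def by (cases "i < M") auto
    moreover have "q j x \<in> cbox (-1-\<i>) (1+\<i>)" if "j < s" for j
      using box[of "q j x" 1] q(2)[OF that x] by simp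
    ultimately show "x \<in> box_polyhedron l u q s" by (auto simp: box_polyhedron_def prod_box_def)
  qed
  \<comment> \<open>A point \<open>y 0\<close> of the square with half side \<open>r\<close> has
    modulus at most \<open>2 * r = 1 / \<epsilon>\<close>. On the hypersurface
    \<open>y 0 * h = 1\<close> this forces \<open>cmod (h x) \<ge> \<epsilon>\<close>, that is,
    membership in \<open>N\<close>.\<close>
  define r where "r = 1 / (2 * \<epsilon>)"
  have r: "r > 0" "r * \<epsilon> = 1 / 2" using \<epsilon> by (auto simp: r_def)
  define c d where "c = of_real r * (-1-\<i>)" and "d = of_real r * (1+\<i>)"
  have cbcd: "\<zeta> \<in> cbox c d" if "cmod \<zeta> \<le> r" for \<zeta>
    using that abs_Re_le_cmod[of \<zeta>] abs_Im_le_cmod[of \<zeta>] by (auto simp: in_cbox_complex_iff c_def d_def)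
  define X1 where "X1 = box_polyhedron (prepend_const 1 c l) (prepend_const 1 d u) (\<lambda>j x. q j (shift_seq x)) s"
  have X1: "y \<in> X1 \<longleftrightarrow> y 0 \<in> cbox c d \<and> shift_seq y \<in> box_polyhedron l u q s" for y unfolding X1_def by (rule box_polyhedron_Suc_shift)
  have hq: "hol (\<lambda>x. q j (shift_seq x)) UNIV" if "j < s" for j
    using hol_compose[OF seq_poly_hol[OF q(1)[OF that]], of shift_seq UNIV] hol_shift_seq by auto
  define g where "g y = y 0 * h (shift_seq y) - 1" for y
  define N where "N = shift_seq -` (NA \<union> NB)"
  \<comment> \<open>The indicator of \<open>NA\<close>, which is holomorphic on \<open>N\<close>
    because \<open>NA\<close> and \<open>NB\<close> are disjoint and open.\<close>
  define f where "f y = (if y \<in> shift_seq -` NA then 1 else 0 :: complex)" for y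
  have osh: "open (shift_seq -` S)" if "open S" for S
    using hol_open[OF hol_compose_vimage[OF hol_const[OF that] hol_shift_seq]] .
  have hg: "hol g (shift_seq -` U)" unfolding g_def
    using hol_compose_vimage[OF h(1) hol_shift_seq] osh[OF hol_open[OF h(1)]] by (intro hol_diff hol_mult hol_coord hol_const)
  have hf: "hol f N"
    unfolding f_def N_def vimage_Un by (rule hol_If) (use osh NAB in \<open>auto intro: hol_const\<close>)
  have "extendable f g N X1" unfolding X1_def
  proof (rule hypersurface_extension[OF oka_extension_all hq _ hf hg])
    show "prepend_const 1 c l i = prepend_const 1 d u i" if "i \<ge> Suc M" for i
      using that by (simp add: prepend_const_def l_def u_def)
    show "box_polyhedron (prepend_const 1 c l) (prepend_const 1 d u) (\<lambda>j x. q j (shift_seq x)) s \<subseteq> shift_seq -` U"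
      unfolding X1_def[symmetric] using X1 q(3) by (auto simp: V_def)
    fix y assume y: "y \<in> box_polyhedron (prepend_const 1 c l) (prepend_const 1 d u) (\<lambda>j x. q j (shift_seq x)) s" "g y = 0"
    then have "y \<in> X1" by (simp only: X1_def)
    then have y': "y 0 \<in> cbox c d" "shift_seq y \<in> V" using X1 q(3) by auto
    have "cmod (y 0) \<le> \<bar>Re (y 0)\<bar> + \<bar>Im (y 0)\<bar>" by (rule cmod_le)
    then have "cmod (y 0) \<le> 2 * r" using y'(1) r by (auto simp: in_cbox_complex_iff c_def d_def)
    moreover have "cmod (y 0) * cmod (h (shift_seq y)) = 1" using y(2) by (simp add: g_def flip: norm_mult)
    ultimately have "1 \<le> 2 * r * cmod (h (shift_seq y))" by (metis mult_right_mono norm_ge_zero)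
    then have "\<epsilon> \<le> cmod (h (shift_seq y))" using \<epsilon> by (simp add: r_def field_simps)
    then show "y \<in> N" using y'(2) by (auto simp: V_def N_def)
  qed
  then obtain F T1 w where F: "X1 \<subseteq> T1" "hol F T1" "\<And>y. y \<in> T1 \<Longrightarrow> y \<in> N \<Longrightarrow> F y = f y + g y * w y"
    unfolding extendable_def extension_on_def by blast
  define \<Phi> where "\<Phi> x \<zeta> = prepend_const 1 \<zeta> x" for x :: "nat \<Rightarrow> complex" and \<zeta>
  have \<Phi>: "shift_seq (\<Phi> x \<zeta>) = x" "\<Phi> x \<zeta> 0 = \<zeta>" for x \<zeta> by (auto simp: \<Phi>_def prepend_const_def shift_seq_def)
  have \<Phi>i: "\<Phi> x \<zeta> i = (if i = 0 then \<zeta> else x (i - 1))" for x \<zeta> i by (simp add: \<Phi>_def prepend_const_def)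
  have \<Phi>c: "continuous_on UNIV (\<lambda>(x,\<zeta>). \<Phi> x \<zeta>)"
    unfolding split_beta
  proof (rule continuous_on_coordinatewise_then_product)
    fix i show "continuous_on UNIV (\<lambda>p. \<Phi> (fst p) (snd p) i)"
    proof (cases "i = 0")
      case False
      then show ?thesis
        using continuous_on_compose2[OF continuous_on_coord[of UNIV "i - 1"] continuous_on_fst[OF continuous_on_id]]
        by (simp add: \<Phi>i)
    qed (simp add: \<Phi>i continuous_on_snd)
  qed
  have \<Phi>X1: "\<Phi> x \<zeta> \<in> X1" if "x \<in> box_polyhedron l u q s" "cmod \<zeta> \<le> r" for x \<zeta>
    using that cbcd by (simp add: X1 \<Phi>)
  obtain T0 where T0: "open T0" "box_polyhedron l u q s \<subseteq> T0" "\<And>x \<zeta>. x \<in> T0 \<Longrightarrow> \<zeta> \<in> cball 0 r \<Longrightarrow> \<Phi> x \<zeta> \<in> T1"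
  proof (rule open_neighbourhood_all_points[OF compact_cball hol_open[OF F(2)] \<Phi>c, of "box_polyhedron l u q s"  0 r])
    show "\<Phi> x \<zeta> \<in> T1" if "x \<in> box_polyhedron l u q s" "\<zeta> \<in> cball 0 r" for x \<zeta>
      using \<Phi>X1[of x \<zeta>] that F(1) by auto
  qed blast
  define T2 where "T2 = T0 \<inter> U"
  have T2: "open T2" "box_polyhedron l u q s \<subseteq> T2" using T0 hol_open[OF h(1)] q(3) by (auto simp: T2_def V_def)
  have "compact (F ` X1)"
    by (rule compact_continuous_image)
       (use hol_cont[OF F(2)] F(1) continuous_on_subset compact_box_polyhedron[OF hq] in \<open>auto simp: X1_def\<close>)
  then obtain C where C: "C > 0" "\<And>y. y \<in> X1 \<Longrightarrow> cmod (F y) \<le> C"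
    using compact_imp_bounded bounded_pos by (metis image_eqI)
  define S where "S L x \<zeta> = (\<Sum>s\<le>L. h x ^ (L - s) / \<zeta> ^ Suc s)" for L x \<zeta>
  define G where "G L x = contour_integral (circlepath 0 r) (\<lambda>\<zeta>. F (\<Phi> x \<zeta>) * S L x \<zeta>) / (2 * of_real pi * \<i>)" for L x
  have pim: "path_image (circlepath 0 r) = sphere 0 r" using r by simp
  have \<Phi>hol: "hol (\<lambda>x. F (\<Phi> x \<zeta>)) T2" if "\<zeta> \<in> sphere 0 r" for \<zeta>
  proof (rule hol_compose[OF F(2)])
    show "hol (\<lambda>x. \<Phi> x \<zeta> i) T2" for i unfolding \<Phi>i using T2(1) by (cases "i = 0") (auto intro: hol_const hol_coord)
    show "(\<lambda>x. \<Phi> x \<zeta>) ` T2 \<subseteq> T1" using T0(3) that by (auto simp: T2_def)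
  qed
  have FSc: "continuous_on (T2 \<times> sphere 0 r) (\<lambda>(x, \<zeta>). F (\<Phi> x \<zeta>) * S L x \<zeta>)" for L
  proof -
    have "continuous_on (T2 \<times> sphere 0 r) (\<lambda>p. \<Phi> (fst p) (snd p))"
      using \<Phi>c continuous_on_subset unfolding split_beta by blast
    then have "continuous_on (T2 \<times> sphere 0 r) (\<lambda>p. F (\<Phi> (fst p) (snd p)))"
      by (rule continuous_on_compose2[OF hol_cont[OF F(2)]]) (use T0(3) in \<open>auto simp: T2_def\<close>)
    moreover have "continuous_on (T2 \<times> sphere 0 r) (\<lambda>p. h (fst p))"
      by (rule continuous_on_compose2[OF hol_cont[OF h(1)]]) (auto simp: T2_def intro: continuous_intros)
    ultimately show ?thesis
      unfolding split_beta S_def using r by (intro continuous_intros) auto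
  qed
  have hG: "hol (G L) T2" for L
    unfolding G_def
  proof (intro hol_divide hol_const T2(1) hol_contour_integral)
    show "continuous_on (T2 \<times> path_image (circlepath 0 r)) (\<lambda>(x, \<zeta>). F (\<Phi> x \<zeta>) * S L x \<zeta>)"
      unfolding pim by (rule FSc)
    show "hol (\<lambda>x. F (\<Phi> x \<zeta>) * S L x \<zeta>) T2" if "\<zeta> \<in> path_image (circlepath 0 r)" for \<zeta>
    proof -
      have "hol h T2" by (rule hol_subset[OF h(1) T2(1)]) (auto simp: T2_def)
      then show ?thesis
        unfolding S_def using that pim r \<Phi>hol T2(1)
        by (intro hol_mult hol_sum hol_divide hol_power hol_const) auto
    qed
  qed (auto simp: vector_derivative_circlepath intro!: continuous_intros)
  have Gint: "((\<lambda>\<zeta>. F (\<Phi> x \<zeta>) * S L x \<zeta>) has_contour_integral 2 * of_real pi * \<i> * G L x) (circlepath 0 r)"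
    if "x \<in> T2" for L x
  proof -
    have "continuous_on (sphere 0 r) (\<lambda>\<zeta>. (x,\<zeta>))" by (intro continuous_intros)
    then have "continuous_on (sphere 0 r) (\<lambda>\<zeta>. (\<lambda>(x, \<zeta>). F (\<Phi> x \<zeta>) * S L x \<zeta>) (x,\<zeta>))"
      by (rule continuous_on_compose2[OF FSc]) (use that in auto)
    then have "(\<lambda>\<zeta>. F (\<Phi> x \<zeta>) * S L x \<zeta>) contour_integrable_on (circlepath 0 r)"
      using r by (intro contour_integrable_continuous_circlepath) simp
    from has_contour_integral_integral[OF this] show ?thesis by (simp add: G_def)
  qed
  have two: "cmod (2 * of_real pi * \<i> * z) \<le> b * (2 * pi * r) \<Longrightarrow> cmod z \<le> b * r" for z b
    by (simp add: norm_mult mult_ac)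
  have KT2: "K \<subseteq> T2" using Kph T2 by blast
  have i2: "1 / r = 2 * \<epsilon>" using \<epsilon> by (simp add: r_def)
  \<comment> \<open>Where \<open>h\<close> is small every term of the kernel has size at most
    \<open>(3 * \<epsilon>) ^ L / r\<close>, since \<open>1 / cmod \<zeta>\<close> equals
    2\<epsilon> on the contour.\<close>
  have bound1: "cmod (G L x) \<le> C * (L + 1) * (3 * \<epsilon>) ^ L" if x: "x \<in> K" "cmod (h x) < 3 * \<epsilon>" for L x
  proof -
    have "cmod (2 * of_real pi * \<i> * G L x) \<le> (C * ((L + 1) * ((3 * \<epsilon>) ^ L / r))) * (2 * pi * r)"
    proof (rule has_contour_integral_bound_circlepath[OF Gint])
      fix \<zeta> assume "cmod (\<zeta> - 0) = r"
      then have \<zeta>: "cmod \<zeta> = r" by simp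
      have "cmod (S L x \<zeta>) \<le> (\<Sum>s\<le>L. (3 * \<epsilon>) ^ L / r)"
        unfolding S_def
      proof (rule sum_norm_le)
        fix s assume s: "s \<in> {..L}"
        have "cmod (h x ^ (L - s) / \<zeta> ^ Suc s) = cmod (h x) ^ (L - s) * (2 * \<epsilon>) ^ s / r"
          using \<zeta> by (simp add: norm_divide norm_power norm_mult flip: i2) (simp add: field_simps power_divide)
        also have "\<dots> \<le> (3 * \<epsilon>) ^ (L - s) * (3 * \<epsilon>) ^ s / r"
          using x \<epsilon> r by (intro divide_right_mono mult_mono power_mono) auto
        also have "(3 * \<epsilon>) ^ (L - s) * (3 * \<epsilon>) ^ s = (3 * \<epsilon>) ^ L"
          using s by (simp only: power_add[symmetric] atMost_iff le_add_diff_inverse2)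
        finally show "cmod (h x ^ (L - s) / \<zeta> ^ Suc s) \<le> (3 * \<epsilon>) ^ L / r" .
      qed
      then have S: "cmod (S L x \<zeta>) \<le> (L + 1) * ((3 * \<epsilon>) ^ L / r)" by simp
      show "cmod (F (\<Phi> x \<zeta>) * S L x \<zeta>) \<le> C * ((L + 1) * ((3 * \<epsilon>) ^ L / r))"
        unfolding norm_mult using S C \<Phi>X1 x Kph \<zeta> by (intro mult_mono) auto
    qed (use C r \<epsilon> KT2 x in auto)
    from two[OF this] show ?thesis using r by (simp add: mult_ac)
  qed
  \<comment> \<open>For \<open>cmod (h x) \<ge> 3 * \<epsilon>\<close> the point
    \<open>1 / h x\<close> lies inside the contour, so Cauchy's formula gives \<open>h x ^ L\<close>
    times the value of \<open>F\<close> there, which is the indicator because \<open>g\<close>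
    vanishes. The difference of the kernels is of order \<open>(2 * \<epsilon>) ^ L\<close>.\<close>
  have bound2: "cmod (G L x - h x ^ L * (if x \<in> NA then 1 else 0)) \<le> 2 * C * (2 * \<epsilon>) ^ L"
    if x: "x \<in> K" "cmod (h x) \<ge> 3 * \<epsilon>" for L x
  proof -
    have hx: "h x \<noteq> 0" using x \<epsilon> by auto
    define z where "z = 1 / h x"
    have "r * (3 * \<epsilon>) = 3 * (r * \<epsilon>)" by simp
    then have "r * (3 * \<epsilon>) = 3 / 2" unfolding r(2) by simp
    moreover have "r * (3 * \<epsilon>) \<le> r * cmod (h x)"
      by (rule mult_left_mono[OF x(2)]) (use r(1) in simp)
    ultimately have rh: "3 / 2 \<le> r * cmod (h x)" by linarith
    have z: "cmod z < r" using rh hx by (simp add: z_def norm_divide field_simps)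
    have xN: "x \<in> NA \<union> NB"
    proof -
      have "x \<in> A \<or> x \<in> B" using x \<epsilon> closure_subset[of W] by (auto simp: A_def B_def)
      then show ?thesis using NAB by auto
    qed
    have fz: "F (\<Phi> x z) = (if x \<in> NA then 1 else 0)"
    proof -
      have "\<Phi> x z \<in> T1" using F(1) \<Phi>X1[of x z] x Kph z by auto
      moreover have "\<Phi> x z \<in> N" using xN by (simp add: N_def \<Phi>)
      moreover have "g (\<Phi> x z) = 0" using hx by (simp add: g_def \<Phi> z_def)
      ultimately show ?thesis using F(3)[of "\<Phi> x z"] by (simp add: f_def \<Phi>)
    qed
    have "(\<lambda>\<zeta>. F (\<Phi> x \<zeta>)) holomorphic_on ((\<lambda>\<zeta>. \<Phi> x \<zeta>) -` T1)"
    proof (rule hol_curve[OF F(2)])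
      have "continuous_on UNIV (\<lambda>\<zeta>. \<Phi> x \<zeta>)"
      proof -
        have "continuous_on UNIV (\<lambda>\<zeta>::complex. (x, \<zeta>))" by (intro continuous_intros)
        from continuous_on_compose2[OF \<Phi>c this] show ?thesis by simp
      qed
      then have o: "open ((\<lambda>\<zeta>. \<Phi> x \<zeta>) -` T1)" using hol_open[OF F(2)] by (simp add: open_vimage)
      show "holomorphic_curve (\<lambda>\<zeta>. \<Phi> x \<zeta>) ((\<lambda>\<zeta>. \<Phi> x \<zeta>) -` T1)"
        unfolding holomorphic_curve_def
      proof (intro conjI allI o)
        show "(\<lambda>\<zeta>. \<Phi> x \<zeta> i) holomorphic_on (\<lambda>\<zeta>. \<Phi> x \<zeta>) -` T1" for i
          unfolding \<Phi>i by (cases "i = 0") auto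
      qed
    qed auto
    then have hF: "(\<lambda>\<zeta>. F (\<Phi> x \<zeta>)) holomorphic_on cball 0 r"
      by (rule holomorphic_on_subset) (use T0(3) KT2 x in \<open>auto simp: T2_def\<close>)
    have cauchy: "((\<lambda>\<zeta>. h x ^ L * (F (\<Phi> x \<zeta>) / (\<zeta> - z))) has_contour_integral h x ^ L * (2 * of_real pi * \<i> * F (\<Phi> x z))) (circlepath 0 r)"
      by (intro has_contour_integral_lmul Cauchy_integral_circlepath_simple[OF hF]) (use z in auto)
    have "((\<lambda>\<zeta>. F (\<Phi> x \<zeta>) * S L x \<zeta> - h x ^ L * (F (\<Phi> x \<zeta>) / (\<zeta> - z))) has_contour_integral
        2 * of_real pi * \<i> * G L x - h x ^ L * (2 * of_real pi * \<i> * F (\<Phi> x z))) (circlepath 0 r)"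
      by (intro has_contour_integral_diff Gint cauchy) (use KT2 x in auto)
    then have I: "((\<lambda>\<zeta>. F (\<Phi> x \<zeta>) * S L x \<zeta> - h x ^ L * (F (\<Phi> x \<zeta>) / (\<zeta> - z))) has_contour_integral
        2 * of_real pi * \<i> * (G L x - h x ^ L * F (\<Phi> x z))) (circlepath 0 r)"
      by (simp add: algebra_simps)
    have "cmod (2 * of_real pi * \<i> * (G L x - h x ^ L * F (\<Phi> x z))) \<le> (C * (2 * (2 * \<epsilon>) ^ L / r)) * (2 * pi * r)"
    proof (rule has_contour_integral_bound_circlepath[OF I])
      fix \<zeta> assume "cmod (\<zeta> - 0) = r"
      then have \<zeta>: "cmod \<zeta> = r" by simp
      have ne: "\<zeta> \<noteq> 0" "\<zeta> \<noteq> z" using \<zeta> z r by auto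
      have hz: "h x * z = 1" using hx by (simp add: z_def)
      have ne2: "h x * \<zeta> \<noteq> 1" using ne hx by (auto simp: z_def field_simps)
      have "1 / (\<zeta> - z) = h x / (h x * \<zeta> - 1)"
        using ne ne2 hx by (simp add: z_def field_simps)
      then have "F (\<Phi> x \<zeta>) * S L x \<zeta> - h x ^ L * (F (\<Phi> x \<zeta>) / (\<zeta> - z))
         = F (\<Phi> x \<zeta>) * ((h x ^ Suc L - 1 / \<zeta> ^ Suc L) / (h x * \<zeta> - 1) - h x ^ L * (h x / (h x * \<zeta> - 1)))"
        unfolding S_def peak_kernel_sum[OF ne(1) ne2]
        by (simp only: times_divide_eq_right[symmetric] right_diff_distrib) (simp add: mult_ac divide_inverse)
      also have "\<dots> = F (\<Phi> x \<zeta>) * (- 1 / \<zeta> ^ Suc L / (h x * \<zeta> - 1))"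
        using ne2 by (simp add: diff_divide_distrib)
      finally have eq: "cmod (F (\<Phi> x \<zeta>) * S L x \<zeta> - h x ^ L * (F (\<Phi> x \<zeta>) / (\<zeta> - z)))
         = cmod (F (\<Phi> x \<zeta>)) * ((2 * \<epsilon>) ^ L / r / cmod (h x * \<zeta> - 1))"
        using \<zeta> r by (simp add: norm_mult norm_divide norm_power flip: i2) (simp add: field_simps power_divide)
      have "1 / 2 \<le> cmod (h x * \<zeta> - 1)"
        using norm_triangle_ineq2[of "h x * \<zeta>" 1] rh \<zeta> by (simp add: norm_mult mult.commute)
      then have "(2 * \<epsilon>) ^ L / r / cmod (h x * \<zeta> - 1) \<le> (2 * \<epsilon>) ^ L / r / (1 / 2)"
        using r \<epsilon> by (intro divide_left_mono) auto
      then have k: "(2 * \<epsilon>) ^ L / r / cmod (h x * \<zeta> - 1) \<le> 2 * (2 * \<epsilon>) ^ L / r"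
        by (simp only: divide_divide_eq_right div_by_1 times_divide_eq_left mult.commute[of 2])
      show "cmod (F (\<Phi> x \<zeta>) * S L x \<zeta> - h x ^ L * (F (\<Phi> x \<zeta>) / (\<zeta> - z))) \<le> C * (2 * (2 * \<epsilon>) ^ L / r)"
        unfolding eq using k C \<Phi>X1 x Kph \<zeta> r \<epsilon> by (intro mult_mono) auto
    qed (use C r \<epsilon> in auto)
    from two[OF this] show ?thesis using r unfolding fz by (simp add: mult_ac)
  qed
  have "eventually (\<lambda>L. (4 * C * (real L + 1) + 4 * C + 2) * (3/4) ^ L < 1) sequentially"
  proof -
    have "(\<lambda>L. 4 * C * (real L * (3/4) ^ L) + (8 * C + 2) * (3/4) ^ L) \<longlonglongrightarrow> 4 * C * 0 + (8 * C + 2) * 0"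
      using powser_times_n_limit_0[of "3/4::real"] by (intro tendsto_intros LIMSEQ_power_zero) auto
    moreover have "(\<lambda>L. 4 * C * (real L * (3/4) ^ L) + (8 * C + 2) * (3/4) ^ L)
        = (\<lambda>L. (4 * C * (real L + 1) + 4 * C + 2) * (3/4) ^ L)" by (auto simp: algebra_simps)
    ultimately show ?thesis by (intro order_tendstoD(2)) auto
  qed
  then obtain L where L: "(4 * C * (real L + 1) + 4 * C + 2) * (3/4) ^ L < 1" by (auto simp: eventually_sequentially)
  define b where "b = (3 * \<epsilon>) ^ L"
  have b: "b > 0" "(4 * C * (real L + 1) + 4 * C + 2) * b < (4 * \<epsilon>) ^ L" 
  proof -
    show "b > 0" using \<epsilon> by (simp add: b_def)
    have "(3/4) * (4 * \<epsilon>) = 3 * \<epsilon>" by simp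
    then have "b = (3/4) ^ L * (4 * \<epsilon>) ^ L" unfolding b_def by (metis power_mult_distrib)
    then have "(4 * C * (real L + 1) + 4 * C + 2) * b = ((4 * C * (real L + 1) + 4 * C + 2) * (3/4) ^ L) * (4 * \<epsilon>) ^ L"
      by simp
    also have "\<dots> < 1 * (4 * \<epsilon>) ^ L" using L \<epsilon> by (intro mult_strict_right_mono) auto
    finally show "(4 * C * (real L + 1) + 4 * C + 2) * b < (4 * \<epsilon>) ^ L" by simp
  qed
  have "(2 * \<epsilon>) ^ L \<le> b" unfolding b_def using \<epsilon> by (intro power_mono) auto
  then have b2: "2 * C * (2 * \<epsilon>) ^ L \<le> 2 * C * b" using C by (intro mult_left_mono) auto
  have out: "cmod (G L x) \<le> 2 * C * (real L + 1) * b" if x: "x \<in> K - W" for x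
  proof (cases "cmod (h x) < 3 * \<epsilon>")
    case True
    have "C * (L + 1) * b \<le> 2 * C * (real L + 1) * b" using C b by (intro mult_right_mono) auto
    then show ?thesis using bound1[of x L] True x by (simp add: b_def)
  next
    case False
    then have "x \<in> B" using x \<epsilon> by (auto simp: B_def)
    then have "x \<notin> NA" using NAB by blast
    then have "cmod (G L x) \<le> 2 * C * b" using bound2[of x L] False x b2 by auto
    also have "\<dots> \<le> 2 * C * (real L + 1) * b" using C b by (intro mult_right_mono) (auto simp: algebra_simps)
    finally show ?thesis .
  qed
  have pA: "p \<in> A" using p W(1) \<epsilon> closure_subset[of W] by (auto simp: A_def)
  then have "p \<in> NA" using NAB by auto
  then have "cmod (G L p - h p ^ L) \<le> 2 * C * b" using bound2[of p L] p W(1) \<epsilon> b2 by auto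
  then have Gp: "cmod (G L p) \<ge> (4 * \<epsilon>) ^ L - 2 * C * b"
    using norm_triangle_ineq2[of "h p ^ L" "G L p"] \<epsilon>(2) by (simp add: norm_power norm_minus_commute)
  have "\<exists>P. seq_poly P \<and> (\<forall>x\<in>K. cmod (G L x - P x) < b / 2)"
    by (rule polyhedron_approx[where s=s and p=q and R=R and l=l and u=u and M=M and T=T2])
       (use q R l_def u_def hG T2(2) K(2) b in simp_all)
  then obtain P where P: "seq_poly P" "\<And>x. x \<in> K \<Longrightarrow> cmod (G L x - P x) < b / 2" by blast
  \<comment> \<open>On \<open>K - W\<close> the function \<open>G L\<close>, and with it
    \<open>P\<close>, is at most of order \<open>L * (3 * \<epsilon>) ^ L\<close>, while at
    \<open>p\<close> it has size about \<open>(4 * \<epsilon>) ^ L\<close>. The choice of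
    \<open>L\<close> makes this contradict \<open>small\<close>.\<close>
  have "cmod (P p) \<le> 2 * C * (real L + 1) * b + b / 2"
  proof (rule small[OF P(1) _ p])
    fix y assume y: "y \<in> K - W"
    show "cmod (P y) \<le> 2 * C * (real L + 1) * b + b / 2"
      using out[OF y] P(2)[of y] y norm_triangle_ineq2[of "P y" "G L y"] by (simp add: norm_minus_commute)
  qed
  moreover have "cmod (P p) \<ge> (4 * \<epsilon>) ^ L - 2 * C * b - b / 2"
    using Gp P(2)[of p] p W(1) norm_triangle_ineq2[of "G L p" "P p"] by auto
  ultimately have "(4 * \<epsilon>) ^ L \<le> (2 * C * (real L + 1) + 2 * C + 1) * b" by (simp add: algebra_simps)
  moreover have "(2 * C * (real L + 1) + 2 * C + 1) * b \<le> (4 * C * (real L + 1) + 4 * C + 2) * b"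
    using C b by (intro mult_right_mono) auto
  ultimately show False using b(2) by linarith
qed

section \<open>Polynomial functions and the Bernstein--Walsh inequality\<close>

text \<open>A bound and not the exact degree, so that the class is closed under sums; a property of
  functions, since the polynomials constructed later are known through their values.\<close>

definition polyfun :: "nat \<Rightarrow> (complex ^ 'k::finite \<Rightarrow> complex) \<Rightarrow> bool" where
  "polyfun d f \<longleftrightarrow> (\<exists>p. pdeg p \<le> d \<and> f = peval p)"

definition monomial_value :: "('k::finite \<Rightarrow>\<^sub>0 nat) \<Rightarrow> complex ^ 'k \<Rightarrow> complex" where
  "monomial_value \<alpha> z = (\<Prod>i\<in>UNIV. (z $ i) ^ Poly_Mapping.lookup \<alpha> i)"

definition monomial_degree :: "('k::finite \<Rightarrow>\<^sub>0 nat) \<Rightarrow> nat" where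
  "monomial_degree \<alpha> = (\<Sum>i\<in>UNIV. Poly_Mapping.lookup \<alpha> i)"

lemma monomial_value_add: "monomial_value (\<alpha> + \<beta>) z = monomial_value \<alpha> z * monomial_value \<beta> z"
  by (simp add: monomial_value_def lookup_add power_add prod.distrib)

lemma monomial_degree_add: "monomial_degree (\<alpha> + \<beta>) = monomial_degree \<alpha> + monomial_degree \<beta>"
  by (simp add: monomial_degree_def lookup_add sum.distrib)

lemma peval_superset:
  assumes "finite S" "Poly_Mapping.keys p \<subseteq> S"
  shows "peval p z = (\<Sum>\<alpha>\<in>S. Poly_Mapping.lookup p \<alpha> * monomial_value \<alpha> z)"
  unfolding peval_def monomial_value_def
  by (rule sum.mono_neutral_left) (use assms in \<open>auto simp: in_keys_iff\<close>)

lemma peval_add: "peval (p + q) z = peval p z + peval q z"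
proof -
  let ?S = "Poly_Mapping.keys p \<union> Poly_Mapping.keys q"
  have "peval (p + q) z = (\<Sum>\<alpha>\<in>?S. Poly_Mapping.lookup (p + q) \<alpha> * monomial_value \<alpha> z)"
    by (rule peval_superset) (auto simp: keys_add)
  also have "\<dots> = peval p z + peval q z"
    by (simp add: peval_superset[of ?S] lookup_add distrib_right sum.distrib)
  finally show ?thesis .
qed

lemma peval_zero: "peval 0 z = 0" by (simp add: peval_def)

lemma peval_sum: "peval (sum f A) z = (\<Sum>a\<in>A. peval (f a) z)"
  by (induction A rule: infinite_finite_induct) (auto simp: peval_add peval_zero)

lemma peval_single: "peval (Poly_Mapping.single \<alpha> c) z = c * monomial_value \<alpha> z"
  by (simp add: peval_superset[of "{\<alpha>}"])

lemma poly_mapping_sum_single: "p = (\<Sum>\<alpha>\<in>Poly_Mapping.keys p. Poly_Mapping.single \<alpha> (Poly_Mapping.lookup p \<alpha>))"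
proof (rule poly_mapping_eqI)
  fix k
  show "Poly_Mapping.lookup p k
     = Poly_Mapping.lookup (\<Sum>\<alpha>\<in>Poly_Mapping.keys p. Poly_Mapping.single \<alpha> (Poly_Mapping.lookup p \<alpha>)) k"
    by (cases "k \<in> Poly_Mapping.keys p")
       (auto simp: lookup_sum lookup_single when_def in_keys_iff sum.delta)
qed

lemma peval_mult: "peval (p * q) z = peval p z * peval q z"
proof -
  let ?s = "\<lambda>p \<alpha>. Poly_Mapping.single \<alpha> (Poly_Mapping.lookup p \<alpha>)"
  have "p * q = (\<Sum>\<alpha>\<in>Poly_Mapping.keys p. ?s p \<alpha>) * (\<Sum>\<beta>\<in>Poly_Mapping.keys q. ?s q \<beta>)"
    using poly_mapping_sum_single[of p] poly_mapping_sum_single[of q] by simp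
  then have "peval (p * q) z = (\<Sum>\<alpha>\<in>Poly_Mapping.keys p. \<Sum>\<beta>\<in>Poly_Mapping.keys q. peval (?s p \<alpha> * ?s q \<beta>) z)"
    by (simp add: sum_product peval_sum)
  also have "\<dots> = (\<Sum>\<alpha>\<in>Poly_Mapping.keys p. \<Sum>\<beta>\<in>Poly_Mapping.keys q.
      (Poly_Mapping.lookup p \<alpha> * monomial_value \<alpha> z) * (Poly_Mapping.lookup q \<beta> * monomial_value \<beta> z))"
    by (simp add: mult_single peval_single monomial_value_add mult_ac)
  also have "\<dots> = peval p z * peval q z"
    by (simp add: peval_superset[of "Poly_Mapping.keys p"] peval_superset[of "Poly_Mapping.keys q"] sum_product)
  finally show ?thesis .
qed

lemma pdeg_le_iff: "pdeg p \<le> d \<longleftrightarrow> (\<forall>\<alpha>\<in>Poly_Mapping.keys p. monomial_degree \<alpha> \<le> d)"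
  by (auto simp: pdeg_def monomial_degree_def)

lemma polyfun_mono: "polyfun d f \<Longrightarrow> d \<le> d' \<Longrightarrow> polyfun d' f"
  unfolding polyfun_def using order_trans by blast

lemma polyfun_const: "polyfun d (\<lambda>_. c)"
  unfolding polyfun_def
  by (rule exI[of _ "Poly_Mapping.single 0 c"]) (auto simp: pdeg_le_iff fun_eq_iff peval_single monomial_value_def monomial_degree_def)

lemma polyfun_coord: "1 \<le> d \<Longrightarrow> polyfun d (\<lambda>z::complex ^ 'a. z $ i)"
proof -
  assume d: "1 \<le> d"
  define \<alpha> where "\<alpha> = Poly_Mapping.single i (1::nat)"
  have "(\<Prod>j\<in>UNIV. (z $ j) ^ Poly_Mapping.lookup \<alpha> j) = (\<Prod>j\<in>{i}. (z $ j) ^ Poly_Mapping.lookup \<alpha> j)" for z :: "complex^'a"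
    by (rule prod.mono_neutral_right) (auto simp: \<alpha>_def lookup_single when_def)
  then have "monomial_value \<alpha> z = z $ i" for z :: "complex^'a" by (simp add: monomial_value_def \<alpha>_def)
  moreover have "monomial_degree \<alpha> = 1" by (simp add: monomial_degree_def \<alpha>_def lookup_single when_def)
  ultimately show ?thesis
    unfolding polyfun_def using d
    by (intro exI[of _ "Poly_Mapping.single \<alpha> 1"]) (auto simp: pdeg_le_iff fun_eq_iff peval_single)
qed

lemma polyfun_add: "polyfun d f \<Longrightarrow> polyfun d g \<Longrightarrow> polyfun d (\<lambda>z. f z + g z)"
  unfolding polyfun_def
proof safe
  fix p q :: "'a cpoly"
  assume "pdeg p \<le> d" "pdeg q \<le> d"
  then have "pdeg (p + q) \<le> d" using keys_add[of p q] by (auto simp: pdeg_le_iff)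
  then show "\<exists>r. pdeg r \<le> d \<and> (\<lambda>z. peval p z + peval q z) = peval r"
    by (intro exI[of _ "p + q"]) (auto simp: peval_add fun_eq_iff)
qed

lemma polyfun_mult: "polyfun d f \<Longrightarrow> polyfun e g \<Longrightarrow> polyfun (d + e) (\<lambda>z. f z * g z)"
  unfolding polyfun_def
proof safe
  fix p q :: "'a cpoly"
  assume *: "pdeg p \<le> d" "pdeg q \<le> e"
  have "pdeg (p * q) \<le> d + e"
    unfolding pdeg_le_iff
  proof
    fix \<gamma> assume "\<gamma> \<in> Poly_Mapping.keys (p * q)"
    then obtain \<alpha> \<beta> where "\<gamma> = \<alpha> + \<beta>" "\<alpha> \<in> Poly_Mapping.keys p" "\<beta> \<in> Poly_Mapping.keys q"
      using keys_mult[of p q] by auto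
    then show "monomial_degree \<gamma> \<le> d + e" using * by (auto simp: pdeg_le_iff monomial_degree_add intro: add_mono)
  qed
  then show "\<exists>r. pdeg r \<le> d + e \<and> (\<lambda>z. peval p z * peval q z) = peval r"
    by (intro exI[of _ "p * q"]) (auto simp: peval_mult fun_eq_iff)
qed

lemma polyfun_cmult: "polyfun d f \<Longrightarrow> polyfun d (\<lambda>z. c * f z)"
  using polyfun_mult[OF polyfun_const[of 0 c]] by auto

lemma polyfun_diff: "polyfun d f \<Longrightarrow> polyfun d g \<Longrightarrow> polyfun d (\<lambda>z. f z - g z)"
  using polyfun_add[OF _ polyfun_cmult[of d g "-1"], of f] by simp

lemma polyfun_sum: "(\<And>i. i \<in> I \<Longrightarrow> polyfun d (f i)) \<Longrightarrow> polyfun d (\<lambda>z. \<Sum>i\<in>I. f i z)"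
  by (induction I rule: infinite_finite_induct) (auto intro: polyfun_const polyfun_add)

lemma polyfun_prod: "(\<And>i. i \<in> I \<Longrightarrow> polyfun (d i) (f i)) \<Longrightarrow> polyfun (\<Sum>i\<in>I. d i) (\<lambda>z. \<Prod>i\<in>I. f i z)"
  by (induction I rule: infinite_finite_induct) (auto intro: polyfun_const polyfun_mult)

lemma polyfun_power: "polyfun d f \<Longrightarrow> polyfun (n * d) (\<lambda>z. f z ^ n)"
  by (induction n) (auto intro: polyfun_const polyfun_mult)

text \<open>Allows proofs by closure under the ring operations with the degree bound carried along,
  without formal coefficients.\<close>

lemma polyfun_induct [consumes 1, case_names mono const coord add mult]:
  fixes P :: "nat \<Rightarrow> (complex ^ 'k::finite \<Rightarrow> complex) \<Rightarrow> bool"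
  assumes "polyfun d f"
    and mono: "\<And>d e f. P d f \<Longrightarrow> d \<le> e \<Longrightarrow> P e f"
    and const: "\<And>c. P 0 (\<lambda>_. c)"
    and coord: "\<And>i. P 1 (\<lambda>z. z $ i)"
    and add: "\<And>d f g. P d f \<Longrightarrow> P d g \<Longrightarrow> P d (\<lambda>z. f z + g z)"
    and mult: "\<And>d e f g. P d f \<Longrightarrow> P e g \<Longrightarrow> P (d + e) (\<lambda>z. f z * g z)"
  shows "P d f"
proof -
  obtain p where p: "pdeg p \<le> d" "f = peval p" using assms(1) polyfun_def by blast
  have pw: "P n (\<lambda>z. (z $ i) ^ n)" for i n
  proof (induction n)
    case 0 then show ?case using const[of 1] by simp
  next
    case (Suc n) then show ?case using mult[OF coord[of i] Suc] by simp
  qed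
  have base_pt: "P (\<Sum>i\<in>I. e i) (\<lambda>z. \<Prod>i\<in>I. (z $ i) ^ e i)" if "finite I" for I e
    using that
  proof induction
    case empty then show ?case using const[of 1] by simp
  next
    case (insert i I) then show ?case using mult[OF pw[of "e i" i] insert(3)] by simp
  qed
  have m: "P d (\<lambda>z. Poly_Mapping.lookup p \<alpha> * monomial_value \<alpha> z)" if "\<alpha> \<in> Poly_Mapping.keys p" for \<alpha>
  proof -
    have "P (monomial_degree \<alpha>) (monomial_value \<alpha>)" unfolding monomial_degree_def monomial_value_def[abs_def] by (rule base_pt) auto
    then have "P (monomial_degree \<alpha>) (\<lambda>z. Poly_Mapping.lookup p \<alpha> * monomial_value \<alpha> z)"
      using mult[OF const[of "Poly_Mapping.lookup p \<alpha>"], of "monomial_degree \<alpha>" "monomial_value \<alpha>"] by simp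
    then show ?thesis using mono that p(1) by (auto simp: pdeg_le_iff)
  qed
  have "P d (\<lambda>z. \<Sum>\<alpha>\<in>A. Poly_Mapping.lookup p \<alpha> * monomial_value \<alpha> z)" if "finite A" "A \<subseteq> Poly_Mapping.keys p" for A
    using that
  proof induction
    case empty then show ?case using mono[OF const[of 0], of d] by simp
  next
    case (insert \<alpha> A) then show ?case using add[OF m[of \<alpha>], of "\<lambda>z. \<Sum>\<alpha>\<in>A. Poly_Mapping.lookup p \<alpha> * monomial_value \<alpha> z"] by simp
  qed
  from this[of "Poly_Mapping.keys p"] show ?thesis
    unfolding p(2) by (simp add: peval_superset[OF finite_keys order_refl, abs_def])
qed

text \<open>Taylor expansion at \<open>x0\<close> along lines. The coefficient of order
  \<open>i\<close> has degree at most \<open>i\<close> in the direction \<open>v\<close>, not merely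
  at most \<open>d\<close>; \<open>polyfun_quotient\<close> relies on this for the degree of the
  quotient.\<close>

lemma polyfun_expand:
  assumes "polyfun d f"
  shows "\<exists>g. (\<forall>i. polyfun i (g i)) \<and> (\<forall>i>d. g i = (\<lambda>_. 0)) \<and> (\<forall>v \<mu>. f (x0 + \<mu> *s v) = (\<Sum>i\<le>d. g i v * \<mu> ^ i))"
  using assms
proof (induction rule: polyfun_induct)
  case (mono d e f)
  then obtain g where g: "\<And>i. polyfun i (g i)" "\<And>i. i > d \<Longrightarrow> g i = (\<lambda>_. 0)"
    "\<And>v \<mu>. f (x0 + \<mu> *s v) = (\<Sum>i\<le>d. g i v * \<mu> ^ i)" by blast
  have "(\<Sum>i\<le>d. g i v * \<mu> ^ i) = (\<Sum>i\<le>e. g i v * \<mu> ^ i)" for v \<mu>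
    by (rule sum.mono_neutral_left) (use g(2) mono(2) in auto)
  then show ?case using g mono(2) by (intro exI[of _ g]) auto
next
  case (const c)
  show ?case by (rule exI[of _ "\<lambda>i v. if i = 0 then c else 0"]) (auto intro: polyfun_const)
next
  case (coord j)
  have "polyfun i (\<lambda>v. if i = 0 then x0 $ j else if i = 1 then v $ j else 0)" for i
    by (cases "i = 0"; cases "i = 1") (auto intro: polyfun_const polyfun_coord)
  then show ?case
    by (intro exI[of _ "\<lambda>i v. if i = 0 then x0 $ j else if i = 1 then v $ j else 0"]) (auto simp: fun_eq_iff)
next
  case (add d f1 f2)
  obtain g1 where g1: "\<And>i. polyfun i (g1 i)" "\<And>i. i > d \<Longrightarrow> g1 i = (\<lambda>_. 0)"
    "\<And>v \<mu>. f1 (x0 + \<mu> *s v) = (\<Sum>i\<le>d. g1 i v * \<mu> ^ i)" using add(1) by blast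
  obtain g2 where g2: "\<And>i. polyfun i (g2 i)" "\<And>i. i > d \<Longrightarrow> g2 i = (\<lambda>_. 0)"
    "\<And>v \<mu>. f2 (x0 + \<mu> *s v) = (\<Sum>i\<le>d. g2 i v * \<mu> ^ i)" using add(2) by blast
  note g = g1 g2
  show ?case
    using g by (intro exI[of _ "\<lambda>i v. g1 i v + g2 i v"]) (auto simp: sum.distrib distrib_right intro: polyfun_add)
next
  case (mult d e f1 f2)
  obtain g1 where g1: "\<And>i. polyfun i (g1 i)" "\<And>i. i > d \<Longrightarrow> g1 i = (\<lambda>_. 0)"
    "\<And>v \<mu>. f1 (x0 + \<mu> *s v) = (\<Sum>i\<le>d. g1 i v * \<mu> ^ i)" using mult(1) by blast
  obtain g2 where g2: "\<And>i. polyfun i (g2 i)" "\<And>i. i > e \<Longrightarrow> g2 i = (\<lambda>_. 0)"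
    "\<And>v \<mu>. f2 (x0 + \<mu> *s v) = (\<Sum>i\<le>e. g2 i v * \<mu> ^ i)" using mult(2) by blast
  note g = g1 g2
  define h where "h r v = (\<Sum>k\<le>r. g1 k v * g2 (r - k) v)" for r v
  have h0: "h r v = 0" if "r > d + e" for r v
    unfolding h_def
  proof (rule sum.neutral, safe)
    fix k assume "k \<le> r"
    show "g1 k v * g2 (r - k) v = 0"
      using g(2)[of k] g(5)[of "r - k"] that by (cases "k > d") auto
  qed
  have "polyfun r (h r)" for r
    unfolding h_def[abs_def]
  proof (rule polyfun_sum)
    fix k assume "k \<in> {..r}"
    then show "polyfun r (\<lambda>v. g1 k v * g2 (r - k) v)"
      using polyfun_mult[OF g(1)[of k] g(4)[of "r - k"]] by simp
  qed
  moreover have "f1 (x0 + \<mu> *s v) * f2 (x0 + \<mu> *s v) = (\<Sum>r\<le>d + e. h r v * \<mu> ^ r)" for v \<mu>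
    unfolding g(3) g(6) h_def
    by (rule polynomial_product) (use g(2,5) in auto)
  ultimately show ?case using h0 by (intro exI[of _ h]) auto
qed

lemma polyfun_line:
  assumes "polyfun d f"
  shows "\<exists>q. degree q \<le> d \<and> (\<forall>\<mu>. f (x0 + \<mu> *s v) = poly q \<mu>)"
proof -
  obtain g where g: "\<And>v \<mu>. f (x0 + \<mu> *s v) = (\<Sum>i\<le>d. g i v * \<mu> ^ i)" using polyfun_expand[OF assms] by metis
  show ?thesis
    by (rule exI[of _ "\<Sum>i\<le>d. monom (g i v) i"])
       (auto simp: g poly_sum poly_monom intro: degree_sum_le degree_monom_le order_trans[OF degree_monom_le])
qed

lemma polyfun_holomorphic:
  assumes "polyfun d f"
  shows "\<exists>D. (f has_derivative D) (at z) \<and> (\<forall>c v. D (c *s v) = c * D v)"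
  using assms
proof (induction rule: polyfun_induct)
  case (const c) then show ?case by (intro exI[of _ "\<lambda>_. 0"]) auto
next
  case (coord i)
  have "((\<lambda>z. z $ i) has_derivative (\<lambda>v. v $ i)) (at z)"
    by (simp add: bounded_linear_imp_has_derivative bounded_linear_vec_nth)
  then show ?case by (intro exI[of _ "\<lambda>v. v $ i"]) auto
next
  case (add d f g)
  then obtain D1 D2 where "(f has_derivative D1) (at z)" "\<And>c v. D1 (c *s v) = c * D1 v"
    "(g has_derivative D2) (at z)" "\<And>c v. D2 (c *s v) = c * D2 v" by blast
  then show ?case
    by (intro exI[of _ "\<lambda>v. D1 v + D2 v"]) (auto intro!: derivative_eq_intros simp: algebra_simps)
next
  case (mult d e f g)
  then obtain D1 D2 where "(f has_derivative D1) (at z)" "\<And>c v. D1 (c *s v) = c * D1 v"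
    "(g has_derivative D2) (at z)" "\<And>c v. D2 (c *s v) = c * D2 v" by blast
  then show ?case
    using has_derivative_mult[of f D1 z UNIV g D2]
    by (intro exI[of _ "\<lambda>v. f z * D2 v + D1 v * g z"]) (simp add: distrib_left mult_ac)
qed auto

lemma polyfun_cholomorphic: "polyfun d f \<Longrightarrow> open W \<Longrightarrow> cholomorphic f W"
  unfolding cholomorphic_def using polyfun_holomorphic by blast

lemma cholomorphic_continuous: "cholomorphic f W \<Longrightarrow> continuous_on W f"
  unfolding cholomorphic_def
  by (metis continuous_at_imp_continuous_on has_derivative_continuous)

lemma polyfun_continuous: "polyfun d f \<Longrightarrow> continuous_on S f"
  using cholomorphic_continuous[OF polyfun_cholomorphic[of d f UNIV]] continuous_on_subset by blast

lemma norm_vector_scalar_mult_complex: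
  fixes v :: "complex ^ 'k"
  shows "norm (c *s v) = cmod c * norm v"
proof -
  have "norm (c *s v) = L2_set (\<lambda>i. cmod c * cmod (v $ i)) UNIV" by (simp add: norm_vec_def norm_mult)
  then show ?thesis by (simp add: norm_vec_def L2_set_right_distrib)
qed

text \<open>On the complex line from \<open>x\<close> to \<open>x1\<close> the function is a nonzero
  polynomial in one variable, so its zeros do not accumulate at \<open>x\<close>.\<close>

lemma polyfun_nonzero_dense:
  fixes f :: "complex ^ 'k \<Rightarrow> complex"
  assumes f: "polyfun d f" "f x1 \<noteq> 0" and e: "e > 0"
  shows "\<exists>y. dist x y < e \<and> f y \<noteq> 0"
proof -
  obtain q where q: "\<And>\<mu>. f (x + \<mu> *s (x1 - x)) = poly q \<mu>" using polyfun_line[OF f(1)] by blast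
  have "poly q 1 \<noteq> 0" using q[of 1] f(2) by simp
  then have "finite {\<mu>. poly q \<mu> = 0}" by (intro poly_roots_finite) auto
  moreover define \<delta> where "\<delta> = e / (norm (x1 - x) + 1)"
  have \<delta>: "\<delta> > 0" using e by (auto simp: \<delta>_def intro!: divide_pos_pos add_nonneg_pos)
  then have "infinite (ball (0::complex) \<delta>)" using finite_imp_not_open[OF _ open_ball, of "0::complex" \<delta>] by auto
  ultimately obtain \<mu> where \<mu>: "\<mu> \<in> ball 0 \<delta>" "poly q \<mu> \<noteq> 0"
    by (metis (mono_tags, lifting) finite_subset mem_Collect_eq subsetI)
  have "dist x (x + \<mu> *s (x1 - x)) = norm (\<mu> *s (x1 - x))" by (simp add: dist_norm del: vector_ssub_ldistrib)
  also have "\<dots> = cmod \<mu> * norm (x1 - x)" by (rule norm_vector_scalar_mult_complex)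
  also have "\<dots> \<le> cmod \<mu> * (norm (x1 - x) + 1)" by (intro mult_left_mono) auto
  also have "\<dots> < \<delta> * (norm (x1 - x) + 1)" using \<mu> by (intro mult_strict_right_mono add_nonneg_pos) auto
  also have "\<dots> = e" unfolding \<delta>_def using add_nonneg_pos[OF norm_ge_zero[of "x1 - x"] zero_less_one] by simp
  finally show ?thesis using q \<mu> by metis
qed

lemma polyfun_mult_nonzero:
  assumes "polyfun d f" "f x \<noteq> 0" "polyfun e g" "g y \<noteq> 0"
  shows "\<exists>z. f z * g z \<noteq> 0"
proof -
  have "open (f -` (- {0}))"
    using polyfun_continuous[OF assms(1), of UNIV] by (intro open_vimage) auto
  then obtain r where r: "r > 0" "ball x r \<subseteq> f -` (- {0})" using assms(2) open_contains_ball by blast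
  obtain z where "dist x z < r" "g z \<noteq> 0" using polyfun_nonzero_dense[OF assms(3,4) r(1)] by blast
  then show ?thesis using r by (intro exI[of _ z]) auto
qed

lemma base_expansion_unique:
  fixes a b :: "nat \<Rightarrow> nat"
  assumes "\<And>i. i < m \<Longrightarrow> a i < B" "\<And>i. i < m \<Longrightarrow> b i < B" "(\<Sum>i<m. a i * B ^ i) = (\<Sum>i<m. b i * B ^ i)" "i < m"
  shows "a i = b i"
  using assms
proof (induction m arbitrary: a b i)
  case (Suc m)
  have s: "(\<Sum>i<Suc m. c i * B ^ i) = c 0 + B * (\<Sum>i<m. c (Suc i) * B ^ i)" for c :: "nat \<Rightarrow> nat"
    by (subst sum.lessThan_Suc_shift) (simp add: sum_distrib_left mult_ac)
  have lt: "a 0 < B" "b 0 < B" using Suc.prems by auto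
  have eq: "a 0 + B * (\<Sum>i<m. a (Suc i) * B ^ i) = b 0 + B * (\<Sum>i<m. b (Suc i) * B ^ i)"
    using Suc.prems(3) unfolding s .
  then have 0: "a 0 = b 0" using lt by (metis mod_less mod_mult_self2)
  then have "(\<Sum>i<m. a (Suc i) * B ^ i) = (\<Sum>i<m. b (Suc i) * B ^ i)" using eq lt by auto
  then have "a (Suc j) = b (Suc j)" if "j < m" for j
    using Suc.IH[of "\<lambda>i. a (Suc i)" "\<lambda>i. b (Suc i)" j] Suc.prems(1,2) that by auto
  then show ?case using 0 Suc.prems(4) by (cases i) auto
qed simp

text \<open>Kronecker substitution maps distinct monomials to distinct powers of one variable.\<close>

lemma peval_nonzero:
  fixes p :: "'k::finite cpoly"
  assumes "p \<noteq> 0"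
  shows "\<exists>z. peval p z \<noteq> 0"
proof -
  obtain idx :: "'k \<Rightarrow> nat" where idx: "bij_betw idx UNIV {..<CARD('k)}"
    using ex_bij_betw_finite_nat[OF finite_class.finite_UNIV] by (metis atLeast0LessThan)
  \<comment> \<open>The base exceeds every exponent that occurs, so exponent vectors are digit
    sequences and distinct monomials get distinct powers.\<close>
  define B where "B = Suc (\<Sum>\<alpha>\<in>Poly_Mapping.keys p. monomial_degree \<alpha>)"
  have lt: "Poly_Mapping.lookup \<alpha> i < B" if "\<alpha> \<in> Poly_Mapping.keys p" for \<alpha> i
  proof -
    have "Poly_Mapping.lookup \<alpha> i \<le> monomial_degree \<alpha>" unfolding monomial_degree_def by (rule member_le_sum) auto
    also have "\<dots> \<le> (\<Sum>\<alpha>\<in>Poly_Mapping.keys p. monomial_degree \<alpha>)" using that by (intro member_le_sum) auto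
    finally show ?thesis by (simp add: B_def)
  qed
  define N where "N \<alpha> = (\<Sum>i\<in>UNIV. Poly_Mapping.lookup \<alpha> i * B ^ idx i)" for \<alpha> :: "'k \<Rightarrow>\<^sub>0 nat"
  have N: "N \<alpha> = (\<Sum>j<CARD('k). Poly_Mapping.lookup \<alpha> (inv_into UNIV idx j) * B ^ j)" for \<alpha>
    unfolding N_def
    using sum.reindex_bij_betw[OF idx, of "\<lambda>j. Poly_Mapping.lookup \<alpha> (inv_into UNIV idx j) * B ^ j"] idx
    by (simp add: bij_betw_def)
  have inj: "\<alpha> = \<beta>" if "\<alpha> \<in> Poly_Mapping.keys p" "\<beta> \<in> Poly_Mapping.keys p" "N \<alpha> = N \<beta>" for \<alpha> \<beta>
  proof (rule poly_mapping_eqI)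
    fix i
    have i: "idx i < CARD('k)" using idx by (auto simp: bij_betw_def)
    have "Poly_Mapping.lookup \<alpha> (inv_into UNIV idx (idx i)) = Poly_Mapping.lookup \<beta> (inv_into UNIV idx (idx i))"
      by (rule base_expansion_unique[where m="CARD('k)" and B=B, OF lt[OF that(1)] lt[OF that(2)] _ i])
         (use that(3) N in simp)
    then show "Poly_Mapping.lookup \<alpha> i = Poly_Mapping.lookup \<beta> i"
      using idx by (auto simp: bij_betw_def)
  qed
  define q where "q = (\<Sum>\<alpha>\<in>Poly_Mapping.keys p. monom (Poly_Mapping.lookup p \<alpha>) (N \<alpha>))"
  obtain \<alpha> where \<alpha>: "\<alpha> \<in> Poly_Mapping.keys p" using assms by (metis keys_eq_empty ex_in_conv)
  have "coeff q (N \<alpha>) = (\<Sum>\<beta>\<in>Poly_Mapping.keys p. if \<beta> = \<alpha> then Poly_Mapping.lookup p \<beta> else 0)"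
    unfolding q_def coeff_sum using inj \<alpha> by (intro sum.cong) auto
  then have "coeff q (N \<alpha>) = Poly_Mapping.lookup p \<alpha>" using \<alpha> by simp
  then have "q \<noteq> 0" using \<alpha> by (auto simp: in_keys_iff)
  then obtain w where w: "poly q w \<noteq> 0" using poly_all_0_iff_0 by blast
  have "monomial_value \<alpha> (\<chi> i. w ^ (B ^ idx i)) = w ^ N \<alpha>" for \<alpha>
    by (simp add: monomial_value_def N_def power_sum mult.commute flip: power_mult)
  then have "peval p (\<chi> i. w ^ (B ^ idx i)) = poly q w"
    by (simp add: peval_superset[OF finite_keys order_refl] q_def poly_sum poly_monom)
  then show ?thesis using w by metis
qed

text \<open>After division by \<open>M\<close> the polynomial competes in the supremum that defines
  \<open>siciak\<close>, with its exact degree; \<open>R \<ge> 1\<close> then replaces that degree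
  by the bound \<open>d\<close>. Constants are treated separately because they do not take part in
  the supremum.\<close>

lemma bernstein_walsh:
  fixes K :: "(complex ^ 'm) set"
  assumes f: "polyfun d f" and M: "\<And>y. y \<in> K \<Longrightarrow> cmod (f y) \<le> M" "M > 0" and K: "K \<noteq> {}"
    and x: "siciak K x \<le> ereal R" and R: "R \<ge> 1"
  shows "cmod (f x) \<le> M * R ^ d"
proof -
  obtain p where p: "pdeg p \<le> d" "f = peval p" using f polyfun_def by blast
  define q where "q = Poly_Mapping.single 0 (complex_of_real (1 / M)) * p"
  have q: "peval q z = f z / M" for z
    by (simp add: q_def peval_mult peval_single p(2) monomial_value_def)
  have "pdeg q \<le> pdeg p"
  proof -
    have "monomial_degree \<alpha> \<le> pdeg p" if "\<alpha> \<in> Poly_Mapping.keys q" for \<alpha>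
    proof -
      have "\<alpha> \<in> Poly_Mapping.keys p"
        using that keys_mult[of "Poly_Mapping.single 0 (complex_of_real (1 / M))" p] M(2)
        by (auto simp: q_def simp del: of_real_divide)
      then show ?thesis using pdeg_le_iff[of p "pdeg p"] by blast
    qed
    then show ?thesis by (simp add: pdeg_le_iff)
  qed
  then have qd: "pdeg q \<le> d" using p by simp
  have qK: "\<forall>y\<in>K. cmod (peval q y) \<le> 1" using M by (auto simp: q norm_divide)
  have "cmod (peval q x) \<le> R ^ d"
  proof (cases "pdeg q = 0")
    case True
    have "\<alpha> = 0" if "\<alpha> \<in> Poly_Mapping.keys q" for \<alpha>
    proof -
      have "monomial_degree \<alpha> = 0" using True that pdeg_le_iff[of q 0] by auto
      then show ?thesis by (intro poly_mapping_eqI) (simp add: monomial_degree_def)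
    qed
    then have "Poly_Mapping.keys q \<subseteq> {0}" by blast
    then have c: "peval q z = Poly_Mapping.lookup q 0" for z
      by (simp add: peval_superset[of "{0}"] monomial_value_def)
    obtain y where "y \<in> K" using K by blast
    then have "cmod (peval q x) \<le> 1" using qK c by metis
    also have "1 \<le> R ^ d" using R by simp
    finally show ?thesis .
  next
    case False
    define n where "n = pdeg q"
    have n: "n > 0" using False by (simp add: n_def)
    have "ereal (cmod (peval q x) powr (1 / real n)) \<le> siciak K x"
      unfolding siciak_def n_def by (rule SUP_upper) (use False qK in auto)
    then have "cmod (peval q x) powr (1 / real n) \<le> R" using x by (metis ereal_less_eq(3) order_trans)
    then have "(cmod (peval q x) powr (1 / real n)) ^ n \<le> R ^ n" by (intro power_mono) auto
    moreover have "(cmod (peval q x) powr (1 / real n)) ^ n = cmod (peval q x)"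
    proof (cases "peval q x = 0")
      case False
      then show ?thesis using n by (simp add: powr_powr flip: powr_realpow)
    qed (use n in auto)
    ultimately have "cmod (peval q x) \<le> R ^ n" by simp
    also have "\<dots> \<le> R ^ d" using qd R by (simp add: n_def power_increasing)
    finally show ?thesis .
  qed
  then show ?thesis using M(2) by (simp add: q norm_divide field_simps)
qed

section \<open>Symmetric functions of the roots\<close>

definition root_poly :: "nat \<Rightarrow> (nat \<Rightarrow> complex) \<Rightarrow> complex poly" where
  "root_poly N t = (\<Prod>i<N. [:- t i, 1:])"

definition pow_sum :: "nat \<Rightarrow> (nat \<Rightarrow> complex) \<Rightarrow> nat \<Rightarrow> complex" where
  "pow_sum N t r = (\<Sum>i<N. t i ^ r)"

lemma poly_root_poly: "poly (root_poly N t) z = (\<Prod>i<N. z - t i)"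
  by (simp add: root_poly_def poly_prod)

lemma root_poly_nonzero: "root_poly N t \<noteq> 0"
  by (simp add: root_poly_def)

lemma degree_root_poly: "degree (root_poly N t) = N"
  by (simp add: root_poly_def degree_prod_eq_sum_degree)

lemma monic_root_poly: "coeff (root_poly N t) N = 1"
  using degree_root_poly[of N t] lead_coeff_prod[of "\<lambda>i. [:- t i, 1:]" "{..<N}"] by (simp add: root_poly_def)

lemma poly_root_poly_eq_0: "poly (root_poly N t) z = 0 \<longleftrightarrow> z \<in> t ` {..<N}"
  by (auto simp: poly_root_poly)

lemma poly_splits:
  fixes q :: "complex poly"
  assumes "degree q = N" "q \<noteq> 0"
  shows "\<exists>t. q = smult (lead_coeff q) (root_poly N t)"
  using assms
proof (induction N arbitrary: q)
  case 0
  then obtain c where "q = [:c:]" using degree_eq_zeroE by blast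
  then show ?case by (simp add: root_poly_def)
next
  case (Suc N)
  obtain z where "poly q z = 0" using alg_closed_imp_poly_has_root[of q] Suc.prems by auto
  then obtain q1 where q1: "q = [:- z, 1:] * q1" by (metis poly_eq_0_iff_dvd dvdE)
  then have "q1 \<noteq> 0" using Suc.prems by auto
  then have d: "degree q1 = N" "lead_coeff q = lead_coeff q1"
    using Suc.prems(1) q1 degree_mult_eq[of "[:- z, 1:]" q1] lead_coeff_mult[of "[:- z, 1:]" q1] by auto
  then obtain t where t: "q1 = smult (lead_coeff q1) (root_poly N t)" using Suc.IH \<open>q1 \<noteq> 0\<close> by blast
  have "root_poly (Suc N) (t(N := z)) = root_poly N t * [:- z, 1:]"
    unfolding root_poly_def by (simp add: prod.lessThan_Suc)
  then have "smult (lead_coeff q) (root_poly (Suc N) (t(N := z))) = [:- z, 1:] * smult (lead_coeff q1) (root_poly N t)"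
    unfolding d(2) by (simp only: mult_smult_right mult.commute)
  then show ?case using q1 t by metis
qed

text \<open>Synthetic division: each coefficient of the quotient is a Horner value of the higher
  coefficients of \<open>q\<close>.\<close>

lemma coeff_linear_cofactor:
  fixes c :: complex
  assumes q: "q = [:- c, 1:] * r" and N: "degree r < N"
  shows "coeff r j = (\<Sum>i<N - j. coeff q (Suc (j + i)) * c ^ i)"
proof -
  have *: "coeff q (Suc l) = coeff r l - c * coeff r (Suc l)" for l by (simp add: q)
  have "(\<Sum>i<M. coeff q (Suc (j + i)) * c ^ i) = coeff r j - c ^ M * coeff r (j + M)" for M
    by (induction M) (auto simp: * algebra_simps)
  moreover have "coeff r (j + (N - j)) = 0" using N by (intro coeff_eq_0) linarith
  ultimately show ?thesis by simp
qed

text \<open>For \<open>m > 0\<close> both sides describe a coefficient of the derivative, which is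
  the sum of the cofactors of the linear factors. The constant coefficient leaves no trace in the
  derivative; for \<open>m = 0\<close> the identity is the sum of the equations saying that each
  \<open>t k\<close> is a root.\<close>

lemma newton_identity:
  assumes "m \<le> N"
  shows "of_nat (N - m) * coeff (root_poly N t) m + (\<Sum>i\<in>{1..N - m}. coeff (root_poly N t) (m + i) * pow_sum N t i) = 0"
proof (cases m)
  case 0
  have "(\<Sum>i\<le>N. coeff (root_poly N t) i * pow_sum N t i) = (\<Sum>k<N. poly (root_poly N t) (t k))"
    unfolding poly_altdef degree_root_poly pow_sum_def sum_distrib_left by (rule sum.swap)
  also have "\<dots> = 0" by (intro sum.neutral) (auto simp: poly_root_poly_eq_0)
  finally have "coeff (root_poly N t) 0 * pow_sum N t 0 + (\<Sum>i\<in>{1..N}. coeff (root_poly N t) i * pow_sum N t i) = 0"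
    by (simp add: atMost_atLeast0 sum.atLeast_Suc_atMost)
  then show ?thesis by (simp add: 0 pow_sum_def mult.commute)
next
  case (Suc j)
  let ?q = "root_poly N t"
  have "pderiv ?q = (\<Sum>k<N. \<Prod>i\<in>{..<N} - {k}. [:- t i, 1:])"
    unfolding root_poly_def pderiv_prod by (simp add: pderiv_pCons)
  moreover have "coeff (\<Prod>i\<in>{..<N} - {k}. [:- t i, 1:]) j = (\<Sum>i<N - j. coeff ?q (Suc (j + i)) * t k ^ i)"
    if k: "k < N" for k
  proof (rule coeff_linear_cofactor)
    show "?q = [:- t k, 1:] * (\<Prod>i\<in>{..<N} - {k}. [:- t i, 1:])"
      unfolding root_poly_def using k by (subst prod.remove[of _ k]) auto
    show "degree (\<Prod>i\<in>{..<N} - {k}. [:- t i, 1:]) < N"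
      using k by (simp add: degree_prod_eq_sum_degree)
  qed
  ultimately have "coeff (pderiv ?q) j = (\<Sum>k<N. \<Sum>i<N - j. coeff ?q (Suc (j + i)) * t k ^ i)"
    by (simp add: coeff_sum)
  also have "\<dots> = (\<Sum>i<N - j. coeff ?q (Suc (j + i)) * pow_sum N t i)"
    unfolding pow_sum_def sum_distrib_left by (rule sum.swap)
  also have "\<dots> = (\<Sum>i\<in>{0..N - m}. coeff ?q (m + i) * pow_sum N t i)"
    by (rule sum.cong) (use Suc assms in auto)
  also have "\<dots> = coeff ?q m * of_nat N + (\<Sum>i\<in>{1..N - m}. coeff ?q (m + i) * pow_sum N t i)"
    by (simp add: sum.atLeast_Suc_atMost pow_sum_def)
  finally have "of_nat m * coeff ?q m = coeff ?q m * of_nat N + (\<Sum>i\<in>{1..N - m}. coeff ?q (m + i) * pow_sum N t i)"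
    by (simp add: coeff_pderiv Suc)
  then show ?thesis using assms by (simp add: of_nat_diff algebra_simps)
qed

lemma coeff_root_poly_by_pow_sum:
  assumes "j \<le> N" "j > 0"
  shows "coeff (root_poly N t) (N - j) = - (\<Sum>i\<in>{1..j}. coeff (root_poly N t) (N - (j - i)) * pow_sum N t i) / of_nat j"
proof -
  have "of_nat j * coeff (root_poly N t) (N - j) + (\<Sum>i\<in>{1..j}. coeff (root_poly N t) (N - j + i) * pow_sum N t i) = 0"
    using newton_identity[of "N - j" N t] assms by simp
  moreover have "(\<Sum>i\<in>{1..j}. coeff (root_poly N t) (N - j + i) * pow_sum N t i) = (\<Sum>i\<in>{1..j}. coeff (root_poly N t) (N - (j - i)) * pow_sum N t i)"
    using assms by (intro sum.cong) auto
  ultimately have "of_nat j * coeff (root_poly N t) (N - j) = - (\<Sum>i\<in>{1..j}. coeff (root_poly N t) (N - (j - i)) * pow_sum N t i)"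
    by (simp add: eq_neg_iff_add_eq_0)
  then show ?thesis using assms by (simp add: field_simps)
qed

text \<open>Newton's identities, solved for the coefficients. They are homogeneous if the
  coefficient of index \<open>N - j\<close> has weight \<open>j\<close> and the \<open>r\<close>-th
  power sum weight \<open>r\<close>, so the degree bound \<open>j * B\<close> reproduces
  itself.\<close>

lemma polyfun_coeff_root_poly:
  fixes t :: "complex ^ 'k::finite \<Rightarrow> nat \<Rightarrow> complex"
  assumes S: "\<And>r. r > 0 \<Longrightarrow> polyfun (r * B) (S r)"
    and ps: "\<And>r x. r > 0 \<Longrightarrow> x \<in> A \<Longrightarrow> pow_sum N (t x) r = S r x" and "j \<le> N"
  shows "\<exists>C. polyfun (j * B) C \<and> (\<forall>x\<in>A. coeff (root_poly N (t x)) (N - j) = C x)"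
  using assms(3)
proof (induction j rule: less_induct)
  case (less j)
  show ?case
  proof (cases "j = 0")
    case True
    then show ?thesis by (auto simp: monic_root_poly intro!: exI[of _ "\<lambda>_. 1"] polyfun_const)
  next
    case False
    have "\<forall>i\<in>{..<j}. \<exists>C. polyfun (i * B) C \<and> (\<forall>x\<in>A. coeff (root_poly N (t x)) (N - i) = C x)"
      using less.IH less.prems by auto
    from bchoice[OF this] obtain C where C: "\<And>i. i < j \<Longrightarrow> polyfun (i * B) (C i)"
      "\<And>i x. i < j \<Longrightarrow> x \<in> A \<Longrightarrow> coeff (root_poly N (t x)) (N - i) = C i x" by blast
    have "polyfun (j * B) (\<lambda>x. C (j - i) x * S i x)" if "i \<in> {1..j}" for i
    proof -
      have "polyfun ((j - i) * B + i * B) (\<lambda>x. C (j - i) x * S i x)"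
        using that by (intro polyfun_mult C(1) S) auto
      moreover have "(j - i) * B + i * B = j * B" using that by (simp flip: add_mult_distrib)
      ultimately show ?thesis by simp
    qed
    then have "polyfun (j * B) (\<lambda>x. (- 1 / of_nat j) * (\<Sum>i\<in>{1..j}. C (j - i) x * S i x))"
      by (intro polyfun_cmult polyfun_sum)
    moreover have "coeff (root_poly N (t x)) (N - j) = (- 1 / of_nat j) * (\<Sum>i\<in>{1..j}. C (j - i) x * S i x)" if "x \<in> A" for x
    proof -
      have "(\<Sum>i\<in>{1..j}. coeff (root_poly N (t x)) (N - (j - i)) * pow_sum N (t x) i) = (\<Sum>i\<in>{1..j}. C (j - i) x * S i x)"
      proof (rule sum.cong[OF refl])
        fix i assume "i \<in> {1..j}"
        then show "coeff (root_poly N (t x)) (N - (j - i)) * pow_sum N (t x) i = C (j - i) x * S i x"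
          using C(2)[of "j - i" x] ps[of i x] that by simp
      qed
      then show ?thesis using False less.prems by (simp add: coeff_root_poly_by_pow_sum)
    qed
    ultimately show ?thesis by blast
  qed
qed

text \<open>The recursion bounds the coefficients by powers of \<open>N * \<delta>\<close>. A root
  larger than twice this number would dominate all lower terms, because the sum of
  \<open>(1/2) ^ j\<close> over \<open>1 \<le> j \<le> N\<close> is less than 1. The bound needs
  only the power sums and no numbering of the roots depending on \<open>x\<close>.\<close>

lemma roots_small_of_pow_sum_small:
  assumes ps: "\<And>r. r > 0 \<Longrightarrow> cmod (pow_sum N t r) \<le> real N * \<delta> ^ r" and \<delta>: "\<delta> \<ge> 0" and i: "i < N"
  shows "cmod (t i) \<le> 2 * real N * \<delta>"
proof (rule ccontr)
  assume "\<not> ?thesis"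
  then have big: "2 * (real N * \<delta>) < cmod (t i)" by simp
  then have ti: "cmod (t i) > 0" using \<delta> by (smt (verit) of_nat_0_le_iff mult_nonneg_nonneg)
  have N: "real N \<ge> 1" using i by simp
  have co: "cmod (coeff (root_poly N t) (N - j)) \<le> (N * \<delta>) ^ j" if "j \<le> N" for j
    using that
  proof (induction j rule: less_induct)
    case (less j)
    show ?case
    proof (cases "j = 0")
      case True then show ?thesis by (simp add: monic_root_poly)
    next
      case False
      have "cmod (\<Sum>k\<in>{1..j}. coeff (root_poly N t) (N - (j - k)) * pow_sum N t k) \<le> (\<Sum>k\<in>{1..j}. (N * \<delta>) ^ j)"
      proof (rule sum_norm_le)
        fix k assume k: "k \<in> {1..j}"
        have "cmod (coeff (root_poly N t) (N - (j - k)) * pow_sum N t k) \<le> (N * \<delta>) ^ (j - k) * (N * \<delta> ^ k)"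
          unfolding norm_mult using k less.prems \<delta> by (intro mult_mono less.IH ps) auto
        also have "\<dots> \<le> (N * \<delta>) ^ (j - k) * (N * \<delta>) ^ k"
        proof (intro mult_left_mono)
          have "real N ^ 1 \<le> real N ^ k" using N k by (intro power_increasing) auto
          then show "N * \<delta> ^ k \<le> (N * \<delta>) ^ k" using \<delta> by (simp add: power_mult_distrib mult_right_mono)
        qed (use \<delta> in auto)
        also have "\<dots> = (N * \<delta>) ^ j" using k by (simp flip: power_add)
        finally show "cmod (coeff (root_poly N t) (N - (j - k)) * pow_sum N t k) \<le> (N * \<delta>) ^ j" .
      qed
      also have "\<dots> = real j * (N * \<delta>) ^ j" by simp
      finally show ?thesis using False less.prems
        by (simp add: coeff_root_poly_by_pow_sum norm_divide field_simps)
    qed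
  qed
  define z where "z = cmod (t i)"
  have "(\<Sum>j\<le>N. coeff (root_poly N t) (N - j) * t i ^ (N - j)) = (\<Sum>l\<le>N. coeff (root_poly N t) l * t i ^ l)"
    by (rule sum.reindex_bij_witness[of _ "\<lambda>l. N - l" "\<lambda>l. N - l"]) auto
  also have "\<dots> = poly (root_poly N t) (t i)" by (simp add: poly_altdef degree_root_poly)
  also have "\<dots> = 0" using i by (auto simp: poly_root_poly_eq_0)
  finally have "t i ^ N + (\<Sum>j\<in>{1..N}. coeff (root_poly N t) (N - j) * t i ^ (N - j)) = 0"
    by (simp add: atMost_atLeast0 sum.atLeast_Suc_atMost monic_root_poly)
  then have "z ^ N = cmod (\<Sum>j\<in>{1..N}. coeff (root_poly N t) (N - j) * t i ^ (N - j))"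
    unfolding z_def norm_power[symmetric] by (metis add_eq_0_iff norm_minus_cancel)
  also have "\<dots> \<le> (\<Sum>j\<in>{1..N}. z ^ N * (1/2) ^ j)"
  proof (rule sum_norm_le)
    fix j assume j: "j \<in> {1..N}"
    have "cmod (coeff (root_poly N t) (N - j) * t i ^ (N - j)) \<le> (N * \<delta>) ^ j * z ^ (N - j)"
      unfolding norm_mult norm_power z_def using co j by (intro mult_right_mono) auto
    also have "\<dots> \<le> (z * (1/2)) ^ j * z ^ (N - j)"
      using big \<delta> ti by (intro mult_right_mono power_mono) (auto simp: z_def)
    also have "\<dots> = (z ^ j * z ^ (N - j)) * (1/2) ^ j" by (simp only: power_mult_distrib mult_ac)
    also have "z ^ j * z ^ (N - j) = z ^ N" using j by (simp flip: power_add)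
    finally show "cmod (coeff (root_poly N t) (N - j) * t i ^ (N - j)) \<le> z ^ N * (1/2) ^ j" .
  qed
  also have "\<dots> = z ^ N * (\<Sum>j\<in>{1..N}. (1/2) ^ j)" by (simp add: sum_distrib_left)
  finally have "z ^ N * 1 \<le> z ^ N * (\<Sum>j\<in>{1..N}. (1/2) ^ j)" by simp
  then have "1 \<le> (\<Sum>j\<in>{1..N}. (1/2::real) ^ j)" using ti by (simp add: z_def)
  moreover have "(\<Sum>j\<in>{1..n}. (1/2::real) ^ j) = 1 - (1/2) ^ n" for n by (induction n) auto
  ultimately have "(1/2::real) ^ N \<le> 0" by simp
  moreover have "(1/2::real) ^ N > 0" by (rule zero_less_power) simp
  ultimately show False by linarith
qed

text \<open>The polynomial with coefficients \<open>c l x\<close> need not be monic, so its power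
  sums are rational functions. The \<open>r\<close>-th power of the leading coefficient clears the
  denominators and costs only degree \<open>r * D\<close>.\<close>

lemma polyfun_pow_sum_scaled:
  fixes t :: "complex ^ 'k::finite \<Rightarrow> nat \<Rightarrow> complex" and c :: "nat \<Rightarrow> complex ^ 'k \<Rightarrow> complex"
  assumes c: "\<And>l. polyfun D (c l)"
    and t: "\<And>x l. x \<in> A \<Longrightarrow> c l x = c N x * coeff (root_poly N (t x)) l"
  shows "\<exists>g. polyfun (r * D) g \<and> (\<forall>x\<in>A. c N x ^ r * pow_sum N (t x) r = g x)"
proof (induction r rule: less_induct)
  case (less r)
  show ?case
  proof (cases "r = 0")
    case True
    then show ?thesis by (intro exI[of _ "\<lambda>_. of_nat N"]) (auto simp: pow_sum_def polyfun_const)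
  next
    case False
    have "\<forall>s\<in>{..<r}. \<exists>g. polyfun (s * D) g \<and> (\<forall>x\<in>A. c N x ^ s * pow_sum N (t x) s = g x)"
      using less.IH by blast
    from bchoice[OF this] obtain g where g: "\<And>s. s < r \<Longrightarrow> polyfun (s * D) (g s)"
      "\<And>s x. s < r \<Longrightarrow> x \<in> A \<Longrightarrow> c N x ^ s * pow_sum N (t x) s = g s x" by blast
    define w where "w i = (if r - i \<le> N then if i = 0 then of_nat r else 1 else 0 :: complex)" for i
    define b where "b i x = (if r - i \<le> N then c (N - (r - i)) x else 0)" for i x
    \<comment> \<open>For \<open>r \<le> N\<close> this is Newton's identity; for \<open>r > N\<close> it is the sum of \<open>t\<^sub>k\<^sup>r\<^sup>-\<^sup>N p(t\<^sub>k)\<close>.\<close>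
    have key: "c N x * pow_sum N (t x) r = - (\<Sum>i<r. (if i = 0 \<and> r \<le> N then of_nat r * b 0 x else b i x * pow_sum N (t x) i))"
      if x: "x \<in> A" for x
    proof (cases "r \<le> N")
      case True
      have tl: "c N x * (a * coeff (root_poly N (t x)) l) = a * c l x" "c N x * (coeff (root_poly N (t x)) l * a) = c l x * a" for a l
        by (subst t[OF x, of l], simp add: mult_ac)+
      have "of_nat r * coeff (root_poly N (t x)) (N - r) + (\<Sum>i\<in>{1..r}. coeff (root_poly N (t x)) (N - r + i) * pow_sum N (t x) i) = 0"
        using newton_identity[of "N - r" N "t x"] True by simp
      then have "c N x * (of_nat r * coeff (root_poly N (t x)) (N - r) + (\<Sum>i\<in>{1..r}. coeff (root_poly N (t x)) (N - r + i) * pow_sum N (t x) i)) = 0"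
        by simp
      then have "of_nat r * c (N - r) x + (\<Sum>i\<in>{1..r}. c (N - r + i) x * pow_sum N (t x) i) = 0"
        by (simp only: distrib_left sum_distrib_left tl)
      also have "{1..r} = insert r {1..<r}" using False by auto
      also have "(\<Sum>i\<in>insert r {1..<r}. c (N - r + i) x * pow_sum N (t x) i) = c N x * pow_sum N (t x) r + (\<Sum>i\<in>{1..<r}. b i x * pow_sum N (t x) i)"
        using True by (simp add: b_def) (intro sum.cong, auto)
      finally have "c N x * pow_sum N (t x) r = - (of_nat r * b 0 x + (\<Sum>i\<in>{1..<r}. b i x * pow_sum N (t x) i))"
        using True by (simp add: b_def eq_neg_iff_add_eq_0 algebra_simps)
      also have "of_nat r * b 0 x + (\<Sum>i\<in>{1..<r}. b i x * pow_sum N (t x) i)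
          = (\<Sum>i<r. (if i = 0 \<and> r \<le> N then of_nat r * b 0 x else b i x * pow_sum N (t x) i))"
        using True False by (simp add: lessThan_atLeast0 sum.atLeast_Suc_lessThan)
      finally show ?thesis .
    next
      case r: False
      have tl: "t x k ^ (r - N) * (c N x * (coeff (root_poly N (t x)) l * t x k ^ l)) = c l x * t x k ^ (l + (r - N))" for k l
        by (subst t[OF x, of l]) (simp add: mult_ac power_add)
      have "(\<Sum>l\<le>N. c l x * pow_sum N (t x) (l + (r - N))) = (\<Sum>k<N. \<Sum>l\<le>N. c l x * t x k ^ (l + (r - N)))"
        unfolding pow_sum_def sum_distrib_left by (rule sum.swap)
      also have "\<dots> = (\<Sum>k<N. t x k ^ (r - N) * (c N x * poly (root_poly N (t x)) (t x k)))"
        unfolding poly_altdef degree_root_poly sum_distrib_left tl ..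
      also have "\<dots> = 0" by (intro sum.neutral) (auto simp: poly_root_poly_eq_0)
      finally have "(\<Sum>l<N. c l x * pow_sum N (t x) (l + (r - N))) + c N x * pow_sum N (t x) r = 0"
        using r by (simp add: lessThan_Suc_atMost[symmetric])
      moreover have "(\<Sum>l<N. c l x * pow_sum N (t x) (l + (r - N))) = (\<Sum>i\<in>{r - N..<r}. b i x * pow_sum N (t x) i)"
        by (rule sum.reindex_bij_witness[of _ "\<lambda>i. i - (r - N)" "\<lambda>l. l + (r - N)"]) (use r in \<open>auto simp: b_def\<close>)
      moreover have "(\<Sum>i\<in>{r - N..<r}. b i x * pow_sum N (t x) i) = (\<Sum>i<r. b i x * pow_sum N (t x) i)"
        by (rule sum.mono_neutral_left) (use r in \<open>auto simp: b_def\<close>)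
      moreover have "(\<Sum>i<r. (if i = 0 \<and> r \<le> N then of_nat r * b 0 x else b i x * pow_sum N (t x) i)) = (\<Sum>i<r. b i x * pow_sum N (t x) i)"
        using r by simp
      ultimately show ?thesis by (simp add: eq_neg_iff_add_eq_0 add.commute)
    qed
    \<comment> \<open>The recursion multiplied by \<open>c N x ^ (r - 1)\<close>: the power sum of
      index \<open>i\<close> uses up \<open>c N x ^ i\<close>, and the rest remains as a
      factor.\<close>
    define h where "h x = - (\<Sum>i<r. (if i = 0 \<and> r \<le> N then of_nat r * (b 0 x * c N x ^ (r - 1))
         else b i x * c N x ^ (r - 1 - i) * g i x))" for x
    have pb: "polyfun D (b i)" for i unfolding b_def by (cases "r - i \<le> N") (auto intro: c polyfun_const)
    have pc: "polyfun (n * D) (\<lambda>x. c N x ^ n)" for n by (rule polyfun_power[OF c])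
    have "polyfun (r * D) (\<lambda>x. (-1) * (\<Sum>i<r. (if i = 0 \<and> r \<le> N then of_nat r * (b 0 x * c N x ^ (r - 1))
         else b i x * c N x ^ (r - 1 - i) * g i x)))"
    proof (intro polyfun_cmult polyfun_sum)
      fix i assume i: "i \<in> {..<r}"
      have 1: "polyfun (D + (r - 1) * D) (\<lambda>x. b 0 x * c N x ^ (r - 1))" by (intro polyfun_mult pb pc)
      have 2: "polyfun (D + (r - 1 - i) * D + i * D) (\<lambda>x. b i x * c N x ^ (r - 1 - i) * g i x)"
        using i by (intro polyfun_mult pb pc g(1)) auto
      have "D + (r - 1) * D = r * D" "D + (r - 1 - i) * D + i * D = r * D"
        using i by (auto simp flip: add_mult_distrib mult_Suc)
      then show "polyfun (r * D) (\<lambda>x. if i = 0 \<and> r \<le> N then of_nat r * (b 0 x * c N x ^ (r - 1))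
         else b i x * c N x ^ (r - 1 - i) * g i x)"
        using 1 2 by (cases "i = 0 \<and> r \<le> N") (auto intro: polyfun_cmult)
    qed
    then have "polyfun (r * D) h" by (simp add: h_def[abs_def])
    moreover have "c N x ^ r * pow_sum N (t x) r = h x" if x: "x \<in> A" for x
    proof -
      have "c N x ^ r * pow_sum N (t x) r = c N x ^ (r - 1) * (c N x * pow_sum N (t x) r)"
        using False by (cases r) auto
      also have "\<dots> = - (\<Sum>i<r. c N x ^ (r - 1) * (if i = 0 \<and> r \<le> N then of_nat r * b 0 x else b i x * pow_sum N (t x) i))"
        unfolding key[OF x] by (simp add: sum_distrib_left)
      also have "\<dots> = h x"
        unfolding h_def
      proof (intro arg_cong[of _ _ uminus] sum.cong refl)
        fix i assume i: "i \<in> {..<r}"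
        have "c N x ^ (r - 1) = c N x ^ (r - 1 - i) * c N x ^ i" using i by (simp flip: power_add)
        then have "c N x ^ (r - 1) * (b i x * pow_sum N (t x) i) = b i x * c N x ^ (r - 1 - i) * g i x"
          using g(2)[of i x] i x by (simp add: mult_ac)
        then show "c N x ^ (r - 1) * (if i = 0 \<and> r \<le> N then of_nat r * b 0 x else b i x * pow_sum N (t x) i)
          = (if i = 0 \<and> r \<le> N then of_nat r * (b 0 x * c N x ^ (r - 1)) else b i x * c N x ^ (r - 1 - i) * g i x)"
          by (auto simp: mult_ac)
      qed
      finally show ?thesis .
    qed
    ultimately show ?thesis by blast
  qed
qed

section \<open>Symmetric sums over tuples of roots\<close>

inductive multi_poly :: "nat \<Rightarrow> nat \<Rightarrow> ((nat \<Rightarrow> complex) \<Rightarrow> complex) \<Rightarrow> bool" for k d where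
  mono: "(\<Sum>l<k. \<alpha> l) \<le> d \<Longrightarrow> multi_poly k d (\<lambda>z. c * (\<Prod>l<k. z l ^ \<alpha> l))"
| add: "multi_poly k d F \<Longrightarrow> multi_poly k d G \<Longrightarrow> multi_poly k d (\<lambda>z. F z + G z)"

lemma multi_poly_const: "multi_poly k d (\<lambda>_. c)"
  using multi_poly.mono[where k=k and \<alpha>="\<lambda>_. 0" and d=d and c=c] by simp

lemma multi_poly_coord: "i < k \<Longrightarrow> 1 \<le> d \<Longrightarrow> multi_poly k d (\<lambda>z. z i)"
proof -
  assume i: "i < k" "1 \<le> d"
  have "(\<Prod>l<k. z l ^ (if l = i then 1 else 0)) = z i" for z :: "nat \<Rightarrow> complex"
    using i by (simp add: if_distrib[of "\<lambda>n. z _ ^ n"] prod.delta cong: if_cong)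
  then show ?thesis using multi_poly.mono[where k=k and \<alpha>="\<lambda>l. if l = i then 1 else 0" and d=d and c=1] i by simp
qed

lemma multi_poly_mult_mono:
  assumes "multi_poly k e G" "(\<Sum>l<k. \<alpha> l) \<le> d"
  shows "multi_poly k (d + e) (\<lambda>z. c * (\<Prod>l<k. z l ^ \<alpha> l) * G z)"
  using assms(1)
proof induction
  case (mono \<beta> b)
  have "multi_poly k (d + e) (\<lambda>z. (c * b) * (\<Prod>l<k. z l ^ (\<alpha> l + \<beta> l)))"
    by (rule multi_poly.mono) (use assms(2) mono in \<open>simp add: sum.distrib\<close>)
  then show ?case by (simp add: power_add prod.distrib mult_ac)
next
  case (add F G)
  then show ?case using multi_poly.add[OF add.IH] by (simp add: distrib_left)
qed

lemma multi_poly_mult: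
  assumes "multi_poly k d F" "multi_poly k e G"
  shows "multi_poly k (d + e) (\<lambda>z. F z * G z)"
  using assms(1)
proof induction
  case (mono \<alpha> c) then show ?case using multi_poly_mult_mono[OF assms(2)] by simp
next
  case (add F1 F2)
  then show ?case using multi_poly.add[OF add.IH] by (simp add: distrib_right)
qed

lemma multi_poly_diff: "multi_poly k d F \<Longrightarrow> multi_poly k d G \<Longrightarrow> multi_poly k d (\<lambda>z. F z - G z)"
  using multi_poly.add[of k d F "\<lambda>z. (-1) * G z"] multi_poly_mult[OF multi_poly_const[of k 0 "-1"], of d G] by simp

lemma multi_poly_sum: "(\<And>i. i \<in> I \<Longrightarrow> multi_poly k d (F i)) \<Longrightarrow> multi_poly k d (\<lambda>z. \<Sum>i\<in>I. F i z)"
  by (induction I rule: infinite_finite_induct) (auto intro: multi_poly_const multi_poly.add)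

lemma multi_poly_prod: "(\<And>i. i \<in> I \<Longrightarrow> multi_poly k (d i) (F i)) \<Longrightarrow> multi_poly k (\<Sum>i\<in>I. d i) (\<lambda>z. \<Prod>i\<in>I. F i z)"
  by (induction I rule: infinite_finite_induct) (auto intro: multi_poly_const multi_poly_mult)

lemma multi_poly_power: "multi_poly k d F \<Longrightarrow> multi_poly k (n * d) (\<lambda>z. F z ^ n)"
  by (induction n) (auto intro: multi_poly_const multi_poly_mult)

definition tuple_sum :: "nat \<Rightarrow> nat \<Rightarrow> ((nat \<Rightarrow> complex) \<Rightarrow> complex) \<Rightarrow> (nat \<Rightarrow> complex) \<Rightarrow> complex" where
  "tuple_sum k N G t = (\<Sum>f\<in>PiE {..<k} (\<lambda>_. {..<N}). G (\<lambda>l. t (f l)))"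

text \<open>Each monomial contributes a product of power sums, each scaled by its own power of
  \<open>a\<close>. A monomial of degree \<open>s\<close> less than \<open>e\<close> receives the
  missing factor \<open>a x ^ (e - s)\<close>.\<close>

lemma polyfun_tuple_sum:
  fixes t :: "complex ^ 'k::finite \<Rightarrow> nat \<Rightarrow> complex"
  assumes G: "multi_poly k e G" and a: "polyfun D a"
    and ps: "\<And>r. \<exists>g. polyfun (r * D) g \<and> (\<forall>x\<in>A. a x ^ r * pow_sum N (t x) r = g x)"
  shows "\<exists>h. polyfun (e * D) h \<and> (\<forall>x\<in>A. a x ^ e * tuple_sum k N G (t x) = h x)"
  using G
proof induction
  case (mono \<alpha> c)
  have "\<forall>r. \<exists>g. polyfun (r * D) g \<and> (\<forall>x\<in>A. a x ^ r * pow_sum N (t x) r = g x)" using ps by blast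
  from choice[OF this] obtain g where g: "\<And>r. polyfun (r * D) (g r)"
    "\<And>r x. x \<in> A \<Longrightarrow> a x ^ r * pow_sum N (t x) r = g r x" by blast
  define s where "s = (\<Sum>l<k. \<alpha> l)"
  have s: "s \<le> e" using mono by (simp add: s_def)
  have "polyfun ((e - s) * D + (\<Sum>l<k. \<alpha> l * D)) (\<lambda>x. c * (a x ^ (e - s) * (\<Prod>l<k. g (\<alpha> l) x)))"
    by (intro polyfun_cmult polyfun_mult polyfun_prod polyfun_power a g(1))
  moreover have "(e - s) * D + (\<Sum>l<k. \<alpha> l * D) = e * D"
    using s by (simp add: s_def flip: sum_distrib_right add_mult_distrib)
  moreover have "a x ^ e * tuple_sum k N (\<lambda>z. c * (\<Prod>l<k. z l ^ \<alpha> l)) (t x) = c * (a x ^ (e - s) * (\<Prod>l<k. g (\<alpha> l) x))"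
    if x: "x \<in> A" for x
  proof -
    have "tuple_sum k N (\<lambda>z. c * (\<Prod>l<k. z l ^ \<alpha> l)) (t x) = c * (\<Prod>l<k. pow_sum N (t x) (\<alpha> l))"
      unfolding tuple_sum_def pow_sum_def by (subst prod_sum_PiE) (auto simp: sum_distrib_left)
    moreover have "a x ^ e = a x ^ (e - s) * (\<Prod>l<k. a x ^ \<alpha> l)"
      using s by (simp add: s_def flip: power_sum power_add)
    ultimately show ?thesis by (simp add: g(2)[OF x, symmetric] prod.distrib mult_ac)
  qed
  ultimately show ?case by auto
next
  case (add F G)
  obtain h1 h2 where "polyfun (e * D) h1" "\<forall>x\<in>A. a x ^ e * tuple_sum k N F (t x) = h1 x"
    "polyfun (e * D) h2" "\<forall>x\<in>A. a x ^ e * tuple_sum k N G (t x) = h2 x" using add.IH by blast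
  then show ?case
    by (intro exI[of _ "\<lambda>x. h1 x + h2 x"]) (auto simp: polyfun_add tuple_sum_def sum.distrib distrib_left)
qed

text \<open>Up to sign the square of the Vandermonde determinant. The product over ordered pairs is
  symmetric, so for distinct entries the value depends only on the set of entries.\<close>

definition vandermonde_sq :: "nat \<Rightarrow> (nat \<Rightarrow> complex) \<Rightarrow> complex" where
  "vandermonde_sq k z = (\<Prod>i<k. \<Prod>j\<in>{..<k} - {i}. z i - z j)"

lemma multi_poly_vandermonde_sq: "multi_poly k (k * (k - 1)) (vandermonde_sq k)"
proof -
  have "multi_poly k (\<Sum>i<k. \<Sum>j\<in>{..<k} - {i}. 1) (\<lambda>z. \<Prod>i<k. \<Prod>j\<in>{..<k} - {i}. z i - z j)"
    by (intro multi_poly_prod multi_poly_diff multi_poly_coord) auto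
  moreover have "(\<Sum>i<k. \<Sum>j\<in>{..<k} - {i}. 1::nat) = k * (k - 1)" by simp
  ultimately show ?thesis by (simp only: vandermonde_sq_def[abs_def])
qed

lemma vandermonde_sq_eq_0: "vandermonde_sq k z = 0 \<longleftrightarrow> \<not> inj_on z {..<k}"
  unfolding vandermonde_sq_def inj_on_def by (auto simp: prod_zero_iff)

lemma vandermonde_sq_set:
  assumes "inj_on z {..<k}"
  shows "vandermonde_sq k z = (\<Prod>u\<in>z ` {..<k}. \<Prod>v\<in>z ` {..<k} - {u}. u - v)"
proof -
  have "(\<Prod>j\<in>{..<k} - {i}. z i - z j) = (\<Prod>v\<in>z ` {..<k} - {z i}. z i - v)" if i: "i < k" for i
  proof -
    have "z ` {..<k} - {z i} = z ` ({..<k} - {i})" using assms i by (auto simp: inj_on_def)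
    then show ?thesis using assms by (simp add: prod.reindex inj_on_diff)
  qed
  then show ?thesis unfolding vandermonde_sq_def using assms by (simp add: prod.reindex)
qed

lemma tuple_sum_vandermonde_sq_small: "card (t ` {..<N}) < k \<Longrightarrow> tuple_sum k N (\<lambda>z. vandermonde_sq k z * G z) t = 0"
  unfolding tuple_sum_def
proof (rule sum.neutral, safe)
  fix f assume c: "card (t ` {..<N}) < k" and f: "f \<in> {..<k} \<rightarrow>\<^sub>E {..<N}"
  have "\<not> inj_on (\<lambda>l. t (f l)) {..<k}"
  proof
    assume "inj_on (\<lambda>l. t (f l)) {..<k}"
    then have "card {..<k} \<le> card (t ` {..<N})" by (rule card_inj_on_le) (use f in auto)
    then show False using c by simp
  qed
  then show "vandermonde_sq k (\<lambda>l. t (f l)) * G (\<lambda>l. t (f l)) = 0" using vandermonde_sq_eq_0 by simp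
qed

text \<open>The weight \<open>vandermonde_sq k\<close> kills all tuples with repetitions. If the
  list has exactly \<open>k\<close> distinct values, the surviving tuples enumerate the set of
  values, and \<open>G\<close> has the same value on all of them. A quotient of two tuple sums thus
  recovers a quantity that ignores multiplicities from data that count them.\<close>

lemma tuple_sum_vandermonde_sq_exact:
  assumes c: "card (t ` {..<N}) = k"
    and G: "\<And>z. inj_on z {..<k} \<Longrightarrow> z ` {..<k} = t ` {..<N} \<Longrightarrow> G z = v"
  shows "tuple_sum k N (\<lambda>z. vandermonde_sq k z * G z) t = tuple_sum k N (vandermonde_sq k) t * v" "tuple_sum k N (vandermonde_sq k) t \<noteq> 0"
proof -
  have eq: "inj_on (\<lambda>l. t (f l)) {..<k} \<Longrightarrow> (\<lambda>l. t (f l)) ` {..<k} = t ` {..<N}"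
    if "f \<in> {..<k} \<rightarrow>\<^sub>E {..<N}" for f
    by (rule card_subset_eq) (use that c in \<open>auto simp: card_image\<close>)
  have "vandermonde_sq k (\<lambda>l. t (f l)) * G (\<lambda>l. t (f l)) = vandermonde_sq k (\<lambda>l. t (f l)) * v" if "f \<in> {..<k} \<rightarrow>\<^sub>E {..<N}" for f
    using eq[OF that] G vandermonde_sq_eq_0 by (cases "inj_on (\<lambda>l. t (f l)) {..<k}") auto
  then show "tuple_sum k N (\<lambda>z. vandermonde_sq k z * G z) t = tuple_sum k N (vandermonde_sq k) t * v"
    unfolding tuple_sum_def sum_distrib_right by (intro sum.cong) auto
  define w where "w = (\<Prod>u\<in>t ` {..<N}. \<Prod>v\<in>t ` {..<N} - {u}. u - v)"
  have w: "w \<noteq> 0" by (auto simp: w_def)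
  define I where "I = {f \<in> {..<k} \<rightarrow>\<^sub>E {..<N}. inj_on (\<lambda>l. t (f l)) {..<k}}"
  have fin: "finite ({..<k} \<rightarrow>\<^sub>E {..<N})" by (simp add: finite_PiE)
  have "tuple_sum k N (vandermonde_sq k) t = (\<Sum>f\<in>I. w)"
    unfolding tuple_sum_def
  proof (rule sum.mono_neutral_cong_right[OF fin])
    show "vandermonde_sq k (\<lambda>l. t (f l)) = w" if "f \<in> I" for f
      using that eq[of f] vandermonde_sq_set[of "\<lambda>l. t (f l)" k] by (simp add: I_def w_def)
  qed (auto simp: I_def vandermonde_sq_eq_0)
  moreover have "I \<noteq> {}"
  proof -
    obtain h where h: "bij_betw h {..<k} (t ` {..<N})"
      using c ex_bij_betw_nat_finite[of "t ` {..<N}"] by (auto simp: atLeast0LessThan)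
    define f where "f = (\<lambda>l\<in>{..<k}. SOME i. i < N \<and> t i = h l)"
    have f: "f l < N \<and> t (f l) = h l" if "l < k" for l
    proof -
      have "h l \<in> t ` {..<N}" using h that by (auto simp: bij_betw_def)
      then have "\<exists>i. i < N \<and> t i = h l" by auto
      then show ?thesis using that by (simp add: f_def) (rule someI_ex)
    qed
    have "f \<in> {..<k} \<rightarrow>\<^sub>E {..<N}" using f by (auto simp: f_def PiE_def Pi_def extensional_def)
    moreover have "inj_on (\<lambda>l. t (f l)) {..<k}" using f h by (auto simp: bij_betw_def inj_on_def)
    ultimately show ?thesis by (auto simp: I_def)
  qed
  moreover have "finite I" using fin by (simp add: I_def)
  ultimately show "tuple_sum k N (vandermonde_sq k) t \<noteq> 0" using w by (simp add: card_eq_0_iff)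
qed

section \<open>Fibres of algebraic hypersurfaces\<close>

text \<open>At a root of \<open>R\<close> the estimate forces \<open>P\<close> to vanish, by
  continuity from outside the finite set \<open>F\<close>. One common linear factor is then
  cancelled, and the degree of \<open>R\<close> drops.\<close>

lemma poly_dvd_locally_bounded:
  fixes R P :: "complex poly"
  assumes "R \<noteq> 0" "finite F"
    "\<And>\<mu>0. \<exists>r>0. \<exists>M. \<forall>\<mu>\<in>ball \<mu>0 r - F. cmod (poly P \<mu>) \<le> M * cmod (poly R \<mu>)"
  shows "R dvd P"
  using assms
proof (induction "degree R" arbitrary: R P F)
  case 0
  then show ?case by (metis is_unit_iff_degree unit_imp_dvd)
next
  case (Suc n)
  obtain \<mu>0 where R0: "poly R \<mu>0 = 0"
    using alg_closed_imp_poly_has_root[of R] Suc.hyps(2) by auto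
  have P0: "poly P \<mu>0 = 0"
  proof (rule ccontr)
    assume P0: "poly P \<mu>0 \<noteq> 0"
    obtain r M where r: "r > 0" "\<And>\<mu>. \<mu> \<in> ball \<mu>0 r - F \<Longrightarrow> cmod (poly P \<mu>) \<le> M * cmod (poly R \<mu>)"
      using Suc.prems(3)[of \<mu>0] by blast
    have "((\<lambda>\<mu>. cmod (poly P \<mu>) - M * cmod (poly R \<mu>)) \<longlongrightarrow> cmod (poly P \<mu>0) - M * cmod (poly R \<mu>0)) (at \<mu>0)"
      by (intro tendsto_intros isContD) auto
    then have "eventually (\<lambda>\<mu>. cmod (poly P \<mu>) - M * cmod (poly R \<mu>) > 0) (at \<mu>0)"
      by (rule order_tendstoD(1)) (use P0 R0 in auto)
    moreover have "eventually (\<lambda>\<mu>. \<mu> \<in> ball \<mu>0 r - {\<mu>0}) (at \<mu>0)"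
      using r(1) eventually_at_in_open[of "ball \<mu>0 r" \<mu>0] by simp
    moreover have "eventually (\<lambda>\<mu>. \<mu> \<in> - (F - {\<mu>0}) - {\<mu>0}) (at \<mu>0)"
    proof (rule eventually_at_in_open)
      show "open (- (F - {\<mu>0}))" using Suc.prems(2) by (intro open_Compl finite_imp_closed finite_Diff)
    qed simp
    ultimately have "eventually (\<lambda>\<mu>. False) (at \<mu>0)"
      by eventually_elim (use r(2) in force)
    then show False by simp
  qed
  obtain R1 P1 where RP: "R = [:- \<mu>0, 1:] * R1" "P = [:- \<mu>0, 1:] * P1"
    using R0 P0 by (metis poly_eq_0_iff_dvd dvdE)
  have R1: "R1 \<noteq> 0" using Suc.prems(1) RP by auto
  then have "degree R = Suc (degree R1)" unfolding RP by (subst degree_mult_eq) auto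
  then have "n = degree R1" using Suc.hyps(2) by simp
  \<comment> \<open>Cancelling the factor is impossible at its own root, so this root joins the
    exceptional set. For this reason \<open>F\<close> is generalised in the induction.\<close>
  moreover have "\<exists>r>0. \<exists>M. \<forall>\<mu>\<in>ball \<nu> r - insert \<mu>0 F. cmod (poly P1 \<mu>) \<le> M * cmod (poly R1 \<mu>)" for \<nu>
  proof -
    obtain r M where r: "r > 0" "\<And>\<mu>. \<mu> \<in> ball \<nu> r - F \<Longrightarrow> cmod (poly P \<mu>) \<le> M * cmod (poly R \<mu>)"
      using Suc.prems(3)[of \<nu>] by blast
    have "cmod (poly P1 \<mu>) \<le> M * cmod (poly R1 \<mu>)" if \<mu>: "\<mu> \<in> ball \<nu> r - insert \<mu>0 F" for \<mu>
    proof -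
      have "cmod (\<mu> - \<mu>0) * cmod (poly P1 \<mu>) \<le> cmod (\<mu> - \<mu>0) * (M * cmod (poly R1 \<mu>))"
      proof -
        have "poly [:- \<mu>0, 1:] \<mu> = \<mu> - \<mu>0" by simp
        then show ?thesis
          using r(2)[of \<mu>] \<mu> unfolding RP by (simp only: poly_mult norm_mult) (simp add: mult_ac)
      qed
      moreover have "cmod (\<mu> - \<mu>0) > 0" using \<mu> by simp
      ultimately show ?thesis by (simp only: mult_le_cancel_left_pos)
    qed
    then show ?thesis using r(1) by blast
  qed
  ultimately have "R1 dvd P1" using R1 Suc.prems(2) by (intro Suc.hyps(1)[of R1 "insert \<mu>0 F"]) auto
  then show ?case unfolding RP by (rule mult_dvd_mono[OF dvd_refl])
qed

lemma polyfun_translate: "polyfun d f \<Longrightarrow> polyfun d (\<lambda>x. f (x - x0))"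
proof -
  assume "polyfun d f"
  then obtain g where g: "\<And>i. polyfun i (g i)" "\<And>v \<mu>. f (- x0 + \<mu> *s v) = (\<Sum>i\<le>d. g i v * \<mu> ^ i)"
    using polyfun_expand by metis
  have "polyfun d (\<lambda>v. \<Sum>i\<le>d. g i v)" by (intro polyfun_sum polyfun_mono[OF g(1)]) auto
  moreover have "f (v - x0) = (\<Sum>i\<le>d. g i v)" for v using g(2)[of 1 v] by simp
  ultimately show ?thesis by simp
qed

text \<open>A locally bounded quotient of polynomials is a polynomial: on lines through a fixed point this is
  division in one variable, and the coefficients are found by power series division.\<close>

lemma polyfun_quotient:
  fixes s :: "complex ^ 'k::finite \<Rightarrow> complex"
  assumes E: "polyfun e E" and H: "polyfun d H" and \<Gamma>: "polyfun c \<Gamma>" "\<Gamma> x0 \<noteq> 0"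
    and s: "\<And>x. \<Gamma> x \<noteq> 0 \<Longrightarrow> H x \<noteq> 0 \<and> s x * H x = E x"
    and bd: "\<And>x. \<exists>r>0. \<exists>M. \<forall>y\<in>ball x r. \<Gamma> y \<noteq> 0 \<longrightarrow> cmod (s y) \<le> M"
  shows "\<exists>S. polyfun e S \<and> (\<forall>x. \<Gamma> x \<noteq> 0 \<longrightarrow> s x = S x)"
proof -
  obtain Ec where Ec: "\<And>i. polyfun i (Ec i)" "\<And>i. i > e \<Longrightarrow> Ec i = (\<lambda>_. 0)" "\<And>v \<mu>. E (x0 + \<mu> *s v) = (\<Sum>i\<le>e. Ec i v * \<mu> ^ i)"
    using polyfun_expand[OF E, of x0] by blast
  obtain Hc where Hc: "\<And>i. polyfun i (Hc i)" "\<And>i. i > d \<Longrightarrow> Hc i = (\<lambda>_. 0)" "\<And>v \<mu>. H (x0 + \<mu> *s v) = (\<Sum>i\<le>d. Hc i v * \<mu> ^ i)"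
    using polyfun_expand[OF H, of x0] by blast
  define Ev Hv where "Ev v = (\<Sum>i\<le>e. monom (Ec i v) i)" and "Hv v = (\<Sum>i\<le>d. monom (Hc i v) i)" for v
  have cE: "coeff (Ev v) i = Ec i v" for v i
    using Ec(2)[of i] by (cases "i \<le> e") (auto simp: Ev_def coeff_sum)
  have cH: "coeff (Hv v) i = Hc i v" for v i
    using Hc(2)[of i] by (cases "i \<le> d") (auto simp: Hv_def coeff_sum)
  have pE: "poly (Ev v) \<mu> = E (x0 + \<mu> *s v)" for v \<mu> by (simp add: Ec Ev_def poly_sum poly_monom)
  have pH: "poly (Hv v) \<mu> = H (x0 + \<mu> *s v)" for v \<mu> by (simp add: Hc Hv_def poly_sum poly_monom)
  define h0 where "h0 = H x0"
  have h0: "h0 \<noteq> 0" using s[OF \<Gamma>(2)] by (simp add: h0_def)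
  have Hc0: "Hc 0 v = h0" for v using pH[of v 0] cH[of v 0] by (simp add: h0_def poly_0_coeff_0)
  have dvd: "Hv v dvd Ev v" for v
  proof -
    obtain q where q: "\<And>\<mu>. \<Gamma> (x0 + \<mu> *s v) = poly q \<mu>" using polyfun_line[OF \<Gamma>(1)] by blast
    have "poly q 0 \<noteq> 0" using q[of 0] \<Gamma>(2) by simp
    then have fin: "finite {\<mu>. poly q \<mu> = 0}" by (intro poly_roots_finite) auto
    show ?thesis
    proof (rule poly_dvd_locally_bounded[OF _ fin])
      show "Hv v \<noteq> 0" using cH[of v 0] Hc0 h0 by auto
      fix \<mu>0
      obtain r M where r: "r > 0" "\<And>y. y \<in> ball (x0 + \<mu>0 *s v) r \<Longrightarrow> \<Gamma> y \<noteq> 0 \<Longrightarrow> cmod (s y) \<le> M" using bd by blast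
      have "cmod (poly (Ev v) \<mu>) \<le> M * cmod (poly (Hv v) \<mu>)"
        if \<mu>: "\<mu> \<in> ball \<mu>0 (r / (norm v + 1)) - {\<mu>. poly q \<mu> = 0}" for \<mu>
      proof -
        have pos: "norm v + 1 > 0" by (simp add: add_nonneg_pos)
        have "dist (x0 + \<mu>0 *s v) (x0 + \<mu> *s v) = norm ((\<mu>0 - \<mu>) *s v)"
          by (simp add: dist_norm vector_sub_rdistrib)
        also have "\<dots> = cmod (\<mu>0 - \<mu>) * norm v" by (rule norm_vector_scalar_mult_complex)
        also have "\<dots> \<le> cmod (\<mu>0 - \<mu>) * (norm v + 1)" by (intro mult_left_mono) auto
        also have "\<dots> < r" using \<mu> pos by (simp add: dist_norm pos_less_divide_eq)
        finally have 1: "cmod (s (x0 + \<mu> *s v)) \<le> M" using r(2)[of "x0 + \<mu> *s v"] q \<mu> by auto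
        have "poly (Ev v) \<mu> = s (x0 + \<mu> *s v) * poly (Hv v) \<mu>" using s[of "x0 + \<mu> *s v"] q \<mu> by (simp add: pE pH)
        then show ?thesis using 1 by (simp add: norm_mult mult_right_mono)
      qed
      moreover have "r / (norm v + 1) > 0" using r(1) by (simp add: add_nonneg_pos)
      ultimately show "\<exists>r>0. \<exists>M. \<forall>\<mu>\<in>ball \<mu>0 r - {\<mu>. poly q \<mu> = 0}. cmod (poly (Ev v) \<mu>) \<le> M * cmod (poly (Hv v) \<mu>)"
        by blast
    qed
  qed
  define Q where "Q v = Ev v div Hv v" for v
  have Q: "Ev v = Hv v * Q v" for v using dvd[of v] by (simp add: Q_def)
  have dQ: "degree (Q v) \<le> e" for v
  proof (cases "Q v = 0")
    case False
    moreover have "Hv v \<noteq> 0" using cH[of v 0] Hc0 h0 by auto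
    ultimately have "degree (Q v) \<le> degree (Ev v)" unfolding Q by (simp add: degree_mult_eq)
    also have "\<dots> \<le> e" using Ec(2) cE by (intro degree_le) auto
    finally show ?thesis .
  qed auto
  \<comment> \<open>The constant term of \<open>Hv v\<close> is \<open>h0\<close> for every
    direction \<open>v\<close>. The recursion for the coefficients of the quotient therefore divides
    by a number only, and they stay polynomial in \<open>v\<close>.\<close>
  have "\<exists>C. polyfun i C \<and> (\<forall>v. coeff (Q v) i = C v)" for i
  proof (induction i rule: less_induct)
    case (less i)
    have "\<forall>k\<in>{..<i}. \<exists>C. polyfun k C \<and> (\<forall>v. coeff (Q v) k = C v)" using less.IH by blast
    from bchoice[OF this] obtain C where C: "\<And>k. k < i \<Longrightarrow> polyfun k (C k)" "\<And>k v. k < i \<Longrightarrow> coeff (Q v) k = C k v" by blast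
    have "Ec i v = h0 * coeff (Q v) i + (\<Sum>j\<in>{1..i}. Hc j v * C (i - j) v)" for v
    proof -
      have "Ec i v = (\<Sum>j\<le>i. Hc j v * coeff (Q v) (i - j))"
        using cE[of v i] by (simp add: Q coeff_mult cH)
      also have "\<dots> = Hc 0 v * coeff (Q v) i + (\<Sum>j\<in>{1..i}. Hc j v * coeff (Q v) (i - j))"
        by (simp add: atMost_atLeast0 sum.atLeast_Suc_atMost)
      also have "(\<Sum>j\<in>{1..i}. Hc j v * coeff (Q v) (i - j)) = (\<Sum>j\<in>{1..i}. Hc j v * C (i - j) v)"
        by (intro sum.cong) (auto simp: C(2))
      finally show ?thesis by (simp add: Hc0)
    qed
    then have "coeff (Q v) i = (1 / h0) * (Ec i v - (\<Sum>j\<in>{1..i}. Hc j v * C (i - j) v))" for v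
      using h0 by (simp add: field_simps)
    moreover have "polyfun i (\<lambda>v. Hc j v * C (i - j) v)" if "j \<in> {1..i}" for j
      using polyfun_mult[OF Hc(1)[of j] C(1)[of "i - j"]] that by simp
    then have "polyfun i (\<lambda>v. (1 / h0) * (Ec i v - (\<Sum>j\<in>{1..i}. Hc j v * C (i - j) v)))"
      by (intro polyfun_cmult polyfun_diff polyfun_sum Ec(1))
    ultimately show ?case by blast
  qed
  then have cp: "polyfun i (\<lambda>v. coeff (Q v) i)" for i by (metis ext)
  define S where "S x = (\<Sum>i\<le>e. coeff (Q (x - x0)) i)" for x
  have "polyfun e S" unfolding S_def
    by (intro polyfun_sum polyfun_translate[of _ "\<lambda>v. coeff (Q v) _"] polyfun_mono[OF cp]) auto
  moreover have "s x = S x" if x: "\<Gamma> x \<noteq> 0" for x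
  proof -
    have "S x = poly (Q (x - x0)) 1"
    proof -
      have "(\<Sum>i\<le>e. coeff (Q (x - x0)) i) = (\<Sum>i\<le>degree (Q (x - x0)). coeff (Q (x - x0)) i)"
        by (rule sum.mono_neutral_right) (use dQ[of "x - x0"] in \<open>auto simp: coeff_eq_0\<close>)
      then show ?thesis by (simp add: S_def poly_altdef)
    qed
    moreover have "E x = H x * poly (Q (x - x0)) 1"
      using arg_cong[OF Q[of "x - x0"], of "\<lambda>p. poly p 1"] by (simp add: pE pH)
    ultimately show ?thesis using s[OF x] by (metis mult.commute mult_left_cancel)
  qed
  ultimately show ?thesis by blast
qed

lemma join_nth: "join (x, t) $ None = t" "join (x, t) $ Some j = x $ j"
  by (simp_all add: join_def)

lemma inj_join: "join z = join w \<Longrightarrow> z = w"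
  by (cases z; cases w) (metis join_nth vec_eq_iff)

lemma join_in_image: "join z \<in> join ` V \<longleftrightarrow> z \<in> V"
  using inj_join by blast

lemma join_surj: "\<exists>x t. z = join (x, t)"
proof -
  have "z = join (\<chi> j. z $ Some j, z $ None)"
    by (simp add: vec_eq_iff join_def split: option.split)
  then show ?thesis by blast
qed

lemma polyfun_join:
  fixes f :: "complex ^ ('m::finite option) \<Rightarrow> complex"
  assumes "polyfun d f"
  shows "\<exists>c. (\<forall>i. polyfun d (c i)) \<and> (\<forall>i>d. c i = (\<lambda>_. 0)) \<and> (\<forall>x t. f (join (x, t)) = (\<Sum>i\<le>d. c i x * t ^ i))"
  using assms
proof (induction rule: polyfun_induct)
  case (mono d e f)
  then obtain c where c: "\<And>i. polyfun d (c i)" "\<And>i. i > d \<Longrightarrow> c i = (\<lambda>_. 0)"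
    "\<And>x t. f (join (x, t)) = (\<Sum>i\<le>d. c i x * t ^ i)" by blast
  have "(\<Sum>i\<le>d. c i x * t ^ i) = (\<Sum>i\<le>e. c i x * t ^ i)" for x t
    by (rule sum.mono_neutral_left) (use c(2) mono(2) in auto)
  then show ?case using c mono(2) polyfun_mono[OF c(1) mono(2)] by (intro exI[of _ c]) auto
next
  case (const k)
  show ?case by (rule exI[of _ "\<lambda>i x. if i = 0 then k else 0"]) (auto intro: polyfun_const)
next
  case (coord j)
  show ?case
  proof (cases j)
    case None
    have "polyfun 1 (\<lambda>x. if i = 1 then 1 else 0)" for i :: nat by (cases "i = 1") (auto intro: polyfun_const)
    then show ?thesis using None
      by (intro exI[of _ "\<lambda>i x. if i = 1 then 1 else 0"]) (auto simp: join_nth intro: polyfun_const)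
  next
    case (Some l)
    have "polyfun 1 (\<lambda>x. if i = 0 then x $ l else 0)" for i :: nat by (cases "i = 0") (auto intro: polyfun_const polyfun_coord)
    then show ?thesis using Some
      by (intro exI[of _ "\<lambda>i x. if i = 0 then x $ l else 0"]) (auto simp: join_nth)
  qed
next
  case (add d f1 f2)
  obtain c1 where c1: "\<And>i. polyfun d (c1 i)" "\<And>i. i > d \<Longrightarrow> c1 i = (\<lambda>_. 0)"
    "\<And>x t. f1 (join (x, t)) = (\<Sum>i\<le>d. c1 i x * t ^ i)" using add(1) by blast
  obtain c2 where c2: "\<And>i. polyfun d (c2 i)" "\<And>i. i > d \<Longrightarrow> c2 i = (\<lambda>_. 0)"
    "\<And>x t. f2 (join (x, t)) = (\<Sum>i\<le>d. c2 i x * t ^ i)" using add(2) by blast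
  show ?case
    using c1 c2 by (intro exI[of _ "\<lambda>i x. c1 i x + c2 i x"]) (auto simp: sum.distrib distrib_right intro: polyfun_add)
next
  case (mult d e f1 f2)
  obtain c1 where c1: "\<And>i. polyfun d (c1 i)" "\<And>i. i > d \<Longrightarrow> c1 i = (\<lambda>_. 0)"
    "\<And>x t. f1 (join (x, t)) = (\<Sum>i\<le>d. c1 i x * t ^ i)" using mult(1) by blast
  obtain c2 where c2: "\<And>i. polyfun e (c2 i)" "\<And>i. i > e \<Longrightarrow> c2 i = (\<lambda>_. 0)"
    "\<And>x t. f2 (join (x, t)) = (\<Sum>i\<le>e. c2 i x * t ^ i)" using mult(2) by blast
  define h where "h r x = (\<Sum>k\<le>r. c1 k x * c2 (r - k) x)" for r x
  have h0: "h r x = 0" if "r > d + e" for r x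
    unfolding h_def
  proof (rule sum.neutral, safe)
    fix k assume "k \<le> r"
    show "c1 k x * c2 (r - k) x = 0"
      using c1(2)[of k] c2(2)[of "r - k"] that by (cases "k > d") auto
  qed
  have "polyfun (d + e) (h r)" for r
    unfolding h_def[abs_def] by (intro polyfun_sum polyfun_mult c1 c2)
  moreover have "f1 (join (x, t)) * f2 (join (x, t)) = (\<Sum>r\<le>d + e. h r x * t ^ r)" for x t
    unfolding c1(3) c2(3) h_def by (rule polynomial_product) (use c1(2) c2(2) in auto)
  ultimately show ?case using h0 by (intro exI[of _ h]) auto
qed

lemma pow_sum_image:
  assumes "bij_betw u {..<k} F"
  shows "pow_sum k u r = (\<Sum>z\<in>F. z ^ r)"
  unfolding pow_sum_def by (rule sum.reindex_bij_betw[OF assms, of "\<lambda>z. z ^ r"])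

lemma nearby_root:
  assumes "\<delta> > 0" "cmod (poly (root_poly k u) z) < \<delta> ^ k"
  shows "\<exists>i<k. cmod (z - u i) < \<delta>"
proof (rule ccontr)
  assume "\<not> (\<exists>i<k. cmod (z - u i) < \<delta>)"
  then have "(\<Prod>i<k. \<delta>) \<le> (\<Prod>i<k. cmod (z - u i))" using assms(1) by (intro prod_mono) auto
  then show False using assms(2) by (simp add: poly_root_poly prod_norm flip: prod_norm)
qed

lemma proper_projection_bounded:
  fixes V :: "((complex ^ 'm::finite) \<times> complex) set"
  assumes "proper_projection V U" "compact C" "C \<subseteq> U"
  shows "\<exists>M. \<forall>(x,t)\<in>V. x \<in> C \<longrightarrow> cmod t \<le> M"
proof -
  have "compactin (top_of_set U) C" using assms(2,3) by (simp add: compactin_subtopology)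
  then have "compactin (top_of_set V) {z \<in> topspace (top_of_set V). fst z \<in> C}"
    using assms(1) compactin_proper_map_preimage unfolding proper_projection_def by blast
  then have "compact {z \<in> V. fst z \<in> C}" by (simp add: compactin_subtopology)
  then have "bounded (snd ` {z \<in> V. fst z \<in> C})"
    using compact_imp_bounded bounded_snd by blast
  then obtain M where "\<forall>t\<in>snd ` {z \<in> V. fst z \<in> C}. cmod t \<le> M" unfolding bounded_iff by blast
  then show ?thesis by (intro exI[of _ M]) force
qed

text \<open>The maximum principle for the reciprocal of a polynomial without zeros in the
  disc.\<close>

lemma poly_max_modulus_below:
  assumes "\<rho> > 0" "\<And>\<zeta>. \<zeta> \<in> cball z \<rho> \<Longrightarrow> poly p \<zeta> \<noteq> 0" "\<And>\<zeta>. \<zeta> \<in> sphere z \<rho> \<Longrightarrow> c \<le> cmod (poly p \<zeta>)" "c > 0"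
  shows "c \<le> cmod (poly p z)"
proof -
  have "(\<lambda>\<zeta>. inverse (poly p \<zeta>)) holomorphic_on cball z \<rho>"
    using assms(2) by (intro holomorphic_intros) auto
  then have h: "(\<lambda>\<zeta>. inverse (poly p \<zeta>)) holomorphic_on interior (cball z \<rho>)"
      "continuous_on (closure (cball z \<rho>)) (\<lambda>\<zeta>. inverse (poly p \<zeta>))"
    by (auto intro: holomorphic_on_subset holomorphic_on_imp_continuous_on)
  have "cmod (inverse (poly p z)) \<le> inverse c"
  proof (rule maximum_modulus_frontier[OF h])
    show "cmod (inverse (poly p \<zeta>)) \<le> inverse c" if "\<zeta> \<in> frontier (cball z \<rho>)" for \<zeta>
      using that assms(1,3,4) by (auto simp: norm_inverse intro!: le_imp_inverse_le)
  qed (use assms(1) in auto)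
  moreover have "poly p z \<noteq> 0" using assms(1,2) by simp
  ultimately have "inverse (cmod (poly p z)) \<le> inverse c" by (simp add: norm_inverse)
  then show ?thesis using \<open>poly p z \<noteq> 0\<close> assms(4) by (simp add: inverse_le_iff_le)
qed

text \<open>The family is described through properness and covering number, so an equation monic in
  \<open>t\<close> has to be recovered. For generic \<open>x\<close> the power sums of the distinct
  points of the fibre are quotients of tuple sums formed from the defining polynomial. Properness
  makes them locally bounded, hence polynomials, and Newton's identities turn them into the
  coefficients of a monic polynomial of degree \<open>k\<close>. Continuity transfers the equality
  of zero sets to all \<open>x\<close>.\<close>

lemma hyper_family_roots:
  fixes K :: "(complex ^ 'm) set"
  assumes "W \<in> hyper_family d n K"
  obtains k and t :: "complex ^ 'm \<Rightarrow> nat \<Rightarrow> complex" where "0 < k" "k \<le> n"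
    "\<And>r. polyfun (r * (n * (n\<^sup>2 + 1) * d)) (\<lambda>x. pow_sum k (t x) r)"
    "\<And>x. x \<in> K \<Longrightarrow> fibre W x = t x ` {..<k}"
proof -
  obtain V e k where V: "W = V \<inter> (K \<times> UNIV)" "hypersurface_degree (join ` V) e" "e \<le> d"
    "proper_projection V UNIV" "covering_number V k" "k \<le> n"
    using assms unfolding hyper_family_def by blast
  obtain p where p: "join ` V = {z. peval p z = 0}" "pdeg p = e"
    using V(2) unfolding hypersurface_degree_def by blast
  obtain q where q: "q \<noteq> 0" "\<And>x. peval q x \<noteq> 0 \<Longrightarrow> finite (fibre V x) \<and> card (fibre V x) = k"
    using V(5) unfolding covering_number_def by blast
  have "polyfun d (peval p)" using p(2) V(3) polyfun_def by blast
  then obtain c where c: "\<And>i. polyfun d (c i)" "\<And>i. i > d \<Longrightarrow> c i = (\<lambda>_. 0)"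
    "\<And>x t. peval p (join (x, t)) = (\<Sum>i\<le>d. c i x * t ^ i)" using polyfun_join by blast
  define P where "P x = (\<Sum>i\<le>d. monom (c i x) i)" for x
  have cP: "coeff (P x) i = c i x" for x i
    using c(2)[of i] by (cases "i \<le> d") (auto simp: P_def coeff_sum)
  have pP: "poly (P x) t = peval p (join (x, t))" for x t by (simp add: c(3) P_def poly_sum poly_monom)
  have fV: "fibre V x = {t. poly (P x) t = 0}" for x
    unfolding pP fibre_def using p(1) join_in_image[of "(x, _)" V] by auto
  have bdd: "\<exists>M. \<forall>x\<in>C. \<forall>t\<in>fibre V x. cmod t \<le> M" if cC: "compact C" for C
  proof -
    obtain M where "\<forall>(x,t)\<in>V. x \<in> C \<longrightarrow> cmod t \<le> M"
      using proper_projection_bounded[OF V(4) cC] by blast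
    then show ?thesis by (intro exI[of _ M]) (auto simp: fibre_def)
  qed
  \<comment> \<open>If \<open>P x\<close> were zero, the whole line over \<open>x\<close> would lie
    in \<open>V\<close>, against the boundedness of fibres of a proper projection.\<close>
  have P0: "P x \<noteq> 0" for x
  proof
    assume "P x = 0"
    then have "fibre V x = UNIV" by (simp add: fV)
    then obtain M where "\<forall>t::complex. cmod t \<le> M" using bdd[of "{x}"] by auto
    then have "cmod (of_real (M + 1)) \<le> M" by blast
    then show False by simp
  qed
  define N where "N = Max {i. c i \<noteq> (\<lambda>_. 0)}"
  have fin: "finite {i. c i \<noteq> (\<lambda>_. 0)}"
    by (rule finite_subset[of _ "{..d}"]) (use c(2) in \<open>auto simp: not_le[symmetric]\<close>)
  moreover have "{i. c i \<noteq> (\<lambda>_. 0)} \<noteq> {}"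
  proof
    assume "{i. c i \<noteq> (\<lambda>_. 0)} = {}"
    then have "P undefined = 0" by (intro poly_eqI) (auto simp: cP)
    then show False using P0 by blast
  qed
  ultimately have "N \<in> {i. c i \<noteq> (\<lambda>_. 0)}" unfolding N_def by (rule Max_in)
  then obtain x1 where x1: "c N x1 \<noteq> 0" by auto
  have cN: "c i x = 0" if "i > N" for i x
  proof (rule ccontr)
    assume "c i x \<noteq> 0"
    then have "i \<le> N" unfolding N_def by (intro Max_ge fin) auto
    then show False using that by simp
  qed
  have qf: "polyfun (pdeg q) (peval q)" unfolding polyfun_def by blast
  obtain x2 where x2: "peval q x2 \<noteq> 0" using peval_nonzero[OF q(1)] by blast
  \<comment> \<open>Where \<open>\<Gamma> x \<noteq> 0\<close>, \<open>P x\<close> has its full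
    degree \<open>N\<close> and the fibre has exactly \<open>k\<close> points. Here \<open>N\<close>
    counts roots with multiplicity and \<open>k\<close> counts points.\<close>
  define \<Gamma> where "\<Gamma> x = c N x * peval q x" for x
  have \<Gamma>: "polyfun (d + pdeg q) \<Gamma>" unfolding \<Gamma>_def by (intro polyfun_mult c(1) qf)
  obtain x0 where x0: "\<Gamma> x0 \<noteq> 0" using polyfun_mult_nonzero[OF c(1) x1 qf x2] by (auto simp: \<Gamma>_def)
  define A where "A = {x. \<Gamma> x \<noteq> 0}"
  have dense: "\<exists>y. dist x y < e \<and> y \<in> A" if "e > 0" for x e
    using polyfun_nonzero_dense[OF \<Gamma> x0 that] by (auto simp: A_def)
  have A: "c N x \<noteq> 0" "finite (fibre V x)" "card (fibre V x) = k" if "x \<in> A" for x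
    using that q(2) by (auto simp: A_def \<Gamma>_def)
  have "\<exists>\<tau>. x \<in> A \<longrightarrow> P x = smult (c N x) (root_poly N \<tau>)" for x
  proof (cases "x \<in> A")
    case True
    have "degree (P x) = N"
      using A(1)[OF True] by (intro antisym degree_le le_degree) (auto simp: cP cN)
    then show ?thesis using poly_splits[of "P x" N] P0 cP by auto
  qed auto
  then obtain \<tau> where \<tau>: "\<And>x. x \<in> A \<Longrightarrow> P x = smult (c N x) (root_poly N (\<tau> x))" by metis
  have f\<tau>: "fibre V x = \<tau> x ` {..<N}" if "x \<in> A" for x
  proof -
    have "poly (P x) z = 0 \<longleftrightarrow> z \<in> \<tau> x ` {..<N}" for z
      using A(1)[OF that] by (simp add: \<tau>[OF that] poly_root_poly_eq_0)
    then show ?thesis unfolding fV by auto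
  qed
  have ps: "\<exists>g. polyfun (r * d) g \<and> (\<forall>x\<in>A. c N x ^ r * pow_sum N (\<tau> x) r = g x)" for r
    by (rule polyfun_pow_sum_scaled[OF c(1)]) (metis \<tau> cP coeff_smult)
  \<comment> \<open>Each point of the fibre counts once, in contrast to the power sums of
    \<open>\<tau> x\<close>. The tuple sums weighted with \<open>vandermonde_sq k\<close> mediate
    between the two.\<close>
  define s where "s r x = (\<Sum>z\<in>fibre V x. z ^ r)" for r x
  have "\<exists>S. polyfun ((k * (k - 1) + r) * d) S \<and> (\<forall>x\<in>A. s r x = S x)" for r
  proof -
    obtain h0 where h0: "polyfun (k * (k - 1) * d) h0" "\<And>x. x \<in> A \<Longrightarrow> c N x ^ (k * (k - 1)) * tuple_sum k N (vandermonde_sq k) (\<tau> x) = h0 x"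
      using polyfun_tuple_sum[OF multi_poly_vandermonde_sq c(1) ps, of k] by blast
    have "multi_poly k (k * (k - 1) + r) (\<lambda>z. vandermonde_sq k z * (\<Sum>l<k. z l ^ r))"
    proof (intro multi_poly_mult multi_poly_vandermonde_sq multi_poly_sum)
      fix l assume "l \<in> {..<k}"
      then show "multi_poly k r (\<lambda>z. z l ^ r)" using multi_poly_power[of k 1 "\<lambda>z. z l" r] multi_poly_coord[of l k 1] by simp
    qed
    from polyfun_tuple_sum[OF this c(1) ps] obtain h where h: "polyfun ((k * (k - 1) + r) * d) h"
      "\<And>x. x \<in> A \<Longrightarrow> c N x ^ (k * (k - 1) + r) * tuple_sum k N (\<lambda>z. vandermonde_sq k z * (\<Sum>l<k. z l ^ r)) (\<tau> x) = h x" by blast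
    have ex: "tuple_sum k N (\<lambda>z. vandermonde_sq k z * (\<Sum>l<k. z l ^ r)) (\<tau> x) = tuple_sum k N (vandermonde_sq k) (\<tau> x) * s r x" "tuple_sum k N (vandermonde_sq k) (\<tau> x) \<noteq> 0"
      if x: "x \<in> A" for x
    proof -
      have card: "card (\<tau> x ` {..<N}) = k" using A(3)[OF x] f\<tau>[OF x] by simp
      have sv: "(\<Sum>l<k. z l ^ r) = s r x" if "inj_on z {..<k}" "z ` {..<k} = \<tau> x ` {..<N}" for z
        unfolding s_def f\<tau>[OF x] that(2)[symmetric] using that(1) by (simp add: sum.reindex)
      show "tuple_sum k N (\<lambda>z. vandermonde_sq k z * (\<Sum>l<k. z l ^ r)) (\<tau> x) = tuple_sum k N (vandermonde_sq k) (\<tau> x) * s r x"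
        by (rule tuple_sum_vandermonde_sq_exact(1)[OF card sv])
      show "tuple_sum k N (vandermonde_sq k) (\<tau> x) \<noteq> 0"
        by (rule tuple_sum_vandermonde_sq_exact(2)[OF card, of "\<lambda>z. \<Sum>l<k. z l ^ r" "s r x"]) (rule sv)
    qed
    have H: "polyfun (k * (k - 1) * d + r * d) (\<lambda>x. h0 x * c N x ^ r)"
      by (intro polyfun_mult h0(1) polyfun_power c(1))
    have "\<exists>S. polyfun ((k * (k - 1) + r) * d) S \<and> (\<forall>x. \<Gamma> x \<noteq> 0 \<longrightarrow> s r x = S x)"
    proof (rule polyfun_quotient[OF h(1) H \<Gamma> x0])
      fix x assume "\<Gamma> x \<noteq> 0"
      then have x: "x \<in> A" by (simp add: A_def)
      show "h0 x * c N x ^ r \<noteq> 0 \<and> s r x * (h0 x * c N x ^ r) = h x"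
        using A(1)[OF x] ex(2)[OF x]
        by (simp add: h0(2)[OF x, symmetric] h(2)[OF x, symmetric] ex(1)[OF x] power_add mult_ac)
    next
      fix x :: "complex ^ 'm"
      obtain M where M: "\<forall>y\<in>cball x 1. \<forall>t\<in>fibre V y. cmod t \<le> M" using bdd[OF compact_cball] by blast
      have "cmod (s r y) \<le> real k * (max M 0) ^ r" if y: "y \<in> ball x 1" "\<Gamma> y \<noteq> 0" for y
      proof -
        have "y \<in> A" using y by (simp add: A_def)
        have "cmod (s r y) \<le> (\<Sum>t\<in>fibre V y. (max M 0) ^ r)"
          unfolding s_def
        proof (rule sum_norm_le)
          fix t assume "t \<in> fibre V y"
          moreover have "y \<in> cball x 1" using y(1) by simp
          ultimately have "cmod t \<le> max M 0" using M by (meson max.coboundedI1)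
          then show "cmod (t ^ r) \<le> (max M 0) ^ r" unfolding norm_power by (intro power_mono) auto
        qed
        then show ?thesis using A(3)[OF \<open>y \<in> A\<close>] by simp
      qed
      then show "\<exists>r'>0. \<exists>M. \<forall>y\<in>ball x r'. \<Gamma> y \<noteq> 0 \<longrightarrow> cmod (s r y) \<le> M"
        by (metis zero_less_one)
    qed
    then show ?thesis by (auto simp: A_def)
  qed
  then have "\<forall>r. \<exists>S. polyfun ((k * (k - 1) + r) * d) S \<and> (\<forall>x\<in>A. s r x = S x)" ..
  from choice[OF this] obtain S where S: "\<And>r. polyfun ((k * (k - 1) + r) * d) (S r)" "\<And>r x. x \<in> A \<Longrightarrow> s r x = S r x"
    by blast
  \<comment> \<open>The surplus degree \<open>k * (k - 1) * d\<close> caused by the discriminant is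
    absorbed into \<open>n\<^sup>2\<close>, since \<open>k \<le> n\<close> and \<open>r > 0\<close>.
    The bound becomes proportional to \<open>r\<close>, as the recursion for the coefficients
    requires.\<close>
  define B where "B = (n\<^sup>2 + 1) * d"
  have SB: "polyfun (r * B) (S r)" if "r > 0" for r
  proof (rule polyfun_mono[OF S(1)])
    have "k * (k - 1) \<le> n\<^sup>2" unfolding power2_eq_square using V(6) by (intro mult_mono) auto
    also have "\<dots> \<le> r * n\<^sup>2" using that by simp
    finally have "k * (k - 1) + r \<le> r * (n\<^sup>2 + 1)" by (simp add: algebra_simps)
    then have "(k * (k - 1) + r) * d \<le> r * (n\<^sup>2 + 1) * d" by (rule mult_right_mono) simp
    then show "(k * (k - 1) + r) * d \<le> r * B" by (simp only: B_def mult.assoc)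
  qed
  have "\<exists>u. x \<in> A \<longrightarrow> bij_betw u {..<k} (fibre V x)" for x
    using A(2,3)[of x] ex_bij_betw_nat_finite[of "fibre V x"] by (auto simp: atLeast0LessThan)
  then obtain u where u: "\<And>x. x \<in> A \<Longrightarrow> bij_betw (u x) {..<k} (fibre V x)" by metis
  have "\<exists>C. polyfun (j * B) C \<and> (\<forall>x\<in>A. coeff (root_poly k (u x)) (k - j) = C x)" if "j \<le> k" for j
    by (rule polyfun_coeff_root_poly[OF SB _ that]) (simp_all add: pow_sum_image[OF u] flip: S(2) s_def)
  then have "\<forall>j\<in>{..k}. \<exists>C. polyfun (j * B) C \<and> (\<forall>x\<in>A. coeff (root_poly k (u x)) (k - j) = C x)" by simp
  from bchoice[OF this] obtain C where C: "\<And>j. j \<le> k \<Longrightarrow> polyfun (j * B) (C j)"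
    "\<And>j x. j \<le> k \<Longrightarrow> x \<in> A \<Longrightarrow> coeff (root_poly k (u x)) (k - j) = C j x" by blast
  define b where "b i x = (if i = k then 1 else if i < k then C (k - i) x else 0)" for i x
  have bp: "polyfun (k * B) (b i)" for i
  proof -
    consider "i = k" | "i < k" | "i > k" by linarith
    then show ?thesis
    proof cases
      case 2
      have "polyfun (k * B) (C (k - i))" by (rule polyfun_mono[OF C(1)]) auto
      then show ?thesis using 2 by (simp add: b_def[abs_def])
    qed (auto simp: b_def[abs_def] polyfun_const)
  qed
  define Q where "Q x = (\<Sum>i\<le>k. monom (b i x) i)" for x
  have cQ: "coeff (Q x) i = b i x" for x i by (auto simp: Q_def coeff_sum b_def)
  have QA: "Q x = root_poly k (u x)" if "x \<in> A" for x
  proof (rule poly_eqI)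
    fix i
    consider "i = k" | "i < k" | "i > k" by linarith
    then show "coeff (Q x) i = coeff (root_poly k (u x)) i"
    proof cases
      case 2 then show ?thesis using C(2)[of "k - i" x] that by (simp add: cQ b_def)
    qed (auto simp: cQ b_def monic_root_poly degree_root_poly coeff_eq_0)
  qed
  have dQ: "degree (Q x) = k" for x by (intro antisym degree_le le_degree) (auto simp: cQ b_def)
  have "\<exists>t. Q x = root_poly k t" for x
  proof -
    have "Q x \<noteq> 0" using cQ[of x k] by (auto simp: b_def)
    then obtain t where "Q x = smult (lead_coeff (Q x)) (root_poly k t)" using poly_splits[OF dQ] by blast
    moreover have "lead_coeff (Q x) = 1" by (simp add: dQ cQ b_def)
    ultimately have "Q x = root_poly k t" by simp
    then show ?thesis by blast
  qed
  then obtain t where t: "\<And>x. Q x = root_poly k (t x)" by metis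
  have contQ: "continuous_on UNIV (\<lambda>x. poly (Q x) z)" for z
  proof -
    have "poly (Q x) z = (\<Sum>i\<le>k. b i x * z ^ i)" for x by (simp add: poly_altdef dQ cQ)
    then show ?thesis by (auto intro!: continuous_intros polyfun_continuous[OF bp])
  qed
  have contP: "continuous_on UNIV (\<lambda>(x,z). poly (P x) z)"
  proof -
    have "poly (P x) z = (\<Sum>i\<le>d. c i x * z ^ i)" for x z by (simp add: P_def poly_sum poly_monom)
    then show ?thesis unfolding split_beta
      by (auto intro!: continuous_intros continuous_on_compose2[OF polyfun_continuous[OF c(1)], of UNIV])
  qed
  have contQ2: "continuous_on UNIV (\<lambda>(x,z). poly (Q x) z)"
  proof -
    have "poly (Q x) z = (\<Sum>i\<le>k. b i x * z ^ i)" for x z by (simp add: poly_altdef dQ cQ)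
    then show ?thesis unfolding split_beta
      by (auto intro!: continuous_intros continuous_on_compose2[OF polyfun_continuous[OF bp], of UNIV])
  qed
  have rootsA: "poly (Q x) z = 0 \<longleftrightarrow> poly (P x) z = 0" if "x \<in> A" for x z
  proof -
    have "poly (Q x) z = 0 \<longleftrightarrow> z \<in> u x ` {..<k}" unfolding QA[OF that] by (rule poly_root_poly_eq_0)
    also have "u x ` {..<k} = fibre V x" using u[OF that] by (simp add: bij_betw_def)
    finally show ?thesis by (simp add: fV)
  qed
  have sep: "\<exists>\<delta>>0. \<forall>x' z'. dist x x' < \<delta> \<longrightarrow> dist z z' \<le> \<delta> \<longrightarrow> R x' z' \<noteq> 0"
    if "continuous_on UNIV (\<lambda>(x,z). R x z)" "R x z \<noteq> 0" for R :: "complex ^ 'm \<Rightarrow> complex \<Rightarrow> complex" and x z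
  proof -
    have "open ((\<lambda>(x,z). R x z) -` (- {0}))" using that(1) by (intro open_vimage) auto
    moreover have "(x, z) \<in> (\<lambda>(x,z). R x z) -` (- {0})" using that(2) by simp
    ultimately obtain S T where ST: "open S" "open T" "x \<in> S" "z \<in> T" "S \<times> T \<subseteq> (\<lambda>(x,z). R x z) -` (- {0})"
      using open_prod_elim by (metis mem_Times_iff fst_conv snd_conv)
    obtain r1 where r1: "r1 > 0" "ball x r1 \<subseteq> S" using ST open_contains_ball by blast
    obtain r2 where r2: "r2 > 0" "cball z r2 \<subseteq> T" using ST open_contains_cball by blast
    show ?thesis
      by (rule exI[of _ "min r1 r2"]) (use r1 r2 ST(5) in \<open>force simp: subset_iff\<close>)
  qed
  \<comment> \<open>Over the dense set \<open>A\<close> the two polynomials have the same zeros. A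
    zero of the monic \<open>Q x\<close> persists near \<open>x\<close>, because a small value of a
    monic polynomial means a nearby root. For \<open>P x\<close>, whose leading coefficient may
    vanish, the minimum principle takes over that role.\<close>
  have roots: "poly (Q x) z = 0 \<longleftrightarrow> poly (P x) z = 0" for x z
  proof
    assume Qz: "poly (Q x) z = 0"
    show "poly (P x) z = 0"
    proof (rule ccontr)
      assume "poly (P x) z \<noteq> 0"
      then obtain \<delta> where \<delta>: "\<delta> > 0" "\<And>x' z'. dist x x' < \<delta> \<Longrightarrow> dist z z' \<le> \<delta> \<Longrightarrow> poly (P x') z' \<noteq> 0"
        using sep[OF contP, of x z] by blast
      have "continuous (at x) (\<lambda>x. cmod (poly (Q x) z))"
        using continuous_on_norm[OF contQ] by (simp add: continuous_on_eq_continuous_at)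
      then have "\<exists>\<eta>>0. \<forall>x'. dist x' x < \<eta> \<longrightarrow> dist (cmod (poly (Q x') z)) (cmod (poly (Q x) z)) < \<delta> ^ k"
        unfolding continuous_at_eps_delta using zero_less_power[OF \<delta>(1), of k] by blast
      then obtain \<eta> where \<eta>: "\<eta> > 0" "\<And>x'. dist x' x < \<eta> \<Longrightarrow> cmod (poly (Q x') z) < \<delta> ^ k"
        using Qz by (auto simp: dist_real_def)
      obtain x' where x': "dist x x' < min \<delta> \<eta>" "x' \<in> A" using dense[of "min \<delta> \<eta>" x] \<delta>(1) \<eta>(1) by auto
      then obtain i where i: "i < k" "cmod (z - u x' i) < \<delta>"
        using nearby_root[OF \<delta>(1), of k "u x'" z] \<eta>(2)[of x'] QA by (auto simp: dist_commute)
      have "poly (Q x') (u x' i) = 0" unfolding QA[OF x'(2)] poly_root_poly_eq_0 using i(1) by auto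
      then show False using \<delta>(2)[of x' "u x' i"] rootsA[OF x'(2)] x'(1) i(2) by (simp add: dist_norm)
    qed
  next
    assume Pz: "poly (P x) z = 0"
    show "poly (Q x) z = 0"
    proof (rule ccontr)
      assume "poly (Q x) z \<noteq> 0"
      then obtain \<delta> where \<delta>: "\<delta> > 0" "\<And>x' z'. dist x x' < \<delta> \<Longrightarrow> dist z z' \<le> \<delta> \<Longrightarrow> poly (Q x') z' \<noteq> 0"
        using sep[OF contQ2, of x z] by blast
      have fz: "finite {\<zeta>. poly (P x) \<zeta> = 0}" using P0 by (rule poly_roots_finite)
      \<comment> \<open>A radius for which the circle around \<open>z\<close> misses the finitely
        many zeros of \<open>P x\<close>; then the polynomials over nearby points are bounded below
        on that circle.\<close>
      have "infinite ({0<..<\<delta>} - (\<lambda>\<zeta>. dist z \<zeta>) ` {\<zeta>. poly (P x) \<zeta> = 0})"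
        using fz \<delta>(1) by (intro Diff_infinite_finite finite_imageI infinite_Ioo)
      then obtain \<rho> where \<rho>: "\<rho> \<in> {0<..<\<delta>} - (\<lambda>\<zeta>. dist z \<zeta>) ` {\<zeta>. poly (P x) \<zeta> = 0}"
        using infinite_imp_nonempty by blast
      have nz: "poly (P x) \<zeta> \<noteq> 0" if "\<zeta> \<in> sphere z \<rho>" for \<zeta> using \<rho> that by auto
      have "continuous_on (sphere z \<rho>) (\<lambda>\<zeta>. cmod (poly (P x) \<zeta>))" by (intro continuous_intros)
      moreover have "sphere z \<rho> \<noteq> {}" using \<rho> by (simp add: sphere_eq_empty)
      ultimately obtain \<zeta>0 where \<zeta>0: "\<zeta>0 \<in> sphere z \<rho>" "\<And>\<zeta>. \<zeta> \<in> sphere z \<rho> \<Longrightarrow> cmod (poly (P x) \<zeta>0) \<le> cmod (poly (P x) \<zeta>)"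
        using continuous_attains_inf[OF compact_sphere] by metis
      define m where "m = cmod (poly (P x) \<zeta>0) / 2"
      have m: "m > 0" "\<And>\<zeta>. \<zeta> \<in> sphere z \<rho> \<Longrightarrow> m < cmod (poly (P x) \<zeta>)"
      proof -
        have pos: "cmod (poly (P x) \<zeta>0) > 0" using nz[OF \<zeta>0(1)] by simp
        then show "m > 0" by (simp add: m_def)
        show "m < cmod (poly (P x) \<zeta>)" if "\<zeta> \<in> sphere z \<rho>" for \<zeta>
          using \<zeta>0(2)[OF that] pos unfolding m_def by linarith
      qed
      obtain T0 where T0: "open T0" "{x} \<subseteq> T0" "\<And>x' \<zeta>. x' \<in> T0 \<Longrightarrow> \<zeta> \<in> sphere z \<rho> \<Longrightarrow> poly (P x') \<zeta> \<in> {w. m < cmod w}"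
        by (rule open_neighbourhood_all_points[of "sphere z \<rho>" "{w. m < cmod w}" "\<lambda>x z. poly (P x) z" "{x}"])
           (use contP m(2) in \<open>auto intro!: open_Collect_less continuous_intros\<close>)
      obtain \<eta>1 where \<eta>1: "\<eta>1 > 0" "ball x \<eta>1 \<subseteq> T0" using T0 open_contains_ball by blast
      have "continuous_on UNIV (\<lambda>x'. poly (P x') z)"
      proof -
        have "continuous_on UNIV (\<lambda>x'::complex ^ 'm. (x', z))" by (intro continuous_intros)
        from continuous_on_compose2[OF contP this] show ?thesis by simp
      qed
      then have "continuous (at x) (\<lambda>x'. cmod (poly (P x') z))"
        using continuous_on_norm by (metis continuous_on_eq_continuous_at open_UNIV UNIV_I)
      then have "\<exists>\<eta>>0. \<forall>x'. dist x' x < \<eta> \<longrightarrow> dist (cmod (poly (P x') z)) (cmod (poly (P x) z)) < m"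
        unfolding continuous_at_eps_delta using m(1) by blast
      then obtain \<eta>2 where \<eta>2: "\<eta>2 > 0" "\<And>x'. dist x' x < \<eta>2 \<Longrightarrow> cmod (poly (P x') z) < m"
        using Pz by (auto simp: dist_real_def)
      obtain x' where x': "dist x x' < min \<delta> (min \<eta>1 \<eta>2)" "x' \<in> A"
        using dense[of "min \<delta> (min \<eta>1 \<eta>2)" x] \<delta>(1) \<eta>1(1) \<eta>2(1) by auto
      have "m \<le> cmod (poly (P x') z)"
      proof (rule poly_max_modulus_below[of \<rho>])
        show "poly (P x') \<zeta> \<noteq> 0" if "\<zeta> \<in> cball z \<rho>" for \<zeta>
          using \<delta>(2)[of x' \<zeta>] rootsA[OF x'(2), of \<zeta>] x'(1) that \<rho> by auto
        show "m \<le> cmod (poly (P x') \<zeta>)" if "\<zeta> \<in> sphere z \<rho>" for \<zeta>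
          using T0(3)[OF _ that, of x'] \<eta>1(2) x'(1) by (force intro: less_imp_le)
      qed (use \<rho> m in auto)
      then show False using \<eta>2(2)[of x'] x'(1) by (simp add: dist_commute)
    qed
  qed
  obtain xA where xA: "xA \<in> A" using dense[of 1] by auto
  have "xA \<in> fst ` V" using V(4) by (simp add: proper_projection_def)
  then have "fibre V xA \<noteq> {}" by (auto simp: fibre_def)
  then have k0: "0 < k" using A(2,3)[OF xA] by (metis card_gt_0_iff)
  show ?thesis
  proof (rule that[OF k0, of t])
    fix r
    \<comment> \<open>The leading coefficient is now 1 and the scaling disappears. Every coefficient
      has degree at most \<open>k * B\<close>, which explains the additional factor \<open>n\<close>
      in the final bound.\<close>
    have "\<exists>g. polyfun (r * (k * B)) g \<and> (\<forall>x\<in>UNIV. b k x ^ r * pow_sum k (t x) r = g x)"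
      by (rule polyfun_pow_sum_scaled[OF bp]) (simp add: b_def flip: t cQ, simp add: cQ b_def)
    then have "polyfun (r * (k * B)) (\<lambda>x. pow_sum k (t x) r)" by (auto simp: b_def)
    then show "polyfun (r * (n * (n\<^sup>2 + 1) * d)) (\<lambda>x. pow_sum k (t x) r)"
    proof (rule polyfun_mono)
      show "r * (k * B) \<le> r * (n * (n\<^sup>2 + 1) * d)"
        unfolding B_def mult.assoc using V(6) by (intro mult_le_mono) auto
    qed
  next
    fix x assume "x \<in> K"
    then have "fibre W x = fibre V x" by (auto simp: V(1) fibre_def)
    also have "\<dots> = {z. poly (root_poly k (t x)) z = 0}" unfolding fV t[symmetric] roots ..
    also have "\<dots> = t x ` {..<k}" by (auto simp: poly_root_poly_eq_0)
    finally show "fibre W x = t x ` {..<k}" .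
  qed fact
qed

section \<open>Limits of polynomials\<close>

text \<open>The variable of the polynomial has weight \<open>B\<close> and the total weight is at
  most \<open>N * B\<close>. In contrast to a uniform degree bound for the coefficients, this is
  preserved by products, with \<open>N\<close> additive.\<close>

definition weighted_poly :: "nat \<Rightarrow> nat \<Rightarrow> (complex ^ 'k::finite \<Rightarrow> complex poly) \<Rightarrow> bool" where
  "weighted_poly B N P \<longleftrightarrow> (\<forall>x. degree (P x) \<le> N) \<and> (\<forall>i\<le>N. polyfun ((N - i) * B) (\<lambda>x. coeff (P x) i))"

lemma weighted_poly_mult:
  assumes "weighted_poly B N P" "weighted_poly B M Q"
  shows "weighted_poly B (N + M) (\<lambda>x. P x * Q x)"
  unfolding weighted_poly_def
proof safe
  show "degree (P x * Q x) \<le> N + M" for x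
    using assms degree_mult_le[of "P x" "Q x"] unfolding weighted_poly_def by (meson add_mono order_trans)
  fix i assume i: "i \<le> N + M"
  have "polyfun ((N + M - i) * B) (\<lambda>x. coeff (P x) a * coeff (Q x) (i - a))" if a: "a \<le> i" for a
  proof (cases "a \<le> N \<and> i - a \<le> M")
    case True
    have "polyfun ((N - a) * B + (M - (i - a)) * B) (\<lambda>x. coeff (P x) a * coeff (Q x) (i - a))"
      using assms True unfolding weighted_poly_def by (intro polyfun_mult) auto
    moreover have "(N - a) + (M - (i - a)) = N + M - i" using True a by linarith
    ultimately show ?thesis by (metis add_mult_distrib)
  next
    case False
    have "coeff (P x) a * coeff (Q x) (i - a) = 0" for x
    proof -
      have "degree (P x) < a \<or> degree (Q x) < i - a"
        using assms False unfolding weighted_poly_def by (meson le_less_trans not_le)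
      then show ?thesis using coeff_eq_0 by force
    qed
    then have "(\<lambda>x. coeff (P x) a * coeff (Q x) (i - a)) = (\<lambda>_. 0)" by blast
    then show ?thesis by (simp only: polyfun_const)
  qed
  then show "polyfun ((N + M - i) * B) (\<lambda>x. coeff (P x * Q x) i)"
    unfolding coeff_mult by (intro polyfun_sum) auto
qed

lemma weighted_poly_power: "weighted_poly B N P \<Longrightarrow> weighted_poly B (r * N) (\<lambda>x. P x ^ r)"
proof (induction r)
  case 0
  then show ?case by (auto simp: weighted_poly_def polyfun_const)
next
  case (Suc r)
  then show ?case using weighted_poly_mult[of B N P "r * N" "\<lambda>x. P x ^ r"] by simp
qed

lemma weighted_poly_root_poly:
  assumes "\<And>r. polyfun (r * B) (\<lambda>x. pow_sum n (t x) r)"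
  shows "weighted_poly B n (\<lambda>x. root_poly n (t x))"
  unfolding weighted_poly_def
proof safe
  fix i assume "i \<le> n"
  obtain C where "polyfun ((n - i) * B) C" "\<forall>x\<in>UNIV. coeff (root_poly n (t x)) (n - (n - i)) = C x"
    using polyfun_coeff_root_poly[of B "\<lambda>r x. pow_sum n (t x) r" UNIV n t "n - i"] assms by auto
  moreover from this have "C = (\<lambda>x. coeff (root_poly n (t x)) i)" using \<open>i \<le> n\<close> by (auto simp: fun_eq_iff)
  ultimately show "polyfun ((n - i) * B) (\<lambda>x. coeff (root_poly n (t x)) i)" by simp
qed (simp add: degree_root_poly)

lemma coeff_root_poly_bound:
  assumes "\<And>i. i < n \<Longrightarrow> cmod (t i) \<le> M" "M \<ge> 0"
  shows "cmod (coeff (root_poly n t) i) \<le> (1 + M) ^ n"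
  using assms(1)
proof (induction n arbitrary: i)
  case 0 then show ?case by (cases i) (auto simp: root_poly_def)
next
  case (Suc n)
  have root_poly: "root_poly (Suc n) t = [:- t n, 1:] * root_poly n t" by (simp add: root_poly_def prod.lessThan_Suc mult.commute)
  have IH: "cmod (coeff (root_poly n t) i) \<le> (1 + M) ^ n" for i using Suc by auto
  have tn: "cmod (t n) * cmod (coeff (root_poly n t) i) \<le> M * (1 + M) ^ n" for i
    using Suc.prems[of n] IH assms(2) by (intro mult_mono) auto
  show ?case
  proof (cases i)
    case 0
    have "cmod (coeff (root_poly (Suc n) t) i) = cmod (t n) * cmod (coeff (root_poly n t) 0)" by (simp add: root_poly 0 norm_mult)
    also have "\<dots> \<le> M * (1 + M) ^ n" by (rule tn)
    also have "\<dots> \<le> (1 + M) * (1 + M) ^ n" using assms(2) by (intro mult_right_mono) auto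
    finally have "cmod (coeff (root_poly (Suc n) t) i) \<le> (1 + M) ^ Suc n" by simp
    then show ?thesis .
  next
    case (Suc j)
    have "cmod (coeff (root_poly (Suc n) t) i) = cmod (coeff (root_poly n t) j - t n * coeff (root_poly n t) (Suc j))" by (simp add: root_poly Suc)
    also have "\<dots> \<le> cmod (coeff (root_poly n t) j) + cmod (t n) * cmod (coeff (root_poly n t) (Suc j))"
      using norm_triangle_ineq4 by (metis norm_mult)
    also have "\<dots> \<le> (1 + M) ^ Suc n" using tn[of "Suc j"] IH[of j] by (simp add: algebra_simps)
    finally show ?thesis .
  qed
qed

lemma monic_root_bound:
  fixes z :: complex
  assumes "z ^ n + (\<Sum>i<n. c i * z ^ i) = 0" "\<And>i. i < n \<Longrightarrow> cmod (c i) \<le> b" "b \<ge> 0" "n > 0"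
  shows "cmod z \<le> 1 + n * b"
proof (cases "cmod z \<le> 1")
  case True then show ?thesis using assms by (smt (verit) mult_nonneg_nonneg of_nat_0_le_iff)
next
  case False
  have "cmod z ^ n = cmod (\<Sum>i<n. c i * z ^ i)" using assms(1) by (metis add_eq_0_iff norm_minus_cancel norm_power)
  also have "\<dots> \<le> (\<Sum>i<n. b * cmod z ^ (n - 1))"
    by (rule sum_norm_le) (use False assms in \<open>auto simp: norm_mult norm_power intro!: mult_mono power_increasing\<close>)
  also have "\<dots> = (n * b) * cmod z ^ (n - 1)" by simp
  finally have "cmod z * cmod z ^ (n - 1) \<le> (n * b) * cmod z ^ (n - 1)" using assms(4) by (cases n) auto
  moreover have "cmod z ^ (n - 1) > 0" using False by (intro zero_less_power) linarith
  ultimately have "cmod z \<le> n * b" by (rule mult_right_le_imp_le)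
  then show ?thesis by simp
qed

lemma root_poly_root_bound:
  assumes "\<And>i. i < n \<Longrightarrow> cmod (coeff (root_poly n t) i) \<le> b" "b \<ge> 0" "j < n"
  shows "cmod (t j) \<le> 1 + n * b"
proof (rule monic_root_bound[where c="coeff (root_poly n t)"])
  have "poly (root_poly n t) (t j) = 0" using assms(3) by (auto simp: poly_root_poly_eq_0)
  then show "t j ^ n + (\<Sum>i<n. coeff (root_poly n t) i * t j ^ i) = 0"
    by (simp add: poly_altdef degree_root_poly monic_root_poly add.commute flip: lessThan_Suc_atMost)
qed (use assms in auto)

text \<open>Cauchy's estimate on complex lines.\<close>

lemma polyfun_derivative_bound:
  assumes f: "polyfun d f" and D: "(f has_derivative D) (at x)" and lin: "\<And>c v. D (c *s v) = c * D v"
    and b: "\<And>y. y \<in> ball x r \<Longrightarrow> cmod (f y) \<le> C" and r: "r > 0"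
  shows "cmod (D v) \<le> C / r * norm v"
proof (cases "v = 0")
  case True
  then show ?thesis using has_derivative_bounded_linear[OF D] by (simp add: bounded_linear.linear linear_0)
next
  case False
  obtain q where q: "\<And>\<mu>. f (x + \<mu> *s v) = poly q \<mu>" using polyfun_line[OF f] by blast
  have C: "C \<ge> 0" using b[of x] r by (smt (verit) centre_in_ball norm_ge_zero)
  have diff_quot: "poly (pderiv q) 0 = D v"
  proof -
    have 1: "((\<lambda>\<mu>. x + \<mu> *s v) has_derivative (\<lambda>\<mu>. \<mu> *s v)) (at 0)"
    proof -
      have "bounded_linear (\<lambda>\<mu>::complex. \<mu> *s v)"
        by (rule bounded_linear_intro[of _ "norm v"])
           (auto simp: norm_vector_scalar_mult_complex vec_eq_iff algebra_simps)
      then show ?thesis by (auto intro!: derivative_eq_intros bounded_linear_imp_has_derivative)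
    qed
    have "(f has_derivative D) (at (x + 0 *s v))" using D by simp
    from has_derivative_compose[OF 1 this] have "((\<lambda>\<mu>. poly q \<mu>) has_derivative (\<lambda>\<mu>. D (\<mu> *s v))) (at 0)" by (simp add: q)
    moreover have "((\<lambda>\<mu>. poly q \<mu>) has_derivative (\<lambda>\<mu>. poly (pderiv q) 0 * \<mu>)) (at 0)"
      using poly_DERIV[of q 0] by (simp add: has_field_derivative_def)
    ultimately have "(\<lambda>\<mu>. D (\<mu> *s v)) = (\<lambda>\<mu>. poly (pderiv q) 0 * \<mu>)" by (rule has_derivative_unique)
    from fun_cong[OF this, of 1] show ?thesis by simp
  qed
  have "cmod (D v) \<le> C / \<rho>" if \<rho>: "0 < \<rho>" "\<rho> < r / norm v" for \<rho>
  proof -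
    have "cmod ((deriv ^^ 1) (poly q) 0) \<le> fact 1 * C / \<rho> ^ 1"
    proof (rule Cauchy_inequality)
      fix \<mu> :: complex assume "cmod (0 - \<mu>) = \<rho>"
      then have "norm (\<mu> *s v) < r" using \<rho> False
        by (simp add: norm_vector_scalar_mult_complex pos_less_divide_eq)
      then show "cmod (poly q \<mu>) \<le> C" unfolding q[symmetric] by (intro b) (simp add: dist_norm)
    qed (use \<rho> in \<open>auto intro!: holomorphic_intros continuous_intros\<close>)
    then show ?thesis using diff_quot DERIV_imp_deriv[OF poly_DERIV[of q 0]] by simp
  qed
  then have "eventually (\<lambda>\<rho>. cmod (D v) \<le> C / \<rho>) (at_left (r / norm v))"
    using eventually_at_left_real[of 0 "r / norm v"] r False by (auto elim!: eventually_mono)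
  moreover have "((\<lambda>\<rho>. C / \<rho>) \<longlongrightarrow> C / (r / norm v)) (at_left (r / norm v))"
    using r False by (intro tendsto_intros) auto
  ultimately have "cmod (D v) \<le> C / (r / norm v)"
    by (intro tendsto_lowerbound[of "\<lambda>\<rho>. C / \<rho>"]) auto
  then show ?thesis by simp
qed

section \<open>Normal families of polynomials and their limits\<close>

lemma polyfun_lipschitz:
  assumes f: "polyfun d f" and b: "\<And>y. y \<in> ball x (2 * r) \<Longrightarrow> cmod (f y) \<le> C" and r: "r > 0"
    and yz: "y \<in> ball x r" "z \<in> ball x r"
  shows "cmod (f y - f z) \<le> C / r * norm (y - z)"
proof -
  obtain D where D: "\<And>w. (f has_derivative D w) (at w)" "\<And>w c v. D w (c *s v) = c * D w v"
    using polyfun_holomorphic[OF f] by metis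
  show ?thesis
  proof (rule differentiable_bound[OF convex_ball])
    show "(f has_derivative D w) (at w within ball x r)" for w using D(1) has_derivative_at_withinI by blast
    show "onorm (D w) \<le> C / r" if w: "w \<in> ball x r" for w
    proof (rule onorm_le)
      fix v
      have "cmod (f y) \<le> C" if "y \<in> ball w r" for y
        using that w dist_triangle[of x y w] by (intro b) auto
      then show "norm (D w v) \<le> C / r * norm v"
        using polyfun_derivative_bound[OF f D(1) D(2) _ r] by blast
    qed
  qed (use yz in auto)
qed

text \<open>Cauchy's estimate makes a locally bounded family of polynomials equicontinuous, whatever
  the degrees are, and Arzela--Ascoli applies.\<close>

lemma polyfun_montel:
  fixes f :: "nat \<Rightarrow> complex ^ 'k \<Rightarrow> complex"
  assumes f: "\<And>i. \<exists>d. polyfun d (f i)" and U: "open U" "\<And>i x. x \<in> U \<Longrightarrow> cmod (f i x) \<le> C"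
    and S: "compact S" "S \<subseteq> U"
  shows "\<exists>g k. strict_mono k \<and> uniform_limit S (\<lambda>i. f (k i)) g sequentially"
proof -
  obtain g k where gk: "strict_mono (k :: nat \<Rightarrow> nat)"
    "\<And>e. 0 < e \<Longrightarrow> \<exists>N. \<forall>n x. n \<ge> N \<and> x \<in> S \<longrightarrow> norm (f (k n) x - g x) < e"
  proof (rule Arzela_Ascoli[OF S(1), of f C])
    show "cmod (f n x) \<le> C" if "x \<in> S" for n x using U(2) S(2) that by auto
    fix x :: "complex ^ 'k" and e :: real assume x: "x \<in> S" and e: "e > 0"
    obtain r0 where r0: "r0 > 0" "ball x r0 \<subseteq> U" using U(1) S(2) x open_contains_ball by blast
    define r where "r = r0 / 2"
    have r: "r > 0" "ball x (2 * r) \<subseteq> U" using r0 by (auto simp: r_def)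
    have C: "C \<ge> 0" using U(2)[of x 0] S(2) x by (smt (verit) norm_ge_zero subsetD)
    \<comment> \<open>The Lipschitz constant on the ball of radius \<open>r\<close> is
      \<open>C / r\<close>; the \<open>+ 1\<close> covers \<open>C = 0\<close>.\<close>
    define \<delta> where "\<delta> = min r (e * r / (C + 1))"
    have \<delta>: "\<delta> > 0" using r e C by (simp add: \<delta>_def)
    have "cmod (f n x - f n y) < e" if y: "norm (x - y) < \<delta>" for n y
    proof -
      obtain d where d: "polyfun d (f n)" using f by blast
      have "cmod (f n x - f n y) \<le> C / r * norm (x - y)"
        by (rule polyfun_lipschitz[OF d _ r(1)]) (use r U(2) y in \<open>auto simp: \<delta>_def dist_norm\<close>)
      also have "\<dots> \<le> (C + 1) / r * norm (x - y)" using r by (intro mult_right_mono divide_right_mono) auto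
      also have "\<dots> < (C + 1) / r * (e * r / (C + 1))"
        using y C r by (intro mult_strict_left_mono) (auto simp: \<delta>_def)
      also have "\<dots> = e" using C r by simp
      finally show ?thesis .
    qed
    then show "\<exists>d>0. \<forall>n y. y \<in> S \<and> norm (x - y) < d \<longrightarrow> cmod (f n x - f n y) < e" using \<delta> by blast
  qed blast
  have "uniform_limit S (\<lambda>i. f (k i)) g sequentially"
    unfolding uniform_limit_sequentially_iff dist_norm using gk(2) by meson
  then show ?thesis using gk(1) by blast
qed

lemma polyfun_montel_finite:
  fixes f :: "'j \<Rightarrow> nat \<Rightarrow> complex ^ 'k \<Rightarrow> complex"
  assumes "finite J" "\<And>j i. j \<in> J \<Longrightarrow> \<exists>d. polyfun d (f j i)" "open U" "\<And>j i x. j \<in> J \<Longrightarrow> x \<in> U \<Longrightarrow> cmod (f j i x) \<le> C"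
    and S: "compact S" "S \<subseteq> U"
  shows "\<exists>k g. strict_mono k \<and> (\<forall>j\<in>J. uniform_limit S (\<lambda>i. f j (k i)) (g j) sequentially)"
  using assms(1,2,4)
proof (induction J)
  case empty
  then show ?case using strict_mono_id by blast
next
  case (insert a J)
  then obtain k g where k: "strict_mono k" "\<forall>j\<in>J. uniform_limit S (\<lambda>i. f j (k i)) (g j) sequentially" by auto
  obtain h k' where k': "strict_mono k'" "uniform_limit S (\<lambda>i. f a (k (k' i))) h sequentially"
    using polyfun_montel[of "\<lambda>i. f a (k i)" U C S] insert.prems assms(3) S by auto
  have "uniform_limit S (\<lambda>i. f j (k (k' i))) (g j) sequentially" if "j \<in> J" for j
    using filterlim_compose[OF _ filterlim_subseq[OF k'(1)], of "\<lambda>i. f j (k i)"] k(2) that by blast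
  then show ?case
    using k' strict_mono_o[OF k(1) k'(1)] insert.hyps(2)
    by (intro exI[of _ "k \<circ> k'"] exI[of _ "g(a := h)"]) (auto simp: o_def)
qed

text \<open>Weierstrass' theorem: Cauchy's estimate applied to differences turns uniform convergence
  of values into uniform convergence of derivatives, and complex homogeneity of the derivative
  passes to the limit.\<close>

lemma uniform_limit_polyfun_cholomorphic:
  fixes f :: "nat \<Rightarrow> complex ^ 'k \<Rightarrow> complex"
  assumes f: "\<And>i. \<exists>d. polyfun d (f i)" and lim: "uniform_limit S f g sequentially" and U: "open U" "U \<subseteq> S"
  shows "cholomorphic g U"
  unfolding cholomorphic_def
proof (intro conjI ballI U(1))
  fix z assume z: "z \<in> U"
  obtain r0 where r0: "r0 > 0" "ball z r0 \<subseteq> U" using U(1) z open_contains_ball by blast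
  define r where "r = r0 / 2"
  have r: "r > 0" "ball z (2 * r) \<subseteq> S" using r0 U(2) by (auto simp: r_def)
  have "\<forall>i. \<exists>D. \<forall>w. (f i has_derivative D w) (at w) \<and> (\<forall>c v. D w (c *s v) = c * D w v)"
    using polyfun_holomorphic f by metis
  from choice[OF this] obtain D where D: "\<And>i w. (f i has_derivative D i w) (at w)" "\<And>i w c v. D i w (c *s v) = c * D i w v"
    by blast
  \<comment> \<open>Points of a ball of radius \<open>r\<close> around \<open>w\<close> stay in
    \<open>ball z (2 * r)\<close>, where the values are already uniformly close.\<close>
  have cau: "\<exists>N. \<forall>m\<ge>N. \<forall>n\<ge>N. \<forall>w\<in>ball z r. \<forall>v. cmod (D m w v - D n w v) \<le> e * norm v" if e: "e > 0" for e
  proof -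
    have "e * r / 2 > 0" using e r by simp
    then obtain N where N: "\<And>n x. n \<ge> N \<Longrightarrow> x \<in> S \<Longrightarrow> dist (f n x) (g x) < e * r / 2"
      using lim unfolding uniform_limit_sequentially_iff by meson
    have "cmod (D m w v - D n w v) \<le> e * norm v" if mn: "m \<ge> N" "n \<ge> N" and w: "w \<in> ball z r" for m n w v
    proof -
      obtain d1 d2 where "polyfun d1 (f m)" "polyfun d2 (f n)" using f by blast
      then have p: "polyfun (max d1 d2) (\<lambda>x. f m x - f n x)"
        by (intro polyfun_diff) (auto intro: polyfun_mono)
      have "cmod (D m w v - D n w v) \<le> (e * r) / r * norm v"
      proof (rule polyfun_derivative_bound[OF p _ _ _ r(1)])
        show "((\<lambda>x. f m x - f n x) has_derivative (\<lambda>v. D m w v - D n w v)) (at w)"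
          by (intro has_derivative_diff D)
        show "D m w (c *s v) - D n w (c *s v) = c * (D m w v - D n w v)" for c v
          by (simp add: D(2) algebra_simps)
        fix y assume "y \<in> ball w r"
        then have "y \<in> S" using w r(2) dist_triangle[of z y w] by auto
        then have "dist (f m y) (g y) < e * r / 2" "dist (f n y) (g y) < e * r / 2" using N mn by auto
        then show "cmod (f m y - f n y) \<le> e * r"
          using dist_triangle2[of "f m y" "f n y" "g y"] by (simp add: dist_norm)
      qed
      then show ?thesis using r by simp
    qed
    then show ?thesis by blast
  qed
  have "convergent (\<lambda>i. D i w v)" if w: "w \<in> ball z r" for w v
  proof (rule Cauchy_convergent, rule CauchyI)
    fix e :: real assume e: "e > 0"
    have "e / (norm v + 1) > 0" using e by (simp add: add_nonneg_pos)
    then obtain N where N: "\<forall>m\<ge>N. \<forall>n\<ge>N. \<forall>w\<in>ball z r. \<forall>v'. cmod (D m w v' - D n w v') \<le> e / (norm v + 1) * norm v'"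
      using cau by blast
    have lt: "e / (norm v + 1) * norm v < e" using e add_nonneg_pos[OF norm_ge_zero[of v] zero_less_one]
      by (simp add: field_simps)
    have "norm (D m w v - D n w v) < e" if "m \<ge> N" "n \<ge> N" for m n
      using N w that by (intro le_less_trans[OF _ lt]) blast
    then show "\<exists>M. \<forall>m\<ge>M. \<forall>n\<ge>M. norm (D m w v - D n w v) < e" by blast
  qed
  then obtain g' where g': "\<And>w v. w \<in> ball z r \<Longrightarrow> (\<lambda>i. D i w v) \<longlonglongrightarrow> g' w v"
    unfolding convergent_def by metis
  have "\<exists>G. \<forall>x\<in>ball z r. (\<lambda>n. f n x) \<longlonglongrightarrow> G x \<and> (G has_derivative g' x) (at x within ball z r)"
  proof (rule has_derivative_sequence[OF convex_ball])
    show "(f n has_derivative D n x) (at x within ball z r)" for n x using D(1) has_derivative_at_withinI by blast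
    show "z \<in> ball z r" using r by simp
    show "(\<lambda>n. f n z) \<longlonglongrightarrow> g z" by (rule tendsto_uniform_limitI[OF lim]) (use z U(2) in blast)
    fix e :: real assume "e > 0"
    then obtain N where N: "\<forall>m\<ge>N. \<forall>n\<ge>N. \<forall>w\<in>ball z r. \<forall>v. cmod (D m w v - D n w v) \<le> e * norm v" using cau by blast
    have "cmod (D n x h - g' x h) \<le> e * norm h" if "n \<ge> N" "x \<in> ball z r" for n x h
    proof (rule tendsto_upperbound)
      show "(\<lambda>m. cmod (D n x h - D m x h)) \<longlonglongrightarrow> cmod (D n x h - g' x h)"
        by (intro tendsto_intros g' that)
      show "eventually (\<lambda>m. cmod (D n x h - D m x h) \<le> e * norm h) sequentially"
        unfolding eventually_sequentially by (rule exI[of _ N]) (use N that in auto)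
    qed simp
    then show "\<forall>\<^sub>F n in sequentially. \<forall>x\<in>ball z r. \<forall>h. norm (D n x h - g' x h) \<le> e * norm h"
      unfolding eventually_sequentially by (intro exI[of _ N]) auto
  qed
  then obtain G where G0: "\<forall>x\<in>ball z r. (\<lambda>n. f n x) \<longlonglongrightarrow> G x \<and> (G has_derivative g' x) (at x within ball z r)" ..
  have zr: "z \<in> ball z r" using r(1) by simp
  note G = conjunct1[OF bspec[OF G0]] conjunct2[OF bspec[OF G0 zr]]
  have Gg: "G x = g x" if "x \<in> ball z r" for x
  proof (rule LIMSEQ_unique[OF G(1)[OF that]])
    have "x \<in> S" using that r by auto
    then show "(\<lambda>n. f n x) \<longlonglongrightarrow> g x" by (rule tendsto_uniform_limitI[OF lim])
  qed
  have "(G has_derivative g' z) (at z)" using G(2) at_within_open[of z "ball z r"] r(1) by simp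
  then have "(g has_derivative g' z) (at z)"
    by (rule has_derivative_transform_within_open[of _ _ _ _ "ball z r"]) (use r(1) Gg in auto)
  moreover have "g' z (c *s v) = c * g' z v" for c v
  proof (rule LIMSEQ_unique)
    show "(\<lambda>i. D i z (c *s v)) \<longlonglongrightarrow> g' z (c *s v)" using g' r by simp
    have "(\<lambda>i. D i z v) \<longlonglongrightarrow> g' z v" using g' r by simp
    then show "(\<lambda>i. D i z (c *s v)) \<longlonglongrightarrow> c * g' z v" unfolding D(2) by (intro tendsto_intros)
  qed
  ultimately show "\<exists>D. (g has_derivative D) (at z) \<and> (\<forall>c v. D (c *s v) = c * D v)" by blast
qed

section \<open>Approximation of root families\<close>

lemma infdist_finite_less:
  fixes x :: "'a::heine_borel"
  assumes "finite A" "A \<noteq> {}" "infdist x A < e"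
  shows "\<exists>a\<in>A. dist x a < e"
proof -
  obtain a where "a \<in> A" "infdist x A = dist x a"
    using infdist_attains_inf[of A x] assms finite_imp_closed by metis
  then show ?thesis using assms(3) by auto
qed

lemma hausdorff_dist_lessD:
  assumes E: "finite E" "E \<noteq> {}" and F: "finite F" "F \<noteq> {}" and lt: "hausdorff_dist E F < e"
  shows "x \<in> E \<Longrightarrow> \<exists>y\<in>F. dist x y < e" "y \<in> F \<Longrightarrow> \<exists>x\<in>E. dist y x < e"
proof -
  have b: "bdd_above ((\<lambda>x. infdist x F) ` E)" "bdd_above ((\<lambda>x. infdist x E) ` F)" using E F by auto
  show "\<exists>y\<in>F. dist x y < e" if "x \<in> E"
    using cSUP_upper[OF that b(1)] lt infdist_finite_less[OF F, of x e] by (simp add: hausdorff_dist_def)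
  show "\<exists>x\<in>E. dist y x < e" if "y \<in> F"
    using cSUP_upper[OF that b(2)] lt infdist_finite_less[OF E, of y e] by (simp add: hausdorff_dist_def)
qed

lemma hausdorff_dist_nonneg:
  assumes "finite E" "E \<noteq> {}"
  shows "0 \<le> hausdorff_dist E F"
proof -
  obtain x where "x \<in> E" using assms by blast
  then have "0 \<le> (SUP x\<in>E. infdist x F)"
    using assms by (intro cSUP_upper2[of _ _ x]) (auto simp: infdist_nonneg)
  then show ?thesis by (simp add: hausdorff_dist_def)
qed

text \<open>The strict inequality for the limsup leaves room for a fixed \<theta>, and the strict
  inequality for the infimum selects a member of the family for each large \<open>d\<close>.\<close>

lemma limsup_dist_delta_less:
  assumes K: "K \<noteq> {}" and Y: "\<And>x. x \<in> K \<Longrightarrow> finite (fibre Y x) \<and> fibre Y x \<noteq> {}"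
    and lim: "limsup (\<lambda>d. ereal_root d (dist_delta K Y (\<W> d))) < 1"
  obtains \<theta> d0 where "0 < \<theta>" "\<theta> < 1"
    "\<And>d. d \<ge> d0 \<Longrightarrow> \<exists>W\<in>\<W> d. \<forall>x\<in>K. hausdorff_dist (fibre Y x) (fibre W x) < \<theta> ^ d"
proof -
  obtain \<theta>' where \<theta>': "limsup (\<lambda>d. ereal_root d (dist_delta K Y (\<W> d))) < ereal \<theta>'" "ereal \<theta>' < 1"
    using ereal_dense2[OF lim] by blast
  \<comment> \<open>The maximum with 1/2 makes \<theta> positive, so that its powers can serve as
    error bounds.\<close>
  define \<theta> where "\<theta> = max \<theta>' (1/2)"
  have \<theta>: "0 < \<theta>" "\<theta> < 1" using \<theta>'(2) by (auto simp: \<theta>_def one_ereal_def)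
  have "limsup (\<lambda>d. ereal_root d (dist_delta K Y (\<W> d))) < ereal \<theta>"
    using \<theta>'(1) by (rule less_le_trans) (simp add: \<theta>_def)
  from Limsup_lessD[OF this] obtain d0 where d0: "\<And>d. d \<ge> d0 \<Longrightarrow> ereal_root d (dist_delta K Y (\<W> d)) < ereal \<theta>"
    by (auto simp: eventually_sequentially)
  have ge: "0 \<le> dist_delta K Y W" for W
    unfolding dist_delta_def
  proof (rule INF_greatest)
    fix w
    obtain x where x: "x \<in> K" using K by blast
    have "0 \<le> ereal (hausdorff_dist (fibre Y x) (fibre w x))" using hausdorff_dist_nonneg Y[OF x] by simp
    then show "0 \<le> delta K Y w" unfolding delta_def using x by (meson SUP_upper2)
  qed
  show ?thesis
  proof (rule that[OF \<theta>, of "max d0 1"])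
    fix d assume d: "max d0 1 \<le> d"
    define r where "r = dist_delta K Y (\<W> d)"
    have lt: "ereal_root d r < ereal \<theta>" using d0 d by (simp add: r_def)
    then have "r \<noteq> \<infinity>" by (auto simp: ereal_root_def)
    then obtain s where s: "r = ereal s" "s \<ge> 0" using ge[of "\<W> d"] by (cases r) (auto simp: r_def)
    then have "root d s < \<theta>" using lt by (simp add: ereal_root_def)
    then have "root d s ^ d < \<theta> ^ d" using d s(2) by (intro power_strict_mono) auto
    then have "s < \<theta> ^ d" using d s(2) by simp
    then have "(INF W\<in>\<W> d. delta K Y W) < ereal (\<theta> ^ d)" using s(1) by (simp add: r_def dist_delta_def)
    then obtain W where W: "W \<in> \<W> d" "delta K Y W < ereal (\<theta> ^ d)" unfolding INF_less_iff by blast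
    have "hausdorff_dist (fibre Y x) (fibre W x) < \<theta> ^ d" if "x \<in> K" for x
    proof -
      have "ereal (hausdorff_dist (fibre Y x) (fibre W x)) \<le> delta K Y W"
        unfolding delta_def by (rule SUP_upper[OF that])
      from le_less_trans[OF this W(2)] show ?thesis by simp
    qed
    then show "\<exists>W\<in>\<W> d. \<forall>x\<in>K. hausdorff_dist (fibre Y x) (fibre W x) < \<theta> ^ d" using W(1) by blast
  qed
qed

text \<open>\<open>t d x\<close> lists the \<open>n\<close> roots of the approximant of index
  \<open>d\<close> over \<open>x\<close>. The polynomial dependence holds for all \<open>x\<close>,
  the closeness to \<open>Y\<close> only over \<open>K\<close>. It matters that \<open>c\<close>
  depends neither on \<open>d\<close> nor on \<open>r\<close>.\<close>

locale root_approximation =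
  fixes K :: "(complex ^ 'm) set" and Y :: "((complex ^ 'm) \<times> complex) set" and n c d1 :: nat and \<theta> :: real
    and t :: "nat \<Rightarrow> complex ^ 'm \<Rightarrow> nat \<Rightarrow> complex" and M :: real
  assumes n: "n > 0" and K: "K \<noteq> {}" "compact K" and \<theta>: "0 < \<theta>" "\<theta> < 1" and d1: "d1 > 0" and c: "c > 0"
    and ps: "\<And>d r. d \<ge> d1 \<Longrightarrow> polyfun (r * (c * d)) (\<lambda>x. pow_sum n (t d x) r)"
    and YM: "\<And>x y. x \<in> K \<Longrightarrow> y \<in> fibre Y x \<Longrightarrow> cmod y \<le> M" and M: "M \<ge> 0"
    and Y_near: "\<And>d x y. d \<ge> d1 \<Longrightarrow> x \<in> K \<Longrightarrow> y \<in> fibre Y x \<Longrightarrow> \<exists>i<n. dist y (t d x i) < \<theta> ^ d"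
    and t_near: "\<And>d x i. d \<ge> d1 \<Longrightarrow> x \<in> K \<Longrightarrow> i < n \<Longrightarrow> \<exists>y\<in>fibre Y x. dist (t d x i) y < \<theta> ^ d"
begin

lemma t_bound: "d \<ge> d1 \<Longrightarrow> x \<in> K \<Longrightarrow> i < n \<Longrightarrow> cmod (t d x i) \<le> M + 1"
proof -
  assume *: "d \<ge> d1" "x \<in> K" "i < n"
  then obtain y where y: "y \<in> fibre Y x" "dist (t d x i) y < \<theta> ^ d" using t_near by blast
  have "\<theta> ^ d \<le> 1" using \<theta> by (simp add: power_le_one)
  then show ?thesis using y YM[OF *(2) y(1)] norm_triangle_sub[of "t d x i" y] by (simp add: dist_norm)
qed

text \<open>Bounds the distance of two points of modulus at most \<open>M + 1\<close>, such as roots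
  of approximants over \<open>K\<close>.\<close>

definition L where "L = 2 * M + 3"

lemma L_ge_1: "L \<ge> 1" using M by (simp add: L_def)

lemma poly_small:
  assumes "d \<ge> d1" "x \<in> K" "i < n" "dist z (t d x i) \<le> \<eta>" "cmod z \<le> M + 1"
  shows "cmod (poly (root_poly n (t d x)) z) \<le> \<eta> * L ^ n"
proof -
  have "cmod (poly (root_poly n (t d x)) z) = (\<Prod>j<n. cmod (z - t d x j))" by (simp add: poly_root_poly prod_norm)
  also have "\<dots> = cmod (z - t d x i) * (\<Prod>j\<in>{..<n} - {i}. cmod (z - t d x j))"
    using assms(3) by (subst prod.remove[of _ i]) auto
  also have "\<dots> \<le> \<eta> * (\<Prod>j\<in>{..<n} - {i}. L)"
  proof (intro mult_mono prod_mono)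
    show "0 \<le> cmod (z - t d x j) \<and> cmod (z - t d x j) \<le> L" if "j \<in> {..<n} - {i}" for j
      using norm_triangle_ineq4[of z "t d x j"] t_bound[of d x j] assms that by (auto simp: L_def)
  qed (use assms in \<open>auto simp: dist_norm intro: prod_nonneg order_trans[OF norm_ge_zero]\<close>)
  also have "(\<Prod>j\<in>{..<n} - {i}. L) \<le> L ^ n" using L_ge_1 assms(3) by (simp add: power_increasing)
  finally show ?thesis using assms(4) zero_le_dist[of z "t d x i"] by (simp add: mult_left_mono order_trans)
qed

text \<open>The power sums in \<open>consecutive_values\<close> have degree at most
  \<open>r * n * c * Suc d\<close>; the factor 2 accounts for
  \<open>Suc d \<le> 2 * d\<close>.\<close>

definition B where "B = 2 * n * c"

text \<open>The values at the roots of \<open>P\<^sub>d\<^sub>+\<^sub>1\<close> of \<open>P\<^sub>d\<close> have small power sums, which are polynomials in \<open>x\<close>.\<close>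

lemma consecutive_values:
  assumes d: "d \<ge> d1" and x: "siciak K x \<le> ereal R" "R \<ge> 1" and l: "l < n"
  shows "cmod (poly (root_poly n (t d x)) (t (Suc d) x l)) \<le> 2 * real n * (2 * L ^ n * (\<theta> * R ^ B) ^ d)"
proof (rule roots_small_of_pow_sum_small[where t="\<lambda>l. poly (root_poly n (t d x)) (t (Suc d) x l)", OF _ _ l])
  show "0 \<le> 2 * L ^ n * (\<theta> * R ^ B) ^ d" using L_ge_1 \<theta> x(2) by simp
  fix r :: nat assume r: "r > 0"
  define q where "q x = pow_sum n (\<lambda>l. poly (root_poly n (t d x)) (t (Suc d) x l)) r" for x
  have w: "weighted_poly (c * d) (r * n) (\<lambda>x. root_poly n (t d x) ^ r)" by (intro weighted_poly_power weighted_poly_root_poly ps d)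
  have "q x = (\<Sum>i\<le>r * n. coeff (root_poly n (t d x) ^ r) i * pow_sum n (t (Suc d) x) i)" for x
  proof -
    have "poly (root_poly n (t d x)) z ^ r = (\<Sum>i\<le>r * n. coeff (root_poly n (t d x) ^ r) i * z ^ i)" for z
    proof -
      have "degree (root_poly n (t d x) ^ r) = r * n" by (simp add: degree_power_eq root_poly_nonzero degree_root_poly)
      then show ?thesis using poly_altdef[of "root_poly n (t d x) ^ r" z] by simp
    qed
    then have "q x = (\<Sum>l<n. \<Sum>i\<le>r * n. coeff (root_poly n (t d x) ^ r) i * t (Suc d) x l ^ i)"
      by (simp add: q_def pow_sum_def)
    also have "\<dots> = (\<Sum>i\<le>r * n. coeff (root_poly n (t d x) ^ r) i * pow_sum n (t (Suc d) x) i)"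
      unfolding pow_sum_def sum_distrib_left by (rule sum.swap)
    finally show ?thesis .
  qed
  \<comment> \<open>In the term with index \<open>i\<close> the weights give the coefficient the
    degree \<open>(r * n - i) * (c * d)\<close>, and the power sum of the next approximant has
    degree \<open>i * (c * Suc d)\<close>. The dependence on \<open>i\<close> cancels in the
    sum.\<close>
  moreover have "polyfun (B * d * r) (\<lambda>x. \<Sum>i\<le>r * n. coeff (root_poly n (t d x) ^ r) i * pow_sum n (t (Suc d) x) i)"
  proof (rule polyfun_sum)
    fix i assume i: "i \<in> {..r * n}"
    have "polyfun ((r * n - i) * (c * d) + i * (c * Suc d)) (\<lambda>x. coeff (root_poly n (t d x) ^ r) i * pow_sum n (t (Suc d) x) i)"
      using w i d by (intro polyfun_mult ps) (auto simp: weighted_poly_def)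
    moreover have "(r * n - i) * (c * d) + i * (c * Suc d) \<le> B * d * r"
    proof -
      have "(r * n - i) * (c * d) + i * (c * Suc d) \<le> (r * n - i) * (c * Suc d) + i * (c * Suc d)" by simp
      also have "\<dots> = r * n * (c * Suc d)" using i by (simp flip: add_mult_distrib)
      also have "\<dots> \<le> r * n * (c * (2 * d))" using d d1 by (intro mult_left_mono) auto
      also have "\<dots> = B * d * r" by (simp add: B_def)
      finally show ?thesis .
    qed
    ultimately show "polyfun (B * d * r) (\<lambda>x. coeff (root_poly n (t d x) ^ r) i * pow_sum n (t (Suc d) x) i)"
      by (rule polyfun_mono)
  qed
  ultimately have pq: "polyfun (B * d * r) q" by presburger
  have th: "\<theta> ^ d > 0" using \<theta> by simp
  \<comment> \<open>Over \<open>K\<close> a root of the next approximant is close to a point of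
    \<open>Y\<close>, which in turn is close to a root of the present one. So one factor of the
    value is at most \<open>2 * \<theta> ^ d\<close>.\<close>
  have bK: "cmod (q y) \<le> real n * (2 * L ^ n * \<theta> ^ d) ^ r" if y: "y \<in> K" for y
  proof -
    have "cmod (poly (root_poly n (t d y)) (t (Suc d) y l)) \<le> 2 * L ^ n * \<theta> ^ d" if l: "l < n" for l
    proof -
      obtain z where z: "z \<in> fibre Y y" "dist (t (Suc d) y l) z < \<theta> ^ Suc d" using t_near[of "Suc d" y l] d y l by auto
      obtain i where i: "i < n" "dist z (t d y i) < \<theta> ^ d" using Y_near[OF d y z(1)] by blast
      have "\<theta> ^ Suc d \<le> \<theta> ^ d" using \<theta> by (intro power_decreasing) auto
      then have "dist (t (Suc d) y l) (t d y i) \<le> 2 * \<theta> ^ d"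
        using z(2) i(2) dist_triangle[of "t (Suc d) y l" "t d y i" z] by linarith
      from poly_small[OF d y i(1) this] show ?thesis using t_bound[of "Suc d" y l] d y l by (simp add: mult_ac)
    qed
    then have "cmod (q y) \<le> (\<Sum>l<n. (2 * L ^ n * \<theta> ^ d) ^ r)"
      unfolding q_def pow_sum_def by (intro sum_norm_le) (auto simp: norm_power intro: power_mono)
    then show ?thesis by simp
  qed
  \<comment> \<open>The factor \<open>R ^ (B * d * r)\<close> is an \<open>r\<close>-th power, so
    the estimate keeps the shape that \<open>roots_small_of_pow_sum_small\<close> needs for all
    \<open>r\<close> at once.\<close>
  have "cmod (q x) \<le> real n * (2 * L ^ n * \<theta> ^ d) ^ r * R ^ (B * d * r)"
    by (rule bernstein_walsh[OF pq bK _ K(1) x]) (use n L_ge_1 th in auto)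
  also have "\<dots> = real n * (2 * L ^ n * (\<theta> * R ^ B) ^ d) ^ r"
    by (simp add: power_mult_distrib power_mult)
  finally show "cmod (pow_sum n (\<lambda>l. poly (root_poly n (t d x)) (t (Suc d) x l)) r) \<le> real n * (2 * L ^ n * (\<theta> * R ^ B) ^ d) ^ r"
    by (simp add: q_def)
qed

text \<open>Near \<open>K\<close> each root of an approximant lies close to a root of the preceding
  one, with an error that decays geometrically. Following such a chain down to index
  \<open>d1\<close> bounds all roots by those of a single polynomial plus a geometric
  series.\<close>

lemma roots_bounded_near_K:
  obtains R where "R > 1" "\<And>C. bounded C \<Longrightarrow> \<exists>M'\<ge>0. \<forall>x\<in>C. siciak K x \<le> ereal R \<longrightarrow> (\<forall>d\<ge>d1. \<forall>l<n. cmod (t d x l) \<le> M')"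
proof -
  define \<tau> where "\<tau> = (1 + \<theta>) / 2"
  have \<tau>: "\<theta> < \<tau>" "\<tau> < 1" "\<tau> > 0" using \<theta> by (auto simp: \<tau>_def)
  have B: "B > 0" using n c by (simp add: B_def)
  \<comment> \<open>Chosen so that \<open>\<theta> * R ^ B\<close> equals \<tau>, a number still
    below 1: near \<open>K\<close> part of the exponential decay survives the Bernstein--Walsh
    growth.\<close>
  define R where "R = root B (\<tau> / \<theta>)"
  have R: "R > 1" "R ^ B = \<tau> / \<theta>" using \<tau> \<theta> B by (auto simp: R_def)
  have R1: "R \<ge> 1" using R by simp
  \<comment> \<open>Passing from a small value of a monic polynomial of degree \<open>n\<close> to a
    nearby root costs an \<open>n\<close>-th root of the error.\<close>
  define \<kappa> where "\<kappa> = root n \<tau>"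
  have \<kappa>: "0 < \<kappa>" "\<kappa> < 1" "\<kappa> ^ n = \<tau>" using \<tau> n by (auto simp: \<kappa>_def)
  define C1 where "C1 = 4 * real n * L ^ n + 1"
  have C1: "C1 \<ge> 1" using L_ge_1 by (simp add: C1_def)
  have step: "\<exists>i<n. cmod (t (Suc d) x l - t d x i) < C1 * \<kappa> ^ d"
    if "d \<ge> d1" "siciak K x \<le> ereal R" "l < n" for d x l
  proof (rule nearby_root)
    have "cmod (poly (root_poly n (t d x)) (t (Suc d) x l)) \<le> 4 * real n * L ^ n * \<tau> ^ d"
      using consecutive_values[OF that(1,2) R1 that(3)] R \<theta> by simp
    also have "\<dots> < C1 * \<tau> ^ d" using \<tau> by (intro mult_strict_right_mono) (auto simp: C1_def)
    also have "\<dots> \<le> C1 ^ n * \<tau> ^ d" using C1 \<tau> n self_le_power[of C1 n] by (intro mult_right_mono) auto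
    also have "\<dots> = (C1 * \<kappa> ^ d) ^ n" by (simp add: power_mult_distrib \<kappa>(3)[symmetric] mult.commute flip: power_mult)
    finally show "cmod (poly (root_poly n (t d x)) (t (Suc d) x l)) < (C1 * \<kappa> ^ d) ^ n" .
  qed (use C1 \<kappa> in auto)
  \<comment> \<open>The chain starts from any root at level \<open>d1 + j\<close>; which root of
    level \<open>d1\<close> it ends in does not matter.\<close>
  have grow: "\<forall>l<n. cmod (t (d1 + j) x l) \<le> b + C1 * (\<Sum>i<j. \<kappa> ^ i)"
    if x: "siciak K x \<le> ereal R" and b: "\<forall>l<n. cmod (t d1 x l) \<le> b" for x b j
  proof (induction j)
    case 0 then show ?case using b by simp
  next
    case (Suc j)
    show ?case
    proof (intro allI impI)
      fix l assume l: "l < n"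
      obtain i where i: "i < n" "cmod (t (Suc (d1 + j)) x l - t (d1 + j) x i) < C1 * \<kappa> ^ (d1 + j)"
        using step[OF _ x l, of "d1 + j"] by auto
      have "\<kappa> ^ (d1 + j) \<le> \<kappa> ^ j" using \<kappa> by (intro power_decreasing) auto
      then have "C1 * \<kappa> ^ (d1 + j) \<le> C1 * \<kappa> ^ j" using C1 by (intro mult_left_mono) auto
      then show "cmod (t (d1 + Suc j) x l) \<le> b + C1 * (\<Sum>i<Suc j. \<kappa> ^ i)"
        using i Suc norm_triangle_sub[of "t (Suc (d1 + j)) x l" "t (d1 + j) x i"] by (fastforce simp: distrib_left)
    qed
  qed
  have geo: "(\<Sum>i<j. \<kappa> ^ i) \<le> 1 / (1 - \<kappa>)" for j
    using \<kappa> by (simp add: sum_gp_strict divide_right_mono)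
  show ?thesis
  proof (rule that[OF R(1)])
    fix C :: "(complex ^ 'm) set" assume "bounded C"
    then have cc: "compact (closure C)" by simp
    have "\<exists>b\<ge>0. \<forall>x\<in>C. cmod (coeff (root_poly n (t d1 x)) i) \<le> b" if "i < n" for i
    proof -
      have "weighted_poly (c * d1) n (\<lambda>x. root_poly n (t d1 x))" by (intro weighted_poly_root_poly ps) simp
      then have "polyfun ((n - i) * (c * d1)) (\<lambda>x. coeff (root_poly n (t d1 x)) i)" using that by (auto simp: weighted_poly_def)
      then have "compact ((\<lambda>x. coeff (root_poly n (t d1 x)) i) ` closure C)"
        by (intro compact_continuous_image polyfun_continuous cc)
      then obtain b where "b > 0" "\<forall>y\<in>(\<lambda>x. coeff (root_poly n (t d1 x)) i) ` closure C. cmod y \<le> b"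
        using compact_imp_bounded bounded_pos by metis
      then show ?thesis using closure_subset[of C] by (intro exI[of _ b]) auto
    qed
    then obtain b where b: "\<And>i. i < n \<Longrightarrow> b i \<ge> 0 \<and> (\<forall>x\<in>C. cmod (coeff (root_poly n (t d1 x)) i) \<le> b i)" by metis
    define b' where "b' = (\<Sum>i<n. b i)"
    have b': "cmod (coeff (root_poly n (t d1 x)) i) \<le> b'" if "i < n" "x \<in> C" for i x
    proof -
      have "b i \<le> b'" unfolding b'_def using b that(1) by (intro member_le_sum) auto
      then show ?thesis using b that by (meson order_trans)
    qed
    have b0: "b' \<ge> 0" unfolding b'_def using b by (intro sum_nonneg) auto
    define M' where "M' = 1 + real n * b' + C1 * (1 / (1 - \<kappa>))"
    have "cmod (t d x l) \<le> M'" if x: "x \<in> C" "siciak K x \<le> ereal R" and dl: "d \<ge> d1" "l < n" for x d l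
    proof -
      have "\<forall>l<n. cmod (t d1 x l) \<le> 1 + real n * b'" using root_poly_root_bound[of n "t d1 x" b'] b' x(1) b0 by blast
      from grow[OF x(2) this, of "d - d1"] have "cmod (t d x l) \<le> 1 + real n * b' + C1 * (\<Sum>i<d - d1. \<kappa> ^ i)"
        using dl by simp
      also have "\<dots> \<le> M'" unfolding M'_def using geo C1 by (intro add_left_mono mult_left_mono) auto
      finally show ?thesis .
    qed
    moreover have "M' \<ge> 0" unfolding M'_def using b0 C1 \<kappa> by (intro add_nonneg_nonneg) auto
    ultimately show "\<exists>M'\<ge>0. \<forall>x\<in>C. siciak K x \<le> ereal R \<longrightarrow> (\<forall>d\<ge>d1. \<forall>l<n. cmod (t d x l) \<le> M')" by blast
  qed
qed

lemma siciak_le_1: "x \<in> K \<Longrightarrow> siciak K x \<le> 1"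
  unfolding siciak_def
  by (rule SUP_least) (auto simp: one_ereal_def powr_le1)

lemma open_siciak: "continuous_on UNIV (siciak K) \<Longrightarrow> open {x. siciak K x < ereal R}"
  by (intro open_Collect_less) (auto intro: continuous_intros)

text \<open>The coefficients of the approximants are uniformly bounded near \<open>K\<close>, so a
  subsequence converges to holomorphic functions. Over \<open>K\<close> the zero set of the limit is
  \<open>Y\<close>, by the two-sided closeness of the fibres; multiplicities are not controlled
  here.\<close>

theorem limit_polynomial:
  assumes cont: "continuous_on UNIV (siciak K)" and fin: "\<And>x. x \<in> K \<Longrightarrow> finite (fibre Y x)" and YK: "Y \<subseteq> K \<times> UNIV"
  obtains U b k where "open U" "K \<subseteq> U" "strict_mono k" "\<And>i. k i \<ge> d1" "\<And>j. cholomorphic (b j) U"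
    "\<And>x j. x \<in> U \<Longrightarrow> j \<le> n \<Longrightarrow> (\<lambda>i. coeff (root_poly n (t (k i) x)) (n - j)) \<longlonglongrightarrow> b j x"
    "Y = {(x, z). x \<in> K \<and> monic_eval n b x z = 0}"
proof -
  obtain R where R: "R > 1" "\<And>C. bounded C \<Longrightarrow> \<exists>M'\<ge>0. \<forall>x\<in>C. siciak K x \<le> ereal R \<longrightarrow> (\<forall>d\<ge>d1. \<forall>l<n. cmod (t d x l) \<le> M')"
    using roots_bounded_near_K by blast
  obtain r0 where r0: "\<And>x. x \<in> K \<Longrightarrow> norm x < r0" using compact_imp_bounded[OF K(2)] bounded_pos_less by blast
  \<comment> \<open>Continuity of \<open>siciak K\<close> makes the second set open, and the ball
    makes \<open>U1\<close> bounded, as \<open>roots_bounded_near_K\<close> requires.\<close>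
  define U1 where "U1 = ball 0 r0 \<inter> {x. siciak K x < ereal R}"
  have U1: "open U1" using open_siciak[OF cont] by (auto simp: U1_def)
  have KU1: "K \<subseteq> U1"
  proof
    fix x assume x: "x \<in> K"
    have "siciak K x < ereal R" 
      by (rule le_less_trans[OF siciak_le_1[OF x]]) (simp add: one_ereal_def R(1))
    then show "x \<in> U1" using r0[OF x] by (simp add: U1_def)
  qed
  have "bounded U1" unfolding U1_def by (simp add: bounded_Int)
  from R(2)[OF this] obtain M' where M'0: "M' \<ge> 0" "\<forall>x\<in>U1. siciak K x \<le> ereal R \<longrightarrow> (\<forall>d\<ge>d1. \<forall>l<n. cmod (t d x l) \<le> M')"
    by blast
  have M': "cmod (t d x l) \<le> M'" if "x \<in> U1" "d \<ge> d1" "l < n" for x d l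
    using M'0(2) that by (auto simp: U1_def less_imp_le)
  obtain S where S: "compact S" "K \<subseteq> interior S" "S \<subseteq> U1"
  proof -
    obtain e where e: "e > 0" "(\<Union>x\<in>K. ball x e) \<subseteq> U1"
      using compact_subset_open_imp_ball_epsilon_subset[OF K(2) U1 KU1] by blast
    define S where "S = (\<Union>x\<in>K. cball x (e/2))"
    have "compact S" unfolding S_def using compact_minkowski_sum_cball[OF K(2)] by blast
    moreover have "(\<Union>x\<in>K. ball x (e/2)) \<subseteq> interior S"
      by (rule interior_maximal) (auto simp: S_def intro: less_imp_le)
    then have "K \<subseteq> interior S" using e(1) by force
    moreover have "S \<subseteq> U1" using e by (force simp: S_def)
    ultimately show ?thesis using that by blast
  qed
  have "\<exists>k g. strict_mono k \<and> (\<forall>j\<in>{..n}. uniform_limit S (\<lambda>i x. coeff (root_poly n (t (d1 + k i) x)) (n - j)) (g j) sequentially)"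
  proof (rule polyfun_montel_finite[where f="\<lambda>j i x. coeff (root_poly n (t (d1 + i) x)) (n - j)" and C="(1 + M') ^ n", OF _ _ U1 _ S(1,3)])
    show "\<exists>d. polyfun d (\<lambda>x. coeff (root_poly n (t (d1 + i) x)) (n - j))" if "j \<in> {..n}" for i j
    proof -
      have "weighted_poly (c * (d1 + i)) n (\<lambda>x. root_poly n (t (d1 + i) x))" by (intro weighted_poly_root_poly ps) simp
      then show ?thesis using that unfolding weighted_poly_def by (metis diff_le_self)
    qed
    show "cmod (coeff (root_poly n (t (d1 + i) x)) (n - j)) \<le> (1 + M') ^ n" if "x \<in> U1" for i j x
      using M' M'0(1) that by (intro coeff_root_poly_bound) auto
  qed simp
  then obtain k g where kg: "strict_mono k"
    "\<And>j. j \<le> n \<Longrightarrow> uniform_limit S (\<lambda>i x. coeff (root_poly n (t (d1 + k i) x)) (n - j)) (g j) sequentially" by auto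
  define b where "b j = (if j \<le> n then g j else (\<lambda>_. 0))" for j
  define U where "U = interior S"
  have US: "U \<subseteq> S" by (simp add: U_def interior_subset)
  have hb: "cholomorphic (b j) U" for j
  proof (cases "j \<le> n")
    case True
    have "\<exists>d. polyfun d (\<lambda>x. coeff (root_poly n (t (d1 + k i) x)) (n - j))" for i
    proof -
      have "weighted_poly (c * (d1 + k i)) n (\<lambda>x. root_poly n (t (d1 + k i) x))" by (intro weighted_poly_root_poly ps) simp
      then show ?thesis unfolding weighted_poly_def by (metis diff_le_self)
    qed
    from uniform_limit_polyfun_cholomorphic[OF this kg(2)[OF True] _ US] show ?thesis
      using True by (simp add: b_def U_def)
  next
    case False
    then show ?thesis using polyfun_cholomorphic[OF polyfun_const[of 0 0], of U] by (simp add: b_def U_def)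
  qed
  have lim: "(\<lambda>i. coeff (root_poly n (t (d1 + k i) x)) (n - j)) \<longlonglongrightarrow> b j x" if "x \<in> U" "j \<le> n" for x j
    using tendsto_uniform_limitI[OF kg(2)[OF that(2)]] that US by (auto simp: b_def)
  have b0: "b 0 x = 1" if "x \<in> U" for x
    using lim[OF that, of 0] by (simp add: monic_root_poly LIMSEQ_const_iff)
  have pl: "(\<lambda>i. poly (root_poly n (t (d1 + k i) x)) z) \<longlonglongrightarrow> monic_eval n b x z" if x: "x \<in> U" for x z
  proof -
    have "poly (root_poly n (t d x)) z = (\<Sum>j\<le>n. coeff (root_poly n (t d x)) (n - j) * z ^ (n - j))" for d
      unfolding poly_altdef degree_root_poly
      by (rule sum.reindex_bij_witness[of _ "\<lambda>j. n - j" "\<lambda>j. n - j"]) auto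
    moreover have "monic_eval n b x z = (\<Sum>j\<le>n. b j x * z ^ (n - j))"
      by (simp add: monic_eval_def atMost_atLeast0 sum.atLeast_Suc_atMost b0[OF x])
    ultimately show ?thesis using lim[OF x] by (auto intro!: tendsto_intros)
  qed
  have ke: "strict_mono (\<lambda>i. d1 + k i)" using kg(1) by (simp add: strict_mono_def)
  have th0: "(\<lambda>i. \<theta> ^ (d1 + k i)) \<longlonglongrightarrow> 0"
    using LIMSEQ_subseq_LIMSEQ[OF LIMSEQ_power_zero[of \<theta>] ke] \<theta> by (simp add: o_def)
  \<comment> \<open>A point of \<open>Y\<close> is a limit of roots, hence a zero of the limit.
    Conversely a zero of the limit is close to roots of the approximants, hence to points of the
    finite fibre, and therefore lies in it.\<close>
  have Yb: "z \<in> fibre Y x \<longleftrightarrow> monic_eval n b x z = 0" if x: "x \<in> K" for x z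
  proof
    have xU: "x \<in> U" using x S(2) by (auto simp: U_def)
    assume z: "z \<in> fibre Y x"
    have small: "cmod (poly (root_poly n (t (d1 + k i) x)) z) \<le> \<theta> ^ (d1 + k i) * L ^ n" for i
    proof -
      obtain l where "l < n" "dist z (t (d1 + k i) x l) < \<theta> ^ (d1 + k i)" using Y_near[OF _ x z, of "d1 + k i"] by auto
      then show ?thesis using YM[OF x z] x by (intro poly_small) auto
    qed
    have "(\<lambda>i. poly (root_poly n (t (d1 + k i) x)) z) \<longlonglongrightarrow> 0"
      by (rule Lim_null_comparison[OF _ tendsto_mult_left_zero[OF th0]]) (rule always_eventually, rule allI, rule small)
    then show "monic_eval n b x z = 0" by (rule LIMSEQ_unique[OF pl[OF xU]])
  next
    have xU: "x \<in> U" using x S(2) by (auto simp: U_def)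
    assume z: "monic_eval n b x z = 0"
    show "z \<in> fibre Y x"
    proof (rule ccontr)
      assume "z \<notin> fibre Y x"
      then obtain \<delta> where \<delta>: "\<delta> > 0" "\<And>y. y \<in> fibre Y x \<Longrightarrow> \<delta> \<le> dist z y"
        using separate_point_closed[OF finite_imp_closed[OF fin[OF x]]] by blast
      have "eventually (\<lambda>i. dist (poly (root_poly n (t (d1 + k i) x)) z) 0 < (\<delta> / 2) ^ n) sequentially"
        using tendstoD[OF pl[OF xU, of z], of "(\<delta> / 2) ^ n"] z \<delta>(1) by simp
      moreover have "eventually (\<lambda>i. \<theta> ^ (d1 + k i) < \<delta> / 2) sequentially"
        by (rule order_tendstoD(2)[OF th0]) (simp add: \<delta>(1))
      ultimately have "eventually (\<lambda>i. dist (poly (root_poly n (t (d1 + k i) x)) z) 0 < (\<delta> / 2) ^ n \<and> \<theta> ^ (d1 + k i) < \<delta> / 2) sequentially"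
        by (rule eventually_conj)
      then obtain i where i: "cmod (poly (root_poly n (t (d1 + k i) x)) z) < (\<delta> / 2) ^ n" "\<theta> ^ (d1 + k i) < \<delta> / 2"
        by (auto simp: eventually_sequentially)
      obtain l where l: "l < n" "cmod (z - t (d1 + k i) x l) < \<delta> / 2" using nearby_root[of "\<delta> / 2", OF _ i(1)] \<delta>(1) by auto
      obtain y where y: "y \<in> fibre Y x" "dist (t (d1 + k i) x l) y < \<theta> ^ (d1 + k i)" using t_near[OF _ x l(1), of "d1 + k i"] by auto
      have "dist z y < \<delta>" using l(2) y(2) i(2) dist_triangle[of z y "t (d1 + k i) x l"] by (simp add: dist_norm)
      then show False using \<delta>(2)[OF y(1)] by simp
    qed
  qed
  show ?thesis
  proof (rule that[of U "\<lambda>i. d1 + k i" b])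
    show "Y = {(x, z). x \<in> K \<and> monic_eval n b x z = 0}"
      using Yb YK unfolding fibre_def by auto
  qed (use S(2) ke hb lim in \<open>auto simp: U_def\<close>)
qed

end

section \<open>Zero sets of monic polynomials with holomorphic coefficients\<close>

lemma cholomorphic_open: "cholomorphic f W \<Longrightarrow> open W"
  by (simp add: cholomorphic_def)

lemma cholomorphic_cong:
  assumes "cholomorphic f W" "\<And>z. z \<in> W \<Longrightarrow> g z = f z"
  shows "cholomorphic g W"
  unfolding cholomorphic_def
proof (intro conjI ballI)
  show W: "open W" using assms(1) by (rule cholomorphic_open)
  fix z assume z: "z \<in> W"
  then obtain D where D: "(f has_derivative D) (at z)" "\<And>c v. D (c *s v) = c * D v"
    using assms(1) unfolding cholomorphic_def by blast
  have "(g has_derivative D) (at z)"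
    by (rule has_derivative_transform_within_open[OF D(1) W z]) (simp add: assms(2))
  then show "\<exists>D. (g has_derivative D) (at z) \<and> (\<forall>c v. D (c *s v) = c * D v)" using D(2) by blast
qed

lemma cholomorphic_subset: "cholomorphic f W \<Longrightarrow> open V \<Longrightarrow> V \<subseteq> W \<Longrightarrow> cholomorphic f V"
  unfolding cholomorphic_def by blast

lemma cholomorphic_const: "open W \<Longrightarrow> cholomorphic (\<lambda>_. c) W"
  using polyfun_cholomorphic[OF polyfun_const[of 0 c]] .

lemma cholomorphic_coord: "open W \<Longrightarrow> cholomorphic (\<lambda>z. z $ i) W"
  using polyfun_cholomorphic[OF polyfun_coord[of 1 i]] by simp

lemma cholomorphic_add:
  assumes "cholomorphic f W" "cholomorphic g W"
  shows "cholomorphic (\<lambda>z. f z + g z) W"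
  unfolding cholomorphic_def
proof (intro conjI ballI)
  fix z assume z: "z \<in> W"
  then obtain D E where D: "(f has_derivative D) (at z)" "\<And>c v. D (c *s v) = c * D v"
    and E: "(g has_derivative E) (at z)" "\<And>c v. E (c *s v) = c * E v"
    using assms unfolding cholomorphic_def by metis
  show "\<exists>D. ((\<lambda>z. f z + g z) has_derivative D) (at z) \<and> (\<forall>c v. D (c *s v) = c * D v)"
    by (rule exI, rule conjI, rule has_derivative_add[OF D(1) E(1)]) (simp add: D(2) E(2) algebra_simps)
qed (use assms(1) cholomorphic_open in blast)

lemma cholomorphic_mult:
  assumes "cholomorphic f W" "cholomorphic g W"
  shows "cholomorphic (\<lambda>z. f z * g z) W"
  unfolding cholomorphic_def
proof (intro conjI ballI)
  fix z assume z: "z \<in> W"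
  then obtain D E where D: "(f has_derivative D) (at z)" "\<And>c v. D (c *s v) = c * D v"
    and E: "(g has_derivative E) (at z)" "\<And>c v. E (c *s v) = c * E v"
    using assms unfolding cholomorphic_def by metis
  show "\<exists>D. ((\<lambda>z. f z * g z) has_derivative D) (at z) \<and> (\<forall>c v. D (c *s v) = c * D v)"
    by (rule exI, rule conjI, rule has_derivative_mult[OF D(1) E(1)]) (simp add: D(2) E(2) algebra_simps)
qed (use assms(1) cholomorphic_open in blast)

lemma cholomorphic_diff: "cholomorphic f W \<Longrightarrow> cholomorphic g W \<Longrightarrow> cholomorphic (\<lambda>z. f z - g z) W"
  using cholomorphic_add[of f W "\<lambda>z. -1 * g z"] cholomorphic_mult[of "\<lambda>_. -1" W g] cholomorphic_const[of W "-1"]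
    cholomorphic_open[of f W] by simp

lemma cholomorphic_power: "cholomorphic f W \<Longrightarrow> cholomorphic (\<lambda>z. f z ^ k) W"
  by (induction k) (auto intro: cholomorphic_const cholomorphic_mult cholomorphic_open)

lemma cholomorphic_sum:
  "open W \<Longrightarrow> (\<And>i. i \<in> A \<Longrightarrow> cholomorphic (f i) W) \<Longrightarrow> cholomorphic (\<lambda>z. \<Sum>i\<in>A. f i z) W"
  by (induction A rule: infinite_finite_induct) (auto intro: cholomorphic_const cholomorphic_add)

lemma cholomorphic_linear_compose:
  fixes l :: "complex ^ 'a \<Rightarrow> complex ^ 'b"
  assumes f: "cholomorphic f W" and l: "bounded_linear l" "\<And>c v. l (c *s v) = c *s l v"
  shows "cholomorphic (\<lambda>z. f (l z)) (l -` W)"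
  unfolding cholomorphic_def
proof (intro conjI ballI)
  show "open (l -` W)"
    using linear_continuous_on[OF l(1)] cholomorphic_open[OF f] by (simp add: open_vimage)
  fix z assume "z \<in> l -` W"
  then obtain D where D: "(f has_derivative D) (at (l z))" "\<And>c v. D (c *s v) = c * D v"
    using f unfolding cholomorphic_def by auto
  have "((\<lambda>z. f (l z)) has_derivative (\<lambda>v. D (l v))) (at z)"
    by (rule has_derivative_compose[OF bounded_linear_imp_has_derivative[OF l(1)] D(1)])
  then show "\<exists>D. ((\<lambda>z. f (l z)) has_derivative D) (at z) \<and> (\<forall>c v. D (c *s v) = c * D v)"
    using D(2) l(2) by (intro exI[of _ "\<lambda>v. D (l v)"]) simp
qed

definition base_pt :: "complex ^ ('m option) \<Rightarrow> complex ^ 'm" where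
  "base_pt z = (\<chi> j. z $ Some j)"

lemma base_pt_join [simp]: "base_pt (join (x, t)) = x"
  by (simp add: base_pt_def join_nth vec_eq_iff)

lemma join_base_pt: "join (base_pt z, z $ None) = z"
  by (simp add: base_pt_def vec_eq_iff join_def split: option.split)

lemma bounded_linear_base_pt: "bounded_linear base_pt"
  by (rule linear_conv_bounded_linear[THEN iffD1], rule linearI) (auto simp: base_pt_def vec_eq_iff)

lemma base_pt_scale: "base_pt (c *s v) = c *s base_pt v"
  by (simp add: base_pt_def vec_eq_iff)

lemma continuous_on_base_pt: "continuous_on S base_pt"
  by (rule linear_continuous_on[OF bounded_linear_base_pt])

lemma join_Times_UNIV: "join ` (U \<times> UNIV) = base_pt -` U"
proof
  show "base_pt -` U \<subseteq> join ` (U \<times> UNIV)"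
  proof
    fix z assume "z \<in> base_pt -` U"
    then show "z \<in> join ` (U \<times> UNIV)" by (intro image_eqI[of _ _ "(base_pt z, z $ None)"]) (auto simp: join_base_pt)
  qed
qed auto

lemma continuous_on_join: "continuous_on S join"
  unfolding join_def
proof (rule continuous_on_vec_lambda)
  fix i :: "'a option"
  show "continuous_on S (\<lambda>z::(complex ^ 'a) \<times> complex. case i of None \<Rightarrow> snd z | Some j \<Rightarrow> fst z $ j)"
    by (cases i) (auto intro!: continuous_intros)
qed

definition monic_poly :: "nat \<Rightarrow> (nat \<Rightarrow> 'a \<Rightarrow> complex) \<Rightarrow> 'a \<Rightarrow> complex poly" where
  "monic_poly n b x = monom 1 n + (\<Sum>j=1..n. monom (b j x) (n - j))"

lemma poly_monic_poly: "poly (monic_poly n b x) t = monic_eval n b x t"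
  by (simp add: monic_poly_def monic_eval_def poly_sum poly_monom)

lemma coeff_monic_poly: "coeff (monic_poly n b x) i = (if i = n then 1 else if i < n then b (n - i) x else 0)"
proof -
  have "(\<Sum>j=1..n. coeff (monom (b j x) (n - j)) i) = (\<Sum>j=1..n. if j = n - i then (if i < n then b j x else 0) else 0)"
    by (rule sum.cong) auto
  also have "\<dots> = (if i < n then b (n - i) x else 0)" by (auto simp: sum.delta)
  finally show ?thesis by (auto simp: monic_poly_def coeff_sum)
qed

lemma degree_monic_poly: "degree (monic_poly n b x) = n"
  by (rule antisym) (auto intro!: degree_le le_degree simp: coeff_monic_poly)

lemma monic_poly_nonzero: "monic_poly n b x \<noteq> 0"
  by (metis coeff_monic_poly coeff_0 zero_neq_one)

lemma monic_poly_splits: "\<exists>t. monic_poly n b x = root_poly n t"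
  using poly_splits[OF degree_monic_poly monic_poly_nonzero, of n b x] by (simp add: degree_monic_poly coeff_monic_poly)

lemma finite_roots_monic_eval: "finite {t. monic_eval n b x t = 0}"
  using poly_roots_finite[OF monic_poly_nonzero[of n b x]] by (simp add: poly_monic_poly)

lemma roots_monic_eval_nonempty: "n > 0 \<Longrightarrow> \<exists>t. monic_eval n b x t = 0"
  using monic_poly_splits[of n b x] poly_root_poly_eq_0[of n] by (metis imageI lessThan_iff poly_monic_poly)

lemma cholomorphic_coeff_pderiv:
  assumes "open U" "\<And>i. cholomorphic (\<lambda>x. coeff (p x) i) U"
  shows "cholomorphic (\<lambda>x. coeff ((pderiv ^^ k) (p x)) i) U"
proof (induction k arbitrary: i)
  case (Suc k)
  then show ?case using assms(1) by (auto simp: coeff_pderiv intro!: cholomorphic_mult cholomorphic_const)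
qed (simp add: assms)

lemma iterated_pderiv_order:
  fixes p :: "complex poly"
  assumes "p \<noteq> 0"
  shows "poly ((pderiv ^^ order a p) p) a \<noteq> 0 \<and> (\<forall>j<order a p. poly ((pderiv ^^ j) p) a = 0)"
  using assms
proof (induction "order a p" arbitrary: p)
  case 0
  then show ?case by (metis funpow_0 not_less_zero order_root)
next
  case (Suc k)
  have r: "poly p a = 0" using Suc.hyps(2) Suc.prems by (metis nat.distinct(1) order_root)
  have o: "order a (pderiv p) = k" using order_pderiv[OF Suc.prems r] Suc.hyps(2) by simp
  have "pderiv p \<noteq> 0"
    using Suc.prems r by (metis degree_eq_zeroE pderiv_eq_0_iff poly_const_conv pCons_0_0)
  from Suc.hyps(1)[OF o[symmetric] this] have IH: "poly ((pderiv ^^ k) (pderiv p)) a \<noteq> 0"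
    "\<And>j. j < k \<Longrightarrow> poly ((pderiv ^^ j) (pderiv p)) a = 0" using o by auto
  have "poly ((pderiv ^^ j) p) a = 0" if "j < Suc k" for j
    using that r IH(2) by (cases j) (auto simp: funpow_Suc_right simp del: funpow.simps)
  then show ?case using IH(1) Suc.hyps(2)[symmetric] by (simp add: funpow_Suc_right del: funpow.simps)
qed

text \<open>The divided difference of \<open>p\<close> between \<open>s\<close> and
  \<open>t\<close>, in the polynomial form that makes sense for \<open>s = t\<close> as well, where
  it is the derivative.\<close>

definition diff_quot :: "complex poly \<Rightarrow> complex \<Rightarrow> complex \<Rightarrow> complex" where
  "diff_quot p s t = (\<Sum>i\<le>degree p. coeff p i * (\<Sum>l<i. t ^ (i - Suc l) * s ^ l))"

lemma poly_diff_eq_diff_quot: "poly p s - poly p t = (s - t) * diff_quot p s t"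
proof -
  have "coeff p i * s ^ i - coeff p i * t ^ i = (s - t) * (coeff p i * (\<Sum>l<i. t ^ (i - Suc l) * s ^ l))" for i
  proof -
    have "coeff p i * s ^ i - coeff p i * t ^ i = coeff p i * (s ^ i - t ^ i)" by (simp add: right_diff_distrib)
    also have "\<dots> = coeff p i * ((s - t) * (\<Sum>l<i. t ^ (i - Suc l) * s ^ l))" by (simp only: power_diff_sumr2)
    finally show ?thesis by (simp only: mult.left_commute)
  qed
  then have "poly p s - poly p t = (\<Sum>i\<le>degree p. (s - t) * (coeff p i * (\<Sum>l<i. t ^ (i - Suc l) * s ^ l)))"
    unfolding poly_altdef sum_subtractf[symmetric] by presburger
  then show ?thesis unfolding diff_quot_def by (simp only: sum_distrib_left[of "s - t"])
qed

lemma diff_quot_diag: "diff_quot p t t = poly (pderiv p) t"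
proof (rule DERIV_unique[OF _ poly_DERIV])
  show "(poly p has_field_derivative diff_quot p t t) (at t)"
    unfolding CARAT_DERIV
    by (rule exI[of _ "\<lambda>z. diff_quot p z t"]) (auto simp: poly_diff_eq_diff_quot mult.commute diff_quot_def intro!: continuous_intros)
qed

lemma diff_quot_eq: "degree p \<le> N \<Longrightarrow> diff_quot p s t = (\<Sum>i\<le>N. coeff p i * (\<Sum>l<i. t ^ (i - Suc l) * s ^ l))"
  unfolding diff_quot_def by (rule sum.mono_neutral_left) (auto simp: coeff_eq_0)

lemma degree_iterated_pderiv: "degree ((pderiv ^^ k) p) \<le> degree (p :: complex poly)"
  by (induction k) (auto simp: degree_pderiv)

text \<open>A product rule in which one factor is merely continuous, possible because the other one
  vanishes at \<open>a\<close>. In \<open>cholomorphic_implicit\<close> the continuous factor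
  contains the function whose differentiability is being proved.\<close>

lemma has_derivative_mult_vanishing:
  fixes f g :: "'a::real_normed_vector \<Rightarrow> complex"
  assumes f: "(f has_derivative D) (at a)" "f a = 0" and g: "isCont g a"
  shows "((\<lambda>x. f x * g x) has_derivative (\<lambda>h. D h * g a)) (at a)"
proof -
  interpret D: bounded_linear D using f(1) by (rule has_derivative_bounded_linear)
  have "((\<lambda>x. f x * g a) has_derivative (\<lambda>h. D h * g a)) (at a)"
    by (rule has_derivative_mult_left[OF f(1)])
  moreover have "((\<lambda>x. f x * (g x - g a)) has_derivative (\<lambda>h. 0)) (at a)"
  proof (rule has_derivativeI)
    have "((\<lambda>y. (f y - f a - D (y - a)) /\<^sub>R norm (y - a)) \<longlongrightarrow> 0) (at a)"
      using f(1) unfolding has_derivative_at_within by blast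
    then have 1: "((\<lambda>y. (f y - f a - D (y - a)) /\<^sub>R norm (y - a) * (g y - g a)) \<longlongrightarrow> 0 * (g a - g a)) (at a)"
      by (intro tendsto_intros) (use g in \<open>auto simp: isCont_def\<close>)
    obtain B where B: "\<And>h. cmod (D h) \<le> norm h * B" "B > 0" using D.pos_bounded by auto
    have 2: "((\<lambda>y. D (y - a) /\<^sub>R norm (y - a) * (g y - g a)) \<longlongrightarrow> 0) (at a)"
    proof (rule Lim_null_comparison)
      show "\<forall>\<^sub>F y in at a. cmod (D (y - a) /\<^sub>R norm (y - a) * (g y - g a)) \<le> B * cmod (g y - g a)"
      proof (rule always_eventually, rule allI)
        fix y
        have "cmod (D (y - a) /\<^sub>R norm (y - a)) \<le> B"
          using B(1)[of "y - a"] B(2) by (cases "y = a") (auto simp: divide_simps mult.commute)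
        then show "cmod (D (y - a) /\<^sub>R norm (y - a) * (g y - g a)) \<le> B * cmod (g y - g a)"
          unfolding norm_mult by (rule mult_right_mono) simp
      qed
      have "((\<lambda>y. B * cmod (g y - g a)) \<longlongrightarrow> B * cmod (g a - g a)) (at a)"
        by (intro tendsto_intros) (use g in \<open>auto simp: isCont_def\<close>)
      then show "((\<lambda>y. B * cmod (g y - g a)) \<longlongrightarrow> 0) (at a)" by simp
    qed
    have "((\<lambda>y. (f y - f a - D (y - a)) /\<^sub>R norm (y - a) * (g y - g a) + D (y - a) /\<^sub>R norm (y - a) * (g y - g a)) \<longlongrightarrow> 0) (at a)"
      using tendsto_add[OF 1 2] by simp
    then show "((\<lambda>y. (f y * (g y - g a) - f a * (g a - g a) - 0) /\<^sub>R norm (y - a)) \<longlongrightarrow> 0) (at a)"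
      by (rule Lim_transform_eventually) (auto simp: f(2) algebra_simps scaleR_conv_of_real)
  qed simp
  ultimately have "((\<lambda>x. f x * g a + f x * (g x - g a)) has_derivative (\<lambda>h. D h * g a + 0)) (at a)"
    by (rule has_derivative_add)
  then show ?thesis by (simp add: algebra_simps)
qed

text \<open>Since \<open>u x\<close> is a root,
  \<open>(u x - u y) * diff_quot (q x) (u x) (u y)\<close> equals \<open>- poly (q x) (u y)\<close>.
  Solved for \<open>u x\<close>, this shows \<open>u\<close> as a constant plus a holomorphic
  function vanishing at \<open>y\<close> times a continuous one.\<close>

lemma cholomorphic_implicit:
  assumes c: "\<And>i. cholomorphic (\<lambda>x. coeff (q x) i) V" and V: "open V" and deg: "\<And>x. degree (q x) \<le> N"
    and u: "continuous_on V u" "\<And>x. x \<in> V \<Longrightarrow> poly (q x) (u x) = 0"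
    and nz: "\<And>x y. x \<in> V \<Longrightarrow> y \<in> V \<Longrightarrow> diff_quot (q x) (u x) (u y) \<noteq> 0"
  shows "cholomorphic u V"
  unfolding cholomorphic_def
proof (intro conjI ballI V)
  fix y assume y: "y \<in> V"
  define f where "f x = poly (q x) (u y)" for x
  have f_eq: "f x = (\<Sum>i\<le>N. coeff (q x) i * u y ^ i)" for x
    unfolding f_def poly_altdef by (rule sum.mono_neutral_left) (use deg in \<open>auto simp: coeff_eq_0\<close>)
  have "cholomorphic f V" unfolding f_eq
    by (intro cholomorphic_sum cholomorphic_mult c cholomorphic_const V)
  then obtain D where D: "(f has_derivative D) (at y)" "\<And>c v. D (c *s v) = c * D v"
    using y unfolding cholomorphic_def by blast
  define g where "g x = - 1 / diff_quot (q x) (u x) (u y)" for x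
  have "continuous_on V g" unfolding g_def
  proof (intro continuous_intros)
    have "continuous_on V (\<lambda>x. \<Sum>i\<le>N. coeff (q x) i * (\<Sum>l<i. u y ^ (i - Suc l) * u x ^ l))"
      by (intro continuous_intros u cholomorphic_continuous[OF c])
    then show "continuous_on V (\<lambda>x. diff_quot (q x) (u x) (u y))" using diff_quot_eq[OF deg] by simp
    show "\<forall>x\<in>V. diff_quot (q x) (u x) (u y) \<noteq> 0" using nz y by blast
  qed
  then have g: "isCont g y" using y V by (simp add: continuous_on_eq_continuous_at)
  have "((\<lambda>x. f x * g x) has_derivative (\<lambda>h. D h * g y)) (at y)"
    by (rule has_derivative_mult_vanishing[OF D(1) _ g]) (simp add: f_def u(2) y)
  then have "((\<lambda>x. u y + f x * g x) has_derivative (\<lambda>h. D h * g y)) (at y)"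
    using has_derivative_add_const[of "\<lambda>x. f x * g x"] by (simp add: add.commute has_derivative_add_const)
  then have "(u has_derivative (\<lambda>h. D h * g y)) (at y)"
  proof (rule has_derivative_transform_within_open[OF _ V y])
    fix x assume x: "x \<in> V"
    have "(u x - u y) * diff_quot (q x) (u x) (u y) = - f x"
      using poly_diff_eq_diff_quot[of "q x" "u x" "u y"] u(2)[OF x] by (simp add: f_def)
    then show "u y + f x * g x = u x" using nz[OF x y] by (simp add: g_def field_simps)
  qed
  then show "\<exists>D. (u has_derivative D) (at y) \<and> (\<forall>c v. D (c *s v) = c * D v)"
    using D(2) by (intro exI[of _ "\<lambda>h. D h * g y"]) simp
qed

lemma continuous_on_coeff_poly:
  fixes q :: "'a::topological_space \<Rightarrow> complex poly"
  assumes "\<And>i. continuous_on V (\<lambda>x. coeff (q x) i)" "\<And>x. degree (q x) \<le> N"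
  shows "continuous_on V (\<lambda>x. poly (q x) t)"
proof -
  have "poly (q x) t = (\<Sum>i\<le>N. coeff (q x) i * t ^ i)" for x
    unfolding poly_altdef by (rule sum.mono_neutral_left) (use assms in \<open>auto simp: coeff_eq_0\<close>)
  then show ?thesis using assms(1) by (auto intro!: continuous_intros)
qed

text \<open>The shear that subtracts \<open>u\<close> from the last coordinate straightens the
  graph; adding \<open>u\<close> is its inverse.\<close>

lemma complex_submanifold_graph:
  fixes u :: "complex ^ 'm \<Rightarrow> complex"
  assumes u: "cholomorphic u V" and V: "V \<noteq> {}"
  shows "complex_submanifold CARD('m) (join ` {(x, t). x \<in> V \<and> t = u x})"
  unfolding complex_submanifold_def
proof (intro conjI ballI)
  show "join ` {(x, t). x \<in> V \<and> t = u x} \<noteq> {}" using V by auto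
  fix a assume a: "a \<in> join ` {(x, t). x \<in> V \<and> t = u x}"
  define W where "W = base_pt -` V"
  define f where "f z = join (base_pt z, z $ None - u (base_pt z))" for z
  define g where "g z = join (base_pt z, z $ None + u (base_pt z))" for z
  have W: "open W" unfolding W_def using cholomorphic_open[OF u] continuous_on_base_pt by (rule open_vimage)
  have fg: "f (g z) = z" "g (f z) = z" for z by (auto simp: f_def g_def join_nth join_base_pt)
  have inj: "inj_on f W" by (metis fg(2) inj_onI)
  have fW: "f ` W = W"
  proof
    show "f ` W \<subseteq> W" by (auto simp: f_def W_def)
    show "W \<subseteq> f ` W"
    proof
      fix z assume "z \<in> W"
      then have "g z \<in> W" by (simp add: W_def g_def)
      then have "f (g z) \<in> f ` W" by (rule imageI)
      then show "z \<in> f ` W" by (simp only: fg(1))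
    qed
  qed
  have inv: "inv_into W f z = g z" if "z \<in> W" for z
    by (rule inv_into_f_eq[OF inj _ fg(1)]) (use that in \<open>simp add: W_def g_def\<close>)
  have uW: "cholomorphic (\<lambda>z. u (base_pt z)) W"
    unfolding W_def by (rule cholomorphic_linear_compose[OF u bounded_linear_base_pt base_pt_scale])
  have f: "cholomorphic (\<lambda>z. f z $ i) W" for i
    using W uW by (cases i) (auto simp: f_def join_nth base_pt_def intro!: cholomorphic_coord cholomorphic_diff)
  have "cholomorphic (\<lambda>z. g z $ i) W" for i
    using W uW by (cases i) (auto simp: g_def join_nth base_pt_def intro!: cholomorphic_coord cholomorphic_add)
  then have g: "cholomorphic (\<lambda>z. inv_into W f z $ i) W" for i
    by (rule cholomorphic_cong) (simp add: inv)
  have "biholomorphic_on f W"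
    unfolding biholomorphic_on_def cholomorphic_map_def fW using inj f g by blast
  moreover have "z \<in> join ` {(x, t). x \<in> V \<and> t = u x} \<longleftrightarrow> (\<forall>i. i \<notin> range Some \<longrightarrow> f z $ i = 0)" if "z \<in> W" for z
  proof -
    have "z \<in> join ` {(x, t). x \<in> V \<and> t = u x} \<longleftrightarrow> z $ None = u (base_pt z)"
    proof -
      have "z \<in> join ` {(x, t). x \<in> V \<and> t = u x} \<longleftrightarrow> join (base_pt z, z $ None) \<in> join ` {(x, t). x \<in> V \<and> t = u x}"
        by (simp add: join_base_pt)
      also have "\<dots> \<longleftrightarrow> z $ None = u (base_pt z)" unfolding join_in_image using that by (auto simp: W_def)
      finally show ?thesis .
    qed
    also have "\<dots> \<longleftrightarrow> (\<forall>i. i \<notin> range Some \<longrightarrow> f z $ i = 0)"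
      by (metis f_def join_nth(1) notin_range_Some eq_iff_diff_eq_0)
    finally show ?thesis .
  qed
  moreover have "card (range (Some :: 'm \<Rightarrow> 'm option)) = CARD('m)" by (simp add: card_image)
  moreover have "a \<in> W" using a by (auto simp: W_def)
  ultimately show "\<exists>W f S. open W \<and> a \<in> W \<and> biholomorphic_on f W \<and> card S = CARD('m) \<and>
        (\<forall>z\<in>W. z \<in> join ` {(x, t). x \<in> V \<and> t = u x} \<longleftrightarrow> (\<forall>i. i \<notin> S \<longrightarrow> f z $ i = 0))"
    using W by (intro exI[of _ W] exI[of _ f] exI[of _ "range Some"]) blast
qed

lemma monic_eval_roots_bounded:
  assumes "compact C" "n > 0" "\<And>i. continuous_on C (\<lambda>x. coeff (monic_poly n b x) i)"
  shows "\<exists>M\<ge>0. \<forall>x\<in>C. \<forall>t. monic_eval n b x t = 0 \<longrightarrow> cmod t \<le> M"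
proof -
  have "\<exists>B\<ge>0. \<forall>x\<in>C. cmod (coeff (monic_poly n b x) i) \<le> B" for i
  proof -
    have "compact ((\<lambda>x. coeff (monic_poly n b x) i) ` C)"
      by (intro compact_continuous_image assms)
    then obtain B where "B > 0" "\<forall>y\<in>(\<lambda>x. coeff (monic_poly n b x) i) ` C. cmod y \<le> B"
      using compact_imp_bounded bounded_pos by metis
    then show ?thesis by (intro exI[of _ B]) auto
  qed
  then have "\<forall>i. \<exists>B. B \<ge> 0 \<and> (\<forall>x\<in>C. cmod (coeff (monic_poly n b x) i) \<le> B)" by blast
  from choice[OF this] obtain B where B: "\<And>i. B i \<ge> 0" "\<And>i x. x \<in> C \<Longrightarrow> cmod (coeff (monic_poly n b x) i) \<le> B i" by blast
  have "cmod t \<le> 1 + n * (\<Sum>i<n. B i)" if x: "x \<in> C" and t: "monic_eval n b x t = 0" for x t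
  proof (rule monic_root_bound[where c="coeff (monic_poly n b x)"])
    have "poly (monic_poly n b x) t = 0" using t by (simp add: poly_monic_poly)
    then show "t ^ n + (\<Sum>i<n. coeff (monic_poly n b x) i * t ^ i) = 0"
      by (simp add: poly_altdef degree_monic_poly coeff_monic_poly add.commute flip: lessThan_Suc_atMost)
    show "cmod (coeff (monic_poly n b x) i) \<le> (\<Sum>i<n. B i)" if "i < n" for i
      using B(2)[OF x, of i] member_le_sum[of i "{..<n}" B] that B(1) by force
  qed (use B assms(2) in \<open>auto intro: sum_nonneg\<close>)
  moreover have "0 \<le> 1 + n * (\<Sum>i<n. B i)" using B(1) by (intro add_nonneg_nonneg mult_nonneg_nonneg sum_nonneg) auto
  ultimately show ?thesis by blast
qed

section \<open>Analyticity, properness and dimension of the zero set\<close>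

locale monic_family =
  fixes U :: "(complex ^ 'm) set" and n :: nat and b :: "nat \<Rightarrow> complex ^ 'm \<Rightarrow> complex"
  assumes U: "open U" and n: "n > 0" and b: "\<And>j. j \<in> {1..n} \<Longrightarrow> cholomorphic (b j) U"
begin

definition X where "X = {(x, t). x \<in> U \<and> monic_eval n b x t = 0}"

lemma coeff_cholomorphic: "cholomorphic (\<lambda>x. coeff (monic_poly n b x) i) U"
proof (cases "i < n")
  case True
  then show ?thesis using b[of "n - i"] by (simp add: coeff_monic_poly)
next
  case False
  then show ?thesis using cholomorphic_const[OF U, of 1] cholomorphic_const[OF U, of 0] by (cases "i = n") (auto simp: coeff_monic_poly)
qed

lemma monic_eval_continuous: "continuous_on (U \<times> UNIV) (\<lambda>z. monic_eval n b (fst z) (snd z))"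
  unfolding monic_eval_def
proof (intro continuous_intros)
  fix j assume "j \<in> {1..n}"
  then have "continuous_on U (b j)" using b cholomorphic_continuous by blast
  then show "continuous_on (U \<times> UNIV) (\<lambda>z. b j (fst z))"
    by (rule continuous_on_compose2) (auto intro: continuous_intros)
qed

lemma analytic_X: "analytic_subset (join ` (U \<times> UNIV)) (join ` X)"
  unfolding analytic_subset_def
proof (intro conjI ballI)
  let ?W = "base_pt -` U"
  have W: "open ?W" using U continuous_on_base_pt by (rule open_vimage)
  show "open (join ` (U \<times> UNIV))" using W by (simp add: join_Times_UNIV)
  show "join ` X \<subseteq> join ` (U \<times> UNIV)" by (auto simp: X_def)
  fix a assume "a \<in> join ` (U \<times> UNIV)"
  then have a: "a \<in> ?W" by (simp add: join_Times_UNIV)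
  define G where "G z = monic_eval n b (base_pt z) (z $ None)" for z
  have "cholomorphic G ?W"
    unfolding G_def monic_eval_def
    by (intro cholomorphic_add cholomorphic_sum cholomorphic_mult cholomorphic_power cholomorphic_coord W
        cholomorphic_linear_compose[OF _ bounded_linear_base_pt base_pt_scale] b)
  moreover have "join ` X \<inter> ?W = {z\<in>?W. G z = 0}"
  proof -
    have "z \<in> join ` X \<longleftrightarrow> G z = 0" if "z \<in> ?W" for z
      using join_in_image[of "(base_pt z, z $ None)" X] that by (auto simp: join_base_pt X_def G_def)
    then show ?thesis by blast
  qed
  ultimately show "\<exists>W G. open W \<and> a \<in> W \<and> W \<subseteq> join ` (U \<times> UNIV) \<and> finite G \<and> (\<forall>g\<in>G. cholomorphic g W) \<and>
        join ` X \<inter> W = {z\<in>W. \<forall>g\<in>G. g z = 0}"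
    using W a by (intro exI[of _ ?W] exI[of _ "{G}"]) (simp add: join_Times_UNIV)
qed

lemma roots_bounded:
  assumes "compact C" "C \<subseteq> U"
  shows "\<exists>M\<ge>0. \<forall>x\<in>C. \<forall>t. monic_eval n b x t = 0 \<longrightarrow> cmod t \<le> M"
  by (rule monic_eval_roots_bounded[OF assms(1) n])
    (rule continuous_on_subset[OF cholomorphic_continuous[OF coeff_cholomorphic] assms(2)])

lemma proper_projection_X: "proper_projection X U"
  unfolding proper_projection_def
proof
  show "fst ` X = U"
    using roots_monic_eval_nonempty[OF n] by (force simp: X_def)
  show "proper_map (top_of_set X) (top_of_set U) fst"
  proof (rule compact_imp_proper_map)
    show "k_space (top_of_set U)"
      by (intro metrizable_imp_k_space metrizable_space_subtopology metrizable_space_euclidean)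
    show "kc_space (top_of_set U)"
      by (intro Hausdorff_imp_kc_space Hausdorff_space_subtopology Hausdorff_space_euclidean)
    show "fst \<in> topspace (top_of_set X) \<rightarrow> topspace (top_of_set U)" by (auto simp: X_def)
    show "continuous_map (top_of_set X) (top_of_set U) fst \<or> kc_space (top_of_set X)"
      by (rule disjI2) (intro Hausdorff_imp_kc_space Hausdorff_space_subtopology Hausdorff_space_euclidean)
    fix C assume "compactin (top_of_set U) C"
    then have C: "compact C" "C \<subseteq> U" by (auto simp: compactin_subtopology)
    obtain M where M: "\<And>x t. x \<in> C \<Longrightarrow> monic_eval n b x t = 0 \<Longrightarrow> cmod t \<le> M" using roots_bounded[OF C] by blast
    have cl: "closed (C \<times> cball (0::complex) M)" "compact (C \<times> cball (0::complex) M)"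
      using C by (auto intro!: closed_Times compact_imp_closed compact_Times)
    have "continuous_on (C \<times> cball 0 M) (\<lambda>z. monic_eval n b (fst z) (snd z))"
      by (rule continuous_on_subset[OF monic_eval_continuous]) (use C in auto)
    from continuous_closed_preimage_constant[OF this cl(1), of 0]
    have "compact (C \<times> cball 0 M \<inter> {z \<in> C \<times> cball 0 M. monic_eval n b (fst z) (snd z) = 0})"
      by (rule compact_Int_closed[OF cl(2)])
    moreover have "C \<times> cball 0 M \<inter> {z \<in> C \<times> cball 0 M. monic_eval n b (fst z) (snd z) = 0} = {x \<in> X. fst x \<in> C}"
      using C M by (auto simp: X_def)
    ultimately show "compactin (top_of_set X) {x \<in> topspace (top_of_set X). fst x \<in> C}"
      by (auto simp: compactin_subtopology)
  qed
qed

text \<open>At a nearby root of the least multiplicity \<mu>, the derivative of order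
  \<open>\<mu> - 1\<close> has a simple root and vanishes at all neighbouring points of
  \<open>X\<close>, whose multiplicities are at least \<mu>. So \<open>X\<close> is a graph there,
  even where the polynomial has multiple roots throughout. A graph near the given point is
  sufficient, since \<open>local_dim\<close> asks only for submanifolds in every
  neighbourhood.\<close>

lemma local_graph:
  assumes "(x0, t0) \<in> X" "open W" "(x0, t0) \<in> W"
  obtains u V where "cholomorphic u V" "V \<noteq> {}" "V \<subseteq> U" "{(x, t). x \<in> V \<and> t = u x} \<subseteq> X \<inter> W"
proof -
  have "open (W \<inter> U \<times> UNIV)" using assms U by (auto intro: open_Times)
  moreover have "(x0, t0) \<in> W \<inter> U \<times> UNIV" using assms by (auto simp: X_def)
  ultimately obtain A B where AB: "open A" "open B" "(x0, t0) \<in> A \<times> B" "A \<times> B \<subseteq> W \<inter> U \<times> UNIV"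
    by (rule open_prod_elim)
  define P where "P \<mu> \<longleftrightarrow> (\<exists>x\<in>A. \<exists>t\<in>B. poly (monic_poly n b x) t = 0 \<and> order t (monic_poly n b x) = \<mu>)" for \<mu>
  have "\<exists>\<mu>. P \<mu>" using assms(1) AB(3) unfolding P_def by (auto simp: X_def poly_monic_poly)
  define \<mu> where "\<mu> = (LEAST \<mu>. P \<mu>)"
  have "P \<mu>" unfolding \<mu>_def using \<open>\<exists>\<mu>. P \<mu>\<close> by (rule LeastI_ex)
  then obtain x1 t1 where 1: "x1 \<in> A" "t1 \<in> B" "poly (monic_poly n b x1) t1 = 0" "order t1 (monic_poly n b x1) = \<mu>"
    unfolding P_def by blast
  have min: "\<mu> \<le> order t (monic_poly n b x)" if "x \<in> A" "t \<in> B" "poly (monic_poly n b x) t = 0" for x t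
    unfolding \<mu>_def by (rule Least_le) (use that in \<open>auto simp: P_def\<close>)
  have \<mu>: "\<mu> > 0" using 1 monic_poly_nonzero by (metis gr_zeroI order_root)
  define q where "q x = (pderiv ^^ (\<mu> - 1)) (monic_poly n b x)" for x
  have qc: "cholomorphic (\<lambda>x. coeff (q x) i) U" for i
    unfolding q_def by (rule cholomorphic_coeff_pderiv[OF U coeff_cholomorphic])
  have qd: "degree (q x) \<le> n" for x
    using degree_iterated_pderiv[of "\<mu> - 1" "monic_poly n b x"] by (simp add: q_def degree_monic_poly)
  have q0: "poly (q x) t = 0" if "x \<in> A" "t \<in> B" "poly (monic_poly n b x) t = 0" for x t
    using iterated_pderiv_order[OF monic_poly_nonzero, of t n b x] min[OF that] \<mu> by (simp add: q_def)
  have "poly ((pderiv ^^ \<mu>) (monic_poly n b x1)) t1 \<noteq> 0"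
    using iterated_pderiv_order[OF monic_poly_nonzero, of t1 n b x1] 1(4) by simp
  then have "poly (pderiv (q x1)) t1 \<noteq> 0" using \<mu> by (cases \<mu>) (auto simp: q_def)
  then have nz1: "diff_quot (q x1) t1 t1 \<noteq> 0" by (simp add: diff_quot_diag)
  define H where "H z = diff_quot (q (fst z)) (fst (snd z)) (snd (snd z))" for z
  have AU: "A \<subseteq> U" using AB(3,4) by auto
  have "continuous_on (A \<times> B \<times> B) H"
    unfolding H_def diff_quot_eq[OF qd]
  proof (intro continuous_intros)
    fix i
    show "continuous_on (A \<times> B \<times> B) (\<lambda>z. coeff (q (fst z)) i)"
      by (rule continuous_on_compose2[OF cholomorphic_continuous[OF qc]]) (use AU in \<open>auto intro: continuous_intros\<close>)
  qed
  moreover have oABB: "open (A \<times> B \<times> B)" using AB by (intro open_Times)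
  moreover have "open (- {0 :: complex})" by (rule open_Compl) simp
  ultimately have "open (H -` (- {0}) \<inter> A \<times> B \<times> B)"
    using continuous_open_preimage[of "A \<times> B \<times> B" H "- {0}"] by (simp add: Int_commute)
  moreover have "(x1, t1, t1) \<in> H -` (- {0}) \<inter> A \<times> B \<times> B" using 1 nz1 by (simp add: H_def)
  ultimately obtain A1 T where A1: "open A1" "open T" "(x1, t1, t1) \<in> A1 \<times> T" "A1 \<times> T \<subseteq> H -` (- {0}) \<inter> A \<times> B \<times> B"
    by (rule open_prod_elim)
  obtain B1 B2 where B12: "open B1" "open B2" "(t1, t1) \<in> B1 \<times> B2" "B1 \<times> B2 \<subseteq> T"
    using open_prod_elim[OF A1(2), of "(t1, t1)"] A1(3) by blast
  define B' where "B' = B1 \<inter> B2"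
  have B': "open B'" "t1 \<in> B'" using B12 by (auto simp: B'_def)
  have sub: "A1 \<times> B' \<times> B' \<subseteq> H -` (- {0}) \<inter> A \<times> B \<times> B" using A1 B12 by (auto simp: B'_def)
  then have HB: "diff_quot (q x) s t \<noteq> 0" if "x \<in> A1" "s \<in> B'" "t \<in> B'" for x s t
    using that by (force simp: H_def)
  have AA: "A1 \<subseteq> A" "B' \<subseteq> B" using sub B'(2) A1(3) by auto
  \<comment> \<open>Existence of roots near a given one: a value below \<open>e ^ n\<close> of a
    monic polynomial of degree \<open>n\<close> implies a root at distance less than
    \<open>e\<close>.\<close>
  have near: "\<exists>V. open V \<and> x2 \<in> V \<and> (\<forall>x\<in>V. \<exists>t\<in>ball t2 e. poly (monic_poly n b x) t = 0)"
    if "x2 \<in> U" "poly (monic_poly n b x2) t2 = 0" "e > 0" for x2 t2 e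
  proof -
    have "continuous_on U (\<lambda>x. poly (monic_poly n b x) t2)"
      by (rule continuous_on_coeff_poly[where N=n]) (use cholomorphic_continuous[OF coeff_cholomorphic] in \<open>auto simp: degree_monic_poly\<close>)
    then have "open ((\<lambda>x. poly (monic_poly n b x) t2) -` ball 0 (e ^ n) \<inter> U)"
      using continuous_open_preimage[OF _ U open_ball[of 0 "e ^ n"]] by (simp add: Int_commute)
    moreover have "\<exists>t\<in>ball t2 e. poly (monic_poly n b x) t = 0" if x: "cmod (poly (monic_poly n b x) t2) < e ^ n" for x
    proof -
      obtain s where s: "monic_poly n b x = root_poly n s" using monic_poly_splits[of n b x] by blast
      obtain i where "i < n" "cmod (t2 - s i) < e" using nearby_root[OF \<open>e > 0\<close>, of n s t2] x s by auto
      then show ?thesis using poly_root_poly_eq_0[of n s "s i"] s by (intro bexI[of _ "s i"]) (auto simp: dist_norm)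
    qed
    ultimately show ?thesis
      using that by (intro exI[of _ "(\<lambda>x. poly (monic_poly n b x) t2) -` ball 0 (e ^ n) \<inter> U"]) auto
  qed
  obtain \<rho> where \<rho>: "\<rho> > 0" "ball t1 \<rho> \<subseteq> B'" using B' open_contains_ball by blast
  obtain V1 where V1: "open V1" "x1 \<in> V1" "\<forall>x\<in>V1. \<exists>t\<in>ball t1 \<rho>. poly (monic_poly n b x) t = 0"
    using near[of x1 t1 \<rho>] 1 AU \<rho>(1) by blast
  define V where "V = V1 \<inter> A1"
  have V: "open V" "x1 \<in> V" "V \<subseteq> A1" using V1 A1 by (auto simp: V_def)
  have "\<forall>x\<in>V. \<exists>t. t \<in> ball t1 \<rho> \<and> poly (monic_poly n b x) t = 0" using V1(3) unfolding V_def by blast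
  from bchoice[OF this] obtain u where u: "\<And>x. x \<in> V \<Longrightarrow> u x \<in> ball t1 \<rho>" "\<And>x. x \<in> V \<Longrightarrow> poly (monic_poly n b x) (u x) = 0"
    by blast
  have uniq: "t = u x" if "x \<in> V" "t \<in> B'" "poly (monic_poly n b x) t = 0" for x t
  proof -
    have ux: "u x \<in> B'" using u(1)[OF that(1)] \<rho> by blast
    have AB': "x \<in> A1" "x \<in> A" "t \<in> B" "u x \<in> B" using that V AA ux by auto
    have "(t - u x) * diff_quot (q x) t (u x) = 0"
      using poly_diff_eq_diff_quot[of "q x" t "u x"] q0[OF AB'(2,3) that(3)] q0[OF AB'(2,4) u(2)[OF that(1)]] by simp
    then show ?thesis using HB[OF AB'(1) that(2) ux] by simp
  qed
  have "continuous_on V u"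
  proof (rule continuous_at_imp_continuous_on, rule ballI)
    fix x2 assume x2: "x2 \<in> V"
    show "isCont u x2"
    proof (rule continuous_at_open[THEN iffD2], intro allI impI)
      fix T' assume T': "open T' \<and> u x2 \<in> T'"
      have "open (T' \<inter> B')" "u x2 \<in> T' \<inter> B'" using T' B'(1) u(1)[OF x2] \<rho> by auto
      then obtain e where e: "e > 0" "ball (u x2) e \<subseteq> T' \<inter> B'" using open_contains_ball by blast
      obtain V2 where V2: "open V2" "x2 \<in> V2" "\<forall>x\<in>V2. \<exists>t\<in>ball (u x2) e. poly (monic_poly n b x) t = 0"
        using near[of x2 "u x2" e] u(2)[OF x2] x2 V AA AU e(1) by blast
      have "u x \<in> T'" if x: "x \<in> V2 \<inter> V" for x
      proof -
        obtain t where t: "t \<in> ball (u x2) e" "poly (monic_poly n b x) t = 0" using V2(3) x by blast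
        then have "t \<in> T'" "t \<in> B'" using e(2) by blast+
        then show ?thesis using uniq[OF IntD2[OF x] _ t(2)] by simp
      qed
      then have "\<forall>x'\<in>V2 \<inter> V. u x' \<in> T'" by blast
      moreover have "open (V2 \<inter> V)" "x2 \<in> V2 \<inter> V" using V2 V x2 by auto
      ultimately show "\<exists>S. open S \<and> x2 \<in> S \<and> (\<forall>x'\<in>S. u x' \<in> T')" by blast
    qed
  qed
  have uB: "u x \<in> B'" if "x \<in> V" for x using u(1)[OF that] \<rho> by blast
  have "cholomorphic u V"
  proof (rule cholomorphic_implicit[where q=q and N=n])
    show "cholomorphic (\<lambda>x. coeff (q x) i) V" for i
      by (rule cholomorphic_subset[OF qc V(1)]) (use V AA AU in blast)
    show "diff_quot (q x) (u x) (u y) \<noteq> 0" if "x \<in> V" "y \<in> V" for x y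
      by (rule HB) (use uB[OF that(1)] uB[OF that(2)] that V(3) in auto)
    show "open V" by (rule V(1))
    show "degree (q x) \<le> n" for x by (rule qd)
    show "continuous_on V u" by fact
    show "poly (q x) (u x) = 0" if "x \<in> V" for x
      by (rule q0) (use u(2)[OF that] uB[OF that] that V(3) AA in auto)
  qed
  moreover have "{(x, t). x \<in> V \<and> t = u x} \<subseteq> X \<inter> W"
  proof clarify
    fix x assume x: "x \<in> V"
    have xA: "x \<in> A" using x V(3) AA by blast
    have uxB: "u x \<in> B" using uB[OF x] AA by blast
    have "x \<in> U" using xA AU by blast
    moreover have "(x, u x) \<in> W" using AB(4) xA uxB by blast
    ultimately show "(x, u x) \<in> X \<inter> W" using u(2)[OF x] by (simp add: X_def poly_monic_poly)
  qed
  ultimately show ?thesis 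
    by (intro that[of u V]) (use V AA AU in \<open>assumption | blast\<close>)+
qed

lemma pure_dimensional_X: "pure_dimensional CARD('m) (join ` X)"
  unfolding pure_dimensional_def local_dim_def
proof
  fix a assume "a \<in> join ` X"
  then obtain x0 t0 where a: "a = join (x0, t0)" "(x0, t0) \<in> X" by auto
  let ?S = "{k. \<forall>W. open W \<and> a \<in> W \<longrightarrow> (\<exists>M. complex_submanifold k M \<and> M \<subseteq> join ` X \<inter> W)}"
  have le: "k \<le> CARD('m)" if k: "k \<in> ?S" for k
  proof (rule ccontr)
    assume gt: "\<not> k \<le> CARD('m)"
    from spec[OF CollectD[OF k], of UNIV] obtain M where M: "complex_submanifold k M" "M \<subseteq> join ` X" by auto
    then obtain z where z: "z \<in> M" unfolding complex_submanifold_def by blast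
    from M(1) z obtain W S and f :: "complex ^ 'm option \<Rightarrow> complex ^ 'm option" where W: "open W" "z \<in> W" "card S = k"
      "\<And>z. z \<in> W \<Longrightarrow> z \<in> M \<longleftrightarrow> (\<forall>i. i \<notin> S \<longrightarrow> f z $ i = 0)"
      unfolding complex_submanifold_def by metis
    \<comment> \<open>Too large a dimension leaves no equations: the submanifold would contain an
      open set, and some vertical line would meet \<open>X\<close> in infinitely many
      points.\<close>
    have "CARD('m option) \<le> card S" using gt W(3) by simp
    then have "S = UNIV" by (metis card_seteq finite subset_UNIV)
    then have "W \<subseteq> M" using W(4) by blast
    then have WX: "W \<subseteq> join ` X" using M(2) by blast
    obtain x t where xt: "z = join (x, t)" using join_surj by blast
    have "continuous_on UNIV (\<lambda>s. join (x, s))"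
      by (rule continuous_on_compose2[OF continuous_on_join[of UNIV]]) (auto intro: continuous_intros)
    then have "open ((\<lambda>s. join (x, s)) -` W)" using W(1) by (simp add: open_vimage)
    moreover have "t \<in> (\<lambda>s. join (x, s)) -` W" using xt W(2) by simp
    ultimately obtain e where e: "e > 0" "ball t e \<subseteq> (\<lambda>s. join (x, s)) -` W"
      using open_contains_ball by blast
    have "ball t e \<subseteq> {s. monic_eval n b x s = 0}"
    proof
      fix s assume "s \<in> ball t e"
      then have "join (x, s) \<in> join ` X" using e(2) WX by blast
      then show "s \<in> {s. monic_eval n b x s = 0}" by (simp add: join_in_image X_def)
    qed
    then have "finite (ball t e)" by (rule finite_subset[OF _ finite_roots_monic_eval])
    then show False using e(1) finite_imp_not_open[of "ball t e"] by simp
  qed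
  moreover have "CARD('m) \<in> ?S"
  proof (clarify)
    fix W assume W: "open W" "a \<in> W"
    have "open (join -` W)" using W(1) continuous_on_join by (rule open_vimage)
    then obtain u V where "cholomorphic u V" "V \<noteq> {}" "V \<subseteq> U" "{(x, t). x \<in> V \<and> t = u x} \<subseteq> X \<inter> join -` W"
      using local_graph[OF a(2), of "join -` W"] W(2) a(1) by blast
    then show "\<exists>M. complex_submanifold CARD('m) M \<and> M \<subseteq> join ` X \<inter> W"
      by (intro exI[of _ "join ` {(x, t). x \<in> V \<and> t = u x}"] conjI complex_submanifold_graph) auto
  qed
  moreover have "finite ?S" using le finite_nat_set_iff_bounded_le by blast
  ultimately show "Max ?S = CARD('m)" by (intro Max_eqI) auto
qed

end

section \<open>Extension of the coefficients\<close>

lemma proots_root_poly: "proots (root_poly n s) = image_mset s (mset_set {..<n})"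
  by (simp add: root_poly_def proots_prod sum_unfold_sum_mset image_mset.compositionality o_def)

lemma root_poly_eq_imp_prod_eq:
  assumes "root_poly n s = root_poly n t"
  shows "(\<Prod>l<n. f (s l)) = (\<Prod>l<n. f (t l))"
proof -
  have *: "(\<Prod>l<n. f (s l)) = prod_mset (image_mset f (proots (root_poly n s)))" for s :: "nat \<Rightarrow> complex"
    by (simp add: proots_root_poly prod_unfold_prod_mset image_mset.compositionality o_def)
  show ?thesis unfolding * assms ..
qed

lemma root_poly_eq_imp_image_eq: "root_poly n s = root_poly n t \<Longrightarrow> s ` {..<n} = t ` {..<n}"
  using poly_root_poly_eq_0[of n s] poly_root_poly_eq_0[of n t] by auto

lemma root_poly_distinct:
  assumes "card (s ` {..<n}) = n"
  shows "root_poly n s = (\<Prod>u\<in>s ` {..<n}. [:- u, 1:])"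
proof -
  have "inj_on s {..<n}" using assms by (intro eq_card_imp_inj_on) auto
  then show ?thesis unfolding root_poly_def by (simp add: prod.reindex)
qed

lemma finite_separated:
  fixes S :: "'a::metric_space set"
  assumes "finite S"
  shows "\<exists>\<delta>>0. \<forall>u\<in>S. \<forall>v\<in>S. u \<noteq> v \<longrightarrow> 2 * \<delta> \<le> dist u v"
proof -
  \<comment> \<open>The element 1 keeps the set nonempty when \<open>S\<close> has fewer than two
    points.\<close>
  define D where "D = insert 1 ((\<lambda>(u, v). dist u v) ` {(u, v) \<in> S \<times> S. u \<noteq> v})"
  have f: "finite D" "D \<noteq> {}" using assms by (auto simp: D_def intro: finite_subset[of _ "S \<times> S"])
  have "Min D > 0" using Min_in[OF f] by (auto simp: D_def)
  moreover have "Min D \<le> dist u v" if "u \<in> S" "v \<in> S" "u \<noteq> v" for u v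
    using f(1) that by (intro Min_le) (auto simp: D_def)
  ultimately show ?thesis by (intro exI[of _ "Min D / 2"]) auto
qed

lemma bounded_lists_convergent_subsequence:
  fixes A :: "nat \<Rightarrow> nat \<Rightarrow> complex"
  assumes "\<And>i l. l < N \<Longrightarrow> cmod (A i l) \<le> M"
  shows "\<exists>r \<sigma>. strict_mono r \<and> (\<forall>l<N. (\<lambda>i. A (r i) l) \<longlonglongrightarrow> \<sigma> l)"
  using assms
proof (induction N)
  case 0
  then show ?case using strict_mono_id by blast
next
  case (Suc N)
  then obtain r \<sigma> where r: "strict_mono r" "\<And>l. l < N \<Longrightarrow> (\<lambda>i. A (r i) l) \<longlonglongrightarrow> \<sigma> l" by fastforce
  have "\<forall>i. A (r i) N \<in> cball 0 M" using Suc.prems by simp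
  then obtain w r' where r': "strict_mono (r' :: nat \<Rightarrow> nat)" "((\<lambda>i. A (r i) N) \<circ> r') \<longlonglongrightarrow> w"
    using compact_imp_seq_compact[OF compact_cball[of 0 M]] unfolding seq_compact_def by metis
  have "(\<lambda>i. A ((r \<circ> r') i) l) \<longlonglongrightarrow> (\<sigma>(N := w)) l" if "l < Suc N" for l
  proof (cases "l = N")
    case True
    then show ?thesis using r'(2) by (simp add: o_def)
  next
    case False
    then show ?thesis using LIMSEQ_subseq_LIMSEQ[OF r(2) r'(1), of l] that by (simp add: o_def)
  qed
  then show ?case using strict_mono_o[OF r(1) r'(1)] by blast
qed

text \<open>As long as no two distinct values merge in the limit, multiplicities are preserved.\<close>

lemma root_multiplicities_eq_of_limit:
  fixes A B :: "nat \<Rightarrow> nat \<Rightarrow> complex"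
  assumes A: "\<And>l. l < n \<Longrightarrow> (\<lambda>i. A i l) \<longlonglongrightarrow> \<sigma> l" and B: "\<And>l. l < n \<Longrightarrow> (\<lambda>i. B i l) \<longlonglongrightarrow> \<tau> l"
    and AB: "\<And>i. A i ` {..<n} = B i ` {..<n}" "\<And>i. card (A i ` {..<n}) \<le> card (\<sigma> ` {..<n})"
    and st: "root_poly n \<sigma> = root_poly n \<tau>"
  shows "\<exists>i. root_poly n (A i) = root_poly n (B i)"
proof -
  define S where "S = \<sigma> ` {..<n}"
  have S: "finite S" "S = \<tau> ` {..<n}" using root_poly_eq_imp_image_eq[OF st] by (auto simp: S_def)
  obtain \<delta> where \<delta>: "\<delta> > 0" "\<And>u v. u \<in> S \<Longrightarrow> v \<in> S \<Longrightarrow> u \<noteq> v \<Longrightarrow> 2 * \<delta> \<le> dist u v"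
    using finite_separated[OF S(1)] by blast
  have "\<forall>\<^sub>F i in sequentially. \<forall>l\<in>{..<n}. dist (A i l) (\<sigma> l) < \<delta>"
    using tendstoD[OF A \<delta>(1)] by (intro eventually_ball_finite) auto
  moreover have "\<forall>\<^sub>F i in sequentially. \<forall>l\<in>{..<n}. dist (B i l) (\<tau> l) < \<delta>"
    using tendstoD[OF B \<delta>(1)] by (intro eventually_ball_finite) auto
  ultimately have "\<forall>\<^sub>F i in sequentially. (\<forall>l\<in>{..<n}. dist (A i l) (\<sigma> l) < \<delta>) \<and> (\<forall>l\<in>{..<n}. dist (B i l) (\<tau> l) < \<delta>)"
    by (rule eventually_conj)
  then obtain i where i: "\<And>l. l < n \<Longrightarrow> dist (A i l) (\<sigma> l) < \<delta>" "\<And>l. l < n \<Longrightarrow> dist (B i l) (\<tau> l) < \<delta>"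
    by (auto simp: eventually_sequentially)
  define R where "R = A i ` {..<n}"
  \<comment> \<open>Sends a value to the only point of \<open>S\<close> within distance \<delta>,
    which is unique by the separation of \<open>S\<close>.\<close>
  define g where "g r = (SOME s. s \<in> S \<and> dist r s < \<delta>)" for r
  have g: "g r = s" if "s \<in> S" "dist r s < \<delta>" for r s
  proof -
    have "g r \<in> S \<and> dist r (g r) < \<delta>" unfolding g_def by (rule someI) (use that in blast)
    then show ?thesis using \<delta>(2)[of "g r" s] that dist_triangle2[of "g r" s r] by (force simp: dist_commute)
  qed
  have gA: "g (A i l) = \<sigma> l" if "l < n" for l using g i(1)[OF that] that by (auto simp: S_def)
  have gB: "g (B i l) = \<tau> l" if "l < n" for l using g i(2)[OF that] that S(2) by auto
  have gR: "g ` R = S" unfolding R_def S_def image_image using gA by (intro image_cong) auto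
  \<comment> \<open>\<open>g\<close> maps \<open>R\<close> onto \<open>S\<close>, and
    \<open>R\<close> has no more elements than \<open>S\<close>. Hence the values at stage
    \<open>i\<close> correspond one to one to the limits, and both lists carry the multiplicities of
    their limits.\<close>
  have "inj_on g R"
  proof (rule eq_card_imp_inj_on)
    have "card (g ` R) \<le> card R" by (rule card_image_le) (simp add: R_def)
    then show "card (g ` R) = card R" using AB(2)[of i] gR by (simp add: R_def S_def)
  qed (simp add: R_def)
  then have inv: "inv_into R g (g r) = r" if "r \<in> R" for r using that by simp
  define f where "f s = [:- inv_into R g s, 1:]" for s
  have "root_poly n (A i) = (\<Prod>l<n. f (\<sigma> l))"
    unfolding root_poly_def f_def
  proof (rule prod.cong[OF refl])
    fix l assume "l \<in> {..<n}"
    then show "[:- A i l, 1:] = [:- inv_into R g (\<sigma> l), 1:]" using inv[of "A i l"] gA[of l] by (simp add: R_def)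
  qed
  moreover have "root_poly n (B i) = (\<Prod>l<n. f (\<tau> l))"
    unfolding root_poly_def f_def
  proof (rule prod.cong[OF refl])
    fix l assume l: "l \<in> {..<n}"
    then have "B i l \<in> R" using AB(1)[of i] by (auto simp: R_def)
    then show "[:- B i l, 1:] = [:- inv_into R g (\<tau> l), 1:]" using inv[of "B i l"] gB[of l] l by simp
  qed
  ultimately show ?thesis using root_poly_eq_imp_prod_eq[OF st] by metis
qed

section \<open>Discriminants as polynomials in the coefficients\<close>

lemma seq_poly_tendsto:
  "seq_poly Q \<Longrightarrow> (\<And>i. ((\<lambda>x. \<beta> x i) \<longlongrightarrow> l i) F) \<Longrightarrow> ((\<lambda>x. Q (\<beta> x)) \<longlongrightarrow> Q l) F"
  by (induction rule: seq_poly.induct) (auto intro: tendsto_intros)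

lemma seq_poly_cholomorphic:
  "seq_poly Q \<Longrightarrow> open S \<Longrightarrow> (\<And>i. cholomorphic (\<lambda>x. \<beta> x i) S) \<Longrightarrow> cholomorphic (\<lambda>x. Q (\<beta> x)) S"
  by (induction rule: seq_poly.induct) (auto intro: cholomorphic_const cholomorphic_add cholomorphic_mult)

lemma seq_poly_uminus: "seq_poly P \<Longrightarrow> seq_poly (\<lambda>x. - P x)"
  using seq_poly.mult[OF seq_poly.const[of "-1"]] by fastforce

text \<open>Up to \<open>r = N\<close> Newton's identity expresses the power sum by earlier ones;
  beyond that the equation of the roots, multiplied by a power of the root, gives a linear
  recursion. The coefficient sequence of a polynomial serves directly as argument of a
  \<open>seq_poly\<close>.\<close>

lemma pow_sum_seq_poly: "\<exists>Q. seq_poly Q \<and> (\<forall>t. pow_sum N t r = Q (coeff (root_poly N t)))"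
proof (induction r rule: less_induct)
  case (less r)
  then have "\<forall>i\<in>{..<r}. \<exists>Q. seq_poly Q \<and> (\<forall>t. pow_sum N t i = Q (coeff (root_poly N t)))" by blast
  from bchoice[OF this] obtain Q where Q: "\<And>i. i < r \<Longrightarrow> seq_poly (Q i)" "\<And>i t. i < r \<Longrightarrow> pow_sum N t i = Q i (coeff (root_poly N t))"
    by blast
  consider "r = 0" | "r > 0" "r \<le> N" | "r > N" by linarith
  then show ?case
  proof cases
    case 1
    then show ?thesis by (intro exI[of _ "\<lambda>_. of_nat N"]) (auto simp: pow_sum_def intro: seq_poly.const)
  next
    case 2
    define P where "P c = - (of_nat r * c (N - r) + (\<Sum>i\<in>{1..<r}. c (N - r + i) * Q i c))" for c :: "nat \<Rightarrow> complex"
    have "seq_poly P" unfolding P_def by (intro seq_poly_uminus seq_poly.intros seq_poly_sum Q(1)) auto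
    moreover have "pow_sum N t r = P (coeff (root_poly N t))" for t
    proof -
      have "of_nat r * coeff (root_poly N t) (N - r) + (\<Sum>i\<in>{1..r}. coeff (root_poly N t) (N - r + i) * pow_sum N t i) = 0"
        using newton_identity[of "N - r" N t] 2 by simp
      also have "{1..r} = insert r {1..<r}" using 2 by auto
      finally have "pow_sum N t r = - (of_nat r * coeff (root_poly N t) (N - r) + (\<Sum>i\<in>{1..<r}. coeff (root_poly N t) (N - r + i) * pow_sum N t i))"
        using 2 by (simp add: monic_root_poly eq_neg_iff_add_eq_0 algebra_simps)
      also have "(\<Sum>i\<in>{1..<r}. coeff (root_poly N t) (N - r + i) * pow_sum N t i) = (\<Sum>i\<in>{1..<r}. coeff (root_poly N t) (N - r + i) * Q i (coeff (root_poly N t)))"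
        by (rule sum.cong) (auto simp: Q(2))
      finally show ?thesis unfolding P_def .
    qed
    ultimately show ?thesis by blast
  next
    case 3
    define P where "P c = - (\<Sum>l<N. c l * Q (l + (r - N)) c)" for c :: "nat \<Rightarrow> complex"
    have "seq_poly P" unfolding P_def by (intro seq_poly_uminus seq_poly.intros seq_poly_sum Q(1)) (use 3 in auto)
    moreover have "pow_sum N t r = P (coeff (root_poly N t))" for t
    proof -
      have "(\<Sum>l\<le>N. coeff (root_poly N t) l * pow_sum N t (l + (r - N))) = (\<Sum>k<N. \<Sum>l\<le>N. coeff (root_poly N t) l * t k ^ (l + (r - N)))"
        unfolding pow_sum_def sum_distrib_left by (rule sum.swap)
      also have "\<dots> = (\<Sum>k<N. t k ^ (r - N) * poly (root_poly N t) (t k))"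
        unfolding poly_altdef degree_root_poly sum_distrib_left by (simp add: power_add mult_ac)
      also have "\<dots> = 0" by (intro sum.neutral) (auto simp: poly_root_poly_eq_0)
      finally have "(\<Sum>l<N. coeff (root_poly N t) l * pow_sum N t (l + (r - N))) + pow_sum N t r = 0"
        using 3 by (simp add: monic_root_poly flip: lessThan_Suc_atMost)
      then have "pow_sum N t r = - (\<Sum>l<N. coeff (root_poly N t) l * pow_sum N t (l + (r - N)))"
        by (simp add: eq_neg_iff_add_eq_0 add.commute)
      also have "(\<Sum>l<N. coeff (root_poly N t) l * pow_sum N t (l + (r - N))) = (\<Sum>l<N. coeff (root_poly N t) l * Q (l + (r - N)) (coeff (root_poly N t)))"
        by (rule sum.cong) (use 3 in \<open>auto simp: Q(2)\<close>)
      finally show ?thesis unfolding P_def .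
    qed
    ultimately show ?thesis by blast
  qed
qed

lemma seq_poly_prod: "(\<And>i. i \<in> I \<Longrightarrow> seq_poly (f i)) \<Longrightarrow> seq_poly (\<lambda>x. \<Prod>i\<in>I. f i x)"
  by (induction I rule: infinite_finite_induct) (auto intro: seq_poly.intros)

text \<open>Makes tuple sums continuous and holomorphic functions of the coefficients, although the
  roots themselves are chosen without any continuity.\<close>

lemma tuple_sum_seq_poly:
  assumes "multi_poly k e G"
  shows "\<exists>Q. seq_poly Q \<and> (\<forall>t. tuple_sum k N G t = Q (coeff (root_poly N t)))"
  using assms
proof induction
  case (mono \<alpha> c)
  have "\<forall>r. \<exists>Q. seq_poly Q \<and> (\<forall>t. pow_sum N t r = Q (coeff (root_poly N t)))" using pow_sum_seq_poly by blast
  from choice[OF this] obtain Q where Q: "\<And>r. seq_poly (Q r)" "\<And>r t. pow_sum N t r = Q r (coeff (root_poly N t))" by blast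
  have "tuple_sum k N (\<lambda>z. c * (\<Prod>l<k. z l ^ \<alpha> l)) t = c * (\<Prod>l<k. pow_sum N t (\<alpha> l))" for t
    unfolding tuple_sum_def pow_sum_def by (subst prod_sum_PiE) (auto simp: sum_distrib_left)
  then show ?case
    by (intro exI[of _ "\<lambda>x. c * (\<Prod>l<k. Q (\<alpha> l) x)"]) (auto simp: Q(2) intro!: seq_poly.mult seq_poly.const seq_poly_prod Q(1))
next
  case (add F G)
  obtain P Q where "seq_poly P" "\<forall>t. tuple_sum k N F t = P (coeff (root_poly N t))" "seq_poly Q" "\<forall>t. tuple_sum k N G t = Q (coeff (root_poly N t))"
    using add.IH by blast
  then show ?case by (intro exI[of _ "\<lambda>x. P x + Q x"]) (auto simp: seq_poly.add tuple_sum_def sum.distrib)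
qed

lemma vandermonde_sq_le:
  assumes L: "L \<ge> 1" "\<And>i j. i < k \<Longrightarrow> j < k \<Longrightarrow> cmod (z i - z j) \<le> L"
  shows "cmod (vandermonde_sq k z) \<le> L ^ (k * k)"
    and "i0 < k \<Longrightarrow> j0 < k \<Longrightarrow> i0 \<noteq> j0 \<Longrightarrow> cmod (z i0 - z j0) \<le> \<eta> \<Longrightarrow> cmod (vandermonde_sq k z) \<le> \<eta> * L ^ (k * k)"
proof -
  define p where "p i = (\<Prod>j\<in>{..<k} - {i}. cmod (z i - z j))" for i
  have v: "cmod (vandermonde_sq k z) = (\<Prod>i<k. p i)" by (simp add: vandermonde_sq_def p_def flip: prod_norm)
  have p0: "0 \<le> p i" for i unfolding p_def by (intro prod_nonneg) auto
  have pL: "p i \<le> L ^ k" if "i < k" for i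
  proof -
    have "p i \<le> (\<Prod>j\<in>{..<k} - {i}. L)" unfolding p_def using that L by (intro prod_mono) auto
    also have "\<dots> \<le> L ^ k" using L(1) that by (simp add: power_increasing)
    finally show ?thesis .
  qed
  have "(\<Prod>i<k. p i) \<le> (\<Prod>i<k. L ^ k)" using p0 pL by (intro prod_mono) auto
  then show "cmod (vandermonde_sq k z) \<le> L ^ (k * k)" by (simp add: v power_mult)
  assume ij: "i0 < k" "j0 < k" "i0 \<noteq> j0" and eta: "cmod (z i0 - z j0) \<le> \<eta>"
  have e0: "0 \<le> \<eta>" using eta order_trans[OF norm_ge_zero] by blast
  have "p i0 = cmod (z i0 - z j0) * (\<Prod>j\<in>{..<k} - {i0} - {j0}. cmod (z i0 - z j))"
    unfolding p_def using ij by (intro prod.remove) auto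
  also have "\<dots> \<le> \<eta> * (\<Prod>j\<in>{..<k} - {i0} - {j0}. L)"
    using ij L eta e0 by (intro mult_mono prod_mono prod_nonneg) auto
  also have "\<dots> \<le> \<eta> * L ^ k" using L(1) ij e0 by (intro mult_left_mono) (auto intro!: power_increasing simp: prod_constant card_Diff_subset)
  finally have pi0: "p i0 \<le> \<eta> * L ^ k" .
  have "(\<Prod>i<k. p i) = p i0 * (\<Prod>i\<in>{..<k} - {i0}. p i)" using ij by (intro prod.remove) auto
  also have "\<dots> \<le> (\<eta> * L ^ k) * (\<Prod>i\<in>{..<k} - {i0}. L ^ k)"
    using pi0 p0 pL e0 L(1) by (intro mult_mono prod_mono prod_nonneg) auto
  also have "\<dots> = \<eta> * (L ^ k * (L ^ k) ^ (k - 1))" using ij by simp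
  also have "L ^ k * (L ^ k) ^ (k - 1) = (L ^ k) ^ Suc (k - 1)" by simp
  also have "\<dots> = L ^ (k * k)" using ij by (simp only: Suc_diff_1 power_mult)
  finally show "cmod (vandermonde_sq k z) \<le> \<eta> * L ^ (k * k)" by (simp add: v)
qed

lemma tuple_sum_le:
  assumes "\<And>f. f \<in> PiE {..<k} (\<lambda>_. {..<N}) \<Longrightarrow> cmod (G (\<lambda>l. t (f l))) \<le> C"
  shows "cmod (tuple_sum k N G t) \<le> real (N ^ k) * C"
proof -
  have "cmod (tuple_sum k N G t) \<le> (\<Sum>f\<in>PiE {..<k} (\<lambda>_. {..<N}). C)"
    unfolding tuple_sum_def by (rule sum_norm_le) (rule assms)
  also have "\<dots> = real (N ^ k) * C" by (simp add: card_PiE)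
  finally show ?thesis .
qed

section \<open>Identity theorem and maximum principle in the original variables\<close>

lemma cholomorphic_curve:
  fixes f :: "complex ^ 'm \<Rightarrow> complex" and c :: "complex \<Rightarrow> complex ^ 'm"
  assumes f: "cholomorphic f V" and c: "\<And>i. (\<lambda>z. c z $ i) holomorphic_on D" "c ` D \<subseteq> V" and D: "open D"
  shows "(\<lambda>z. f (c z)) holomorphic_on D"
  unfolding holomorphic_on_open[OF D]
proof (intro ballI)
  fix z assume z: "z \<in> D"
  then have "\<forall>i. \<exists>d. ((\<lambda>z. c z $ i) has_field_derivative d) (at z)"
    using c(1) unfolding holomorphic_on_open[OF D] by blast
  from choice[OF this] obtain d where d: "\<And>i. ((\<lambda>z. c z $ i) has_field_derivative d i) (at z)" by blast
  define v :: "complex ^ 'm" where "v = (\<chi> i. d i)"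
  have "((\<lambda>z. \<Sum>i\<in>UNIV. (c z $ i) *s axis i 1) has_derivative (\<lambda>h. \<Sum>i\<in>UNIV. (d i * h) *s axis i (1::complex))) (at z)"
  proof (rule has_derivative_sum)
    fix i :: 'm
    have "bounded_linear (\<lambda>z::complex. z *s (axis i 1 :: complex ^ 'm))"
      by (rule linear_conv_bounded_linear[THEN iffD1], rule linearI) (auto simp: vec_eq_iff algebra_simps)
    from bounded_linear.has_derivative[OF this d[of i, unfolded has_field_derivative_def]]
    show "((\<lambda>z. (c z $ i) *s (axis i 1 :: complex ^ 'm)) has_derivative (\<lambda>h. (d i * h) *s axis i 1)) (at z)" .
  qed
  then have cd: "(c has_derivative (\<lambda>h. h *s v)) (at z)"
  proof -
    have "(\<lambda>z. \<Sum>i\<in>UNIV. (c z $ i) *s axis i (1::complex)) = c" by (simp add: basis_expansion)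
    moreover have "(\<lambda>h. \<Sum>i\<in>UNIV. (d i * h) *s axis i (1::complex)) = (\<lambda>h. h *s v)"
    proof
      fix h
      show "(\<Sum>i\<in>UNIV. (d i * h) *s axis i (1::complex)) = h *s v"
        using basis_expansion[of "h *s v"] by (simp add: v_def mult.commute)
    qed
    ultimately show ?thesis using \<open>((\<lambda>z. \<Sum>i\<in>UNIV. (c z $ i) *s axis i 1) has_derivative _) (at z)\<close> by simp
  qed
  obtain E where E: "(f has_derivative E) (at (c z))" "\<And>c v. E (c *s v) = c * E v"
    using f c(2) z unfolding cholomorphic_def by blast
  have "((\<lambda>z. f (c z)) has_derivative (\<lambda>h. E (h *s v))) (at z)"
    by (rule has_derivative_compose[OF cd E(1)])
  moreover have "(\<lambda>h. E (h *s v)) = (\<lambda>h. E v * h)" by (auto simp: E(2))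
  ultimately show "\<exists>f'. ((\<lambda>z. f (c z)) has_field_derivative f') (at z)"
    unfolding has_field_derivative_def by (intro exI[of _ "E v"]) simp
qed

text \<open>The interior of the zero set is relatively closed: if it meets a ball in
  \<open>V\<close>, then the one-variable identity theorem on complex lines through a common point
  makes the function vanish on the whole ball.\<close>

lemma cholomorphic_identity:
  fixes f :: "complex ^ 'm \<Rightarrow> complex"
  assumes f: "cholomorphic f V" and V: "connected V" and T: "open T" "T \<noteq> {}" "T \<subseteq> V" "\<And>x. x \<in> T \<Longrightarrow> f x = 0" and y: "y \<in> V"
  shows "f y = 0"
proof -
  have oV: "open V" using f by (rule cholomorphic_open)
  define Z where "Z = interior {x \<in> V. f x = 0}"
  have oZ: "open Z" "Z \<subseteq> V" unfolding Z_def using interior_subset by auto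
  have local: "ball w r \<subseteq> Z" if r: "ball w r \<subseteq> V" and z: "z \<in> Z" "z \<in> ball w r" for w r z
  proof -
    have "f p = 0" if p: "p \<in> ball w r" for p
    proof -
      define c where "c \<mu> = z + \<mu> *s (p - z)" for \<mu> :: complex
      have cc: "continuous_on UNIV c"
      proof -
        have "bounded_linear (\<lambda>\<mu>::complex. \<mu> *s (p - z))"
          by (rule linear_conv_bounded_linear[THEN iffD1], rule linearI) (auto simp: vec_eq_iff algebra_simps)
        then show ?thesis unfolding c_def by (intro continuous_intros linear_continuous_on)
      qed
      define D where "D = c -` ball w r"
      have D: "open D" unfolding D_def using cc by (intro open_vimage) auto
      have "convex D"
      proof (rule convexI)
        fix a b :: complex and u v :: real assume *: "a \<in> D" "b \<in> D" "0 \<le> u" "0 \<le> v" "u + v = 1"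
        have "c (u *\<^sub>R a + v *\<^sub>R b) = u *\<^sub>R c a + v *\<^sub>R c b"
        proof -
          have u: "u = 1 - v" using *(5) by simp
          have "c (u *\<^sub>R a + v *\<^sub>R b) $ i = (u *\<^sub>R c a + v *\<^sub>R c b) $ i" for i
            unfolding c_def u vector_add_component vector_scaleR_component vector_smult_component
              vector_minus_component
            by (simp only: scaleR_conv_of_real of_real_diff of_real_1) (simp add: algebra_simps)
          then show ?thesis by (simp add: vec_eq_iff)
        qed
        then show "u *\<^sub>R a + v *\<^sub>R b \<in> D"
          using * convexD[OF convex_ball[of w r], of "c a" "c b" u v] by (simp add: D_def)
      qed
      then have "connected D" by (rule convex_connected)
      have "f (c 1) = 0"
      proof (rule analytic_continuation_open[of "D \<inter> c -` Z" D "\<lambda>\<mu>. f (c \<mu>)" "\<lambda>_. 0"])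
        show "open (D \<inter> c -` Z)" using D oZ(1) cc by (intro open_Int open_vimage)
        show "(\<lambda>\<mu>. f (c \<mu>)) holomorphic_on D"
        proof (rule cholomorphic_curve[OF f _ _ D])
          show "(\<lambda>z. c z $ i) holomorphic_on D" for i unfolding c_def by (auto intro!: holomorphic_intros)
          show "c ` D \<subseteq> V" using r by (auto simp: D_def)
        qed
        have c0: "c 0 = z" by (simp add: c_def)
        show "D \<inter> c -` Z \<noteq> {}" using z c0 by (auto simp: D_def intro!: exI[of _ 0])
        show "1 \<in> D" using p by (simp add: D_def c_def)
        show "f (c \<mu>) = 0" if "\<mu> \<in> D \<inter> c -` Z" for \<mu>
          using that interior_subset[of "{x \<in> V. f x = 0}"] by (auto simp: Z_def)
      qed (use D \<open>connected D\<close> in auto)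
      then show ?thesis by (simp add: c_def)
    qed
    then show ?thesis unfolding Z_def using r by (intro interior_maximal) auto
  qed
  define Z' where "Z' = V - Z"
  have "open Z'"
    unfolding open_contains_ball
  proof
    fix w assume w: "w \<in> Z'"
    then obtain r where r: "r > 0" "ball w r \<subseteq> V" using oV open_contains_ball unfolding Z'_def by blast
    have "ball w r \<inter> Z = {}" 
    proof (rule ccontr)
      assume "ball w r \<inter> Z \<noteq> {}"
      then obtain z where "z \<in> Z" "z \<in> ball w r" by blast
      then have "ball w r \<subseteq> Z" by (rule local[OF r(2)])
      moreover have "w \<in> ball w r" using r(1) by simp
      ultimately show False using w unfolding Z'_def by blast
    qed
    then show "\<exists>e>0. ball w e \<subseteq> Z'" using r unfolding Z'_def by blast
  qed
  moreover have "T \<subseteq> Z" unfolding Z_def using T by (intro interior_maximal) auto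
  ultimately have "Z' = {}"
    using connectedD[OF V oZ(1), of Z'] oZ(2) T(2,3) unfolding Z'_def by blast
  then have "y \<in> Z" using y by (auto simp: Z'_def)
  then show ?thesis using interior_subset[of "{x \<in> V. f x = 0}"] by (auto simp: Z_def)
qed

lemma peval_polyfun: "polyfun (pdeg p) (peval p)"
  by (auto simp: polyfun_def)

text \<open>An enumeration of the index type embeds the space into sequences with finitely many
  nonzero entries, where \<open>polynomial_hull_boundary_zero\<close> applies. Polynomials
  correspond in both directions, which translates the hull condition as well as the estimate
  \<open>small\<close>.\<close>

theorem polynomially_convex_boundary_zero:
  fixes K :: "(complex ^ 'm) set"
  assumes pc: "polynomially_convex K" and h: "cholomorphic h U" "K \<subseteq> U"
    and W: "W \<subseteq> K" "compact (K - W)" "\<And>x. x \<in> closure W \<Longrightarrow> x \<in> K - W \<Longrightarrow> h x = 0"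
    and small: "\<And>d f c x. polyfun d f \<Longrightarrow> (\<And>y. y \<in> K - W \<Longrightarrow> cmod (f y) \<le> c) \<Longrightarrow> x \<in> W \<Longrightarrow> cmod (f x) \<le> c"
    and p: "p \<in> W"
  shows "h p = 0"
proof -
  obtain e :: "'m \<Rightarrow> nat" where e: "bij_betw e UNIV {0..<CARD('m)}" using ex_bij_betw_finite_nat[of "UNIV :: 'm set"] by auto
  define e' where "e' = inv_into UNIV e"
  have ee: "e' (e j) = j" "e j < CARD('m)" for j
    using e by (auto simp: e'_def bij_betw_def)
  have ee': "e (e' i) = i" if "i < CARD('m)" for i
    using e that by (auto simp: e'_def bij_betw_def f_inv_into_f)
  define \<iota> :: "complex ^ 'm \<Rightarrow> nat \<Rightarrow> complex" where "\<iota> x i = (if i < CARD('m) then x $ e' i else 0)" for x i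
  define \<pi> :: "(nat \<Rightarrow> complex) \<Rightarrow> complex ^ 'm" where "\<pi> \<xi> = (\<chi> j. \<xi> (e j))" for \<xi>
  have \<pi>\<iota>: "\<pi> (\<iota> x) = x" for x by (simp add: \<pi>_def \<iota>_def vec_eq_iff ee)
  have \<iota>\<pi>: "\<iota> (\<pi> \<xi>) = \<xi>" if "\<And>i. i \<ge> CARD('m) \<Longrightarrow> \<xi> i = 0" for \<xi>
    using that by (auto simp: \<pi>_def \<iota>_def fun_eq_iff ee')
  have c\<iota>: "continuous_on S \<iota>" for S
  proof (rule continuous_on_coordinatewise_then_product)
    fix i
    show "continuous_on S (\<lambda>x. \<iota> x i)"
      unfolding \<iota>_def by (cases "i < CARD('m)") (auto intro: continuous_intros)
  qed
  have c\<pi>: "continuous_on S \<pi>" for S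
    unfolding \<pi>_def by (intro continuous_on_vec_lambda continuous_on_product_then_coordinatewise[OF continuous_on_id])
  have inj: "inj \<iota>" by (metis \<pi>\<iota> injI)
  have seq_poly_\<pi>: "seq_poly (\<lambda>\<xi>. f (\<pi> \<xi>))" if "polyfun d f" for d f
    using that
  proof (induction rule: polyfun_induct)
    case (coord i)
    then show ?case unfolding \<pi>_def using seq_poly.coord[of "e i"] by simp
  qed (auto intro: seq_poly.intros)
  have polyfun_\<iota>: "\<exists>d. polyfun d (\<lambda>x. P (\<iota> x))" if "seq_poly P" for P
    using that
  proof induction
    case (coord i)
    show ?case unfolding \<iota>_def by (cases "i < CARD('m)") (auto intro: polyfun_const polyfun_coord[of 1])
  next
    case (add f g)
    then obtain d1 d2 where "polyfun d1 (\<lambda>x. f (\<iota> x))" "polyfun d2 (\<lambda>x. g (\<iota> x))" by blast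
    then have "polyfun (max d1 d2) (\<lambda>x. f (\<iota> x) + g (\<iota> x))"
      by (intro polyfun_add) (auto intro: polyfun_mono)
    then show ?case by blast
  qed (auto intro: polyfun_const polyfun_mult)
  have K: "K \<noteq> {}" "compact K" using pc by (auto simp: polynomially_convex_def)
  have Kp: "(\<forall>q. cmod (peval q x) \<le> (SUP y\<in>K. cmod (peval q y))) \<longrightarrow> x \<in> K" for x
  proof -
    have "K = {x. \<forall>q. cmod (peval q x) \<le> (SUP y\<in>K. cmod (peval q y))}"
      using pc unfolding polynomially_convex_def by blast
    then show ?thesis by blast
  qed
  have diff: "\<iota> ` K - \<iota> ` W = \<iota> ` (K - W)" using inj by (simp add: image_set_diff)
  have "h (\<pi> (\<iota> p)) = 0"
  proof (rule polynomial_hull_boundary_zero[where h="\<lambda>\<xi>. h (\<pi> \<xi>)" and K="\<iota> ` K" and M="CARD('m)" and U="\<pi> -` U" and W="\<iota> ` W"])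
    show "compact (\<iota> ` K)" by (intro compact_continuous_image c\<iota> K)
    show "\<xi> i = 0" if "\<xi> \<in> \<iota> ` K" "i \<ge> CARD('m)" for \<xi> i using that by (auto simp: \<iota>_def)
    show "\<exists>P. seq_poly P \<and> (\<forall>y\<in>\<iota> ` K. cmod (P y) \<le> 1) \<and> cmod (P \<xi>) > 2"
      if \<xi>: "\<xi> \<notin> \<iota> ` K" "\<And>i. i \<ge> CARD('m) \<Longrightarrow> \<xi> i = 0" for \<xi>
    proof -
      have e\<xi>: "\<iota> (\<pi> \<xi>) = \<xi>" by (rule \<iota>\<pi>) (rule \<xi>(2))
      have "\<pi> \<xi> \<notin> K"
      proof
        assume "\<pi> \<xi> \<in> K"
        then have "\<iota> (\<pi> \<xi>) \<in> \<iota> ` K" by (rule imageI)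
        then show False using \<xi>(1) unfolding e\<xi> by contradiction
      qed
      then obtain q where q: "\<not> cmod (peval q (\<pi> \<xi>)) \<le> (SUP y\<in>K. cmod (peval q y))" using Kp by blast
      define m where "m = (SUP y\<in>K. cmod (peval q y))"
      have "compact ((\<lambda>y. cmod (peval q y)) ` K)"
        by (intro compact_continuous_image continuous_on_norm polyfun_continuous[OF peval_polyfun] K)
      then have bdd: "bdd_above ((\<lambda>y. cmod (peval q y)) ` K)" by (intro bounded_imp_bdd_above compact_imp_bounded)
      have up: "cmod (peval q y) \<le> m" if "y \<in> K" for y unfolding m_def by (rule cSUP_upper[OF that bdd])
      obtain y0 where "y0 \<in> K" using K by blast
      then have m0: "m \<ge> 0" using up order_trans[OF norm_ge_zero] by blast
      obtain s where s: "m < s" "s < cmod (peval q (\<pi> \<xi>))" using q dense unfolding m_def by (metis not_le)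
      have "1 < cmod (peval q (\<pi> \<xi>)) / s" using s m0 by simp
      \<comment> \<open>Polynomial convexity only gives a ratio above 1; a power of the polynomial
        raises it above 2.\<close>
      then obtain N where N: "2 < (cmod (peval q (\<pi> \<xi>)) / s) ^ N" using real_arch_pow by blast
      define P where "P \<zeta> = (of_real (1 / s) * peval q (\<pi> \<zeta>)) ^ N" for \<zeta>
      have "seq_poly P" unfolding P_def by (intro seq_poly_power seq_poly.mult seq_poly.const seq_poly_\<pi>[OF peval_polyfun])
      moreover have "cmod (P y) \<le> 1" if "y \<in> \<iota> ` K" for y
      proof -
        have "cmod (peval q (\<pi> y)) / s \<le> 1" using that up s m0 by (force simp: \<pi>\<iota> divide_simps)
        then show ?thesis unfolding P_def using s m0 by (simp add: norm_mult norm_power norm_divide power_le_one)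
      qed
      moreover have "cmod (P \<xi>) > 2" unfolding P_def using N s m0 by (simp add: norm_mult norm_power norm_divide)
      ultimately show ?thesis by blast
    qed
    have oU: "open (\<pi> -` U)" using cholomorphic_open[OF h(1)] c\<pi> by (rule open_vimage)
    show "hol (\<lambda>\<xi>. h (\<pi> \<xi>)) (\<pi> -` U)"
      unfolding hol_def
    proof (intro conjI oU allI impI)
      show "continuous_on (\<pi> -` U) (\<lambda>\<xi>. h (\<pi> \<xi>))"
        by (rule continuous_on_compose2[OF cholomorphic_continuous[OF h(1)] c\<pi>]) auto
      fix c D assume c: "holomorphic_curve c D \<and> c ` D \<subseteq> \<pi> -` U"
      show "(\<lambda>z. h (\<pi> (c z))) holomorphic_on D"
        by (rule cholomorphic_curve[OF h(1)]) (use c in \<open>auto simp: holomorphic_curve_def \<pi>_def\<close>)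
    qed
    show "\<iota> ` K \<subseteq> \<pi> -` U" using h(2) by (auto simp: \<pi>\<iota>)
    show "\<iota> ` W \<subseteq> \<iota> ` K" using W(1) by blast
    show "compact (\<iota> ` K - \<iota> ` W)" unfolding diff by (intro compact_continuous_image c\<iota> W)
    show "h (\<pi> \<xi>) = 0" if "\<xi> \<in> closure (\<iota> ` W)" "\<xi> \<in> \<iota> ` K - \<iota> ` W" for \<xi>
    proof (rule W(3))
      have "\<pi> ` closure (\<iota> ` W) \<subseteq> closure (\<pi> ` (\<iota> ` W))"
        by (rule image_closure_subset[OF c\<pi> closed_closure closure_subset])
      moreover have "\<pi> ` (\<iota> ` W) = W" by (simp add: image_image \<pi>\<iota>)
      ultimately show "\<pi> \<xi> \<in> closure W" using that(1) by auto
      show "\<pi> \<xi> \<in> K - W" using that(2) unfolding diff by (auto simp: \<pi>\<iota>)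
    qed
    show "cmod (P \<xi>) \<le> c" if P: "seq_poly P" "\<And>y. y \<in> \<iota> ` K - \<iota> ` W \<Longrightarrow> cmod (P y) \<le> c" "\<xi> \<in> \<iota> ` W" for P c \<xi>
    proof -
      obtain d where d: "polyfun d (\<lambda>x. P (\<iota> x))" using polyfun_\<iota>[OF P(1)] by blast
      obtain x where x: "\<xi> = \<iota> x" "x \<in> W" using P(3) by blast
      have "cmod (P (\<iota> y)) \<le> c" if "y \<in> K - W" for y using P(2)[of "\<iota> y"] that unfolding diff by blast
      from small[OF d this x(2)] show ?thesis using x(1) by simp
    qed
    show "\<iota> p \<in> \<iota> ` W" using p by blast
  qed
  then show ?thesis by (simp add: \<pi>\<iota>)
qed

section \<open>Comparison of the limit with the given coefficients\<close>

lemma continuous_on_monic_poly_limit: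
  assumes c: "\<And>j. j \<in> {1..n} \<Longrightarrow> continuous_on K (b j)" and X: "\<And>i. X i \<in> K" "x \<in> K" "X \<longlonglongrightarrow> x"
    and A: "\<And>i. monic_poly n b (X i) = root_poly n (A i)" "\<And>l. l < n \<Longrightarrow> (\<lambda>i. A i l) \<longlonglongrightarrow> \<sigma> l"
  shows "monic_poly n b x = root_poly n \<sigma>"
proof -
  have "poly (monic_poly n b x) z = poly (root_poly n \<sigma>) z" for z
  proof (rule LIMSEQ_unique)
    have "continuous_on K (\<lambda>x. monic_eval n b x z)"
      unfolding monic_eval_def by (intro continuous_intros c) auto
    then have "(\<lambda>i. monic_eval n b (X i) z) \<longlonglongrightarrow> monic_eval n b x z"
      using X by (rule_tac continuous_on_tendsto_compose) auto
    then show "(\<lambda>i. poly (monic_poly n b (X i)) z) \<longlonglongrightarrow> poly (monic_poly n b x) z" by (simp add: poly_monic_poly)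
    show "(\<lambda>i. poly (monic_poly n b (X i)) z) \<longlonglongrightarrow> poly (root_poly n \<sigma>) z"
      unfolding A(1) poly_root_poly by (intro tendsto_intros A(2)) auto
  qed
  then show ?thesis by (intro poly_ext) auto
qed

text \<open>Two monic polynomials with the same zero set over \<open>K\<close>: the given one with
  continuous coefficients \<open>a\<close>, and the limit with holomorphic coefficients
  \<open>b\<close>. They can differ only in the multiplicities of their roots.\<close>

locale root_limit = root_approximation K Y n c d1 \<theta> t M
  for K :: "(complex ^ 'm) set" and Y n c d1 \<theta> t M +
  fixes U :: "(complex ^ 'm) set" and b a :: "nat \<Rightarrow> complex ^ 'm \<Rightarrow> complex" and k :: "nat \<Rightarrow> nat"
  assumes pc: "polynomially_convex K" and siciak_cont: "continuous_on UNIV (siciak K)"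
    and U: "open U" "K \<subseteq> U" and k: "strict_mono k" "\<And>i. k i \<ge> d1"
    and b: "\<And>j. cholomorphic (b j) U" and a: "\<And>j. j \<in> {1..n} \<Longrightarrow> continuous_on K (a j)"
    and b_lim: "\<And>x j. x \<in> U \<Longrightarrow> j \<le> n \<Longrightarrow> (\<lambda>i. coeff (root_poly n (t (k i) x)) (n - j)) \<longlonglongrightarrow> b j x"
    and Yb: "Y = {(x, z). x \<in> K \<and> monic_eval n b x z = 0}"
    and Ya: "Y = {(x, z). x \<in> K \<and> monic_eval n a x z = 0}"
begin

sublocale family: monic_family U n b
  by unfold_locales (use U n b in auto)

definition roots_a where "roots_a x = (SOME s. monic_poly n a x = root_poly n s)"
definition roots_b where "roots_b x = (SOME s. monic_poly n b x = root_poly n s)"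

lemma monic_poly_roots_a: "monic_poly n a x = root_poly n (roots_a x)" and monic_poly_roots_b: "monic_poly n b x = root_poly n (roots_b x)"
  unfolding roots_a_def roots_b_def using someI_ex[OF monic_poly_splits] by metis+

lemma fibre_roots_a: "x \<in> K \<Longrightarrow> fibre Y x = roots_a x ` {..<n}"
  using poly_root_poly_eq_0[of n "roots_a x"] by (auto simp: fibre_def Ya simp flip: monic_poly_roots_a poly_monic_poly)

lemma fibre_roots_b: "x \<in> K \<Longrightarrow> fibre Y x = roots_b x ` {..<n}"
  using poly_root_poly_eq_0[of n "roots_b x"] by (auto simp: fibre_def Yb simp flip: monic_poly_roots_b poly_monic_poly)

lemma finite_fibre: "x \<in> K \<Longrightarrow> finite (fibre Y x)" and card_fibre_le: "x \<in> K \<Longrightarrow> card (fibre Y x) \<le> n"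
  using card_image_le[of "{..<n}" "roots_b x"] by (auto simp: fibre_roots_b)

lemma monic_poly_eq_if_distinct:
  assumes "x \<in> K" "card (fibre Y x) = n"
  shows "monic_poly n a x = monic_poly n b x"
  using root_poly_distinct[of "roots_a x" n] root_poly_distinct[of "roots_b x" n] assms fibre_roots_a[of x] fibre_roots_b[of x]
  by (simp add: monic_poly_roots_a monic_poly_roots_b)

lemma monic_poly_eq_iff: "monic_poly n a x = monic_poly n b x \<longleftrightarrow> (\<forall>j\<in>{1..n}. a j x = b j x)"
proof
  assume "monic_poly n a x = monic_poly n b x"
  then have *: "coeff (monic_poly n a x) (n - j) = coeff (monic_poly n b x) (n - j)" for j by simp
  show "\<forall>j\<in>{1..n}. a j x = b j x"
  proof
    fix j assume "j \<in> {1..n}"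
    then have "n - j < n" "n - (n - j) = j" by auto
    then show "a j x = b j x" using *[of j] by (simp add: coeff_monic_poly)
  qed
next
  assume "\<forall>j\<in>{1..n}. a j x = b j x"
  then show "monic_poly n a x = monic_poly n b x" unfolding monic_poly_def by (intro arg_cong2[of _ _ _ _ "(+)"] sum.cong) auto
qed

lemma coeff_tendsto: "x \<in> U \<Longrightarrow> (\<lambda>i. coeff (root_poly n (t (k i) x)) l) \<longlonglongrightarrow> coeff (monic_poly n b x) l"
proof -
  assume x: "x \<in> U"
  consider "l < n" | "l = n" | "l > n" by linarith
  then show ?thesis
  proof cases
    case 1
    then show ?thesis using b_lim[OF x, of "n - l"] by (simp add: coeff_monic_poly)
  next
    case 2
    then show ?thesis by (simp add: coeff_monic_poly monic_root_poly)
  next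
    case 3
    then show ?thesis by (simp add: coeff_monic_poly coeff_eq_0 degree_root_poly)
  qed
qed

text \<open>Up to sign \<open>n!\<close> times the discriminant of the approximant, because only the
  permutations among the tuples contribute.\<close>

definition approx_discr where "approx_discr d z = tuple_sum n n (vandermonde_sq n) (t d z)"

lemma approx_discr_polyfun:
  assumes "d \<ge> d1"
  shows "polyfun (n * (n - 1) * (c * d)) (approx_discr d)"
proof -
  have "\<exists>h. polyfun (n * (n - 1) * (c * d)) h \<and> (\<forall>x\<in>UNIV. 1 ^ (n * (n - 1)) * tuple_sum n n (vandermonde_sq n) (t d x) = h x)"
  proof (rule polyfun_tuple_sum[OF multi_poly_vandermonde_sq polyfun_const])
    show "\<exists>g. polyfun (r * (c * d)) g \<and> (\<forall>x\<in>UNIV. 1 ^ r * pow_sum n (t d x) r = g x)" for r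
      using ps[OF assms, of r] by (intro exI[of _ "\<lambda>x. pow_sum n (t d x) r"]) simp
  qed
  then obtain h where "polyfun (n * (n - 1) * (c * d)) h" "\<And>x. tuple_sum n n (vandermonde_sq n) (t d x) = h x" by auto
  then show ?thesis by (simp add: approx_discr_def[abs_def])
qed

lemma t_diff_le: "d \<ge> d1 \<Longrightarrow> x \<in> K \<Longrightarrow> i < n \<Longrightarrow> j < n \<Longrightarrow> cmod (t d x i - t d x j) \<le> L"
  using t_bound[of d x i] t_bound[of d x j] norm_triangle_ineq4[of "t d x i" "t d x j"] by (simp add: L_def)

lemma approx_discr_bound:
  assumes "d \<ge> d1" "x \<in> K"
  shows "cmod (approx_discr d x) \<le> real (n ^ n) * L ^ (n * n)"
  unfolding approx_discr_def
proof (rule tuple_sum_le, rule vandermonde_sq_le(1)[OF L_ge_1])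
  fix f i j assume "f \<in> {..<n} \<rightarrow>\<^sub>E {..<n}" "i < n" "j < n"
  then show "cmod (t d x (f i) - t d x (f j)) \<le> L" using t_diff_le[OF assms] by blast
qed

text \<open>With fewer than \<open>n\<close> points in the fibre of \<open>Y\<close>, two of the
  \<open>n\<close> entries are close to the same point, and one factor of
  \<open>vandermonde_sq\<close> is at most \<open>2 * \<theta> ^ d\<close>.\<close>

lemma approx_discr_small:
  assumes "d \<ge> d1" "x \<in> K" "card (fibre Y x) < n"
  shows "cmod (approx_discr d x) \<le> real (n ^ n) * (2 * \<theta> ^ d * L ^ (n * n))"
  unfolding approx_discr_def
proof (rule tuple_sum_le)
  fix f assume f: "f \<in> {..<n} \<rightarrow>\<^sub>E {..<n}"
  have "\<forall>l\<in>{..<n}. \<exists>y. y \<in> fibre Y x \<and> dist (t d x (f l)) y < \<theta> ^ d"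
    using t_near[OF assms(1,2)] f by blast
  from bchoice[OF this] obtain y where y: "\<And>l. l < n \<Longrightarrow> y l \<in> fibre Y x" "\<And>l. l < n \<Longrightarrow> dist (t d x (f l)) (y l) < \<theta> ^ d"
    by blast
  have "\<not> inj_on y {..<n}"
  proof
    assume "inj_on y {..<n}"
    then have "card {..<n} \<le> card (fibre Y x)"
      by (rule card_inj_on_le) (use y(1) finite_fibre[OF assms(2)] in auto)
    then show False using assms(3) by simp
  qed
  then obtain i j where ij: "i < n" "j < n" "i \<noteq> j" "y i = y j" by (auto simp: inj_on_def)
  show "cmod (vandermonde_sq n (\<lambda>l. t d x (f l))) \<le> 2 * \<theta> ^ d * L ^ (n * n)"
  proof (rule vandermonde_sq_le(2)[OF L_ge_1 _ ij(1-3)])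
    show "cmod (t d x (f i) - t d x (f j)) \<le> L" if "i < n" "j < n" for i j
      using t_diff_le[OF assms(1,2)] f that by blast
    show "cmod (t d x (f i) - t d x (f j)) \<le> 2 * \<theta> ^ d"
      using y(2)[OF ij(1)] y(2)[OF ij(2)] dist_triangle2[of "t d x (f i)" "t d x (f j)" "y i"] ij(4)
      by (simp add: dist_norm)
  qed
qed

text \<open>Where \<open>Y\<close> has fewer than \<open>n\<close> points the discriminants \<open>approx_discr d\<close> are of size \<open>\<theta>\<^sup>d\<close>. If a polynomial \<open>f\<close> were larger
  at a point of \<open>W\<close> than on \<open>K - W\<close>, then the Bernstein--Walsh inequality for \<open>approx_discr d * f ^ N\<close> with \<open>N\<close> proportional to \<open>d\<close>
  would force the limit of \<open>approx_discr d\<close> to vanish identically.\<close>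

lemma polyfun_le_off_degenerate:
  assumes U1: "open U1" "connected U1" "U1 \<subseteq> U" and y: "y \<in> K" "y \<in> U1" "card (fibre Y y) = n"
    and W: "W \<subseteq> K \<inter> U1" "\<And>x. x \<in> W \<Longrightarrow> card (fibre Y x) < n"
    and f: "polyfun e f" "\<And>z. z \<in> K - W \<Longrightarrow> cmod (f z) \<le> C" and x: "x \<in> W"
  shows "cmod (f x) \<le> C"
proof (rule ccontr)
  assume "\<not> cmod (f x) \<le> C"
  then have "C < cmod (f x)" by simp
  \<comment> \<open>The assumed gap between \<open>C\<close> and \<open>cmod (f x)\<close> is used
    twice: \<open>c0\<close> bounds \<open>f\<close> on \<open>K - W\<close>, and \<open>s\<close>
    bounds it from below near \<open>x\<close>. The quotient \<open>s / c0\<close> is what the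
    Bernstein--Walsh growth may consume.\<close>
  then obtain c0 where c0: "C < c0" "c0 < cmod (f x)" using dense by blast
  obtain s where s: "c0 < s" "s < cmod (f x)" using dense[OF c0(2)] by blast
  have "y \<in> K - W" using y W(2)[of y] by auto
  then have "C \<ge> 0" using f(2)[of y] order_trans[OF norm_ge_zero] by blast
  then have c0p: "c0 > 0" "s > 0" using c0 s by auto
  have "compact (f ` K)" by (intro compact_continuous_image polyfun_continuous[OF f(1)] K)
  then obtain Mf where Mf: "Mf > 0" "\<And>z. z \<in> K \<Longrightarrow> cmod (f z) \<le> Mf"
    using compact_imp_bounded bounded_pos by (metis imageI)
  \<comment> \<open>\<open>f\<close> will be raised to the power \<open>d div Q\<close>. With this
    \<open>Q\<close> the decay \<open>\<theta> ^ d\<close> of the discriminant on \<open>W\<close>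
    outweighs the size \<open>Mf\<close> of \<open>f\<close> there.\<close>
  obtain Q where Q: "Q > 0" "\<theta> ^ Q * Mf \<le> c0"
  proof -
    have "0 < c0 / Mf" using c0p Mf by simp
    from real_arch_pow_inv[OF this \<theta>(2)] obtain q where q: "\<theta> ^ q < c0 / Mf" by blast
    have "\<theta> ^ Suc q \<le> \<theta> ^ q" using \<theta> by (intro power_decreasing) auto
    then have "\<theta> ^ Suc q \<le> c0 / Mf" using q by linarith
    then have "\<theta> ^ Suc q * Mf \<le> c0" using Mf(1) by (simp only: pos_le_divide_eq)
    then show ?thesis using that[of "Suc q"] by blast
  qed
  define q0 where "q0 = n * (n - 1) * c"
  define B1 where "B1 = q0 * Q + e"
  \<comment> \<open>Then \<open>c0 * R ^ B1\<close> stays strictly below \<open>s\<close>. The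
    exponent \<open>Suc B1\<close> provides the strictness and also covers
    \<open>B1 = 0\<close>.\<close>
  define R where "R = root (Suc B1) (s / c0)"
  have R: "R > 1" "R ^ Suc B1 = s / c0" using s c0p by (auto simp: R_def simp del: power_Suc)
  have "R ^ B1 < R ^ Suc B1" using R(1) by (intro power_strict_increasing) auto
  then have "R ^ B1 < s / c0" by (simp only: R(2))
  then have RB: "c0 * R ^ B1 < s" using c0p by (simp only: pos_less_divide_eq mult.commute)
  define \<kappa> where "\<kappa> = c0 * R ^ B1 / s"
  have \<kappa>: "0 < \<kappa>" "\<kappa> < 1" using RB c0p R(1) by (auto simp: \<kappa>_def)
  define C' where "C' = real (n ^ n) * (2 * L ^ (n * n))"
  have C': "C' > 0" using n L_ge_1 by (simp add: C'_def)
  define T where "T = U1 \<inter> {z. siciak K z < ereal R} \<inter> {z. s < cmod (f z)}"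
  have "open {z. s < cmod (f z)}"
    by (intro open_Collect_less continuous_on_const continuous_on_norm polyfun_continuous[OF f(1)])
  then have oT: "open T" unfolding T_def using U1(1) open_siciak[OF siciak_cont, of R] by (intro open_Int)
  have "siciak K x < ereal R"
    by (rule le_less_trans[OF siciak_le_1]) (use x W(1) R(1) in \<open>auto simp: one_ereal_def\<close>)
  then have xT: "x \<in> T" using x W(1) s by (auto simp: T_def)
  obtain P where P: "seq_poly P" "\<And>t. tuple_sum n n (vandermonde_sq n) t = P (coeff (root_poly n t))" using tuple_sum_seq_poly[OF multi_poly_vandermonde_sq] by blast
  define D where "D z = P (coeff (monic_poly n b z))" for z
  have D_lim: "(\<lambda>i. approx_discr (k i) z) \<longlonglongrightarrow> D z" if "z \<in> U" for z
    unfolding approx_discr_def D_def P(2) by (rule seq_poly_tendsto[OF P(1)]) (rule coeff_tendsto[OF that])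
  have "cholomorphic D U" unfolding D_def
    by (rule seq_poly_cholomorphic[OF P(1) U(1)]) (rule family.coeff_cholomorphic)
  then have hD: "cholomorphic D U1" using U1 cholomorphic_subset by blast
  have small: "cmod (approx_discr d z) \<le> C' * R ^ (q0 * Q) * \<kappa> ^ (d div Q)" if d: "d \<ge> d1" and z: "z \<in> T" for d z
  proof -
    define N where "N = d div Q"
    define g where "g x = approx_discr d x * f x ^ N" for x
    have dN: "Q * N \<le> d" "d \<le> Q * (N + 1)"
    proof -
      have "Q * N + d mod Q = d" "d mod Q < Q" using Q(1) by (auto simp: N_def)
      then show "Q * N \<le> d" "d \<le> Q * (N + 1)" unfolding distrib_left by linarith+
    qed
    have "polyfun (n * (n - 1) * (c * d) + N * e) g"
      unfolding g_def by (intro polyfun_mult polyfun_power approx_discr_polyfun d f(1))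
    then have pg: "polyfun (q0 * d + N * e) g" by (simp add: q0_def mult.assoc)
    \<comment> \<open>On \<open>W\<close> the discriminant is small and \<open>f\<close> merely
      bounded; off \<open>W\<close> it is the other way round. The product is of order
      \<open>c0 ^ N\<close> on all of \<open>K\<close>.\<close>
    have gK: "cmod (g z') \<le> C' * c0 ^ N" if z': "z' \<in> K" for z'
    proof (cases "z' \<in> W")
      case True
      have 1: "cmod (approx_discr d z') \<le> C' * \<theta> ^ d"
        using approx_discr_small[OF d z' W(2)[OF True]] by (simp add: C'_def mult_ac)
      have "\<theta> ^ d \<le> \<theta> ^ (Q * N)" using \<theta> dN(1) by (intro power_decreasing) auto
      then have "C' * \<theta> ^ d \<le> C' * (\<theta> ^ Q) ^ N" using C' by (simp add: power_mult)
      then have "cmod (approx_discr d z') \<le> C' * (\<theta> ^ Q) ^ N" using 1 by linarith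
      moreover have "cmod (f z') ^ N \<le> Mf ^ N" using Mf(2)[OF z'] by (intro power_mono) auto
      ultimately have "cmod (g z') \<le> (C' * (\<theta> ^ Q) ^ N) * Mf ^ N"
        unfolding g_def norm_mult norm_power using C' \<theta> by (intro mult_mono) auto
      also have "\<dots> = C' * (\<theta> ^ Q * Mf) ^ N" by (simp add: power_mult_distrib)
      also have "\<dots> \<le> C' * c0 ^ N" using Q(2) \<theta> Mf(1) C' by (intro mult_left_mono power_mono) auto
      finally show ?thesis .
    next
      case False
      have "0 \<le> real (n ^ n) * L ^ (n * n)" using L_ge_1 by simp
      then have "real (n ^ n) * L ^ (n * n) \<le> C'" unfolding C'_def by linarith
      then have "cmod (approx_discr d z') \<le> C'" using approx_discr_bound[OF d z'] by linarith
      moreover have "cmod (f z') ^ N \<le> c0 ^ N"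
        using f(2)[of z'] z' False c0(1) by (intro power_mono) auto
      ultimately show ?thesis
        unfolding g_def norm_mult norm_power using C' by (intro mult_mono) auto
    qed
    have "cmod (g z) \<le> C' * c0 ^ N * R ^ (q0 * d + N * e)"
      by (rule bernstein_walsh[OF pg gK _ K(1)]) (use C' c0p z R(1) in \<open>auto simp: T_def\<close>)
    also have "\<dots> \<le> C' * c0 ^ N * R ^ (q0 * Q + B1 * N)"
    proof (intro mult_left_mono power_increasing)
      have "q0 * d \<le> q0 * (Q * (N + 1))" using dN(2) by simp
      then show "q0 * d + N * e \<le> q0 * Q + B1 * N" by (simp add: B1_def algebra_simps)
    qed (use R(1) C' c0p in auto)
    also have "\<dots> = C' * R ^ (q0 * Q) * (c0 * R ^ B1) ^ N"
      by (simp add: power_add power_mult power_mult_distrib)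
    also have "c0 * R ^ B1 = \<kappa> * s" using c0p by (simp add: \<kappa>_def)
    finally have "cmod (g z) \<le> C' * R ^ (q0 * Q) * (\<kappa> * s) ^ N" .
    moreover have "cmod (approx_discr d z) * s ^ N \<le> cmod (g z)"
      unfolding g_def norm_mult norm_power
      using z c0p by (intro mult_left_mono power_mono) (auto simp: T_def)
    ultimately have "cmod (approx_discr d z) * s ^ N \<le> (C' * R ^ (q0 * Q) * \<kappa> ^ N) * s ^ N"
      by (simp add: power_mult_distrib)
    then show ?thesis using c0p by (simp add: N_def)
  qed
  \<comment> \<open>On \<open>T\<close> the growth of \<open>f ^ N\<close> exceeds the bound for the
    product, so the discriminants tend to 0 there. \<open>T\<close> is open and nonempty, so the
    identity theorem carries this to \<open>y\<close>, where the limit has \<open>n\<close> distinct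
    roots.\<close>
  have DT: "D z = 0" if z: "z \<in> T" for z
  proof (rule LIMSEQ_unique)
    show "(\<lambda>i. approx_discr (k i) z) \<longlonglongrightarrow> D z" using z U1(3) by (intro D_lim) (auto simp: T_def)
    have "filterlim (\<lambda>i. k i div Q) sequentially sequentially"
      by (rule filterlim_compose[OF filterlim_at_top_div_const_nat[OF Q(1)] filterlim_subseq[OF k(1)]])
    from filterlim_compose[OF LIMSEQ_power_zero this, of \<kappa>]
    have "(\<lambda>i. \<kappa> ^ (k i div Q)) \<longlonglongrightarrow> 0" using \<kappa> by simp
    then have "(\<lambda>i. C' * R ^ (q0 * Q) * \<kappa> ^ (k i div Q)) \<longlonglongrightarrow> 0" by (rule tendsto_mult_right_zero)
    then show "(\<lambda>i. approx_discr (k i) z) \<longlonglongrightarrow> 0"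
      by (rule Lim_null_comparison[rotated]) (rule always_eventually, rule allI, rule small[OF k(2) z])
  qed
  have TU1: "T \<subseteq> U1" by (auto simp: T_def)
  have "D y = 0"
  proof (rule cholomorphic_identity[OF hD U1(2) oT _ TU1 _ y(2)])
    show "T \<noteq> {}" using xT by blast
    show "D z = 0" if "z \<in> T" for z by (rule DT[OF that])
  qed
  moreover have "card (roots_b y ` {..<n}) = n" using fibre_roots_b[OF y(1)] y(3) by simp
  from tuple_sum_vandermonde_sq_exact(2)[OF this, of "\<lambda>_. 0" 0] have "D y \<noteq> 0" by (simp add: D_def monic_poly_roots_b P(2))
  ultimately show False by contradiction
qed

text \<open>On the bad set \<open>W\<close> the fibres are degenerate, so polynomials on
  \<open>W\<close> are controlled from \<open>K - W\<close>. The stratum \<open>W'\<close> with the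
  most points is the set that the maximum principle excludes: \<open>h\<close>, a discriminant for
  \<open>N\<close> distinct points, has no zero on \<open>W'\<close> but vanishes at every point of
  its closure in \<open>K - W'\<close>.\<close>

theorem coefficients_extend:
  assumes y: "y \<in> K" "card (fibre Y y) = n" and x: "x \<in> connected_component_set K y" and j: "j \<in> {1..n}"
  shows "b j x = a j x"
proof -
  \<comment> \<open>A component of \<open>U\<close> and not of \<open>K\<close>: it is open, as the
    identity theorem requires, and contains the component of \<open>y\<close> in
    \<open>K\<close>.\<close>
  define U1 where "U1 = connected_component_set U y"
  have U1: "open U1" "connected U1" "U1 \<subseteq> U" "y \<in> U1"
    using open_connected_component[OF U(1)] connected_component_subset y(1) U(2) by (auto simp: U1_def)
  have xKU1: "x \<in> K \<inter> U1"
    using x connected_component_mono[OF U(2), of y] connected_component_subset[of K y] by (auto simp: U1_def)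
  define W where "W = {x \<in> K \<inter> U1. monic_poly n a x \<noteq> monic_poly n b x}"
  have W_card: "card (fibre Y x) < n" if "x \<in> W" for x
    using that monic_poly_eq_if_distinct[of x] card_fibre_le[of x] by (force simp: W_def)
  have "W = {}"
  proof (rule ccontr)
    assume ne: "W \<noteq> {}"
    define N where "N = Max ((\<lambda>x. card (fibre Y x)) ` W)"
    have fin: "finite ((\<lambda>x. card (fibre Y x)) ` W)"
      by (rule finite_subset[of _ "{..<n}"]) (auto intro: W_card)
    have N_le: "card (fibre Y x) \<le> N" if "x \<in> W" for x unfolding N_def using fin that by simp
    have "N \<in> (\<lambda>x. card (fibre Y x)) ` W" unfolding N_def using fin ne by (intro Max_in) auto
    then obtain p where p: "p \<in> W" "card (fibre Y p) = N" by auto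
    define W' where "W' = {x \<in> W. card (fibre Y x) = N}"
    obtain P where P: "seq_poly P" "\<And>t. tuple_sum N n (vandermonde_sq N) t = P (coeff (root_poly n t))" using tuple_sum_seq_poly[OF multi_poly_vandermonde_sq] by blast
    define h where "h z = P (coeff (monic_poly n b z))" for z
    have h_eq: "h z = tuple_sum N n (vandermonde_sq N) (roots_b z)" for z by (simp add: h_def P(2) monic_poly_roots_b)
    have hh: "cholomorphic h U" unfolding h_def
      by (rule seq_poly_cholomorphic[OF P(1) U(1)]) (rule family.coeff_cholomorphic)
    have h0: "h z = 0" if "z \<in> K" "card (fibre Y z) < N" for z
      using tuple_sum_vandermonde_sq_small[of "roots_b z" n N "\<lambda>_. 1"] that fibre_roots_b[of z] by (simp add: h_eq)
    have h1: "h z \<noteq> 0" if "z \<in> W'" for z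
      using tuple_sum_vandermonde_sq_exact(2)[of "roots_b z" n N "\<lambda>_. 0" 0] that fibre_roots_b[of z] by (auto simp: h_eq W'_def W_def)
    have "h p = 0"
    proof (rule polynomially_convex_boundary_zero[OF pc hh U(2), of W'])
      show "W' \<subseteq> K" by (auto simp: W'_def W_def)
      \<comment> \<open>A point of \<open>K\<close> escapes \<open>W'\<close> by lying outside
        \<open>U1\<close>, by equality of all coefficients, or by having fewer than \<open>N\<close>
        points in its fibre, which within \<open>W\<close> means \<open>h = 0\<close>. Each of the
        three conditions is closed.\<close>
      have "K - W' = (K - U1) \<union> (K \<inter> (\<Inter>j\<in>{1..n}. {x \<in> K. a j x - b j x = 0})) \<union> {x \<in> K. h x = 0}" (is "_ = ?R")
      proof
        show "K - W' \<subseteq> ?R"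
        proof
          fix z assume z: "z \<in> K - W'"
          show "z \<in> ?R"
          proof (cases "z \<in> W")
            case True
            then have "card (fibre Y z) < N" using z N_le[OF True] by (force simp: W'_def)
            then show ?thesis using h0[of z] z by auto
          next
            case False
            then show ?thesis using z by (auto simp: W_def monic_poly_eq_iff)
          qed
        qed
        show "?R \<subseteq> K - W'" using h1 by (auto simp: W'_def W_def monic_poly_eq_iff)
      qed
      moreover have "compact (K - U1)" by (rule compact_diff[OF K(2) U1(1)])
      moreover have "closed {x \<in> K. a j x - b j x = 0}" if "j \<in> {1..n}" for j
        using a[OF that] continuous_on_subset[OF cholomorphic_continuous[OF b] U(2)]
        by (intro continuous_closed_preimage_constant continuous_on_diff compact_imp_closed K)
      then have "compact (K \<inter> (\<Inter>j\<in>{1..n}. {x \<in> K. a j x - b j x = 0}))"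
        by (intro compact_Int_closed K closed_INT) blast
      moreover have "closed {x \<in> K. h x = 0}"
        using continuous_on_subset[OF cholomorphic_continuous[OF hh] U(2)]
        by (intro continuous_closed_preimage_constant compact_imp_closed K)
      then have "compact (K \<inter> {x \<in> K. h x = 0})" by (rule compact_Int_closed[OF K(2)])
      then have "compact {x \<in> K. h x = 0}" by (simp add: Int_def conj_ac)
      ultimately show "compact (K - W')" by (simp add: compact_Un)
      show "cmod (f z) \<le> C" if "polyfun d f" "\<And>y. y \<in> K - W' \<Longrightarrow> cmod (f y) \<le> C" "z \<in> W'" for d f C z
      proof (rule polyfun_le_off_degenerate[OF U1(1-3) y(1) U1(4) y(2), of W d f])
        show "W \<subseteq> K \<inter> U1" by (auto simp: W_def)
        show "card (fibre Y x) < n" if "x \<in> W" for x by (rule W_card[OF that])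
        show "polyfun d f" by fact
        show "cmod (f z) \<le> C" if "z \<in> K - W" for z
          by (rule \<open>\<And>y. y \<in> K - W' \<Longrightarrow> cmod (f y) \<le> C\<close>) (use that in \<open>auto simp: W'_def\<close>)
        show "z \<in> W" using \<open>z \<in> W'\<close> by (simp add: W'_def)
      qed
      show "p \<in> W'" using p by (simp add: W'_def)
      \<comment> \<open>If \<open>h x\<close> were nonzero, the fibre over \<open>x\<close> would
        have at least \<open>N\<close> points. Then \<open>x\<close> is not in \<open>W\<close>, so
        the two polynomials agree at \<open>x\<close>, and it remains to carry the agreement to
        nearby points of \<open>W'\<close>.\<close>
      show "h x = 0" if x: "x \<in> closure W'" "x \<in> K - W'" for x
      proof (rule ccontr)
        assume hx: "h x \<noteq> 0"
        then have cN: "N \<le> card (fibre Y x)" using h0[of x] x(2) by force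
        have "x \<notin> W" using x(2) N_le[of x] cN by (auto simp: W'_def)
        have "x \<in> U1"
        proof -
          have xU: "x \<in> U" using x(2) U(2) by blast
          have "open (connected_component_set U x)" by (rule open_connected_component[OF U(1)])
          moreover have "x \<in> connected_component_set U x" using xU by simp
          ultimately have "connected_component_set U x \<inter> W' \<noteq> {}"
            using x(1) unfolding closure_iff_nhds_not_empty by blast
          then have "connected_component_set U x \<inter> U1 \<noteq> {}" by (auto simp: W'_def W_def)
          then have "connected_component_set U x = U1"
            unfolding U1_def by (simp add: connected_component_overlap)
          then show ?thesis using xU by auto
        qed
        then have ab: "monic_poly n a x = monic_poly n b x" using \<open>x \<notin> W\<close> x(2) by (auto simp: W_def)
        obtain X where X: "\<And>i. X i \<in> W'" "X \<longlonglongrightarrow> x" using x(1) unfolding closure_sequential by blast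
        have XK: "X i \<in> K" for i using X(1)[of i] by (auto simp: W'_def W_def)
        \<comment> \<open>Both root lists in one list of length \<open>2 * n\<close>, so that a
          single subsequence makes all of them converge.\<close>
        define Z where "Z i l = (if l < n then roots_a (X i) l else roots_b (X i) (l - n))" for i l
        have "cmod (Z i l) \<le> M" if "l < 2 * n" for i l
        proof -
          have "Z i l \<in> fibre Y (X i)"
            using that fibre_roots_a[OF XK[of i]] fibre_roots_b[OF XK[of i]] unfolding Z_def by (cases "l < n") auto
          from YM[OF XK this] show ?thesis .
        qed
        then obtain r \<sigma> where r: "strict_mono r" "\<And>l. l < 2 * n \<Longrightarrow> (\<lambda>i. Z (r i) l) \<longlonglongrightarrow> \<sigma> l"
          using bounded_lists_convergent_subsequence[of "2 * n" Z M] by blast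
        define \<tau> where "\<tau> l = \<sigma> (n + l)" for l
        have A: "(\<lambda>i. roots_a (X (r i)) l) \<longlonglongrightarrow> \<sigma> l" if "l < n" for l
          using r(2)[of l] that by (simp add: Z_def)
        have B: "(\<lambda>i. roots_b (X (r i)) l) \<longlonglongrightarrow> \<tau> l" if "l < n" for l
          using r(2)[of "n + l"] that by (simp add: Z_def \<tau>_def)
        have Xr: "(\<lambda>i. X (r i)) \<longlonglongrightarrow> x" using LIMSEQ_subseq_LIMSEQ[OF X(2) r(1)] by (simp add: o_def)
        have xK: "x \<in> K" using x(2) by blast
        have \<sigma>: "monic_poly n a x = root_poly n \<sigma>"
          by (rule continuous_on_monic_poly_limit[OF a XK xK Xr monic_poly_roots_a A])
        have \<tau>: "monic_poly n b x = root_poly n \<tau>"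
          by (rule continuous_on_monic_poly_limit[OF _ XK xK Xr monic_poly_roots_b B])
            (rule continuous_on_subset[OF cholomorphic_continuous[OF b] U(2)])
        have \<sigma>Y: "\<sigma> ` {..<n} = fibre Y x"
          using root_poly_eq_imp_image_eq[of n \<sigma> "roots_a x"] \<sigma> monic_poly_roots_a[of x] fibre_roots_a[OF xK] by simp
        \<comment> \<open>The fibres along the sequence have \<open>N\<close> points and the limit
          fibre has at least \<open>N\<close>, so distinct roots do not merge. Equal multiplicities
          at \<open>x\<close> then give equal multiplicities at some \<open>X (r i)\<close>,
          although this point belongs to \<open>W\<close>.\<close>
        have "\<exists>i. root_poly n (roots_a (X (r i))) = root_poly n (roots_b (X (r i)))"
        proof (rule root_multiplicities_eq_of_limit[OF A B])
          show "roots_a (X (r i)) ` {..<n} = roots_b (X (r i)) ` {..<n}" for i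
            using fibre_roots_a[OF XK] fibre_roots_b[OF XK] by metis
          have "card (fibre Y (X i)) = N" for i using X(1)[of i] by (simp add: W'_def)
          then show "card (roots_a (X (r i)) ` {..<n}) \<le> card (\<sigma> ` {..<n})" for i
            using fibre_roots_a[OF XK] cN \<sigma>Y by metis
          show "root_poly n \<sigma> = root_poly n \<tau>" using \<sigma> \<tau> ab by simp
        qed
        then obtain i where "monic_poly n a (X (r i)) = monic_poly n b (X (r i))" by (auto simp: monic_poly_roots_a monic_poly_roots_b)
        then show False using X(1)[of "r i"] by (simp add: W'_def W_def)
      qed
    qed
    moreover have "h p \<noteq> 0" using p by (intro h1) (simp add: W'_def)
    ultimately show False by contradiction
  qed
  then show ?thesis using xKU1 j monic_poly_eq_iff[of x] by (auto simp: W_def)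
qed

end

text \<open>Equality with the given coefficients is stated for the components of \<open>K\<close>
  that contain a point with \<open>n\<close> distinct roots; over other components the zero set
  alone does not determine multiplicities.\<close>

theorem theorem2p6:
  fixes K :: "(complex ^ 'm) set" and n :: nat
    and a :: "nat \<Rightarrow> complex ^ 'm \<Rightarrow> complex"
    and Y :: "((complex ^ 'm) \<times> complex) set"
  assumes "n \<ge> 1"
    and "K \<noteq> {}" and "compact K" and "polynomially_convex K"
    and "continuous_on UNIV (siciak K)"
    and "\<And>j. j \<in> {1..n} \<Longrightarrow> continuous_on K (a j)"
    and "Y = {(x, t). x \<in> K \<and> monic_eval n a x t = 0}"
    and "\<exists>x0\<in>K. card (fibre Y x0) = n"
    and "limsup (\<lambda>d. ereal_root d (dist_delta K Y (hyper_family d n K))) < 1"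
  shows "\<exists>U X. open U \<and> K \<subseteq> U \<and>
    analytic_subset (join ` (U \<times> UNIV)) (join ` X) \<and>
    pure_dimensional CARD('m) (join ` X) \<and>
    proper_projection X U \<and>
    X \<inter> (K \<times> UNIV) = Y \<and>
    (\<exists>b. (\<forall>j\<in>{1..n}. cholomorphic (b j) U) \<and>
         X = {(x, t). x \<in> U \<and> monic_eval n b x t = 0} \<and>
         (\<forall>y\<in>K. card (fibre Y y) = n \<longrightarrow>
            (\<forall>x\<in>connected_component_set K y. \<forall>j\<in>{1..n}. b j x = a j x)))"
proof -
  have n: "n > 0" using assms(1) by simp
  have fibre: "fibre Y x = {t. monic_eval n a x t = 0}" if "x \<in> K" for x
    using that by (auto simp: fibre_def assms(7))
  have fin: "finite (fibre Y x)" if "x \<in> K" for x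
    using finite_roots_monic_eval by (simp add: fibre[OF that])
  have ne: "fibre Y x \<noteq> {}" if "x \<in> K" for x
    using roots_monic_eval_nonempty[OF n, of a x] by (simp add: fibre[OF that])
  have "continuous_on K (\<lambda>x. coeff (monic_poly n a x) i)" for i
  proof (cases "i < n")
    case True
    then show ?thesis using assms(6)[of "n - i"] by (simp add: coeff_monic_poly)
  next
    case False
    then show ?thesis by (cases "i = n") (auto simp: coeff_monic_poly)
  qed
  from monic_eval_roots_bounded[OF assms(3) n this] obtain M where M: "M \<ge> 0"
    "\<forall>x\<in>K. \<forall>t. monic_eval n a x t = 0 \<longrightarrow> cmod t \<le> M" by blast
  obtain \<theta> d0 where \<theta>: "0 < \<theta>" "\<theta> < 1"
    and W: "\<And>d. d \<ge> d0 \<Longrightarrow> \<exists>W\<in>hyper_family d n K. \<forall>x\<in>K. hausdorff_dist (fibre Y x) (fibre W x) < \<theta> ^ d"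
    using limsup_dist_delta_less[OF assms(2) _ assms(9)] fin ne by blast
  define c where "c = n * (n\<^sup>2 + 1)"
  \<comment> \<open>A pair consists of the number of roots and the root functions; both are chosen
    together for each \<open>d\<close>, since the covering number may depend on
    \<open>d\<close>.\<close>
  define good where "good d p \<longleftrightarrow> 0 < fst p \<and> fst p \<le> n \<and> (\<forall>r. polyfun (r * (c * d)) (\<lambda>x. pow_sum (fst p) (snd p x) r)) \<and>
      (\<forall>x\<in>K. hausdorff_dist (fibre Y x) (snd p x ` {..<fst p}) < \<theta> ^ d)" for d and p :: "nat \<times> (complex ^ 'm \<Rightarrow> nat \<Rightarrow> complex)"
  have "\<forall>d. \<exists>p. d \<ge> d0 \<longrightarrow> good d p"
  proof
    fix d
    show "\<exists>p. d \<ge> d0 \<longrightarrow> good d p"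
    proof (cases "d \<ge> d0")
      case True
      then obtain V where V: "V \<in> hyper_family d n K" "\<forall>x\<in>K. hausdorff_dist (fibre Y x) (fibre V x) < \<theta> ^ d"
        using W by blast
      obtain k and t :: "complex ^ 'm \<Rightarrow> nat \<Rightarrow> complex" where kt: "0 < k" "k \<le> n"
        "\<And>r. polyfun (r * (n * (n\<^sup>2 + 1) * d)) (\<lambda>x. pow_sum k (t x) r)" "\<And>x. x \<in> K \<Longrightarrow> fibre V x = t x ` {..<k}"
        using hyper_family_roots[OF V(1)] by blast
      have "good d (k, t)" unfolding good_def c_def using kt V(2) by simp
      then show ?thesis by blast
    qed blast
  qed
  from choice[OF this] obtain p where p: "\<And>d. d \<ge> d0 \<Longrightarrow> good d (p d)" by blast
  define t where "t d = snd (p d)" for d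
  obtain x0 where x0: "x0 \<in> K" "card (fibre Y x0) = n" using assms(8) by blast
  obtain \<delta> where \<delta>: "\<delta> > 0" "\<And>u v. u \<in> fibre Y x0 \<Longrightarrow> v \<in> fibre Y x0 \<Longrightarrow> u \<noteq> v \<Longrightarrow> 2 * \<delta> \<le> dist u v"
    using finite_separated[OF fin[OF x0(1)]] by blast
  \<comment> \<open>From here on the error is below half the least distance of the points over
    \<open>x0\<close>, so different points of that fibre need different roots nearby.\<close>
  obtain d2 where d2: "\<theta> ^ d2 < \<delta>" using real_arch_pow_inv[OF \<delta>(1) \<theta>(2)] by blast
  define d1 where "d1 = max (max d0 d2) 1"
  have near: "\<exists>i<fst (p d). dist y (t d x i) < \<theta> ^ d" "\<lbrakk>i < fst (p d)\<rbrakk> \<Longrightarrow> \<exists>y\<in>fibre Y x. dist (t d x i) y < \<theta> ^ d"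
    if d: "d \<ge> d0" and x: "x \<in> K" and y: "y \<in> fibre Y x" for d x y i
  proof -
    have H: "hausdorff_dist (fibre Y x) (t d x ` {..<fst (p d)}) < \<theta> ^ d" "fst (p d) > 0"
      using p[OF d] x by (auto simp: good_def t_def)
    have F: "finite (t d x ` {..<fst (p d)})" "t d x ` {..<fst (p d)} \<noteq> {}" using H(2) by auto
    show "\<exists>i<fst (p d). dist y (t d x i) < \<theta> ^ d"
      using hausdorff_dist_lessD(1)[OF fin[OF x] ne[OF x] F H(1) y] by blast
    show "\<exists>y\<in>fibre Y x. dist (t d x i) y < \<theta> ^ d" if "i < fst (p d)"
      using hausdorff_dist_lessD(2)[OF fin[OF x] ne[OF x] F H(1), of "t d x i"] that by blast
  qed
  \<comment> \<open>The \<open>n\<close> points over \<open>x0\<close> require at least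
    \<open>n\<close> roots, and the family allows at most \<open>n\<close>. This is where the point
    with \<open>n\<close> distinct roots fixes the degree of all late approximants.\<close>
  have pn: "fst (p d) = n" if d: "d \<ge> d1" for d
  proof -
    have d02: "d \<ge> d0" "d \<ge> d2" using d by (auto simp: d1_def)
    have "\<theta> ^ d \<le> \<theta> ^ d2" using \<theta> d02 by (intro power_decreasing) auto
    then have td: "\<theta> ^ d < \<delta>" using d2 by simp
    have "\<forall>y\<in>fibre Y x0. \<exists>i. i < fst (p d) \<and> dist y (t d x0 i) < \<theta> ^ d"
      using near(1)[OF d02(1) x0(1)] by blast
    from bchoice[OF this] obtain i where i: "\<And>y. y \<in> fibre Y x0 \<Longrightarrow> i y < fst (p d)"
      "\<And>y. y \<in> fibre Y x0 \<Longrightarrow> dist y (t d x0 (i y)) < \<theta> ^ d" by blast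
    have "inj_on i (fibre Y x0)"
    proof (rule inj_onI, rule ccontr)
      fix u v assume uv: "u \<in> fibre Y x0" "v \<in> fibre Y x0" "i u = i v" "u \<noteq> v"
      then show False
        using \<delta>(2)[OF uv(1,2,4)] i(2)[OF uv(1)] i(2)[OF uv(2)] td dist_triangle2[of u v "t d x0 (i u)"] by simp
    qed
    then have "card (fibre Y x0) \<le> card {..<fst (p d)}"
      by (rule card_inj_on_le) (use i(1) in auto)
    moreover have "fst (p d) \<le> n" using p[OF d02(1)] by (simp add: good_def)
    ultimately show ?thesis using x0(2) by simp
  qed
  interpret approx: root_approximation K Y n c d1 \<theta> t M
  proof
    fix d assume d: "d \<ge> d1"
    then have d0: "d \<ge> d0" by (simp add: d1_def)
    show "polyfun (r * (c * d)) (\<lambda>x. pow_sum n (t d x) r)" for r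
      using p[OF d0] pn[OF d] by (simp add: good_def t_def)
    fix x assume x: "x \<in> K"
    show "\<exists>i<n. dist y (t d x i) < \<theta> ^ d" if "y \<in> fibre Y x" for y
      using near(1)[OF d0 x that] pn[OF d] by simp
    obtain y where "y \<in> fibre Y x" using ne[OF x] by blast
    then show "\<exists>y\<in>fibre Y x. dist (t d x i) y < \<theta> ^ d" if "i < n" for i
      using near(2)[OF d0 x] pn[OF d] that by simp
  next
    show "d1 > 0" by (simp add: d1_def)
    show "c > 0" using n by (simp add: c_def)
    show "cmod y \<le> M" if "x \<in> K" "y \<in> fibre Y x" for x y using M(2) that fibre by blast
  qed (use n \<theta> M(1) assms in auto)
  have YK: "Y \<subseteq> K \<times> UNIV" by (auto simp: assms(7))
  obtain U b k where U: "open U" "K \<subseteq> U" and k: "strict_mono k" "\<And>i. k i \<ge> d1" and b: "\<And>j. cholomorphic (b j) U"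
    and b_lim: "\<And>x j. x \<in> U \<Longrightarrow> j \<le> n \<Longrightarrow> (\<lambda>i. coeff (root_poly n (t (k i) x)) (n - j)) \<longlonglongrightarrow> b j x"
    and Yb: "Y = {(x, z). x \<in> K \<and> monic_eval n b x z = 0}"
  proof (rule approx.limit_polynomial[OF assms(5) fin YK], goal_cases)
    case (2 U b k)
    show ?thesis by (rule that[of U k b]) (fact 2)+
  qed
  interpret root_limit K Y n c d1 \<theta> t M U b a k
    by unfold_locales (use assms U k b b_lim Yb in auto)
  show ?thesis
  proof (intro exI[of _ U] exI[of _ family.X] conjI exI[of _ b] ballI impI)
    show "family.X \<inter> (K \<times> UNIV) = Y" using U(2) by (auto simp: family.X_def Yb)
    show "family.X = {(x, t). x \<in> U \<and> monic_eval n b x t = 0}" by (rule family.X_def)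
    show "b j x = a j x" if "y \<in> K" "card (fibre Y y) = n" "x \<in> connected_component_set K y" "j \<in> {1..n}" for y x j
      by (rule coefficients_extend[OF that])
    show "cholomorphic (b j) U" for j by (rule b)
  qed (fact U family.analytic_X family.pure_dimensional_X family.proper_projection_X)+
qed

end
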